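(* Let $M$ be a connected closed $3$-manifold. If $(\Gamma,\gamma)$ is a crystallization of $M$, then $\Gamma$ has at least $\psi(M)$ vertices. Equivalently, if $X$ is a contracted pseudotriangulation of $M$, then $f_3(X)\ge\psi(M)$, where $f_3(X)$ is the number of $3$-cells of $X$.
   Context: **Pseudotriangulations and crystallizations.** A simplicial cell complex $K$ of dimension $d$ is the face poset (closed cells together with the empty set, ordered by inclusion) of a $d$-dimensional regular CW complex $W$ such that the boundary complex of each cell is isomorphic, as a poset, to the boundary complex of a simplex of the same dimension; write $|K|=W$. If a space $X$ is homeomorphic to $|K|$, then $K$ is a pseudotriangulation of $X$. A $d$-dimensional simplicial cell complex is contracted if it has exactly $d+1$ vertices ($0$-cells). $f_j(K)$ is the number of $j$-cells of $K$. Graphs are finite multigraphs without loops. An edge coloring $\gamma:E\to C$ of $\Gamma=(V,E)$ satisfies $\gamma(e)\neq\gamma(f)$ whenever $e\ne f$ share a vertex; if $|C|=h$, $(\Gamma,\gamma)$ is an $h$-colored graph. For $B\subseteq C$, $\Gamma_B=(V,\gamma^{-1}(B))$. A connected colored graph is contracted if $\Gamma_{C\setminus\{c\}}$ is connected for all $c\in C$. A connected $(d+1)$-colored graph $(\Gamma,\gamma)$ with colors $1,\dots,d+1$ determines a $d$-dimensional simplicial cell complex $\mathcal K(\Gamma)$: take a $d$-simplex $\sigma_v$ with vertices labelled $1,\dots,d+1$ for each $v\in V$, and for each edge of color $i$ joining $u,v$ identify the $(d-1)$-faces of $\sigma_u$ and $\sigma_v$ opposite to the vertices labelled $i$ so that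 equally labelled vertices are identified. A crystallization of a connected closed $d$-manifold $M$ is a contracted $(d+1)$-colored graph $(\Gamma,\gamma)$ such that $\mathcal K(\Gamma)$ is a pseudotriangulation of $M$. **Weight of a group.** $F(S)$ is the free group on $S$; for $R\subseteq F(S)$, $N(R)$ is the smallest normal subgroup containing $R$ and $\langle S\mid R\rangle=F(S)/N(R)$. For a reduced word $w=x_1^{\varepsilon_1}\cdots x_m^{\varepsilon_m}$ ($x_i\in S$, $\varepsilon_i=\pm1$, $m\ge1$), let $\varepsilon(w)=0$ if $m=1$, and $\varepsilon(w)=|\varepsilon_1-\varepsilon_2|+\cdots+|\varepsilon_{m-1}-\varepsilon_m|+|\varepsilon_m-\varepsilon_1|$ if $m\ge2$. Define $\lambda$ on $F(S)$ inductively: $\lambda(\emptyset)=2$ for the empty word (identity); $\lambda(w)=2m-\tfrac12\varepsilon(w)$ if $w=x_1^{\varepsilon_1}\cdots x_m^{\varepsilon_m}$ with $(x_m,\varepsilon_m)\ne(x_1,-\varepsilon_1)$; and $\lambda(w)=\lambda(w')$ if $w=x_1^{\varepsilon_1}w'x_1^{-\varepsilon_1}$ is reduced. For finite $R\subseteq F(S)$, let $\overline R=\{w\in N(R): N((R\setminus\{r\})\cup\{w\})=N(R)\text{ for each }r\in R\}$. For $S=\{x_1,\dots,x_s\}$ and $R=\{r_1,\dots,r_t\}\subseteq F(S)$ with $t\le s$, let $r_{t+1}$ be an element of $\overline R$ of minimum $\lambda$ (if $R=\emptyset$, $r_{t+1}$ is the empty word), and put $\varphi(S,R)=\lambda(r_1)+\cdots+\lambda(r_t)+\lambda(r_{t+1})+2(s-t)$.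 For a finitely presented group $G$ and an integer $q\ge0$, let $\mathcal P_q(G)$ be the set of presentations $\langle S\mid R\rangle\cong G$ with $\#R\le\#S\le q$. For a group $G$ having a finite presentation with at most as many relations as generators, put $\mu(G)=\min\{q:\mathcal P_q(G)\ne\emptyset\}$; $\psi(G;q)=\min\{\varphi(S,R):\langle S\mid R\rangle\in\mathcal P_q(G)\}$ for $q\ge\mu(G)$; $\rho(G)=\min\{q\ge\mu(G):\psi(G;q)\le 6(q+1)\}$; and the weight $\psi(G)=\max\{\psi(G;\rho(G)),\,6\mu(G)+2\}$. For a connected closed $3$-manifold $M$ (whose fundamental group always has such a presentation, by Epstein), $\psi(M):=\psi(\pi_1(M))$. *)

theory Defs
  imports "HOL-Analysis.Analysis" "HOL-Algebra.Coset" "HOL-Homology.Simplices"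
begin

section \<open>Quotient spaces, balls and closed manifolds\<close>

definition quotient_topology :: "'a topology \<Rightarrow> ('a \<Rightarrow> 'b) \<Rightarrow> 'b topology" where
  "quotient_topology X q =
     topology (\<lambda>U. U \<subseteq> q ` topspace X \<and> openin X {x \<in> topspace X. q x \<in> U})"

lemma openin_quotient_topology:
  "openin (quotient_topology X q) U \<longleftrightarrow>
     U \<subseteq> q ` topspace X \<and> openin X {x \<in> topspace X. q x \<in> U}"
proof -
  have "istopology (\<lambda>U. U \<subseteq> q ` topspace X \<and> openin X {x \<in> topspace X. q x \<in> U})"
    unfolding istopology_def
  proof (intro conjI allI impI; (elim conjE)?)
    fix S T
    assume "openin X {x \<in> topspace X. q x \<in> S}" "openin X {x \<in> topspace X. q x \<in> T}"
    then have "openin X ({x \<in> topspace X. q x \<in> S} \<inter> {x \<in> topspace X. q x \<in> T})"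
      by (rule openin_Int)
    then show "openin X {x \<in> topspace X. q x \<in> S \<inter> T}"
      by (rule back_subst[of "openin X"]) auto
  next
    fix \<K>
    assume *: "\<forall>U\<in>\<K>. U \<subseteq> q ` topspace X \<and> openin X {x \<in> topspace X. q x \<in> U}"
    then have "openin X (\<Union>U\<in>\<K>. {x \<in> topspace X. q x \<in> U})"
      by (intro openin_Union) auto
    then show "openin X {x \<in> topspace X. q x \<in> \<Union>\<K>}"
      by (rule back_subst[of "openin X"]) auto
  qed auto
  then show ?thesis
    by (simp add: quotient_topology_def topology_inverse')
qed

lemma topspace_quotient_topology: "topspace (quotient_topology X q) = q ` topspace X"
proof (rule subset_antisym)
  show "topspace (quotient_topology X q) \<subseteq> q ` topspace X"
    using openin_quotient_topology[of X q] by (metis openin_topspace)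
  have "{x \<in> topspace X. q x \<in> q ` topspace X} = topspace X"
    by auto
  then show "q ` topspace X \<subseteq> topspace (quotient_topology X q)"
    by (intro openin_subset) (simp add: openin_quotient_topology)
qed

lemma quotient_map_quotient_topology: "quotient_map X (quotient_topology X q) q"
  by (auto simp: quotient_map_def topspace_quotient_topology openin_quotient_topology)

definition unit_cball :: "nat \<Rightarrow> (nat \<Rightarrow> real) set" where
  "unit_cball n = {x \<in> topspace (Euclidean_space n). (\<Sum>i<n. x i ^ 2) \<le> 1}"

definition unit_ball :: "nat \<Rightarrow> (nat \<Rightarrow> real) set" where
  "unit_ball n = {x \<in> topspace (Euclidean_space n). (\<Sum>i<n. x i ^ 2) < 1}"

definition unit_sphere :: "nat \<Rightarrow> (nat \<Rightarrow> real) set" where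
  "unit_sphere n = {x \<in> topspace (Euclidean_space n). (\<Sum>i<n. x i ^ 2) = 1}"

abbreviation cball_space :: "nat \<Rightarrow> (nat \<Rightarrow> real) topology" where
  "cball_space n \<equiv> subtopology (Euclidean_space n) (unit_cball n)"

definition closed_manifold :: "nat \<Rightarrow> 'a topology \<Rightarrow> bool" where
  "closed_manifold d M \<longleftrightarrow>
     compact_space M \<and> Hausdorff_space M \<and> second_countable M \<and>
     (\<forall>x \<in> topspace M. \<exists>U. openin M U \<and> x \<in> U \<and>
        subtopology M U homeomorphic_space Euclidean_space d)"


section \<open>Simplicial cell complexes and pseudotriangulations\<close>

text \<open>
  A regular CW structure is given by its closed cells \<open>\<C>\<close>: each cell has a dimension \<open>n c\<close> and
  a characteristic map \<open>\<xi> c\<close> that is a homeomorphism from the closed ball onto the cell, so that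
  \<open>\<xi> c ` unit_ball (n c)\<close> is the open cell.  The last two clauses are closure-finiteness and the
  weak topology; \<open>\<C>\<close> itself need not be finite.
\<close>

definition regular_cw_complex :: "'b topology \<Rightarrow> 'b set set \<Rightarrow> bool" where
  "regular_cw_complex W \<C> \<longleftrightarrow>
     Hausdorff_space W \<and>
     (\<exists>n \<xi>.
        (\<forall>c\<in>\<C>. c \<subseteq> topspace W \<and> homeomorphic_map (cball_space (n c)) (subtopology W c) (\<xi> c)) \<and>
        disjoint_family_on (\<lambda>c. \<xi> c ` unit_ball (n c)) \<C> \<and>
        (\<Union>c\<in>\<C>. \<xi> c ` unit_ball (n c)) = topspace W \<and>
        (\<forall>c\<in>\<C>. \<exists>\<D>. finite \<D> \<and> \<D> \<subseteq> \<C> \<and> (\<forall>e\<in>\<D>. n e < n c) \<and>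
            \<xi> c ` unit_sphere (n c) \<subseteq> (\<Union>e\<in>\<D>. \<xi> e ` unit_ball (n e))) \<and>
        (\<forall>A. A \<subseteq> topspace W \<and> (\<forall>c\<in>\<C>. closedin (subtopology W c) (A \<inter> c)) \<longrightarrow> closedin W A))"

definition is_cell :: "'b topology \<Rightarrow> nat \<Rightarrow> 'b set \<Rightarrow> bool" where
  "is_cell W n c \<longleftrightarrow> subtopology W c homeomorphic_space cball_space n"

definition inclusion_isomorphic :: "'b set set \<Rightarrow> 'c set set \<Rightarrow> bool" where
  "inclusion_isomorphic \<A> \<B> \<longleftrightarrow>
     (\<exists>f. bij_betw f \<A> \<B> \<and> (\<forall>x\<in>\<A>. \<forall>y\<in>\<A>. x \<subseteq> y \<longleftrightarrow> f x \<subseteq> f y))"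

text \<open>
  A face poset \<open>K\<close> is represented by the concrete family of closed cells of the CW complex
  \<open>W = |K|\<close> together with the empty set, ordered by inclusion.  The \<open>n\<close>-simplex is the power set
  of \<open>{..n}\<close>.
\<close>

definition simplicial_cell_complex :: "nat \<Rightarrow> 'b topology \<Rightarrow> 'b set set \<Rightarrow> bool" where
  "simplicial_cell_complex d W K \<longleftrightarrow>
     {} \<in> K \<and> regular_cw_complex W (K - {{}}) \<and>
     (\<forall>c\<in>K. \<forall>n. is_cell W n c \<longrightarrow>
        n \<le> d \<and> inclusion_isomorphic {\<tau>\<in>K. \<tau> \<subset> c} {T. T \<subset> {..n}}) \<and>
     (\<exists>c\<in>K. is_cell W d c)"

definition face_number :: "'b topology \<Rightarrow> 'b set set \<Rightarrow> nat \<Rightarrow> nat" where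
  "face_number W K j = card {c\<in>K. is_cell W j c}"

definition pseudotriangulation :: "nat \<Rightarrow> 'b topology \<Rightarrow> 'b set set \<Rightarrow> 'a topology \<Rightarrow> bool" where
  "pseudotriangulation d W K X \<longleftrightarrow> simplicial_cell_complex d W K \<and> X homeomorphic_space W"

definition contracted_complex :: "nat \<Rightarrow> 'b topology \<Rightarrow> 'b set set \<Rightarrow> bool" where
  "contracted_complex d W K \<longleftrightarrow> simplicial_cell_complex d W K \<and> face_number W K 0 = d + 1"


section \<open>Colored graphs and crystallizations\<close>

record ('v, 'e) multigraph =
  verts :: "'v set"
  edges :: "'e set"
  ends :: "'e \<Rightarrow> 'v set"
  color :: "'e \<Rightarrow> nat"

definition colored_graph :: "nat set \<Rightarrow> ('v, 'e) multigraph \<Rightarrow> bool" where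
  "colored_graph C \<Gamma> \<longleftrightarrow>
     finite (verts \<Gamma>) \<and> finite (edges \<Gamma>) \<and>
     (\<forall>e\<in>edges \<Gamma>. ends \<Gamma> e \<subseteq> verts \<Gamma> \<and> card (ends \<Gamma> e) = 2 \<and> color \<Gamma> e \<in> C) \<and>
     (\<forall>e\<in>edges \<Gamma>. \<forall>f\<in>edges \<Gamma>.
        e \<noteq> f \<and> ends \<Gamma> e \<inter> ends \<Gamma> f \<noteq> {} \<longrightarrow> color \<Gamma> e \<noteq> color \<Gamma> f)"

text \<open>\<open>connected_in B \<Gamma>\<close>: the subgraph \<open>\<Gamma>\<^sub>B\<close> on all vertices and the edges with color in \<open>B\<close> is connected.\<close>

definition connected_in :: "nat set \<Rightarrow> ('v, 'e) multigraph \<Rightarrow> bool" where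
  "connected_in B \<Gamma> \<longleftrightarrow>
     verts \<Gamma> \<noteq> {} \<and>
     (\<forall>u\<in>verts \<Gamma>. \<forall>v\<in>verts \<Gamma>.
        (u, v) \<in> {(a, b). \<exists>e\<in>edges \<Gamma>. color \<Gamma> e \<in> B \<and> ends \<Gamma> e = {a, b}}\<^sup>*)"

definition contracted_graph :: "nat set \<Rightarrow> ('v, 'e) multigraph \<Rightarrow> bool" where
  "contracted_graph C \<Gamma> \<longleftrightarrow>
     colored_graph C \<Gamma> \<and> connected_in C \<Gamma> \<and> (\<forall>c\<in>C. connected_in (C - {c}) \<Gamma>)"

text \<open>
  The \<open>d + 1\<close> colors are \<open>0, \<dots>, d\<close>, matching the coordinates of \<^const>\<open>standard_simplex\<close>: the
  vertex of \<open>\<sigma>\<^sub>v\<close> labelled \<open>i\<close> is the \<open>i\<close>-th unit vector, and the facet opposite to it is \<open>x i = 0\<close>.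
\<close>

definition gluing_step :: "nat \<Rightarrow> ('v, 'e) multigraph \<Rightarrow> (('v \<times> (nat \<Rightarrow> real)) \<times> ('v \<times> (nat \<Rightarrow> real))) set" where
  "gluing_step d \<Gamma> =
     {((u, x), (v, x)) | u v x. x \<in> standard_simplex d \<and>
        (\<exists>e\<in>edges \<Gamma>. ends \<Gamma> e = {u, v} \<and> x (color \<Gamma> e) = 0)}"

definition glue :: "nat \<Rightarrow> ('v, 'e) multigraph \<Rightarrow> 'v \<times> (nat \<Rightarrow> real) \<Rightarrow> ('v \<times> (nat \<Rightarrow> real)) set" where
  "glue d \<Gamma> a = (gluing_step d \<Gamma>)\<^sup>* `` {a}"

definition graph_space :: "nat \<Rightarrow> ('v, 'e) multigraph \<Rightarrow> ('v \<times> (nat \<Rightarrow> real)) set topology" where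
  "graph_space d \<Gamma> =
     quotient_topology
       (prod_topology (discrete_topology (verts \<Gamma>))
          (subtopology (powertop_real UNIV) (standard_simplex d)))
       (glue d \<Gamma>)"

text \<open>\<open>A = {}\<close> contributes the empty face.\<close>

definition graph_complex :: "nat \<Rightarrow> ('v, 'e) multigraph \<Rightarrow> ('v \<times> (nat \<Rightarrow> real)) set set set" where
  "graph_complex d \<Gamma> =
     {glue d \<Gamma> ` ({v} \<times> {x \<in> standard_simplex d. \<forall>i. i \<notin> A \<longrightarrow> x i = 0}) | v A.
        v \<in> verts \<Gamma> \<and> A \<subseteq> {..d}}"

definition crystallization :: "nat \<Rightarrow> ('v, 'e) multigraph \<Rightarrow> 'a topology \<Rightarrow> bool" where
  "crystallization d \<Gamma> M \<longleftrightarrow>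
     contracted_graph {..d} \<Gamma> \<and>
     pseudotriangulation d (graph_space d \<Gamma>) (graph_complex d \<Gamma>) M"


section \<open>The fundamental group\<close>

definition loops :: "'a topology \<Rightarrow> 'a \<Rightarrow> (real \<Rightarrow> 'a) set" where
  "loops X p = {g. pathin X g \<and> g 0 = p \<and> g 1 = p}"

definition loop_class :: "'a topology \<Rightarrow> 'a \<Rightarrow> (real \<Rightarrow> 'a) \<Rightarrow> (real \<Rightarrow> 'a) set" where
  "loop_class X p g =
     {h \<in> loops X p. homotopic_with (\<lambda>k. k 0 = p \<and> k 1 = p) (top_of_set {0..1}) X g h}"

definition concat_path :: "(real \<Rightarrow> 'a) \<Rightarrow> (real \<Rightarrow> 'a) \<Rightarrow> real \<Rightarrow> 'a" where
  "concat_path g h = (\<lambda>t. if t \<le> 1/2 then g (2 * t) else h (2 * t - 1))"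

definition fundamental_group :: "'a topology \<Rightarrow> 'a \<Rightarrow> (real \<Rightarrow> 'a) set monoid" where
  "fundamental_group X p =
     \<lparr>carrier = loop_class X p ` loops X p,
      mult = (\<lambda>A B. \<Union>g\<in>A. \<Union>h\<in>B. loop_class X p (concat_path g h)),
      one = loop_class X p (\<lambda>_. p)\<rparr>"


section \<open>Free groups and presentations\<close>

text \<open>The letter \<open>(x, True)\<close> is \<open>x\<close>, and \<open>(x, False)\<close> is its formal inverse.\<close>

type_synonym 'x word = "('x \<times> bool) list"

definition inv_letter :: "'x \<times> bool \<Rightarrow> 'x \<times> bool" where
  "inv_letter a = (fst a, \<not> snd a)"

definition reduced :: "'x word \<Rightarrow> bool" where
  "reduced = successively (\<lambda>a b. b \<noteq> inv_letter a)"

definition push :: "'x \<times> bool \<Rightarrow> 'x word \<Rightarrow> 'x word" where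
  "push a w = (if w \<noteq> [] \<and> hd w = inv_letter a then tl w else a # w)"

text \<open>On reduced words, \<open>foldr push u v\<close> is the reduced form of the concatenation \<open>u @ v\<close>.\<close>

definition free_group :: "'x set \<Rightarrow> 'x word monoid" where
  "free_group S =
     \<lparr>carrier = {w. reduced w \<and> fst ` set w \<subseteq> S}, mult = foldr push, one = []\<rparr>"

lemma inv_letter_inv_letter [simp]: "inv_letter (inv_letter a) = a"
  by (simp add: inv_letter_def)

lemma reduced_push: "reduced w \<Longrightarrow> reduced (push a w)"
  by (cases w) (auto simp: push_def reduced_def successively_Cons)

lemma reduced_foldr_push: "reduced w \<Longrightarrow> reduced (foldr push u w)"
  by (induction u) (auto intro: reduced_push)

lemma push_inv_letter: "reduced w \<Longrightarrow> push a (push (inv_letter a) w) = w"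
  by (cases w) (auto simp: push_def reduced_def successively_Cons)

lemma foldr_push_push:
  assumes "reduced w"
  shows "foldr push (push a u) w = push a (foldr push u w)"
proof (cases "u \<noteq> [] \<and> hd u = inv_letter a")
  case True
  then obtain v where "u = inv_letter a # v"
    by (cases u) auto
  then show ?thesis
    using assms by (simp add: push_def[of a "inv_letter a # v"] push_inv_letter reduced_foldr_push)
qed (auto simp: push_def)

lemma foldr_push_assoc:
  "reduced w \<Longrightarrow> foldr push (foldr push u v) w = foldr push u (foldr push v w)"
  by (induction u) (auto simp: foldr_push_push)

lemma foldr_push_Nil: "reduced u \<Longrightarrow> foldr push u [] = u"
proof (induction u)
  case (Cons a u)
  then show ?case
    by (cases u) (auto simp: push_def reduced_def)
qed simp

lemma set_foldr_push: "set (foldr push u v) \<subseteq> set u \<union> set v"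
proof (induction u)
  case (Cons a u)
  have "set (push a w) \<subseteq> insert a (set w)" for w
    by (cases w) (auto simp: push_def)
  with Cons show ?case
    by fastforce
qed simp

lemma group_free_group: "group (free_group S)"
proof (rule groupI)
  show "\<exists>y\<in>carrier (free_group S). y \<otimes>\<^bsub>free_group S\<^esub> x = \<one>\<^bsub>free_group S\<^esub>"
    if "x \<in> carrier (free_group S)" for x
  proof -
    let ?y = "map inv_letter (rev x)"
    have *: "foldr push (map inv_letter (rev v)) v = []" for v
    proof (induction v)
      case (Cons a v)
      then show ?case
        by (simp add: push_def)
    qed simp
    have "successively (\<lambda>a b. b \<noteq> inv_letter a) x"
      using that by (simp add: free_group_def reduced_def)
    then have "successively (\<lambda>a b. inv_letter a \<noteq> b) x"
      by (rule successively_mono) auto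
    then have "reduced ?y"
      by (simp add: reduced_def successively_map successively_rev)
    moreover have "fst ` set ?y \<subseteq> S"
      using that by (auto simp: free_group_def inv_letter_def)
    ultimately show ?thesis
      using * by (intro bexI[of _ ?y]) (auto simp: free_group_def)
  qed
next
  show "x \<otimes>\<^bsub>free_group S\<^esub> y \<in> carrier (free_group S)"
    if "x \<in> carrier (free_group S)" "y \<in> carrier (free_group S)" for x y
    using that set_foldr_push[of x y] by (fastforce simp: free_group_def reduced_foldr_push)
qed (auto simp: free_group_def foldr_push_assoc reduced_def)

definition normal_closure :: "'x set \<Rightarrow> 'x word set \<Rightarrow> 'x word set" where
  "normal_closure S R = \<Inter>{N. N \<lhd> free_group S \<and> R \<subseteq> N}"

definition presented_group :: "'x set \<Rightarrow> 'x word set \<Rightarrow> 'x word set monoid" where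
  "presented_group S R = free_group S Mod normal_closure S R"


section \<open>The weight of a group\<close>

definition sign :: "'x \<times> bool \<Rightarrow> int" where
  "sign a = (if snd a then 1 else -1)"

definition sign_variation :: "'x word \<Rightarrow> int" where
  "sign_variation w =
     (if length w \<le> 1 then 0
      else \<Sum>i<length w. \<bar>sign (w ! i) - sign (w ! ((i + 1) mod length w))\<bar>)"

text \<open>The next lemma shows that the division and the conversion to \<^typ>\<open>nat\<close> below are exact.\<close>

lemma sign_variation_bounds:
  "even (sign_variation w)" "0 \<le> sign_variation w" "sign_variation w \<le> 2 * int (length w)"
proof -
  show "even (sign_variation w)"
    unfolding sign_variation_def by (auto simp: sign_def intro!: dvd_sum)
  show "0 \<le> sign_variation w"
    unfolding sign_variation_def by (auto intro!: sum_nonneg)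
  have "(\<Sum>i<length w. \<bar>sign (w ! i) - sign (w ! ((i + 1) mod length w))\<bar>) \<le> (\<Sum>i<length w. 2)"
    by (rule sum_mono) (simp add: sign_def)
  then show "sign_variation w \<le> 2 * int (length w)"
    unfolding sign_variation_def by (auto simp: mult.commute)
qed

function lambda_weight :: "'x word \<Rightarrow> nat" where
  "lambda_weight w =
     (if w = [] then 2
      else if last w \<noteq> inv_letter (hd w) then nat (2 * int (length w) - sign_variation w div 2)
      else lambda_weight (butlast (tl w)))"
  by auto
termination
  by (relation "Wellfounded.measure length") (auto simp: less_Suc_eq_le)

declare lambda_weight.simps [simp del]

definition replacing_relators :: "'x set \<Rightarrow> 'x word set \<Rightarrow> 'x word set" where
  "replacing_relators S R =
     {w \<in> normal_closure S R.
        \<forall>r\<in>R. normal_closure S (insert w (R - {r})) = normal_closure S R}"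

text \<open>For \<open>R = {}\<close> the only replacing relator is the empty word.\<close>

definition presentation_weight :: "'x set \<Rightarrow> 'x word set \<Rightarrow> nat" where
  "presentation_weight S R =
     (\<Sum>r\<in>R. lambda_weight r)
     + (LEAST n. n \<in> lambda_weight ` replacing_relators S R)
     + 2 * (card S - card R)"

text \<open>Generators are drawn from \<^typ>\<open>nat\<close>; every finite presentation is a relabelling of such a one.\<close>

definition presentations :: "'g monoid \<Rightarrow> nat \<Rightarrow> (nat set \<times> nat word set) set" where
  "presentations G q =
     {(S, R). finite S \<and> finite R \<and> R \<subseteq> carrier (free_group S) \<and>
        card R \<le> card S \<and> card S \<le> q \<and> presented_group S R \<cong> G}"

definition min_generators :: "'g monoid \<Rightarrow> nat" where
  "min_generators G = (LEAST q. presentations G q \<noteq> {})"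

definition weight_upto :: "'g monoid \<Rightarrow> nat \<Rightarrow> nat" where
  "weight_upto G q = (LEAST n. \<exists>(S, R)\<in>presentations G q. n = presentation_weight S R)"

definition weight_index :: "'g monoid \<Rightarrow> nat" where
  "weight_index G = (LEAST q. min_generators G \<le> q \<and> weight_upto G q \<le> 6 * (q + 1))"

definition group_weight :: "'g monoid \<Rightarrow> nat" where
  "group_weight G = max (weight_upto G (weight_index G)) (6 * min_generators G + 2)"

end

theory Submission
  imports Defs "HOL-Homology.Invariance_of_Domain" "HOL-Library.Sublist"
begin

text \<open>
 Why the theorem holds. In a contracted complex of dimension 3 there are only four vertices, so the
 faces of every cell are labelled by sets of labels and all cells carry compatible barycentric
 coordinates. The manifold is thus glued from finitely many tetrahedra with labelled vertices
 (locale \<open>tetrahedra\<close>, \<open>tetrahedra_of_cells\<close>). By invariance of domain, exactly two tetrahedra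
 meet in each facet; crossing the facet opposite to the vertex \<open>c\<close> is an involution \<open>\<alpha> c\<close> on the set
 \<open>V\<close> of tetrahedra, and these involutions are the edges of a graph with four colours.

 Local topology enters through flat bundles: a punctured ball in a chart is simply connected, so
 every cocycle on it has a section (\<open>local_section\<close>). Cocycles with coefficients in \<open>\<int>/2\<close> show that
 the tetrahedra around an edge form one bicoloured cycle (\<open>edge_link_connected\<close>) and that the link of a
 vertex is connected and has no cohomology in degree 1 (\<open>vertex_link_connected\<close>, \<open>vertex_link_pure\<close>).
 A combinatorial collapse turns this into statements about spheres (\<open>sphere_faces\<close>): the Euler
 characteristic of the link is 2, and for every group \<open>G\<close> a \<open>G\<close>-valued connection on it that is trivial
 around all 2-cells but one is trivial. The first part gives, for the number \<open>g i j\<close> of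
 bicoloured cycles, \<open>g i j = g k l\<close> and \<open>g i j + g i k + g j k = card V / 2 + 2\<close>, so that some pair of
 colours satisfies \<open>6 * g i j \<le> card V + 4\<close>.

 For this pair the fundamental group has a presentation with \<open>g i j - 1\<close> generators, the cycles of
 colours \<open>k, l\<close> (dual to the edges \<open>i j\<close>) except one, and with one relator for every cycle of colours
 \<open>i, j\<close>, read off along the cycle with alternating exponents. The second part above makes each single
 relator a consequence of the others (\<open>relator_redundant\<close>). That this presents the fundamental group is
 proved by holonomy rather than by a cell decomposition: the relators allow a flat bundle over the
 manifold whose structure group is the presented group, and its holonomy is inverse, up to conjugation,
 to the evident homomorphism into the fundamental group (\<open>fundamental_group_presentation\<close>).

 An alternating word has weight at most its length, so the weights of the relators add up to at most
 \<open>card V\<close> (\<open>lambda_relator\<close>). As the presentation has one relator more than generators and any relator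
 may play the role of the redundant one, \<open>presentation_weight\<close> is at most \<open>card V\<close>, and
 \<open>6 * card S + 2 \<le> card V\<close> by the choice of colours; \<open>group_weight_le\<close> turns the two inequalities into
 the bound on the weight of the group. A crystallization is covered because its complex has four
 vertices and at most as many 3-cells as the graph has vertices.
\<close>


lemmas continuous_map_into = continuous_map_in_subtopology

section \<open>Coloured involutions\<close>

lemma (in group) inv_mult_cancel: "a \<in> carrier G ==> b \<in> carrier G ==> inv a \<otimes> (a \<otimes> b) = b"
 by (simp flip: m_assoc)

lemma (in group) mult_inv_cancel: "a \<in> carrier G ==> b \<in> carrier G ==> a \<otimes> (inv a \<otimes> b) = b"
 by (simp flip: m_assoc)

text \<open>The dual graph of a closed pseudomanifold with labelled vertices: the edge of colour \<open>c\<close> at the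
 simplex \<open>u\<close> leads to \<open>\<alpha> c u\<close>. The orbits of \<open>D\<close> are the components of the subgraph with colours in \<open>D\<close>.\<close>
locale colored_involutions =
 fixes V :: "'v set" and \<alpha> :: "'c => 'v => 'v"
 assumes finite_V: "finite V"
  and alpha_closed: "u \<in> V ==> \<alpha> c u \<in> V"
  and alpha_alpha: "u \<in> V ==> \<alpha> c (\<alpha> c u) = u"
  and alpha_no_fix: "u \<in> V ==> \<alpha> c u \<noteq> u"
begin

definition orb :: "'c set => 'v => 'v set" where
 "orb D u = {foldr \<alpha> cs u | cs. set cs \<subseteq> D}"

lemma foldr_closed: "u \<in> V ==> foldr \<alpha> cs u \<in> V"
 by (induction cs) (auto intro: alpha_closed)

lemma orb_subset: "u \<in> V ==> orb D u \<subseteq> V"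
 by (auto simp: orb_def foldr_closed)

lemma orb_refl: "u \<in> orb D u"
 unfolding orb_def by (rule CollectI, rule exI[of _ "[]"]) simp

lemma orb_step: "v \<in> orb D u ==> c \<in> D ==> \<alpha> c v \<in> orb D u"
 unfolding orb_def by (auto, rule_tac x="c # cs" in exI) simp

lemma foldr_rev_alpha: "u \<in> V ==> foldr \<alpha> (rev cs) (foldr \<alpha> cs u) = u"
 by (induction cs) (auto simp: alpha_alpha foldr_closed)

lemma orb_trans: "v \<in> orb D u ==> w \<in> orb D v ==> w \<in> orb D u"
 unfolding orb_def
proof (clarify)
 fix cs ds assume "set cs \<subseteq> D" "set ds \<subseteq> D"
 thus "\<exists>es. foldr \<alpha> ds (foldr \<alpha> cs u) = foldr \<alpha> es u \<and> set es \<subseteq> D"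
  by (intro exI[of _ "ds @ cs"]) auto
qed

lemma orb_sym: assumes "u \<in> V" "v \<in> orb D u" shows "u \<in> orb D v"
proof -
 obtain cs where cs: "v = foldr \<alpha> cs u" "set cs \<subseteq> D" using assms(2) by (auto simp: orb_def)
 hence "foldr \<alpha> (rev cs) v = u" using foldr_rev_alpha assms(1) by blast
 thus ?thesis unfolding orb_def using cs(2)
  by (intro CollectI exI[of _ "rev cs"]) auto
qed

lemma orb_eq: assumes "u \<in> V" "v \<in> orb D u" shows "orb D v = orb D u"
 using orb_trans orb_sym assms by blast

lemma orb_induct:
 assumes "v \<in> orb D u" "P u" "!!x c. x \<in> orb D u ==> P x ==> c \<in> D ==> P (\<alpha> c x)"
 shows "P v"
proof -
 obtain cs where cs: "v = foldr \<alpha> cs u" "set cs \<subseteq> D" using assms(1) by (auto simp: orb_def)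
 have "set cs \<subseteq> D ==> P (foldr \<alpha> cs u) \<and> foldr \<alpha> cs u \<in> orb D u"
  by (induction cs) (auto intro: assms orb_refl orb_step)
 thus ?thesis using cs by blast
qed

definition orbs :: "'c set => 'v set set" where
 "orbs D = orb D ` V"

lemma finite_orbs: "finite (orbs D)"
 by (simp add: orbs_def finite_V)

lemma Union_orbs: "\<Union> (orbs D) = V"
 using orb_subset orb_refl by (fastforce simp: orbs_def)

lemma orbs_disjoint: assumes "Q \<in> orbs D" "Q' \<in> orbs D" "Q \<noteq> Q'" shows "Q \<inter> Q' = {}"
proof -
 obtain u u' where u: "Q = orb D u" "Q' = orb D u'" "u \<in> V" "u' \<in> V"
  using assms by (auto simp: orbs_def)
 show ?thesis
 proof (rule ccontr)
  assume "Q \<inter> Q' \<noteq> {}"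
  then obtain x where "x \<in> orb D u" "x \<in> orb D u'" using u by blast
  thus False using orb_eq[OF u(3)] orb_eq[OF u(4)] u(1,2) assms(3) by metis
 qed
qed

lemma sum_card_orbs: "(\<Sum>Q\<in>orbs D. card Q) = card V"
proof -
 have "card (\<Union> (orbs D)) = (\<Sum>Q\<in>orbs D. card Q)"
  using orbs_disjoint finite_subset[OF orb_subset finite_V]
  by (intro card_Union_disjoint) (auto simp: disjoint_def orbs_def)
 thus ?thesis by (simp add: Union_orbs)
qed

lemma even_card_V: "even (card V)"
proof -
 fix c :: 'c
 have "card Q = 2" if Q: "Q \<in> orbs {c}" for Q
 proof -
  obtain u where u: "Q = orb {c} u" "u \<in> V" using Q by (auto simp: orbs_def)
  have "v \<in> {u, \<alpha> c u}" if "v \<in> orb {c} u" for v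
   using that by (rule orb_induct) (use u in \<open>auto simp: alpha_alpha\<close>)
  hence "Q = {u, \<alpha> c u}" using u orb_refl orb_step[of u "{c}" u c] by auto
  thus ?thesis using alpha_no_fix[of u c] u by simp
 qed
 hence "card V = 2 * card (orbs {c})" using sum_card_orbs[of "{c}"] by simp
 thus ?thesis by simp
qed

section \<open>Bicoloured cycles\<close>

text \<open>The walk that crosses edges of the colours \<open>c, d, c, d, \<dots>\<close>.\<close>
fun zig :: "'c => 'c => 'v => nat => 'v" where
 "zig c d u 0 = u"
| "zig c d u (Suc t) = \<alpha> (if even t then c else d) (zig c d u t)"

lemma zig_closed: "u \<in> V ==> zig c d u t \<in> V"
 by (induction t) (auto intro: alpha_closed)

lemma zig_back: "u \<in> V ==> zig c d u t = \<alpha> (if even t then c else d) (zig c d u (Suc t))"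
 by (simp add: alpha_alpha zig_closed)

lemma zig_cancel: "u \<in> V ==> zig c d u s = zig c d u (s + 2 * k) ==> zig c d u (2 * k) = u"
proof (induction s)
 case (Suc s)
 have "zig c d u s = \<alpha> (if even s then c else d) (zig c d u (Suc s + 2 * k))"
  using zig_back[OF Suc.prems(1), of c d s] Suc.prems(2) by (simp only:)
 also have "\<dots> = zig c d u (s + 2 * k)"
  using zig_back[OF Suc.prems(1), of c d "s + 2 * k"] by (simp only: add_Suc even_add even_mult_iff even_numeral simp_thms)
 finally show ?case using Suc by blast
qed simp

text \<open>A closed walk of odd length would, folded from both ends, fix the vertex in its middle.\<close>
lemma zig_odd: "u \<in> V ==> zig c d u s \<noteq> zig c d u (s + 2 * k + 1)"
proof (induction k arbitrary: s)
 case 0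
 thus ?case using alpha_no_fix[OF zig_closed] by (metis Suc_eq_plus1 add_0_right mult_0_right zig.simps(2))
next
 case (Suc k)
 show ?case
 proof
  assume eq: "zig c d u s = zig c d u (s + 2 * Suc k + 1)"
  have "zig c d u (Suc s) = zig c d u (s + 2 * Suc k)"
   using zig_back[of u c d "s + 2 * Suc k"] eq Suc.prems by simp
  thus False using Suc.IH[of "Suc s"] Suc.prems by simp
 qed
qed

definition half_period :: "'c => 'c => 'v => nat" where
 "half_period c d u = (LEAST m. m > 0 \<and> zig c d u (2 * m) = u)"

lemma half_period: assumes "u \<in> V"
 shows "half_period c d u > 0" "zig c d u (2 * half_period c d u) = u"
proof -
 have "\<not> inj_on (\<lambda>k. zig c d u (2 * k)) {..card V}"
 proof
  assume "inj_on (\<lambda>k. zig c d u (2 * k)) {..card V}"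
  hence "card {..card V} \<le> card V"
   using finite_V zig_closed[OF assms] by (intro card_inj_on_le) auto
  thus False by simp
 qed
 then obtain a b where ab: "zig c d u (2 * a) = zig c d u (2 * b)" "a < b"
  unfolding inj_on_def by (metis linorder_neqE_nat)
 hence "zig c d u (2 * (b - a)) = u"
  using zig_cancel[OF assms, of c d "2 * a" "b - a"] by (simp add: algebra_simps)
 hence "\<exists>m. m > 0 \<and> zig c d u (2 * m) = u" using ab(2) by (intro exI[of _ "b - a"]) auto
 hence "half_period c d u > 0 \<and> zig c d u (2 * half_period c d u) = u"
  unfolding half_period_def by (rule LeastI_ex)
 thus "half_period c d u > 0" "zig c d u (2 * half_period c d u) = u" by auto
qed

lemma zig_inj: assumes "u \<in> V" shows "inj_on (zig c d u) {..<2 * half_period c d u}"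
proof -
 have False if st: "s < t" "t < 2 * half_period c d u" "zig c d u s = zig c d u t" for s t
 proof (cases "even (t - s)")
  case True
  then obtain k where k: "t - s = 2 * k" by (rule evenE)
  hence t: "t = s + 2 * k" using st(1) by linarith
  have "zig c d u (2 * k) = u" using zig_cancel[OF assms, of c d s k] st(3) unfolding t by blast
  moreover have "k > 0" "k < half_period c d u" using k st by auto
  ultimately show False unfolding half_period_def using not_less_Least by blast
 next
  case False
  then obtain k where k: "t - s = 2 * k + 1" by (rule oddE)
  hence "t = s + 2 * k + 1" using st by simp
  thus False using zig_odd[OF assms, of c d s k] st by simp
 qed
 thus ?thesis unfolding inj_on_def by (metis lessThan_iff linorder_neqE_nat)
qed

lemma zig_last: assumes "u \<in> V"
 shows "\<alpha> d u = zig c d u (2 * half_period c d u - 1)"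
proof -
 obtain m where m: "half_period c d u = Suc m" using half_period(1)[OF assms, of c d] by (metis gr0_implies_Suc)
 have "zig c d u (2 * m + 1) = \<alpha> d (zig c d u (2 * m + 2))"
  using zig_back[OF assms, of c d "2 * m + 1"] by simp
 thus ?thesis using half_period(2)[OF assms, of c d] m by simp
qed

text \<open>The two edges at a position of the cycle lead to the next position and to the preceding one.\<close>
lemma zig_neighbour:
 assumes "u \<in> V" "t < 2 * half_period c d u" "e \<in> {c, d}"
 obtains "e = (if even t then c else d)"
 | s where "s < 2 * half_period c d u" "zig c d u t = zig c d u (Suc s)" "e = (if even s then c else d)"
proof (cases "e = (if even t then c else d)")
 case False
 show ?thesis
 proof (cases t)
  case 0
  thus ?thesis using half_period[OF assms(1), of c d] False assms(3)
   by (intro that(2)[of "2 * half_period c d u - 1"]) (auto simp del: zig.simps(2))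
 next
  case (Suc s)
  thus ?thesis using assms(2,3) False by (intro that(2)[of s]) (auto simp del: zig.simps(2))
 qed
qed (rule that(1))

lemma zig_image: assumes u: "u \<in> V"
 shows "zig c d u ` {..<2 * half_period c d u} = orb {c, d} u"
proof
 have "zig c d u t \<in> orb {c, d} u" for t
  by (induction t) (auto intro: orb_refl orb_step)
 thus "zig c d u ` {..<2 * half_period c d u} \<subseteq> orb {c, d} u" by auto
 let ?n = "2 * half_period c d u"
 have image: "zig c d u t \<in> zig c d u ` {..<?n}" if "t \<le> ?n" for t
  using that half_period[OF u, of c d] by (cases "t = ?n") (auto intro!: image_eqI[of _ _ 0])
 show "orb {c, d} u \<subseteq> zig c d u ` {..<?n}"
 proof
  fix v assume "v \<in> orb {c, d} u"
  thus "v \<in> zig c d u ` {..<?n}"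
  proof (rule orb_induct)
   show "u \<in> zig c d u ` {..<?n}" using image[of 0] by simp
  next
   fix x e assume "x \<in> zig c d u ` {..<?n}" and e: "e \<in> {c, d}"
   then obtain t where t: "x = zig c d u t" "t < ?n" by auto
   show "\<alpha> e x \<in> zig c d u ` {..<?n}"
   proof (rule zig_neighbour[OF u t(2) e])
    assume "e = (if even t then c else d)"
    thus ?thesis using image[of "Suc t"] t by simp
   next
    fix s assume s: "s < ?n" "zig c d u t = zig c d u (Suc s)" "e = (if even s then c else d)"
    hence "\<alpha> e x = zig c d u s" using zig_back[OF u, of c d s] t(1) by (simp only:)
    thus ?thesis using image[of s] s(1) by simp
   qed
  qed
 qed
qed

lemma card_orb2: "u \<in> V ==> card (orb {c, d} u) = 2 * half_period c d u"
 using card_image[OF zig_inj[of u c d]] zig_image[of u c d] by simp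

section \<open>Connections and holonomy\<close>

text \<open>The pair \<open>(c, u)\<close> stands for the edge of colour \<open>c\<close> at \<open>u\<close>, directed away from \<open>u\<close>; \<open>face {c, d} u\<close> is
 the set of directed edges of a bicoloured cycle, the boundary of a 2-cell of the dual complex.\<close>
definition face :: "'c set => 'v => ('c \<times> 'v) set" where
 "face D u = D \<times> orb D u"

definition connection :: "('g, 'b) monoid_scheme => ('c => 'v => 'g) => bool" where
 "connection G h \<longleftrightarrow> (\<forall>c. \<forall>u\<in>V. h c u \<in> carrier G \<and> h c (\<alpha> c u) = inv\<^bsub>G\<^esub> (h c u))"

definition trivial_on :: "('g, 'b) monoid_scheme => ('c => 'v => 'g) => ('c \<times> 'v) set => bool" where
 "trivial_on G h E \<longleftrightarrow>
   (\<exists>F. F \<in> V \<rightarrow> carrier G \<and> (\<forall>(c, u)\<in>E. h c u = inv\<^bsub>G\<^esub> (F u) \<otimes>\<^bsub>G\<^esub> F (\<alpha> c u)))"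

primrec holonomy :: "('g, 'b) monoid_scheme => ('c => 'v => 'g) => 'c => 'c => 'v => nat => 'g" where
 "holonomy G h c d u 0 = \<one>\<^bsub>G\<^esub>"
| "holonomy G h c d u (Suc t) =
   holonomy G h c d u t \<otimes>\<^bsub>G\<^esub> h (if even t then c else d) (zig c d u t)"

lemma trivial_onE:
 assumes "trivial_on G h E"
 obtains F where "F \<in> V \<rightarrow> carrier G"
  "!!c u. (c, u) \<in> E ==> h c u = inv\<^bsub>G\<^esub> (F u) \<otimes>\<^bsub>G\<^esub> F (\<alpha> c u)"
 using assms unfolding trivial_on_def by (auto split: prod.splits)

lemma trivial_on_mono: "trivial_on G h E ==> E' \<subseteq> E ==> trivial_on G h E'"
 unfolding trivial_on_def by blast

lemma trivial_on_cong:
 "trivial_on G h E ==> (!!c u. (c, u) \<in> E ==> h' c u = h c u) ==> trivial_on G h' E"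
 unfolding trivial_on_def by (elim exE conjE, rule_tac x=F in exI) auto

lemma holonomy_cong:
 "(!!s. s < t ==> h (if even s then c else d) (zig c d u s) = h' (if even s then c else d) (zig c d u s)) ==>
  holonomy G h c d u t = holonomy G h' c d u t"
 by (induction t) simp_all

lemma holonomy_closed:
 assumes "group G" "connection G h" "u \<in> V"
 shows "holonomy G h c d u t \<in> carrier G"
proof -
 interpret group G by fact
 show ?thesis
  using assms(2,3) by (induction t) (auto simp: connection_def zig_closed)
qed

lemma holonomy_trivial:
 fixes G (structure)
 assumes "group G" "u \<in> V" and F: "F \<in> V \<rightarrow> carrier G"
  and h: "!!t. h (if even t then c else d) (zig c d u t) =
     inv\<^bsub>G\<^esub> (F (zig c d u t)) \<otimes>\<^bsub>G\<^esub> F (\<alpha> (if even t then c else d) (zig c d u t))"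
 shows "holonomy G h c d u t = inv\<^bsub>G\<^esub> (F u) \<otimes>\<^bsub>G\<^esub> F (zig c d u t)"
proof -
 interpret group G by fact
 have Fc: "F (zig c d u t) \<in> carrier G" for t using F zig_closed[OF assms(2)] by auto
 show ?thesis
 proof (induction t)
  case 0 thus ?case using Fc[of 0] by simp
 next
  case (Suc t)
  have "holonomy G h c d u (Suc t) = inv (F u) \<otimes> F (zig c d u t) \<otimes>
    (inv (F (zig c d u t)) \<otimes> F (zig c d u (Suc t)))"
   using Suc h[of t] by simp
  also have "\<dots> = inv (F u) \<otimes> F (zig c d u (Suc t))"
   using Fc[of 0] Fc[of t] Fc[of "Suc t"] by (simp add: m_assoc mult_inv_cancel del: zig.simps(2))
  finally show ?case .
 qed
qed

lemma zig_in_orb: "zig c d u t \<in> orb {c, d} u"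
 by (induction t) (auto intro: orb_refl orb_step)

lemma holonomy_face:
 fixes G (structure)
 assumes "group G" "u \<in> V" "trivial_on G h (face {c, d} u)"
 shows "holonomy G h c d u (2 * half_period c d u) = \<one>\<^bsub>G\<^esub>"
proof -
 interpret group G by fact
 obtain F where F: "F \<in> V \<rightarrow> carrier G"
  "!!e x. (e, x) \<in> face {c, d} u ==> h e x = inv (F x) \<otimes> F (\<alpha> e x)"
  using trivial_onE[OF assms(3)] by metis
 have "holonomy G h c d u (2 * half_period c d u) = inv (F u) \<otimes> F (zig c d u (2 * half_period c d u))"
  using zig_in_orb[of c d u] by (intro holonomy_trivial[OF assms(1,2) F(1)] F(2)) (auto simp: face_def)
 thus ?thesis using half_period(2)[OF assms(2)] funcset_mem[OF F(1) assms(2)] by simp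
qed

text \<open>A potential at \<open>x\<close> is the holonomy of the walk from \<open>u\<close> to \<open>x\<close>; it is consistent since the walk once around is trivial.\<close>
lemma trivial_on_face:
 fixes G (structure)
 assumes "group G" "connection G h" "u \<in> V"
  and 1: "holonomy G h c d u (2 * half_period c d u) = \<one>\<^bsub>G\<^esub>"
 shows "trivial_on G h (face {c, d} u)"
proof -
 interpret group G by fact
 let ?n = "2 * half_period c d u" and ?p = "zig c d u" and ?hol = "holonomy G h c d u"
 have n: "?n > 0" using half_period(1)[OF assms(3)] by simp
 have hc: "?hol t \<in> carrier G" for t by (rule holonomy_closed[OF assms(1-3)])
 define F where "F x = (if x \<in> orb {c, d} u then ?hol (inv_into {..<?n} ?p x) else \<one>)" for x
 have Fp: "F (?p t) = ?hol t" if "t \<le> ?n" for t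
 proof (cases "t = ?n")
  case True
  hence "F (?p t) = F (?p 0)" using half_period(2)[OF assms(3)] by simp
  also have "\<dots> = ?hol 0"
   using inv_into_f_f[OF zig_inj[OF assms(3)], of 0 c d] n zig_in_orb[of c d u 0] by (simp add: F_def)
  finally show ?thesis using True 1 by simp
 next
  case False
  thus ?thesis
   using inv_into_f_f[OF zig_inj[OF assms(3)], of t c d] that zig_in_orb[of c d u t] by (simp add: F_def)
 qed
 have Fc: "F \<in> V \<rightarrow> carrier G" using hc by (auto simp: F_def)
 have fwd: "h (if even t then c else d) (?p t) = inv (F (?p t)) \<otimes> F (?p (Suc t))" if "t < ?n" for t
 proof -
  have "h (if even t then c else d) (?p t) \<in> carrier G"
   using assms(2) zig_closed[OF assms(3)] by (auto simp: connection_def)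
  thus ?thesis using Fp[of t] Fp[of "Suc t"] that hc[of t]
   by (simp add: inv_mult_cancel split del: if_split del: zig.simps)
 qed
 have bwd: "h (if even t then c else d) (?p (Suc t)) = inv (F (?p (Suc t))) \<otimes> F (?p t)" if "t < ?n" for t
 proof -
  have "h (if even t then c else d) (?p (Suc t)) = inv (h (if even t then c else d) (?p t))"
   using assms(2) zig_closed[OF assms(3)] by (auto simp: connection_def)
  also have "\<dots> = inv (F (?p (Suc t))) \<otimes> F (?p t)"
   using fwd[OF that] Fc zig_closed[OF assms(3)] by (auto simp: inv_mult_group Pi_iff simp del: zig.simps)
  finally show ?thesis .
 qed
 have "h e x = inv (F x) \<otimes> F (\<alpha> e x)" if ex: "(e, x) \<in> face {c, d} u" for e x
 proof -
  obtain t where t: "x = ?p t" "t < ?n"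
   using ex zig_image[OF assms(3), of c d] by (auto simp: face_def)
  have "e \<in> {c, d}" using ex by (simp add: face_def)
  thus ?thesis
  proof (rule zig_neighbour[OF assms(3) t(2)])
   assume "e = (if even t then c else d)"
   thus ?thesis using fwd[OF t(2)] t(1) by simp
  next
   fix s assume s: "s < ?n" "?p t = ?p (Suc s)" "e = (if even s then c else d)"
   hence "\<alpha> e x = ?p s" using zig_back[OF assms(3), of c d s] t(1) by (simp only:)
   thus ?thesis using bwd[OF s(1)] s t(1) by simp
  qed
 qed
 thus ?thesis unfolding trivial_on_def using Fc by blast
qed

lemma zig_neq_start: "u \<in> V ==> 0 < t ==> t < 2 * half_period c d u ==> zig c d u t \<noteq> u"
 using inj_onD[OF zig_inj, of u c d t 0] by auto

lemma zig_neq_end: "u \<in> V ==> t < 2 * half_period c d u - 1 ==> zig c d u t \<noteq> \<alpha> d u"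
 using inj_onD[OF zig_inj, of u c d t "2 * half_period c d u - 1"] zig_last[of u d c] by fastforce

text \<open>Removing one edge from a bicoloured cycle leaves a path.\<close>
lemma face_minus_edge_connected:
 assumes "w \<in> V" "c \<noteq> d"
  and q: "!!e x. (e, x) \<in> face {c, d} w - {(d, w), (d, \<alpha> d w)} ==> q (\<alpha> e x) = q x"
 shows "x \<in> orb {c, d} w ==> q x = q w"
proof -
 let ?n = "2 * half_period c d w" and ?p = "zig c d w"
 have n: "?n > 0" using half_period(1)[OF assms(1)] by simp
 have "t < ?n ==> q (?p t) = q w" for t
 proof (induction t)
  case (Suc t)
  let ?e = "if even t then c else d"
  have "(?e, ?p t) \<noteq> (d, w)"
   using zig_neq_start[OF assms(1), of t c d] Suc.prems assms(2) by (cases "t = 0") auto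
  moreover have "?p t \<noteq> \<alpha> d w"
   using Suc.prems by (intro zig_neq_end[OF assms(1)]) auto
  ultimately have "q (\<alpha> ?e (?p t)) = q (?p t)"
   by (intro q) (auto simp: face_def zig_in_orb)
  thus ?case using Suc by simp
 qed simp
 thus "x \<in> orb {c, d} w ==> q x = q w" unfolding zig_image[OF assms(1), of c d, symmetric] by auto
qed

text \<open>The value on a single edge can absorb the holonomy of a bicoloured cycle through it.\<close>
lemma flatten_edge:
 fixes G (structure)
 assumes "group G" "connection G h" "w \<in> V" "c \<noteq> d"
 obtains h' where "connection G h'" "trivial_on G h' (face {c, d} w)"
  "!!e x. (e, x) \<notin> {(d, w), (d, \<alpha> d w)} ==> h' e x = h e x"
proof -
 interpret group G by fact
 let ?n = "2 * half_period c d w" and ?p = "zig c d w"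
 have n: "?n > 0" using half_period(1)[OF assms(3)] by simp
 define a where "a = holonomy G h c d w (?n - 1)"
 have ac: "a \<in> carrier G" unfolding a_def by (rule holonomy_closed[OF assms(1-3)])
 define h' where "h' e x = (if (e, x) = (d, w) then a else if (e, x) = (d, \<alpha> d w) then inv a else h e x)" for e x
 have w': "\<alpha> d w \<noteq> w" "\<alpha> d (\<alpha> d w) = w" using alpha_no_fix alpha_alpha assms(3) by auto
 have con: "connection G h'"
  unfolding connection_def
 proof (intro allI ballI conjI)
  fix e u assume u: "u \<in> V"
  show "h' e u \<in> carrier G" using assms(2) ac u by (auto simp: h'_def connection_def)
  have "u = \<alpha> d w" if "\<alpha> d u = w" using that alpha_alpha[OF u, of d] by metis
  moreover have "u = w" if "\<alpha> d u = \<alpha> d w" using that alpha_alpha[OF u, of d] w' by metis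
  ultimately have "(e, \<alpha> e u) = (d, w) \<longleftrightarrow> (e, u) = (d, \<alpha> d w)"
   "(e, \<alpha> e u) = (d, \<alpha> d w) \<longleftrightarrow> (e, u) = (d, w)"
   using w'(2) by auto
  thus "h' e (\<alpha> e u) = inv (h' e u)"
   using assms(2) ac u w'(1) unfolding h'_def connection_def by (auto simp only: if_True if_False inv_inv split: if_splits)
 qed
 have "holonomy G h' c d w ?n = holonomy G h' c d w (?n - 1) \<otimes> h' d (?p (?n - 1))"
 proof -
  have "odd (?n - 1)" "Suc (?n - 1) = ?n" using n by auto
  thus ?thesis using holonomy.simps(2)[of G h' c d w "?n - 1"] by simp
 qed
 also have "h' d (?p (?n - 1)) = inv a"
  using zig_last[OF assms(3), of d c] w' by (simp add: h'_def)
 also have "holonomy G h' c d w (?n - 1) = a"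
  unfolding a_def
 proof (rule holonomy_cong)
  fix t assume t: "t < ?n - 1"
  let ?e = "if even t then c else d"
  have "(?e, ?p t) \<noteq> (d, w)"
   using zig_neq_start[OF assms(3), of t c d] t assms(4) by (cases "t = 0") auto
  moreover have "?p t \<noteq> \<alpha> d w"
   using t by (intro zig_neq_end[OF assms(3)]) auto
  ultimately show "h' ?e (?p t) = h ?e (?p t)" by (auto simp: h'_def)
 qed
 finally have "holonomy G h' c d w ?n = \<one>" using ac by simp
 hence "trivial_on G h' (face {c, d} w)" by (intro trivial_on_face[OF assms(1) con assms(3)])
 thus ?thesis using con by (intro that[of h']) (auto simp: h'_def)
qed

end

section \<open>Collapsing a surface\<close>

definition Z2 :: "bool monoid" where
 "Z2 = \<lparr>carrier = UNIV, mult = (\<noteq>), one = False\<rparr>"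

lemma Z2_simps [simp]: "carrier Z2 = UNIV" "x \<otimes>\<^bsub>Z2\<^esub> y \<longleftrightarrow> x \<noteq> y" "\<one>\<^bsub>Z2\<^esub> \<longleftrightarrow> False"
 by (simp_all add: Z2_def)

lemma group_Z2: "group Z2"
 by (rule groupI) auto

lemma inv_Z2 [simp]: "inv\<^bsub>Z2\<^esub> x = x"
proof -
 interpret group Z2 by (rule group_Z2)
 show ?thesis by (rule inv_equality) auto
qed

context colored_involutions begin

lemma dart_flip:
 fixes G (structure)
 assumes "group G" "connection G h" "u \<in> V" "F \<in> V \<rightarrow> carrier G" "h c u = inv (F u) \<otimes> F (\<alpha> c u)"
 shows "h c (\<alpha> c u) = inv (F (\<alpha> c u)) \<otimes> F (\<alpha> c (\<alpha> c u))"
proof -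
 interpret group G by fact
 have "F u \<in> carrier G" "F (\<alpha> c u) \<in> carrier G" using assms alpha_closed by auto
 thus ?thesis
  using assms(2,3,5) by (simp add: connection_def alpha_alpha inv_mult_group)
qed

text \<open>If \<open>E\<close> is the set of edges of a surface and \<open>A\<close> the set of its 2-cells, this is the vanishing of the first
 cohomology with coefficients in \<open>G\<close>.\<close>
definition pure :: "('g, 'b) monoid_scheme => ('c \<times> 'v) set => ('c \<times> 'v) set set => bool" where
 "pure G E A \<longleftrightarrow> (\<forall>h. connection G h \<and> (\<forall>a\<in>A. trivial_on G h a) --> trivial_on G h E)"

lemma pureD: "pure G E A ==> connection G h ==> (!!a. a \<in> A ==> trivial_on G h a) ==> trivial_on G h E"
 by (simp add: pure_def)

text \<open>The unions of connected components of the graph with edges \<open>E\<close>.\<close>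
definition saturated :: "('c \<times> 'v) set => 'v set set" where
 "saturated E = {Q. Q \<subseteq> V \<and> (\<forall>(c, u)\<in>E. \<alpha> c u \<in> Q \<longleftrightarrow> u \<in> Q)}"

definition symmetric :: "('c \<times> 'v) set => bool" where
 "symmetric E \<longleftrightarrow> (\<forall>(c, u)\<in>E. u \<in> V \<and> (c, \<alpha> c u) \<in> E)"

lemma symmetric_remove:
 assumes "symmetric E" "(c, w) \<in> E"
 shows "symmetric (E - {(c, w), (c, \<alpha> c w)})"
proof -
 have w: "w \<in> V" using assms by (auto simp: symmetric_def)
 have "x = w" if "\<alpha> c x = \<alpha> c w" "x \<in> V" for x using that alpha_alpha w by metis
 moreover have "x = \<alpha> c w" if "\<alpha> c x = w" "x \<in> V" for x using that alpha_alpha by metis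
 ultimately show ?thesis using assms(1) unfolding symmetric_def by blast
qed

lemma card_remove_edge:
 assumes "symmetric E" "(c, w) \<in> E" "finite E"
 shows "card E = card (E - {(c, w), (c, \<alpha> c w)}) + 2"
proof -
 have w: "w \<in> V" "(c, \<alpha> c w) \<in> E" using assms by (auto simp: symmetric_def)
 hence "card {(c, w), (c, \<alpha> c w)} = 2" using alpha_no_fix[of w c] by simp
 moreover have "card {(c, w), (c, \<alpha> c w)} \<le> card E"
  using assms w by (intro card_mono) auto
 ultimately show ?thesis using w assms by (subst card_Diff_subset) auto
qed

text \<open>If all \<open>\<int>/2\<close> connections on \<open>E\<close> are trivial, the graph has no cycle: it has \<open>card V - card E / 2\<close> components
 (\<open>E\<close> contains each edge in both directions), and connections with values in any group are trivial. For the
 induction one edge is removed. The connection that is nonzero on this edge alone has a potential \<open>Fb\<close>, which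
 separates the two ends. Adding its support \<open>Q0\<close> modulo 2 matches the sets saturated for \<open>E\<close> with
 the other sets saturated for the smaller \<open>E'\<close>, and multiplying a potential by a constant on \<open>Q0\<close> fits it to the removed edge.\<close>
lemma forest:
 fixes G (structure)
 assumes "finite E" "symmetric E" "pure Z2 E {}"
 shows "even (card E) \<and> card (saturated E) * 2 ^ (card E div 2) = 2 ^ card V \<and>
  (group G --> pure G E {})"
 using assms
proof (induction "card E" arbitrary: E rule: less_induct)
 case less
 show ?case
 proof (cases "E = {}")
  case True
  have "saturated E = Pow V" using True by (auto simp: saturated_def)
  moreover have "pure G E {}" if "group G"
  proof -
   interpret group G by fact
   show ?thesis using True by (auto simp: pure_def trivial_on_def intro!: exI[of _ "\<lambda>_. \<one>"])
  qed
  ultimately show ?thesis using True by (simp add: card_Pow finite_V)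
 next
  case False
  then obtain c w0 where cw0: "(c, w0) \<in> E" by auto
  hence w0: "w0 \<in> V" using less.prems by (auto simp: symmetric_def)
  define hb where "hb e x \<longleftrightarrow> (e, x) = (c, w0) \<or> (e, x) = (c, \<alpha> c w0)" for e x
  have conb: "connection Z2 hb"
   unfolding connection_def
  proof (intro allI ballI conjI)
   fix e u assume u: "u \<in> V"
   have "\<alpha> c u = w0 \<longleftrightarrow> u = \<alpha> c w0" "\<alpha> c u = \<alpha> c w0 \<longleftrightarrow> u = w0"
    using u w0 alpha_alpha by metis+
   thus "hb e (\<alpha> e u) = inv\<^bsub>Z2\<^esub> hb e u" by (auto simp: hb_def)
  qed simp
  obtain Fb :: "'v => bool" where Fb: "!!e u. (e, u) \<in> E ==> hb e u = (Fb u \<noteq> Fb (\<alpha> e u))"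
   by (rule trivial_onE[OF pureD[OF less.prems(3) conb]]) auto
  have "hb c w0" by (simp add: hb_def)
  hence "Fb w0 \<noteq> Fb (\<alpha> c w0)" using Fb cw0 by blast
  define w where "w = (if Fb w0 then \<alpha> c w0 else w0)"
  have w: "w \<in> V" "(c, w) \<in> E" "\<not> Fb w" "Fb (\<alpha> c w)" "{(c, w), (c, \<alpha> c w)} = {(c, w0), (c, \<alpha> c w0)}"
   using cw0 w0 less.prems(2) \<open>Fb w0 \<noteq> Fb (\<alpha> c w0)\<close> by (auto simp: w_def alpha_closed alpha_alpha symmetric_def)
  define E' where "E' = E - {(c, w), (c, \<alpha> c w)}"
  have sym': "symmetric E'" unfolding E'_def by (intro symmetric_remove less.prems w)
  have cardE: "card E = card E' + 2"
   unfolding E'_def by (intro card_remove_edge less.prems w)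
  have fin': "finite E'" using less.prems by (simp add: E'_def)
  have pure': "pure Z2 E' {}" using less.prems(3) by (auto simp: pure_def E'_def intro: trivial_on_mono)
  have IH: "even (card E')" "card (saturated E') * 2 ^ (card E' div 2) = 2 ^ card V"
    "group G --> pure G E' {}"
   using less.hyps[of E'] cardE fin' sym' pure' by auto
  have Fb': "Fb u = Fb (\<alpha> e u)" if "(e, u) \<in> E'" for e u
  proof -
   have "\<not> hb e u" using that w(5) unfolding E'_def hb_def by auto
   thus ?thesis using Fb[of e u] that by (auto simp: E'_def)
  qed
  define Q0 where "Q0 = {x \<in> V. Fb x}"
  have EV: "u \<in> V" "\<alpha> e u \<in> V" if "(e, u) \<in> E" for e u
   using that less.prems(2) by (auto simp: symmetric_def)
  define tw where "tw Q = (Q - Q0) \<union> (Q0 - Q)" for Q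
  have twtw: "tw (tw Q) = Q" for Q by (auto simp: tw_def)
  have E: "E = insert (c, w) (insert (c, \<alpha> c w) E')" using w less.prems(2) by (auto simp: E'_def symmetric_def)
  have satE: "Q \<in> saturated E \<longleftrightarrow> Q \<in> saturated E' \<and> (\<alpha> c w \<in> Q \<longleftrightarrow> w \<in> Q)" for Q
   unfolding E saturated_def using alpha_alpha[OF w(1), of c] by auto
  have tw_sat': "tw Q \<in> saturated E'" if "Q \<in> saturated E'" for Q
  proof -
   have "\<alpha> e u \<in> Q0 \<longleftrightarrow> u \<in> Q0" if "(e, u) \<in> E'" for e u
    using Fb'[OF that] EV[of e u] that by (auto simp: Q0_def E'_def)
   thus ?thesis using that unfolding saturated_def tw_def Q0_def by fastforce
  qed
  have w_tw: "(w \<in> tw Q \<longleftrightarrow> w \<in> Q)" "(\<alpha> c w \<in> tw Q \<longleftrightarrow> \<alpha> c w \<notin> Q)" for Q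
   using w EV[OF w(2)] by (auto simp: tw_def Q0_def)
  have "tw ` saturated E = saturated E' - saturated E"
  proof
   show "tw ` saturated E \<subseteq> saturated E' - saturated E"
   proof (rule image_subsetI)
    fix Q assume "Q \<in> saturated E"
    hence "Q \<in> saturated E'" "\<alpha> c w \<in> Q \<longleftrightarrow> w \<in> Q" using satE[of Q] by simp_all
    thus "tw Q \<in> saturated E' - saturated E"
     using tw_sat'[of Q] satE[of "tw Q"] w_tw[of Q] by simp
   qed
   show "saturated E' - saturated E \<subseteq> tw ` saturated E"
   proof
    fix Q assume "Q \<in> saturated E' - saturated E"
    hence "Q \<in> saturated E'" "\<not> (\<alpha> c w \<in> Q \<longleftrightarrow> w \<in> Q)" using satE[of Q] by simp_all
    hence "tw Q \<in> saturated E"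
     using tw_sat'[of Q] satE[of "tw Q"] w_tw[of Q] by simp
    thus "Q \<in> tw ` saturated E" using twtw by (metis imageI)
   qed
  qed
  moreover have "card (tw ` saturated E) = card (saturated E)"
   by (intro card_image inj_onI) (metis twtw)
  moreover have "saturated E \<subseteq> saturated E'" using satE by blast
  moreover have "finite (saturated E')"
   by (rule finite_subset[of _ "Pow V"]) (auto simp: saturated_def finite_V)
  ultimately have "card (saturated E') = 2 * card (saturated E)"
   by (metis card_Diff_subset card_mono finite_subset le_add_diff_inverse mult_2)
  hence "card (saturated E) * 2 ^ (card E div 2) = 2 ^ card V"
   using IH(2) cardE by simp
  moreover have "pure G E {}" if grp: "group G"
   unfolding pure_def
  proof (intro allI impI)
   fix h assume "connection G h \<and> (\<forall>a\<in>{}. trivial_on G h a)"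
   hence con: "connection G h" by simp
   interpret group G by (rule grp)
   obtain F where F: "F \<in> V \<rightarrow> carrier G"
     "!!e u. (e, u) \<in> E' ==> h e u = inv F u \<otimes> F (\<alpha> e u)"
    using trivial_onE[OF pureD[of G E' "{}" h]] IH(3) con grp by (metis empty_iff)
   have Fc: "F x \<in> carrier G" if "x \<in> V" for x using F(1) that by auto
   define g where "g = F w \<otimes> h c w \<otimes> inv F (\<alpha> c w)"
   have hc: "h c w \<in> carrier G" using con w by (auto simp: connection_def)
   have gc: "g \<in> carrier G" using hc Fc w(1) EV[OF w(2)] by (auto simp: g_def)
   define F' where "F' x = (if Fb x then g \<otimes> F x else F x)" for x
   have F'c: "F' \<in> V \<rightarrow> carrier G" using Fc gc by (auto simp: F'_def)
   have 1: "h c w = inv F' w \<otimes> F' (\<alpha> c w)"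
    using w(3,4) hc gc Fc[OF w(1)] Fc[OF EV(2)[OF w(2)]]
    by (simp add: F'_def g_def m_assoc inv_mult_cancel)
   have 2: "h e u = inv F' u \<otimes> F' (\<alpha> e u)" if "(e, u) \<in> E'" for e u
   proof -
    have "u \<in> V" "\<alpha> e u \<in> V" using that EV by (auto simp: E'_def)
    thus ?thesis using F(2)[OF that] Fb'[OF that] Fc gc
     by (simp add: F'_def inv_mult_group m_assoc inv_mult_cancel)
   qed
   have "h e u = inv F' u \<otimes> F' (\<alpha> e u)" if "(e, u) \<in> E" for e u
    using that 1 2 dart_flip[OF grp con w(1) F'c 1] unfolding E by auto
   thus "trivial_on G h E" unfolding trivial_on_def using F'c by blast
  qed
  ultimately show ?thesis using IH cardE by simp
 qed
qed

definition faces :: "'c set => ('c \<times> 'v) set set" where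
 "faces T = {face (T - {d}) u | d u. d \<in> T \<and> u \<in> V}"

lemma finite_face: "finite T ==> u \<in> V ==> finite (face (T - {d}) u)"
 using finite_subset[OF orb_subset finite_V] by (auto simp: face_def)

lemma face_eq_orb:
 "u \<in> V ==> v \<in> orb D u ==> face D v = face D u"
 by (simp add: face_def orb_eq)

lemma finite_faces: "finite T ==> finite (faces T)"
 using finite_V finite_image_set2[of "\<lambda>d. d \<in> T" "\<lambda>u. u \<in> V" "\<lambda>d u. face (T - {d}) u"]
 by (simp add: faces_def)

lemma face_inj:
 assumes "card T = 3" "face (T - {d}) u = face (T - {d'}) v" "d \<in> T" "d' \<in> T"
 shows "d = d'"
proof -
 have "fst ` face (T - {d}) u = fst ` face (T - {d'}) v" using assms by simp
 hence "T - {d} = T - {d'}" using orb_refl unfolding face_def by (metis empty_iff fst_image_times)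
 thus ?thesis using assms by blast
qed

lemma card_faces:
 assumes "card T = 3"
 shows "card (faces T) = (\<Sum>d\<in>T. card (orbs (T - {d})))"
proof -
 have fT: "finite T" using assms by (intro card_ge_0_finite) simp
 have ne: "T - {d} \<noteq> {}" for d
 proof
  assume "T - {d} = {}" hence "card T \<le> card {d}" by (intro card_mono) auto
  thus False using assms by simp
 qed
 let ?f = "\<lambda>(d, B). (T - {d}) \<times> B" and ?D = "SIGMA d:T. orbs (T - {d})"
 have "faces T = ?f ` ?D" unfolding faces_def face_def orbs_def by (auto simp: image_iff)
 moreover have "inj_on ?f ?D"
 proof (rule inj_onI, clarify)
  fix d B d' B' assume *: "d \<in> T" "B \<in> orbs (T - {d})" "d' \<in> T" "B' \<in> orbs (T - {d'})" "(T - {d}) \<times> B = (T - {d'}) \<times> B'"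
  have "B \<noteq> {}" using *(2) orb_refl by (auto simp: orbs_def)
  hence "T - {d} = T - {d'} \<and> B = B'" using *(5) ne by (simp add: times_eq_iff)
  thus "d = d' \<and> B = B'" using *(1,3) by blast
 qed
 ultimately show ?thesis using fT finite_orbs by (simp add: card_image card_SigmaI)
qed

lemma dart_faces:
 assumes "a \<in> faces T" "(c, x) \<in> a"
 obtains d where "d \<in> T" "d \<noteq> c" "c \<in> T" "x \<in> V" "a = face (T - {d}) x"
proof -
 obtain d u where a: "a = face (T - {d}) u" "d \<in> T" "u \<in> V" using assms by (auto simp: faces_def)
 hence "c \<in> T" "c \<noteq> d" "x \<in> orb (T - {d}) u" using assms(2) by (auto simp: face_def)
 thus ?thesis using a face_eq_orb[of u x "T - {d}"] orb_subset that[of d] by auto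
qed

text \<open>A surface from which at least one 2-cell has been removed collapses onto a tree: as the graph is connected,
 some edge lies on exactly one of the remaining 2-cells, and both are removed. This preserves purity over
 \<open>\<int>/2\<close> and connectedness. Purity over \<open>G\<close> is carried back along the collapse: the potentials
 off the 2-cell and on its boundary agree up to a constant, because a bicoloured cycle minus one edge is connected. The count is the Euler characteristic of a disc,
 with each edge counted in both directions.\<close>
lemma collapse:
 fixes G (structure)
 assumes T: "card T = 3" and trans: "!!u. u \<in> V ==> orb T u = V" and ne: "V \<noteq> {}" and grp: "group G"
  and "A \<subset> faces T" "E \<subseteq> T \<times> V" "symmetric E" "\<Union>A \<subseteq> E" "pure Z2 E A" "saturated E = {{}, V}"
 shows "pure G E A \<and> card E + 2 = 2 * card V + 2 * card A"
 using assms(5-)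
proof (induction "card A" arbitrary: A E)
 case 0
 have fT: "finite T" using T by (intro card_ge_0_finite) simp
 have "finite A" by (rule finite_subset[OF psubset_imp_subset[OF 0(2)] finite_faces[OF fT]])
 hence A: "A = {}" using 0 by simp
 have "finite E" by (rule finite_subset[OF 0(3)]) (simp add: fT finite_V)
 hence f: "even (card E)" "card (saturated E) * 2 ^ (card E div 2) = 2 ^ card V" "pure G E {}"
  using forest[of E G] 0 A grp by auto
 have "card (saturated E) = 2" using 0 ne by simp
 hence "(2::nat) ^ (card E div 2 + 1) = 2 ^ card V" using f(2) by simp
 hence "card E div 2 + 1 = card V" by (subst (asm) power_inject_exp) simp_all
 thus ?case using f A by auto
next
 case (Suc n)
 have fT: "finite T" using T by (intro card_ge_0_finite) simp
 have finA: "finite A" by (rule finite_subset[OF psubset_imp_subset[OF Suc.prems(1)] finite_faces[OF fT]])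
 \<comment> \<open>Otherwise \<open>A\<close>, being nonempty, would contain all 2-cells by connectedness.\<close>
 obtain x d d' where x: "x \<in> V" "d \<in> T" "d' \<in> T" "face (T - {d}) x \<in> A" "face (T - {d'}) x \<notin> A"
 proof (rule ccontr)
  note found = that
  assume no: "\<not> thesis"
  have same: "face (T - {d}) x \<in> A \<longleftrightarrow> face (T - {d'}) x \<in> A" if "x \<in> V" "d \<in> T" "d' \<in> T" for x d d'
   using found[of x d d'] found[of x d' d] that no by blast
  have "A \<noteq> {}" using Suc.hyps(2) by auto
  then obtain a where aA: "a \<in> A" by blast
  hence "a \<in> faces T" using Suc.prems(1) by blast
  then obtain d0 u0 where u0: "face (T - {d0}) u0 \<in> A" "d0 \<in> T" "u0 \<in> V"
   using aA unfolding faces_def by blast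
  have "\<forall>d\<in>T. face (T - {d}) u \<in> A" if "u \<in> V" for u
  proof -
   have "u \<in> orb T u0" using trans u0 that by blast
   thus ?thesis
   proof (rule orb_induct)
    show "\<forall>d\<in>T. face (T - {d}) u0 \<in> A" using same u0 by blast
   next
    fix y c assume y: "y \<in> orb T u0" "\<forall>d\<in>T. face (T - {d}) y \<in> A" "c \<in> T"
    have yV: "y \<in> V" using y u0 orb_subset by blast
    have "T - {c} \<noteq> {}" using T y(3) by (metis card.empty card_Diff_singleton diff_Suc_1 numeral_3_eq_3 nat.distinct(1))
    then obtain d where d: "d \<in> T" "d \<noteq> c" by blast
    have "face (T - {d}) (\<alpha> c y) = face (T - {d}) y"
     using face_eq_orb[OF yV, of "\<alpha> c y" "T - {d}"] orb_step[OF orb_refl, of c "T - {d}" y] d y by auto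
    thus "\<forall>d\<in>T. face (T - {d}) (\<alpha> c y) \<in> A" using same[of "\<alpha> c y" d] alpha_closed[OF yV] y d by metis
   qed
  qed
  hence "faces T \<subseteq> A" by (auto simp: faces_def)
  thus False using Suc.prems(1) by blast
 qed
 have dd: "d \<noteq> d'" using x by blast
 have "card (T - {d, d'}) = 1" using T x dd fT by (subst card_Diff_subset) auto
 then obtain c where c: "T - {d, d'} = {c}" by (rule card_1_singletonE)
 hence cT: "c \<in> T" "c \<noteq> d" "c \<noteq> d'" and Td: "T - {d} = {d', c}" using x dd by auto
 define a where "a = face (T - {d}) x"
 have a: "a = face {d', c} x" "a \<in> A" using x Td by (auto simp: a_def)
 have cxa: "(c, x) \<in> a" "(c, \<alpha> c x) \<in> a" using orb_refl orb_step[OF orb_refl] by (auto simp: a face_def)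
 have cxE: "(c, x) \<in> E" using cxa a Suc.prems(4) by blast
 define E' where "E' = E - {(c, x), (c, \<alpha> c x)}"
 define A' where "A' = A - {a}"
 have only: "b = a" if b: "b \<in> A" "(c, x) \<in> b \<or> (c, \<alpha> c x) \<in> b" for b
 proof -
  have bf: "b \<in> faces T" using b Suc.prems(1) by blast
  have "(c, x) \<in> b"
  proof (rule disjE[OF b(2)])
   assume "(c, \<alpha> c x) \<in> b"
   then obtain e where e: "e \<noteq> c" "b = face (T - {e}) (\<alpha> c x)" using dart_faces[OF bf] by metis
   thus ?thesis using orb_step[OF orb_refl, of c "T - {e}" "\<alpha> c x"] cT alpha_alpha[OF x(1)] by (auto simp: face_def)
  qed
  then obtain e where e: "e \<in> T" "e \<noteq> c" "b = face (T - {e}) x" using dart_faces[OF bf] by metis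
  have "e \<noteq> d'" using e b x by auto
  hence "e = d" using e c by blast
  thus ?thesis using e by (simp add: a_def)
 qed
 have sub': "\<Union>A' \<subseteq> E'" using only Suc.prems(4) by (auto simp: E'_def A'_def)
 have aE': "a - {(c, x), (c, \<alpha> c x)} \<subseteq> E'" using a Suc.prems(4) by (auto simp: E'_def)
 have Z: "pure Z2 E' A'"
  unfolding pure_def
 proof (intro allI impI)
  fix h assume h: "connection Z2 h \<and> (\<forall>b\<in>A'. trivial_on Z2 h b)"
  obtain h' where h': "connection Z2 h'" "trivial_on Z2 h' (face {d', c} x)"
   "!!e y. (e, y) \<notin> {(c, x), (c, \<alpha> c x)} ==> h' e y = h e y"
   using flatten_edge[OF group_Z2, of h x d' c] h x cT by metis
  have "trivial_on Z2 h' b" if "b \<in> A" for b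
  proof (cases "b = a")
   case True thus ?thesis using h' a by simp
  next
   case False
   hence "b \<in> A'" using that by (simp add: A'_def)
   hence "trivial_on Z2 h b" using h by blast
   thus ?thesis
   proof (rule trivial_on_cong)
    fix e y assume "(e, y) \<in> b"
    thus "h' e y = h e y" using only[OF that] False by (intro h'(3)) auto
   qed
  qed
  hence "trivial_on Z2 h' E" using Suc.prems(5) h'(1) pureD by blast
  hence "trivial_on Z2 h' E'" by (rule trivial_on_mono) (auto simp: E'_def)
  thus "trivial_on Z2 h E'" by (rule trivial_on_cong) (use h'(3) in \<open>auto simp: E'_def\<close>)
 qed
 have edge_connb: "q y = q x" if "!!e y. (e, y) \<in> E' ==> q (\<alpha> e y) = q y" "y \<in> orb {d', c} x" for y and q :: "'v => bool"
  using face_minus_edge_connected[of x d' c q y] x(1) cT that aE' a(1) by blast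
 have sat: "saturated E' = {{}, V}"
 proof -
  have "saturated E' \<subseteq> saturated E"
  proof
   fix Q assume Q: "Q \<in> saturated E'"
   have "(\<alpha> c x \<in> Q) = (x \<in> Q)"
    by (rule edge_connb[of "\<lambda>y. y \<in> Q"]) (use Q orb_step[OF orb_refl] in \<open>auto simp: saturated_def\<close>)
   thus "Q \<in> saturated E" using Q alpha_alpha[OF x(1), of c] unfolding saturated_def E'_def by auto
  qed
  moreover have "saturated E \<subseteq> saturated E'" unfolding saturated_def E'_def by blast
  ultimately show ?thesis using Suc.prems(6) by blast
 qed
 have cA: "card A = Suc (card A')" using card.remove[OF finA a(2)] by (simp only: A'_def)
 have finE: "finite E" by (rule finite_subset[OF Suc.prems(2)]) (simp add: fT finite_V)
 have IH: "pure G E' A' \<and> card E' + 2 = 2 * card V + 2 * card A'"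
 proof (rule Suc.hyps(1))
  show "n = card A'" using cA Suc.hyps(2) by simp
  show "symmetric E'" unfolding E'_def by (intro symmetric_remove Suc.prems cxE)
 qed (use Suc.prems sub' Z sat in \<open>auto simp: A'_def E'_def\<close>)
 have "pure G E A"
  unfolding pure_def
 proof (intro allI impI)
  fix h assume h: "connection G h \<and> (\<forall>b\<in>A. trivial_on G h b)"
  interpret group G by (rule grp)
  obtain F where F: "F \<in> V \<rightarrow> carrier G"
     "!!e u. (e, u) \<in> E' ==> h e u = inv F u \<otimes> F (\<alpha> e u)"
   using trivial_onE[OF pureD[of G E' A' h]] IH h by (metis A'_def DiffD1)
  obtain K where K: "K \<in> V \<rightarrow> carrier G"
     "!!e u. (e, u) \<in> a ==> h e u = inv K u \<otimes> K (\<alpha> e u)"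
   using trivial_onE[of G h a] h a(2) by metis
  have FK: "F y \<in> carrier G" "K y \<in> carrier G" if "y \<in> V" for y using F(1) K(1) that by auto
  have q: "F y \<otimes> inv K y = F x \<otimes> inv K x" if "y \<in> orb {d', c} x" for y
  proof (rule face_minus_edge_connected[OF x(1) cT(3)[symmetric] _ that, of "\<lambda>y. F y \<otimes> inv K y"])
   fix e y assume ey: "(e, y) \<in> face {d', c} x - {(c, x), (c, \<alpha> c x)}"
   hence "(e, y) \<in> E'" using aE' a by blast
   moreover have "(e, y) \<in> a" using ey a by blast
   ultimately have eq: "inv F y \<otimes> F (\<alpha> e y) = inv K y \<otimes> K (\<alpha> e y)"
    using F(2) K(2) by metis
   have yV: "y \<in> V" "\<alpha> e y \<in> V" using ey orb_subset[OF x(1), of "{d', c}"] alpha_closed by (auto simp: face_def)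
   note c4 = FK[OF yV(1)] FK[OF yV(2)]
   have "F (\<alpha> e y) = F y \<otimes> (inv K y \<otimes> K (\<alpha> e y))"
    using c4 eq[symmetric] by (simp add: mult_inv_cancel)
   thus "F (\<alpha> e y) \<otimes> inv K (\<alpha> e y) = F y \<otimes> inv K y"
    using c4 by (simp add: m_assoc)
  qed
  have x': "\<alpha> c x \<in> V" using alpha_closed x by blast
  have "F (\<alpha> c x) \<otimes> inv K (\<alpha> c x) = F x \<otimes> inv K x"
   by (rule q) (auto intro: orb_step orb_refl)
  hence "inv F x \<otimes> (F (\<alpha> c x) \<otimes> inv K (\<alpha> c x)) \<otimes> K (\<alpha> c x) = inv K x \<otimes> K (\<alpha> c x)"
   using FK[OF x(1)] FK[OF x'] by (simp add: inv_mult_cancel)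
  hence 1: "h c x = inv F x \<otimes> F (\<alpha> c x)"
   using FK[OF x(1)] FK[OF x'] K(2)[OF cxa(1)] by (simp add: m_assoc)
  have 2: "h c (\<alpha> c x) = inv F (\<alpha> c x) \<otimes> F (\<alpha> c (\<alpha> c x))"
   using dart_flip[of G h x F c] grp h x(1) F(1) 1 by blast
  have "h e u = inv F u \<otimes> F (\<alpha> e u)" if "(e, u) \<in> E" for e u
  proof (cases "(e, u) \<in> E'")
   case False
   hence "(e, u) = (c, x) \<or> (e, u) = (c, \<alpha> c x)" using that by (auto simp: E'_def)
   thus ?thesis using 1 2 by auto
  qed (rule F(2))
  thus "trivial_on G h E" unfolding trivial_on_def using F(1) by blast
 qed
 moreover have "card E = card E' + 2" unfolding E'_def by (intro card_remove_edge Suc.prems cxE finE)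
 ultimately show ?case using IH cA by simp
qed

lemma saturated_full:
 assumes "!!u. u \<in> V ==> orb T u = V"
 shows "saturated (T \<times> V) = {{}, V}"
proof -
 have "Q = V" if Q: "Q \<in> saturated (T \<times> V)" "Q \<noteq> {}" for Q
 proof -
  obtain u where u: "u \<in> Q" "u \<in> V" using Q by (auto simp: saturated_def)
  have "v \<in> Q" if "v \<in> V" for v
  proof -
   have "v \<in> orb T u" using assms u that by blast
   thus ?thesis
   proof (rule orb_induct)
    fix y c assume "y \<in> orb T u" "y \<in> Q" "c \<in> T"
    thus "\<alpha> c y \<in> Q" using Q orb_subset[OF u(2)] by (auto simp: saturated_def)
   qed (rule u)
  qed
  thus ?thesis using Q by (auto simp: saturated_def)
 qed
 moreover have "{} \<in> saturated (T \<times> V)" "V \<in> saturated (T \<times> V)"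
  by (auto simp: saturated_def alpha_closed)
 ultimately show ?thesis by blast
qed

lemma even_card_closed:
 assumes "S \<subseteq> V" "!!y. y \<in> S ==> \<alpha> e y \<in> S"
 shows "even (card S)"
proof -
 interpret S: colored_involutions S "\<lambda>_::unit. \<alpha> e"
  using assms finite_subset[OF assms(1) finite_V] alpha_alpha alpha_no_fix by unfold_locales auto
 show ?thesis by (rule S.even_card_V)
qed

text \<open>The vertices with \<open>F\<close> are the ends of the \<open>k\<close> edges of colour \<open>e\<close> that cross, together with pairs joined by an edge that does not cross.\<close>
lemma card_coboundary:
 fixes F :: "'v => bool"
 assumes "B \<subseteq> V" "!!y. y \<in> B ==> \<alpha> e y \<in> B"
 shows "\<exists>k. card {y \<in> B. F y \<noteq> F (\<alpha> e y)} = 2 * k \<and> (even k \<longleftrightarrow> even (card {y \<in> B. F y}))"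
proof -
 have fin: "finite B" using assms finite_V finite_subset by blast
 let ?P1 = "{y \<in> B. F y \<and> \<not> F (\<alpha> e y)}" and ?P2 = "{y \<in> B. \<not> F y \<and> F (\<alpha> e y)}"
 have aa: "\<alpha> e (\<alpha> e y) = y" if "y \<in> B" for y using that assms(1) alpha_alpha by blast
 have "?P2 = \<alpha> e ` ?P1"
 proof
  show "?P2 \<subseteq> \<alpha> e ` ?P1"
   using aa assms(2) by (intro subsetI, rule_tac x="\<alpha> e x" in image_eqI) auto
 qed (use aa assms(2) in auto)
 moreover have "inj_on (\<alpha> e) ?P1" by (rule inj_onI) (metis (mono_tags, lifting) aa mem_Collect_eq)
 ultimately have 1: "card ?P2 = card ?P1" by (simp add: card_image)
 have "{y \<in> B. F y \<noteq> F (\<alpha> e y)} = ?P1 \<union> ?P2" by auto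
 hence "card {y \<in> B. F y \<noteq> F (\<alpha> e y)} = card ?P1 + card ?P2"
  using fin by (simp, subst card_Un_disjoint) auto
 moreover have "card {y \<in> B. F y} = card ?P1 + card {y \<in> B. F y \<and> F (\<alpha> e y)}"
  using fin by (subst card_Un_disjoint[symmetric]) (auto intro: arg_cong[of _ _ card])
 moreover have "even (card {y \<in> B. F y \<and> F (\<alpha> e y)})"
  using assms aa by (intro even_card_closed) auto
 ultimately show ?thesis using 1 by (intro exI[of _ "card ?P1"]) auto
qed

end

section \<open>Spherical links\<close>

context colored_involutions begin

text \<open>By \<open>card_coboundary\<close> both colours contribute numbers of crossing edges of the same parity.\<close>
lemma trivial_Z2_face_card:
 assumes "c \<noteq> d" "u \<in> V" "trivial_on Z2 h (face {c, d} u)"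
 shows "4 dvd card {(e, y) \<in> face {c, d} u. h e y}"
proof -
 obtain F :: "'v => bool" where F: "!!e y. (e, y) \<in> face {c, d} u ==> h e y = (F y \<noteq> F (\<alpha> e y))"
  by (rule trivial_onE[OF assms(3)]) auto
 let ?B = "orb {c, d} u"
 have B: "?B \<subseteq> V" "finite ?B" using orb_subset assms finite_V finite_subset by blast+
 let ?N = "\<lambda>e. {y \<in> ?B. F y \<noteq> F (\<alpha> e y)}"
 have eq: "{(e, y) \<in> face {c, d} u. h e y} = ({c} \<times> ?N c) \<union> ({d} \<times> ?N d)"
  using F by (auto simp: face_def)
 have *: "card {(e, y) \<in> face {c, d} u. h e y} = card (?N c) + card (?N d)"
  unfolding eq using B assms(1) by (subst card_Un_disjoint) (auto simp: card_cartesian_product)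
 obtain k where k: "card (?N c) = 2 * k" "even k \<longleftrightarrow> even (card {y \<in> ?B. F y})"
  using card_coboundary[OF B(1), of c F] orb_step[of _ "{c, d}" u] by blast
 obtain l where l: "card (?N d) = 2 * l" "even l \<longleftrightarrow> even (card {y \<in> ?B. F y})"
  using card_coboundary[OF B(1), of d F] orb_step[of _ "{c, d}" u] by blast
 have "even (k + l)" using k(2) l(2) by simp
 then obtain j where "k + l = 2 * j" by (rule Parity.evenE)
 hence "card (?N c) + card (?N d) = 4 * j" using k(1) l(1) by linarith
 thus ?thesis unfolding * by (rule dvdI)
qed

text \<open>Changing \<open>h\<close> on a single edge makes it trivial. A proper change would alter the number of directed edges with
 value \<open>True\<close> by two, but both numbers are divisible by four.\<close>
lemma trivial_Z2_face_iff:
 assumes "c \<noteq> d" "u \<in> V" "connection Z2 h"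
 shows "trivial_on Z2 h (face {c, d} u) \<longleftrightarrow> 4 dvd card {(e, y) \<in> face {c, d} u. h e y}"
proof
 assume 4: "4 dvd card {(e, y) \<in> face {c, d} u. h e y}"
 obtain h' where h': "connection Z2 h'" "trivial_on Z2 h' (face {c, d} u)"
  "!!e x. (e, x) \<notin> {(d, u), (d, \<alpha> d u)} ==> h' e x = h e x"
  using flatten_edge[OF group_Z2 assms(3,2,1)] by metis
 let ?N = "\<lambda>h. {(e, y) \<in> face {c, d} u. h e y}"
 have dvd': "4 dvd card (?N h')" by (rule trivial_Z2_face_card[OF assms(1,2) h'(2)])
 have fin: "finite (face {c, d} u)"
  using finite_subset[OF orb_subset[OF assms(2)] finite_V] by (simp add: face_def)
 have in_face: "(d, u) \<in> face {c, d} u" "(d, \<alpha> d u) \<in> face {c, d} u"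
  using orb_refl orb_step[OF orb_refl] by (auto simp: face_def)
 have flip: "g d (\<alpha> d u) = g d u" if "connection Z2 g" for g
  using that assms(2) by (simp add: connection_def)
 let ?P = "{(d, u), (d, \<alpha> d u)}"
 have two: "card ?P = 2" using alpha_no_fix[OF assms(2), of d] by simp
 have N: "card (?N g) = card (?N g - ?P) + (if g d u then 2 else 0)" if "connection Z2 g" for g
 proof (cases "g d u")
  case True
  hence P: "?P \<subseteq> ?N g" using flip[OF that] in_face by auto
  have "finite (?N g)" using fin by (rule rev_finite_subset) auto
  thus ?thesis using True P two card_mono[OF _ P] by (simp add: card_Diff_subset)
 next
  case False
  hence "?N g - ?P = ?N g" using flip[OF that] by auto
  thus ?thesis using False by simp
 qed
 have "?N h' - ?P = ?N h - ?P" using h'(3) by auto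
 hence "card (?N h) = card (?N h' - ?P) + (if h d u then 2 else 0)" using N[OF assms(3)] by simp
 moreover have "a = b" if "4 dvd x + a" "4 dvd x + b" "a = 0 \<or> a = 2" "b = 0 \<or> b = 2" for x a b :: nat
  using that by presburger
 from this[of "card (?N h' - ?P)" "if h d u then 2 else 0" "if h' d u then 2 else 0"]
 have "h' d u = h d u" using calculation N[OF h'(1)] 4 dvd' by (auto split: if_splits)
 hence "h e x = h' e x" for e x using h'(3)[of e x] flip[OF assms(3)] flip[OF h'(1)] by (cases "(e, x) \<in> {(d, u), (d, \<alpha> d u)}") auto
 thus "trivial_on Z2 h (face {c, d} u)" using h'(2) by (rule trivial_on_cong[rotated])
qed (rule trivial_Z2_face_card[OF assms(1,2)])

lemma remove_color:
 assumes "card T = 3" "d \<in> T"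
 obtains c c' where "T - {d} = {c, c'}" "c \<noteq> c'"
 using assms card_2_iff[of "T - {d}"] by (metis card_Diff_singleton diff_Suc_1 eval_nat_numeral(3))

text \<open>On a closed surface every directed edge lies on two 2-cells, so the counts of \<open>trivial_Z2_face_iff\<close> add up to
 a multiple of four.\<close>
lemma Z2_last_face:
 assumes T: "card T = 3" and f: "f \<in> faces T"
  and con: "connection Z2 h" and triv: "!!a. a \<in> faces T - {f} ==> trivial_on Z2 h a"
 shows "trivial_on Z2 h f"
proof -
 have fT: "finite T" using T by (intro card_ge_0_finite) simp
 have face_iff: "trivial_on Z2 h a \<longleftrightarrow> 4 dvd card {(e, y) \<in> a. h e y}" if af: "a \<in> faces T" for a
 proof -
  obtain d u where a: "d \<in> T" "u \<in> V" "a = face (T - {d}) u" using af unfolding faces_def by blast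
  obtain c c' where "T - {d} = {c, c'}" "c \<noteq> c'" using remove_color[OF T a(1)] by metis
  thus ?thesis using trivial_Z2_face_iff[of c c' u h] con a by simp
 qed
 let ?D = "{(e, y) \<in> T \<times> V. h e y}"
 have finD: "finite ?D" by (rule finite_subset[of _ "T \<times> V"]) (auto simp: fT finite_V)
 have "?D = (SIGMA e:T. {y \<in> V. h e y})" by auto
 hence "card ?D = (\<Sum>e\<in>T. card {y \<in> V. h e y})" using fT finite_V by (simp add: card_SigmaI)
 moreover have "even (card {y \<in> V. h e y})" for e
  using con alpha_closed by (intro even_card_closed[of _ e]) (auto simp: connection_def)
 ultimately have evenD: "even (card ?D)" by (simp add: dvd_sum)
 have two: "card {a \<in> faces T. p \<in> a} = 2" if p: "p \<in> ?D" for p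
 proof -
  obtain e y where ey: "p = (e, y)" "e \<in> T" "y \<in> V" using p by auto
  have "{a \<in> faces T. p \<in> a} = (\<lambda>d. face (T - {d}) y) ` (T - {e})"
  proof
   show "{a \<in> faces T. p \<in> a} \<subseteq> (\<lambda>d. face (T - {d}) y) ` (T - {e})" unfolding ey(1) by (auto elim: dart_faces)
  qed (use ey orb_refl in \<open>auto simp: faces_def face_def\<close>)
  moreover have "inj_on (\<lambda>d. face (T - {d}) y) (T - {e})" by (rule inj_onI) (use face_inj[OF T] in blast)
  ultimately show ?thesis using T ey(2) by (simp add: card_image)
 qed
 have "{(e, y) \<in> a. h e y} = {p \<in> ?D. p \<in> a}" if "a \<in> faces T" for a
  using that orb_subset by (fastforce simp: faces_def face_def)
 hence "(\<Sum>a\<in>faces T. card {(e, y) \<in> a. h e y}) = (\<Sum>a\<in>faces T. card {p \<in> ?D. p \<in> a})" by simp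
 also have "\<dots> = 2 * card ?D"
  using two by (intro sum_multicount[OF finite_faces[OF fT] finD]) blast
 finally have ***: "(\<Sum>a\<in>faces T. card {(e, y) \<in> a. h e y}) = 2 * card ?D" .
 have "4 dvd (\<Sum>a\<in>faces T. card {(e, y) \<in> a. h e y})"
  using evenD unfolding *** by (elim Parity.evenE) simp
 also have "(\<Sum>a\<in>faces T. card {(e, y) \<in> a. h e y}) =
   card {(e, y) \<in> f. h e y} + (\<Sum>a\<in>faces T - {f}. card {(e, y) \<in> a. h e y})"
  using finite_faces[OF fT] f by (simp add: sum.remove)
 finally have "4 dvd card {(e, y) \<in> f. h e y} + (\<Sum>a\<in>faces T - {f}. card {(e, y) \<in> a. h e y})" .
 moreover have "4 dvd (\<Sum>a\<in>faces T - {f}. card {(e, y) \<in> a. h e y})"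
  using triv face_iff by (intro dvd_sum) auto
 ultimately have "4 dvd card {(e, y) \<in> f. h e y}" by (simp only: dvd_add_left_iff)
 thus ?thesis using face_iff[OF f] by blast
qed

text \<open>The 2-sphere among closed surfaces: with vanishing cohomology over \<open>\<int>/2\<close> the Euler characteristic
 \<open>card V - 3 * card V / 2 + card (faces T)\<close> is 2, and the complement of one 2-cell is contractible.\<close>
lemma sphere_faces:
 fixes G (structure)
 assumes T: "card T = 3" and trans: "!!u. u \<in> V ==> orb T u = V" and ne: "V \<noteq> {}"
  and Z: "pure Z2 (T \<times> V) (faces T)" and G: "group G" and f: "f \<in> faces T"
 shows "2 * card (faces T) = card V + 4" "pure G (T \<times> V) (faces T - {f})"
proof -
 have fT: "finite T" using T by (intro card_ge_0_finite) simp
 have *: "pure G (T \<times> V) (faces T - {f}) \<and> card (T \<times> V) + 2 = 2 * card V + 2 * card (faces T - {f})"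
 proof (rule collapse[OF T trans ne G])
  show "pure Z2 (T \<times> V) (faces T - {f})"
   unfolding pure_def
  proof (intro allI impI)
   fix h assume h: "connection Z2 h \<and> (\<forall>a\<in>faces T - {f}. trivial_on Z2 h a)"
   hence "trivial_on Z2 h f" using Z2_last_face[OF T f] by blast
   thus "trivial_on Z2 h (T \<times> V)" using pureD[OF Z] h by blast
  qed
  show "symmetric (T \<times> V)" by (auto simp: symmetric_def alpha_closed)
  show "\<Union> (faces T - {f}) \<subseteq> T \<times> V"
   using orb_subset by (fastforce simp: faces_def face_def)
 qed (use saturated_full[OF trans] f in auto)
 thus "pure G (T \<times> V) (faces T - {f})" by blast
 have "card (faces T) = Suc (card (faces T - {f}))"
  by (rule card.remove[OF finite_faces[OF fT] f])
 thus "2 * card (faces T) = card V + 4" using * T by (simp add: card_cartesian_product)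
qed

end

section \<open>Cocycles with discrete coefficients\<close>

abbreviation unit_interval :: "real topology" ("\<I>") where
 "\<I> \<equiv> top_of_set {0..1}"

abbreviation unit_square :: "(real \<times> real) topology" where
 "unit_square \<equiv> top_of_set ({0..1} \<times> {0..1})"

text \<open>Transition functions of a flat bundle: locally constant, with values in the structure group \<open>G\<close>.\<close>
definition cocycle ::
 "('g, 'm) monoid_scheme => 'x topology => ('i => 'x set) => ('i => 'i => 'x => 'g) => bool" where
 "cocycle G X U t \<longleftrightarrow>
   (\<forall>a. openin X {x \<in> topspace X. x \<in> U a}) \<and> (\<forall>x\<in>topspace X. \<exists>a. x \<in> U a) \<and>
   (\<forall>a b. \<forall>x\<in>topspace X. x \<in> U a \<and> x \<in> U b --> t a b x \<in> carrier G) \<and>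
   (\<forall>a b c. \<forall>x\<in>topspace X. x \<in> U a \<and> x \<in> U b \<and> x \<in> U c --> t a b x \<otimes>\<^bsub>G\<^esub> t b c x = t a c x) \<and>
   (\<forall>a b z. openin X {x \<in> topspace X. x \<in> U a \<and> x \<in> U b \<and> t a b x = z})"

definition global_section ::
 "('g, 'm) monoid_scheme => 'x topology => ('i => 'x set) => ('i => 'i => 'x => 'g) =>
   ('i => 'x => 'g) => bool" where
 "global_section G X U t s \<longleftrightarrow>
   (\<forall>a. \<forall>x\<in>topspace X. x \<in> U a --> s a x \<in> carrier G) \<and>
   (\<forall>a b. \<forall>x\<in>topspace X. x \<in> U a \<and> x \<in> U b --> s a x = t a b x \<otimes>\<^bsub>G\<^esub> s b x) \<and>
   (\<forall>a z. openin X {x \<in> topspace X. x \<in> U a \<and> s a x = z})"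

lemma cocycle_closed: "cocycle G X U t ==> x \<in> topspace X ==> x \<in> U a ==> x \<in> U b ==> t a b x \<in> carrier G"
 unfolding cocycle_def by blast

lemma cocycle_open: "cocycle G X U t ==> openin X {x \<in> topspace X. x \<in> U a}"
 unfolding cocycle_def by blast

lemma cocycle_fibre_open: "cocycle G X U t ==> openin X {x \<in> topspace X. x \<in> U a \<and> x \<in> U b \<and> t a b x = z}"
 unfolding cocycle_def by blast

lemma section_fibre_open: "global_section G X U t s ==> openin X {x \<in> topspace X. x \<in> U a \<and> s a x = z}"
 unfolding global_section_def by blast

lemma global_sectionI:
 assumes "!!a x. x \<in> topspace X ==> x \<in> U a ==> s a x \<in> carrier G"
  "!!a b x. x \<in> topspace X ==> x \<in> U a ==> x \<in> U b ==> s a x = t a b x \<otimes>\<^bsub>G\<^esub> s b x"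
  "!!a z. openin X {x \<in> topspace X. x \<in> U a \<and> s a x = z}"
 shows "global_section G X U t s"
 unfolding global_section_def using assms by blast

lemma cocycle_mult: "cocycle G X U t ==> x \<in> topspace X ==> x \<in> U a ==> x \<in> U b ==> x \<in> U c ==>
  t a b x \<otimes>\<^bsub>G\<^esub> t b c x = t a c x"
 unfolding cocycle_def by blast

lemma cocycle_cover: "cocycle G X U t ==> x \<in> topspace X ==> \<exists>a. x \<in> U a"
 unfolding cocycle_def by blast

lemma section_closed: "global_section G X U t s ==> x \<in> topspace X ==> x \<in> U a ==> s a x \<in> carrier G"
 unfolding global_section_def by blast

lemma section_transition: "global_section G X U t s ==> x \<in> topspace X ==> x \<in> U a ==> x \<in> U b ==>
  s a x = t a b x \<otimes>\<^bsub>G\<^esub> s b x"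
 unfolding global_section_def by blast

lemma openin_vimage:
 assumes "continuous_map Y X f" "openin X {x \<in> topspace X. P x}"
 shows "openin Y {y \<in> topspace Y. P (f y)}"
proof -
 have "{y \<in> topspace Y. P (f y)} = {y \<in> topspace Y. f y \<in> {x \<in> topspace X. P x}}"
  using continuous_map_funspace[OF assms(1)] by auto
 thus ?thesis using openin_continuous_map_preimage[OF assms] by simp
qed

lemma cocycle_pullback:
 assumes "cocycle G X U t" "continuous_map Y X f"
 shows "cocycle G Y (\<lambda>a. f -` U a) (\<lambda>a b y. t a b (f y))"
proof -
 have f: "f y \<in> topspace X" if "y \<in> topspace Y" for y using continuous_map_funspace[OF assms(2)] that by auto
 show ?thesis
  using assms(1) f unfolding cocycle_def vimage_eq
  by (auto intro!: openin_vimage[OF assms(2)])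
qed

lemma section_pullback:
 assumes "global_section G X U t s" "continuous_map Y X f"
 shows "global_section G Y (\<lambda>a. f -` U a) (\<lambda>a b y. t a b (f y)) (\<lambda>a y. s a (f y))"
proof -
 have f: "f y \<in> topspace X" if "y \<in> topspace Y" for y using continuous_map_funspace[OF assms(2)] that by auto
 show ?thesis
 proof (rule global_sectionI, unfold vimage_eq)
  show "openin Y {y \<in> topspace Y. f y \<in> U a \<and> s a (f y) = z}" for a z
   by (rule openin_vimage[OF assms(2) section_fibre_open[OF assms(1)]])
 qed (use f section_closed[OF assms(1)] section_transition[OF assms(1)] in blast)+
qed

lemma section_cong:
 assumes s: "global_section G X U t s"
  and U: "!!a x. x \<in> topspace X ==> x \<in> U' a \<longleftrightarrow> x \<in> U a"
  and t: "!!a b x. x \<in> topspace X ==> x \<in> U a ==> x \<in> U b ==> t' a b x = t a b x"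
 shows "global_section G X U' t' s"
proof (rule global_sectionI)
 have "{x \<in> topspace X. x \<in> U' a \<and> s a x = z} = {x \<in> topspace X. x \<in> U a \<and> s a x = z}" for a z using U by auto
 thus "openin X {x \<in> topspace X. x \<in> U' a \<and> s a x = z}" for a z using section_fibre_open[OF s, of a z] by (simp only:)
 show "s a x \<in> carrier G" if "x \<in> topspace X" "x \<in> U' a" for a x using that U section_closed[OF s] by blast
 show "s a x = t' a b x \<otimes>\<^bsub>G\<^esub> s b x" if "x \<in> topspace X" "x \<in> U' a" "x \<in> U' b" for a b x
  using that U t section_transition[OF s that(1), of a b] by simp
qed

lemma cocycle_subset:
 assumes "cocycle G (top_of_set D) U t" "D' \<subseteq> D"
 shows "cocycle G (top_of_set D') U t"
 using cocycle_pullback[OF assms(1), of "top_of_set D'" "\<lambda>x. x"] assms(2)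
 by (simp add: continuous_map_into Pi_iff vimage_def subset_iff)

lemma section_subset:
 assumes "global_section G (top_of_set D) U t s" "D' \<subseteq> D"
 shows "global_section G (top_of_set D') U t s"
 using section_pullback[OF assms(1), of "top_of_set D'" "\<lambda>x. x"] assms(2)
 by (simp add: continuous_map_into Pi_iff vimage_def subset_iff)

context
 fixes G (structure)
 assumes G: "group G"
begin

interpretation group G by (rule G)

lemma cocycle_self:
 assumes "cocycle G X U t" "x \<in> topspace X" "x \<in> U a"
 shows "t a a x = \<one>"
proof -
 show ?thesis using cocycle_mult[OF assms(1-3,3,3)] cocycle_closed[OF assms(1-3,3)]
  by (metis r_cancel_one)
qed

lemma section_in_chart:
 assumes "cocycle G X U t" "topspace X \<subseteq> U a"
 shows "global_section G X U t (\<lambda>b x. t b a x)"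
proof -
 have "{x \<in> topspace X. x \<in> U b \<and> t b a x = z} = {x \<in> topspace X. x \<in> U b \<and> x \<in> U a \<and> t b a x = z}" for b z
  using assms(2) by auto
 hence "openin X {x \<in> topspace X. x \<in> U b \<and> t b a x = z}" for b z
  using cocycle_fibre_open[OF assms(1)] by simp
 thus ?thesis
  using cocycle_closed[OF assms(1)] cocycle_mult[OF assms(1)] assms(2) by (intro global_sectionI) auto
qed

text \<open>Two sections differ by a locally constant right factor.\<close>
lemma section_unique:
 assumes coc: "cocycle G X U t" and conn: "connected_space X"
  and s: "global_section G X U t s" "global_section G X U t s'"
  and x0: "x0 \<in> topspace X" "x0 \<in> U a0" and x: "x \<in> topspace X" "x \<in> U a"
 shows "s' a x = s a x \<otimes> (inv (s a0 x0) \<otimes> s' a0 x0)"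
proof -
 define k where "k x = (let a = SOME a. x \<in> U a in inv (s a x) \<otimes> s' a x)" for x
 have k: "k x = inv (s a x) \<otimes> s' a x" if x: "x \<in> topspace X" "x \<in> U a" for x a
 proof -
  have indep: "inv (s a x) \<otimes> s' a x = inv (s b x) \<otimes> s' b x" if "x \<in> U b" for b
  proof -
   have c: "t a b x \<in> carrier G" "s b x \<in> carrier G" "s' b x \<in> carrier G"
    using cocycle_closed[OF coc x that] section_closed[OF s(1) x(1) that] section_closed[OF s(2) x(1) that] by auto
   show ?thesis
    unfolding section_transition[OF s(1) x that] section_transition[OF s(2) x that]
    using c by (simp add: inv_mult_group m_assoc inv_mult_cancel)
  qed
  show ?thesis unfolding k_def Let_def using someI[of "\<lambda>a. x \<in> U a" a] indep x(2) by metis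
 qed
 have kopen: "openin X {x \<in> topspace X. k x = z}" for z
 proof (subst openin_subopen, intro ballI)
  fix x assume "x \<in> {x \<in> topspace X. k x = z}"
  hence x: "x \<in> topspace X" "k x = z" by auto
  obtain a where a: "x \<in> U a" using cocycle_cover[OF coc x(1)] by blast
  let ?T = "{y \<in> topspace X. y \<in> U a \<and> s a y = s a x} \<inter> {y \<in> topspace X. y \<in> U a \<and> s' a y = s' a x}"
  have "openin X ?T" using s unfolding global_section_def by blast
  moreover have "?T \<subseteq> {x \<in> topspace X. k x = z}" using k x a by auto
  ultimately show "\<exists>T. openin X T \<and> x \<in> T \<and> T \<subseteq> {x \<in> topspace X. k x = z}"
   using x a by (intro exI[of _ ?T]) auto
 qed
 have "k y = k x0" if "y \<in> topspace X" for y
 proof (rule ccontr)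
  assume ne: "k y \<noteq> k x0"
  let ?A = "{x \<in> topspace X. k x = k x0}"
  have "openin X (\<Union>z\<in>- {k x0}. {x \<in> topspace X. k x = z})" using kopen by blast
  moreover have "topspace X - ?A = (\<Union>z\<in>- {k x0}. {x \<in> topspace X. k x = z})" by auto
  ultimately have "closedin X ?A" by (simp add: closedin_def)
  hence "?A = {} \<or> ?A = topspace X" using conn kopen connected_space_clopen_in by blast
  thus False using ne that x0 by auto
 qed
 hence "inv (s a x) \<otimes> s' a x = inv (s a0 x0) \<otimes> s' a0 x0"
  using k[OF x] k[OF x0] x by metis
 thus ?thesis
  using section_closed[OF s(1) x] section_closed[OF s(2) x] by (metis inv_closed m_assoc r_inv l_one)
qed

lemma section_translate:
 assumes coc: "cocycle G X U t" and s: "global_section G X U t s" and g: "g \<in> carrier G"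
 shows "global_section G X U t (\<lambda>a x. s a x \<otimes> g)"
proof -
 have op: "openin X {x \<in> topspace X. x \<in> U a \<and> s a x \<otimes> g = z}" for a z
 proof (cases "z \<in> carrier G")
  case True
  have "{x \<in> topspace X. x \<in> U a \<and> s a x \<otimes> g = z} = {x \<in> topspace X. x \<in> U a \<and> s a x = z \<otimes> inv g}"
   using section_closed[OF s] True g by (auto simp: m_assoc)
  thus ?thesis using section_fibre_open[OF s] by simp
 next
  case False
  hence "{x \<in> topspace X. x \<in> U a \<and> s a x \<otimes> g = z} = {}"
   using section_closed[OF s] g by auto
  thus ?thesis by (simp only: openin_empty)
 qed
 moreover have tr: "s a x \<otimes> g = t a b x \<otimes> (s b x \<otimes> g)" if "x \<in> topspace X" "x \<in> U a" "x \<in> U b" for a b x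
  using section_transition[OF s that] cocycle_closed[OF coc that] section_closed[OF s that(1,3)] g by (simp add: m_assoc)
 ultimately show ?thesis
  by (intro global_sectionI op tr) (use section_closed[OF s] g in blast)+
qed

text \<open>On the connected overlap the sections differ by a constant factor, which is absorbed in the second one.\<close>
lemma section_glue:
 assumes coc: "cocycle G (top_of_set (D1 \<union> D2)) U t"
  and s: "global_section G (top_of_set D1) U t s1" "global_section G (top_of_set D2) U t s2"
  and D: "closed D1" "closed D2" "connected (D1 \<inter> D2)"
 shows "\<exists>s. global_section G (top_of_set (D1 \<union> D2)) U t s"
proof -
 have coc1: "cocycle G (top_of_set D1) U t" and coc2: "cocycle G (top_of_set D2) U t"
  and coc12: "cocycle G (top_of_set (D1 \<inter> D2)) U t"
  using cocycle_subset[OF coc] by blast+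
 obtain g where g: "g \<in> carrier G" "!!a x. x \<in> D1 \<inter> D2 ==> x \<in> U a ==> s1 a x = s2 a x \<otimes> g"
 proof (cases "D1 \<inter> D2 = {}")
  case True thus ?thesis using that[of \<one>] by auto
 next
  case False
  then obtain x0 where x0: "x0 \<in> D1 \<inter> D2" by blast
  then obtain a0 where a0: "x0 \<in> U a0" using cocycle_cover[OF coc12] by auto
  have sr: "global_section G (top_of_set (D1 \<inter> D2)) U t s1" "global_section G (top_of_set (D1 \<inter> D2)) U t s2"
   using section_subset s by blast+
  have cn: "connected_space (top_of_set (D1 \<inter> D2))" using D(3) by (simp add: connected_space_subtopology)
  let ?g = "inv (s2 a0 x0) \<otimes> s1 a0 x0"
  show ?thesis
  proof (rule that[of ?g])
   show "?g \<in> carrier G" using section_closed[OF sr(1), of x0 a0] section_closed[OF sr(2), of x0 a0] x0 a0 by auto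
   show "s1 a x = s2 a x \<otimes> ?g" if "x \<in> D1 \<inter> D2" "x \<in> U a" for a x
    using section_unique[OF coc12 cn sr(2,1), of x0 a0 x a] x0 a0 that by simp
  qed
 qed
 define s2' where "s2' a x = s2 a x \<otimes> g" for a x
 have s2': "global_section G (top_of_set D2) U t s2'"
  unfolding s2'_def by (rule section_translate[OF coc2 s(2) g(1)])
 define s where "s a x = (if x \<in> D1 then s1 a x else s2' a x)" for a x
 have e1: "s a x = s1 a x" if "x \<in> D1" for a x using that by (simp add: s_def)
 have e2: "s a x = s2' a x" if "x \<in> D2" "x \<in> U a" for a x using that g(2)[of x a] by (auto simp: s_def s2'_def)
 have op: "openin (top_of_set (D1 \<union> D2)) {x \<in> D1 \<union> D2. x \<in> U a \<and> s a x = z}" for a z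
 proof -
  let ?S = "{x \<in> D1 \<union> D2. x \<in> U a \<and> s a x = z}"
  have "?S \<inter> D1 = {x \<in> D1. x \<in> U a \<and> s1 a x = z}" using e1 by auto
  hence o1: "openin (top_of_set D1) (?S \<inter> D1)" using s(1) by (simp add: global_section_def)
  have "?S \<inter> D2 = {x \<in> D2. x \<in> U a \<and> s2' a x = z}" using e2 by auto
  hence o2: "openin (top_of_set D2) (?S \<inter> D2)" using s2' by (simp add: global_section_def)
  have "closedin (top_of_set D1) (D1 - ?S)"
   using closedin_diff[OF closedin_topspace o1] by (simp only: topspace_euclidean_subtopology Diff_Int2 Diff_Int Diff_cancel Un_empty_right)
  hence c1: "closed (D1 - ?S)" using closedin_closed_trans D(1) by blast
  have "closedin (top_of_set D2) (D2 - ?S)"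
   using closedin_diff[OF closedin_topspace o2] by (simp only: topspace_euclidean_subtopology Diff_Int2 Diff_Int Diff_cancel Un_empty_right)
  hence c2: "closed (D2 - ?S)" using closedin_closed_trans D(2) by blast
  have "(D1 \<union> D2) - ?S = (D1 - ?S) \<union> (D2 - ?S)" by blast
  hence "closed ((D1 \<union> D2) - ?S)" using closed_Un[OF c1 c2] by (simp only:)
  hence "closedin (top_of_set (D1 \<union> D2)) ((D1 \<union> D2) - ?S)" by (rule closed_subset[rotated]) blast
  moreover have "?S \<subseteq> D1 \<union> D2" by blast
  ultimately show ?thesis unfolding openin_closedin_eq topspace_euclidean_subtopology by blast
 qed
 moreover have cl: "s a x \<in> carrier G" if "x \<in> D1 \<union> D2" "x \<in> U a" for a x
  using that e1 e2 section_closed[OF s(1), of x a] section_closed[OF s2', of x a] by auto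
 moreover have tr: "s a x = t a b x \<otimes> s b x" if "x \<in> D1 \<union> D2" "x \<in> U a" "x \<in> U b" for a b x
  using that e1 e2 section_transition[OF s(1), of x a b] section_transition[OF s2', of x a b] by auto
 ultimately have "global_section G (top_of_set (D1 \<union> D2)) U t s"
  by (intro global_sectionI; (unfold topspace_euclidean_subtopology)?; (rule op cl tr; assumption)?)
 thus ?thesis by blast
qed

text \<open>Small rectangles lie in one chart, and adjacent ones can be glued along a segment. Bisection is used twice:
 vertically to obtain thin full strips, then horizontally.\<close>
lemma split_square:
 fixes U :: "'i => (real \<times> real) set"
 assumes coc: "cocycle G unit_square U t"
 shows "\<exists>s. global_section G unit_square U t s"
proof -
 define rect :: "real => real => real => real => (real \<times> real) set"
  where "rect a b c d = ({a..b} \<inter> {0..1}) \<times> ({c..d} \<inter> {0..1})" for a b c d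
 define Sp where "Sp D \<longleftrightarrow> (\<exists>s. global_section G (top_of_set D) U t s)" for D
 let ?Q = "{0..1} \<times> {0..1} :: (real \<times> real) set"
 have sub: "rect a b c d \<subseteq> ?Q" for a b c d by (auto simp: rect_def)
 have closed: "closed (rect a b c d)" for a b c d
  unfolding rect_def by (intro closed_Times closed_Int) auto
 have conn: "connected (rect a b c d)" for a b c d
  unfolding rect_def by (intro connected_Times) (simp_all add: Int_atLeastAtMost)
 have glue: "Sp (D1 \<union> D2)" if "Sp D1" "Sp D2" "D1 \<subseteq> ?Q" "D2 \<subseteq> ?Q" "closed D1" "closed D2" "connected (D1 \<inter> D2)" for D1 D2
  using that section_glue[OF cocycle_subset[OF coc], of D1 D2] unfolding Sp_def by blast
 have local: "\<exists>e>0. \<forall>D. D \<subseteq> ?Q \<inter> ball x e --> Sp D" if x: "x \<in> ?Q" for x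
 proof -
  obtain a where a: "x \<in> U a" using cocycle_cover[OF coc] x by auto
  have "openin (top_of_set ?Q) {y \<in> ?Q. y \<in> U a}" using coc by (simp add: cocycle_def)
  then obtain T where T: "open T" "{y \<in> ?Q. y \<in> U a} = ?Q \<inter> T" by (auto simp: openin_open)
  then obtain e where e: "e > 0" "ball x e \<subseteq> T" using x a open_contains_ball by blast
  show ?thesis
  proof (intro exI[of _ e] conjI allI impI e(1))
   fix D assume D: "D \<subseteq> ?Q \<inter> ball x e"
   hence "topspace (top_of_set D) \<subseteq> U a" using e(2) T(2) by auto
   thus "Sp D" unfolding Sp_def
    using section_in_chart[OF cocycle_subset[OF coc], of D a] D by blast
  qed
 qed
 have strip: "\<exists>e>0. \<forall>a b. a \<le> x \<and> x \<le> b \<and> b - a < e --> Sp (rect a b 0 1)" if x: "0 \<le> x" "x \<le> 1" for x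
 proof (rule Bolzano[where P = "\<lambda>c d. \<exists>e>0. \<forall>a b. a \<le> x \<and> x \<le> b \<and> b - a < e --> Sp (rect a b c d)" and a = 0 and b = 1])
  fix c d f :: real
  assume "\<exists>e>0. \<forall>a b. a \<le> x \<and> x \<le> b \<and> b - a < e --> Sp (rect a b c d)"
   "\<exists>e>0. \<forall>a b. a \<le> x \<and> x \<le> b \<and> b - a < e --> Sp (rect a b d f)" and cdf: "c \<le> d" "d \<le> f"
  then obtain e1 e2 where e: "e1 > 0" "e2 > 0"
   "!!a b. a \<le> x ==> x \<le> b ==> b - a < e1 ==> Sp (rect a b c d)"
   "!!a b. a \<le> x ==> x \<le> b ==> b - a < e2 ==> Sp (rect a b d f)" by blast
  show "\<exists>e>0. \<forall>a b. a \<le> x \<and> x \<le> b \<and> b - a < e --> Sp (rect a b c f)"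
  proof (intro exI[of _ "min e1 e2"] conjI allI impI)
   fix a b assume ab: "a \<le> x \<and> x \<le> b \<and> b - a < min e1 e2"
   have "rect a b c d \<union> rect a b d f = rect a b c f" "rect a b c d \<inter> rect a b d f = rect a b d d"
    using cdf by (auto simp: rect_def)
   thus "Sp (rect a b c f)"
    using glue[of "rect a b c d" "rect a b d f"] e(3,4) ab closed conn sub by auto
  qed (use e in auto)
 next
  fix y :: real assume y: "0 \<le> y" "y \<le> 1"
  obtain e where e: "e > 0" "!!D. D \<subseteq> ?Q \<inter> ball (x, y) e ==> Sp D" using local[of "(x, y)"] x y by auto
  have "rect a b c d \<subseteq> ball (x, y) e" if "a \<le> x" "x \<le> b" "b - a < e / 2" "c \<le> y" "y \<le> d" "d - c < e / 2" for a b c d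
  proof (clarsimp simp: rect_def)
   fix u v assume "a \<le> u" "u \<le> b" "c \<le> v" "v \<le> d"
   hence "dist x u < e / 2" "dist y v < e / 2" using that unfolding dist_real_def by linarith+
   moreover have "dist (x, y) (u, v) \<le> dist x u + dist y v"
    unfolding dist_Pair_Pair by (rule sqrt_sum_squares_le_sum) auto
   ultimately show "dist (x, y) (u, v) < e" by linarith
  qed
  thus "\<exists>d>0. \<forall>a b. a \<le> y \<and> y \<le> b \<and> b - a < d -->
    (\<exists>e>0. \<forall>a' b'. a' \<le> x \<and> x \<le> b' \<and> b' - a' < e --> Sp (rect a' b' a b))"
   using e sub by (intro exI[of _ "e / 2"] conjI allI impI) auto
 qed auto
 have "Sp (rect 0 1 0 1)"
 proof (rule Bolzano[where P = "\<lambda>a b. Sp (rect a b 0 1)"])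
  fix a b c :: real assume s: "Sp (rect a b 0 1)" "Sp (rect b c 0 1)" "a \<le> b" "b \<le> c"
  have "rect a b 0 1 \<union> rect b c 0 1 = rect a c 0 1" "rect a b 0 1 \<inter> rect b c 0 1 = rect b b 0 1"
   using s(3,4) by (auto simp: rect_def)
  thus "Sp (rect a c 0 1)" using glue[OF s(1,2)] closed conn sub by auto
 qed (use strip in auto)
 moreover have "rect 0 1 0 1 = ?Q" by (auto simp: rect_def)
 ultimately show ?thesis unfolding Sp_def by simp
qed

end

section \<open>Holonomy along paths\<close>

abbreviation path_section ::
 "('g, 'm) monoid_scheme => ('i => 'x set) => ('i => 'i => 'x => 'g) => (real => 'x) => ('i => real => 'g) => bool" where
 "path_section G U t \<gamma> s \<equiv>
   global_section G \<I> (\<lambda>a. \<gamma> -` U a) (\<lambda>a b x. t a b (\<gamma> x)) s"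

text \<open>The interval is a retract of the square.\<close>
lemma split_interval:
 fixes U :: "'i => real set"
 assumes "group G" and coc: "cocycle G \<I> U t"
 shows "\<exists>s. global_section G \<I> U t s"
proof -
 have "continuous_map unit_square \<I> (fst :: real \<times> real => real)"
  by (auto simp: continuous_map_into intro!: continuous_intros)
 from cocycle_pullback[OF coc this] obtain s where
  s: "global_section G unit_square (\<lambda>a. fst -` U a) (\<lambda>a b y. t a b (fst y)) s"
  using split_square[OF assms(1)] by blast
 have "continuous_map \<I> unit_square (\<lambda>x::real. (x, 0::real))"
  by (auto simp: continuous_map_into intro!: continuous_intros)
 from section_pullback[OF s this] show ?thesis by (auto simp: vimage_def)
qed

lemma path_section_exists:
 assumes "group G" "cocycle G X U t" "pathin X \<gamma>"
 shows "\<exists>s. path_section G U t \<gamma> s"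
 using split_interval[OF assms(1) cocycle_pullback[OF assms(2) assms(3)[unfolded pathin_def]]] .

lemma path_section_reparam:
 assumes s: "path_section G U t \<gamma> s" and f: "continuous_on {0..1} f" "f \<in> {0..1} \<rightarrow> {0..1}"
  and eq: "!!x. x \<in> {0..1} ==> \<gamma>' x = \<gamma> (f x)"
 shows "path_section G U t \<gamma>' (\<lambda>a x. s a (f x))"
proof -
 have "continuous_map \<I> \<I> f"
  using f by (auto simp: continuous_map_into)
 from section_pullback[OF s this] show ?thesis by (rule section_cong) (use eq in auto)
qed

lemma pathin_concat:
 assumes "pathin X g" "pathin X h" "g 1 = h 0"
 shows "pathin X (concat_path g h)"
proof -
 have "continuous_map \<I> X (\<lambda>t. if t \<le> 1/2 then g (2 * t) else h (2 * t - 1))"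
 proof (rule continuous_map_cases_le)
  show "continuous_map (subtopology \<I> {x \<in> topspace \<I>. x \<le> 1/2}) X (\<lambda>t. g (2 * t))"
   using assms(1) unfolding pathin_def
   by (rule continuous_map_compose[unfolded comp_def, rotated])
    (auto simp: continuous_map_into subtopology_subtopology intro!: continuous_intros)
  show "continuous_map (subtopology \<I> {x \<in> topspace \<I>. 1/2 \<le> x}) X (\<lambda>t. h (2 * t - 1))"
   using assms(2) unfolding pathin_def
   by (rule continuous_map_compose[unfolded comp_def, rotated])
    (auto simp: continuous_map_into subtopology_subtopology intro!: continuous_intros)
  show "g (2 * x) = h (2 * x - 1)" if "x = 1/2" for x using assms(3) unfolding that by simp
 qed auto
 thus ?thesis by (simp add: pathin_def concat_path_def)
qed

text \<open>Parallel transport along \<open>\<gamma>\<close>, read in the chart \<open>a\<close> at the start and in \<open>b\<close> at the end; by \<open>hol_eq\<close> any section gives the same value.\<close>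
definition hol ::
 "('g, 'm) monoid_scheme => ('i => 'x set) => ('i => 'i => 'x => 'g) => (real => 'x) => 'i => 'i => 'g" where
 "hol G U t \<gamma> a b = (let s = SOME s. path_section G U t \<gamma> s in s a 0 \<otimes>\<^bsub>G\<^esub> inv\<^bsub>G\<^esub> (s b 1))"

context
 fixes G (structure) and X :: "'x topology" and U :: "'i => 'x set" and t
 assumes G: "group G" and coc: "cocycle G X U t"
begin

interpretation group G by (rule G)

lemma hol_eq:
 assumes \<gamma>: "pathin X \<gamma>" and s: "path_section G U t \<gamma> s" and ab: "\<gamma> 0 \<in> U a" "\<gamma> 1 \<in> U b"
 shows "hol G U t \<gamma> a b = s a 0 \<otimes> inv (s b 1)"
proof -
 define s' where "s' = (SOME s. path_section G U t \<gamma> s)"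
 have s': "path_section G U t \<gamma> s'" unfolding s'_def by (rule someI[of "\<lambda>s. path_section G U t \<gamma> s", OF s])
 have c: "cocycle G \<I> (\<lambda>a. \<gamma> -` U a) (\<lambda>a b x. t a b (\<gamma> x))"
  using cocycle_pullback[OF coc] \<gamma> by (simp add: pathin_def)
 have conn: "connected_space \<I>" by (simp add: connected_space_subtopology)
 have cl: "s a 0 \<in> carrier G" "s' a 0 \<in> carrier G" "s b 1 \<in> carrier G"
  using section_closed[OF s, of 0 a] section_closed[OF s', of 0 a] section_closed[OF s, of 1 b] ab by auto
 have "s' b 1 = s b 1 \<otimes> (inv (s a 0) \<otimes> s' a 0)"
  using ab by (intro section_unique[OF G c conn s s']) auto
 hence "s' a 0 \<otimes> inv (s' b 1) = s a 0 \<otimes> inv (s b 1)"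
  using cl by (simp add: inv_mult_group m_assoc mult_inv_cancel)
 thus ?thesis by (simp add: hol_def flip: s'_def)
qed

lemma hol_closed:
 assumes \<gamma>: "pathin X \<gamma>" and ab: "\<gamma> 0 \<in> U a" "\<gamma> 1 \<in> U b"
 shows "hol G U t \<gamma> a b \<in> carrier G"
proof -
 obtain s where s: "path_section G U t \<gamma> s" using path_section_exists[OF G coc \<gamma>] by blast
 show ?thesis
  unfolding hol_eq[OF \<gamma> s ab] using section_closed[OF s, of 0 a] section_closed[OF s, of 1 b] ab by auto
qed

lemma inv_transition:
 assumes "x \<in> topspace X" "x \<in> U a" "x \<in> U b"
 shows "inv (t a b x) = t b a x"
 using cocycle_mult[OF coc assms(1,3,2,3)] cocycle_self[OF G coc assms(1,3)]
  cocycle_closed[OF coc assms] cocycle_closed[OF coc assms(1,3,2)] by (intro inv_equality) auto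

lemma hol_in_chart:
 assumes \<gamma>: "pathin X \<gamma>" and ab: "\<gamma> 0 \<in> U a" "\<gamma> 1 \<in> U b" and c: "\<gamma> \<in> {0..1} \<rightarrow> U c"
 shows "hol G U t \<gamma> a b = t a c (\<gamma> 0) \<otimes> t c b (\<gamma> 1)"
proof -
 have cp: "cocycle G \<I> (\<lambda>a. \<gamma> -` U a) (\<lambda>a b x. t a b (\<gamma> x))"
  using cocycle_pullback[OF coc] \<gamma> by (simp add: pathin_def)
 have s: "path_section G U t \<gamma> (\<lambda>b x. t b c (\<gamma> x))"
  using section_in_chart[OF G cp, of c] c by auto
 have "\<gamma> 1 \<in> topspace X" using \<gamma> by (auto simp: pathin_def dest!: continuous_map_funspace)
 thus ?thesis unfolding hol_eq[OF \<gamma> s ab] using inv_transition[of "\<gamma> 1" b c] ab funcset_mem[OF c, of 1] by auto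
qed

lemma hol_concat:
 assumes g: "pathin X g" and h: "pathin X h" and "g 1 = h 0" and abc: "g 0 \<in> U a" "g 1 \<in> U b" "h 1 \<in> U c"
 shows "hol G U t (concat_path g h) a c = hol G U t g a b \<otimes> hol G U t h b c"
proof -
 let ?p = "concat_path g h"
 have p: "pathin X ?p" by (rule pathin_concat) fact+
 obtain s where s: "path_section G U t ?p s" using path_section_exists[OF G coc p] by blast
 have sg: "path_section G U t g (\<lambda>a x. s a (x / 2))"
  by (rule path_section_reparam[OF s]) (auto simp: concat_path_def intro!: continuous_intros)
 have sh: "path_section G U t h (\<lambda>a x. s a ((1 + x) / 2))"
 proof (rule path_section_reparam[OF s])
  show "h x = ?p ((1 + x) / 2)" if "x \<in> {0..1}" for x
   using that assms(3) by (cases "x = 0") (auto simp: concat_path_def field_simps)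
 qed (auto intro!: continuous_intros)
 have cl: "s a 0 \<in> carrier G" "s b (1/2) \<in> carrier G" "s c 1 \<in> carrier G"
  using section_closed[OF s, of 0 a] section_closed[OF s, of "1/2" b] section_closed[OF s, of 1 c] abc
  by (auto simp: concat_path_def)
 have "hol G U t ?p a c = s a 0 \<otimes> inv (s c 1)"
  using abc by (intro hol_eq[OF p s]) (auto simp: concat_path_def)
 moreover have "hol G U t g a b = s a 0 \<otimes> inv (s b (1/2))"
  using hol_eq[OF g sg] abc by simp
 moreover have "hol G U t h b c = s b (1/2) \<otimes> inv (s c 1)"
  using hol_eq[OF h sh, of b c] abc assms(3) by simp
 ultimately show ?thesis using cl by (simp add: m_assoc inv_mult_cancel)
qed

text \<open>A section over the square of the homotopy restricts to sections along both paths and is constant on the two sides that are mapped to the end points.\<close>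
lemma hol_homotopic:
 assumes hom: "homotopic_with (\<lambda>k. k 0 = p \<and> k 1 = q) \<I> X g h"
  and ab: "p \<in> U a" "q \<in> U b"
 shows "hol G U t g a b = hol G U t h a b"
proof -
 obtain H :: "real \<times> real => 'x" where H: "continuous_map (prod_topology \<I> \<I>) X H"
  "!!x. x \<in> {0..1} ==> H (0, x) = g x" "!!x. x \<in> {0..1} ==> H (1, x) = h x"
  "!!r. r \<in> {0..1} ==> H (r, 0) = p \<and> H (r, 1) = q"
  using hom by (subst (asm) homotopic_with) auto
 have Hc: "continuous_map unit_square X H"
  using H(1) by (simp add: prod_topology_subtopology_eu)
 have pg: "pathin X g" "pathin X h"
  using homotopic_with_imp_continuous_maps[OF hom] by (auto simp: pathin_def)
 have ends: "g 0 = p" "g 1 = q" "h 0 = p" "h 1 = q" using homotopic_with_imp_property[OF hom] by auto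
 obtain s where s: "global_section G unit_square (\<lambda>a. H -` U a) (\<lambda>a b x. t a b (H x)) s"
  using split_square[OF G cocycle_pullback[OF coc Hc]] by blast
 have line: "path_section G U t (\<lambda>x. H (f x)) (\<lambda>a x. s a (f x))"
  if "continuous_on {0..1} f" "f \<in> {0..1} \<rightarrow> {0..1} \<times> {0..1}" for f
  using section_pullback[OF s, of "\<I>" f] that
  by (simp add: continuous_map_into vimage_def)
 have cp: "continuous_on {0..1} (\<lambda>x. (c, x))" "continuous_on {0..1} (\<lambda>x. (x, c))" for c :: real
  by (intro continuous_intros)+
 have sg: "path_section G U t g (\<lambda>a x. s a (0, x))"
  using path_section_reparam[OF line[OF cp(1)[of 0]], of "\<lambda>x. x" g] H(2) by (auto intro!: continuous_intros)
 have sh: "path_section G U t h (\<lambda>a x. s a (1, x))"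
  using path_section_reparam[OF line[OF cp(1)[of 1]], of "\<lambda>x. x" h] H(3) by (auto intro!: continuous_intros)
 have const: "s c (0, e) = s c (1, e)" if "H (0, e) = r" "!!x. x \<in> {0..1} ==> H (x, e) = r" "r \<in> U c" "e \<in> {0..1}" for c e r
 proof -
  have r: "r \<in> topspace X" using funcset_mem[OF continuous_map_funspace[OF Hc], of "(0, e)"] that by auto
  hence pr: "pathin X (\<lambda>_. r)" by (simp add: pathin_def)
  have sr: "path_section G U t (\<lambda>_. r) (\<lambda>a x. s a (x, e))"
   using path_section_reparam[OF line[OF cp(2)[of e]], of "\<lambda>x. x" "\<lambda>_. r"] that
   by (auto intro!: continuous_intros)
  have "s c (0, e) \<otimes> inv (s c (1, e)) = hol G U t (\<lambda>_. r) c c"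
   by (rule hol_eq[OF pr sr, symmetric]) (use that in auto)
  also have "\<dots> = t c c r \<otimes> t c c r" by (rule hol_in_chart[OF pr]) (use that in auto)
  also have "\<dots> = \<one>" using cocycle_self[OF G coc r that(3)] by simp
  finally have "s c (0, e) \<otimes> inv (s c (1, e)) = \<one>" .
  moreover have "s c (0, e) \<in> carrier G" "s c (1, e) \<in> carrier G"
   using section_closed[OF sr, of 0 c] section_closed[OF sr, of 1 c] that(3) by auto
  ultimately show ?thesis by (metis inv_closed inv_equality inv_inv)
 qed
 have "s a (0, 0) = s a (1, 0)" "s b (0, 1) = s b (1, 1)"
  using const[of 0 p a] const[of 1 q b] H(4) ab by auto
 thus ?thesis using hol_eq[OF pg(1) sg, of a b] hol_eq[OF pg(2) sh, of a b] ends ab by simp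
qed

end

text \<open>The section at \<open>x\<close> is the transport along any path to the base point; all paths give the same value by homotopy invariance.\<close>
lemma split_simply_connected:
 fixes D :: "'n::euclidean_space set" and U :: "'i => 'n set"
 assumes G: "group G" and coc: "cocycle G (top_of_set D) U t" and D: "open D" "simply_connected D"
 shows "\<exists>s. global_section G (top_of_set D) U t s"
proof (cases "D = {}")
 case True thus ?thesis by (auto simp: global_section_def)
next
 case False
 interpret group G by (rule G)
 let ?X = "top_of_set D"
 obtain x0 where x0: "x0 \<in> D" using False by blast
 obtain a0 where a0: "x0 \<in> U a0" using cocycle_cover[OF coc] x0 by auto
 have pc: "path_connected D" using D(2) by (rule simply_connected_imp_path_connected)
 have "\<exists>g. path g \<and> path_image g \<subseteq> D \<and> pathstart g = x \<and> pathfinish g = x0" if "x \<in> D" for x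
  using pc that x0 unfolding path_connected_def by blast
 then obtain g where g: "!!x. x \<in> D ==> path (g x) \<and> path_image (g x) \<subseteq> D \<and> pathstart (g x) = x \<and> pathfinish (g x) = x0"
  by metis
 have pin: "pathin ?X p" if "path p" "path_image p \<subseteq> D" for p
  using that by (auto simp: pathin_def path_def path_image_def continuous_map_into)
 have gp: "pathin ?X (g x)" "g x 0 = x" "g x 1 = x0" if "x \<in> D" for x
  using g[OF that] pin by (auto simp: pathstart_def pathfinish_def)
 define s where "s a x = hol G U t (g x) a a0" for a x
 have indep: "hol G U t p a a0 = s a x" if "path p" "path_image p \<subseteq> D" "pathstart p = x" "pathfinish p = x0" "x \<in> U a" for p a x
 proof -
  have x: "x \<in> D" using that pathstart_in_path_image by blast
  have "homotopic_paths D p (g x)"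
   using D(2) that g[OF x] unfolding simply_connected_eq_homotopic_paths by metis
  hence "homotopic_with (\<lambda>k. k 0 = x \<and> k 1 = x0) \<I> ?X p (g x)"
   using that by (simp add: homotopic_paths_def pathstart_def pathfinish_def)
  thus ?thesis unfolding s_def by (rule hol_homotopic[OF G coc]) (use that a0 in auto)
 qed
 have cl: "s a x \<in> carrier G" if "x \<in> D" "x \<in> U a" for a x
  unfolding s_def using gp[OF that(1)] that a0 by (intro hol_closed[OF G coc]) auto
 have tr: "s a x = t a b x \<otimes>\<^bsub>G\<^esub> s b x" if x: "x \<in> D" "x \<in> U a" "x \<in> U b" for a b x
 proof -
  obtain r where r: "path_section G U t (g x) r" using path_section_exists[OF G coc gp(1)[OF x(1)]] by blast
  have e: "s c x = r c 0 \<otimes>\<^bsub>G\<^esub> inv\<^bsub>G\<^esub> r a0 1" if "x \<in> U c" for c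
   unfolding s_def using gp[OF x(1)] that a0 by (intro hol_eq[OF G coc _ r]) auto
  have "r a 0 = t a b x \<otimes>\<^bsub>G\<^esub> r b 0" using section_transition[OF r, of 0 a b] gp[OF x(1)] x by simp
  thus ?thesis
   unfolding e[OF x(2)] e[OF x(3)]
   using cocycle_closed[OF coc, of x a b] section_closed[OF r, of 0 b] section_closed[OF r, of 1 a0] gp[OF x(1)] x a0
   by (simp add: m_assoc)
 qed
 have op: "openin ?X {x \<in> D. x \<in> U a \<and> s a x = z}" for a z
 proof (subst openin_subopen, intro ballI)
  fix x assume "x \<in> {x \<in> D. x \<in> U a \<and> s a x = z}"
  hence x: "x \<in> D" "x \<in> U a" "s a x = z" by auto
  have "openin ?X {x \<in> topspace ?X. x \<in> U a}" by (rule cocycle_open[OF coc])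
  hence "open (D \<inter> U a)" using D(1) by (simp add: openin_open_eq Int_def)
  then obtain e where e: "e > 0" "ball x e \<subseteq> D \<inter> U a" using x open_contains_ball by (metis IntI)
  have "s a y = z" if y: "y \<in> ball x e" for y
  proof -
   have yD: "y \<in> D" "y \<in> U a" using e y by auto
   have seg: "path_image (linepath y x) \<subseteq> ball x e"
    using y e(1) by (simp add: closed_segment_subset)
   have lp: "pathin ?X (linepath y x)" using seg e by (intro pin) auto
   have lp_chart: "linepath y x \<in> {0..1} \<rightarrow> U a" using seg e(2) unfolding path_image_def by blast
   have "s a y = hol G U t (linepath y x +++ g x) a a0"
    using g[OF x(1)] seg e yD by (intro indep[symmetric]) (auto simp: path_image_join)
   also have "linepath y x +++ g x = concat_path (linepath y x) (g x)"
    by (simp add: joinpaths_def concat_path_def)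
   also have "hol G U t (concat_path (linepath y x) (g x)) a a0 = hol G U t (linepath y x) a a \<otimes>\<^bsub>G\<^esub> s a x"
    unfolding s_def using gp[OF x(1)] lp yD x a0
    by (intro hol_concat[OF G coc]) (auto simp: linepath_def)
   also have "hol G U t (linepath y x) a a = t a a y \<otimes>\<^bsub>G\<^esub> t a a x"
    using hol_in_chart[OF G coc lp, of a a a] lp_chart yD x by (simp add: linepath_def)
   also have "\<dots> = \<one>\<^bsub>G\<^esub>" using cocycle_self[OF G coc] yD x by simp
   finally show ?thesis using cl[OF x(1,2)] x(3) by simp
  qed
  thus "\<exists>T. openin ?X T \<and> x \<in> T \<and> T \<subseteq> {x \<in> D. x \<in> U a \<and> s a x = z}"
   using e by (intro exI[of _ "ball x e"]) (auto simp: openin_open_eq D(1))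
 qed
 have "global_section G ?X U t s"
  by (rule global_sectionI; unfold topspace_euclidean_subtopology; rule cl tr op; assumption)
 thus ?thesis by blast
qed

section \<open>Paths up to homotopy\<close>

definition joins :: "'x topology => 'x => 'x => (real => 'x) => bool" where
 "joins X x y g \<longleftrightarrow> pathin X g \<and> g 0 = x \<and> g 1 = y"

definition path_homotopic :: "'x topology => 'x => 'x => (real => 'x) => (real => 'x) => bool" where
 "path_homotopic X x y g h \<longleftrightarrow> homotopic_with (\<lambda>k. k 0 = x \<and> k 1 = y) \<I> X g h"

definition rev_path :: "(real => 'x) => real => 'x" where
 "rev_path g = (\<lambda>t. g (1 - t))"

text \<open>The straight-line homotopy in the parameter domain \<open>D\<close>. Most homotopies below are reparametrizations of this kind.\<close>
lemma homotopic_in_convex: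
 fixes D :: "'n::real_normed_vector set"
 assumes Q: "continuous_map (top_of_set D) X Q" and D: "convex D"
  and f: "continuous_on {0..1} f" "f \<in> {0..1} \<rightarrow> D" and g: "continuous_on {0..1} g" "g \<in> {0..1} \<rightarrow> D"
  and ends: "f 0 = g 0" "f 1 = g 1" "Q (f 0) = x" "Q (f 1) = y"
 shows "path_homotopic X x y (\<lambda>t. Q (f t)) (\<lambda>t. Q (g t))"
 unfolding path_homotopic_def
proof (subst homotopic_with, force, intro exI conjI ballI)
 let ?h = "\<lambda>(s, t). Q ((1 - s) *\<^sub>R f t + s *\<^sub>R g t)"
 have "continuous_on ({0..1} \<times> {0..1}) (\<lambda>(s, t). (1 - s) *\<^sub>R f t + s *\<^sub>R g t)"
  unfolding split_beta
  by (intro continuous_intros continuous_on_compose2[OF f(1)] continuous_on_compose2[OF g(1)]) auto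
 moreover have "(\<lambda>(s, t). (1 - s) *\<^sub>R f t + s *\<^sub>R g t) \<in> {0..1} \<times> {0..1} \<rightarrow> D"
  using D f g by (auto simp: convex_alt Pi_iff)
 ultimately have "continuous_map unit_square (top_of_set D) (\<lambda>(s, t). (1 - s) *\<^sub>R f t + s *\<^sub>R g t)"
  by (simp add: continuous_map_into)
 hence "continuous_map unit_square X (Q \<circ> (\<lambda>(s, t). (1 - s) *\<^sub>R f t + s *\<^sub>R g t))"
  using Q by (rule continuous_map_compose)
 thus "continuous_map (prod_topology \<I> \<I>) X ?h"
  by (simp add: prod_topology_subtopology_eu comp_def case_prod_unfold)
qed (use ends in \<open>auto simp flip: scaleR_left.add\<close>)

lemma path_homotopic_refl: "joins X x y g ==> path_homotopic X x y g g"
 by (auto simp: path_homotopic_def joins_def pathin_def)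

lemma path_homotopic_sym: "path_homotopic X x y g h ==> path_homotopic X x y h g"
 by (simp add: path_homotopic_def homotopic_with_sym)

lemma path_homotopic_trans [trans]:
 "path_homotopic X x y g h ==> path_homotopic X x y h k ==> path_homotopic X x y g k"
 unfolding path_homotopic_def by (rule homotopic_with_trans)

lemma path_homotopic_imp:
 "path_homotopic X x y g h ==> joins X x y g \<and> joins X x y h"
 unfolding path_homotopic_def joins_def pathin_def
 using homotopic_with_imp_continuous_maps[of "\<lambda>k. k 0 = x \<and> k 1 = y" "\<I>" X g h]
  homotopic_with_imp_property[of "\<lambda>k. k 0 = x \<and> k 1 = y" "\<I>" X g h] by blast

lemma path_homotopic_cong:
 assumes "path_homotopic X x y g h" "!!t. t \<in> {0..1} ==> g' t = g t" "!!t. t \<in> {0..1} ==> h' t = h t"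
 shows "path_homotopic X x y g' h'"
 using assms unfolding path_homotopic_def
 by (elim homotopic_with_eq) auto

lemma path_reparam:
 assumes g: "pathin X g" and f: "continuous_on {0..1} f" "f \<in> {0..1} \<rightarrow> {0..1}"
  and f': "continuous_on {0..1} f'" "f' \<in> {0..1} \<rightarrow> {0..1}" and "f 0 = f' 0" "f 1 = f' 1"
  and h: "!!t. t \<in> {0..1} ==> h t = g (f t)" "!!t. t \<in> {0..1} ==> h' t = g (f' t)"
  and "h 0 = x" "h 1 = y"
 shows "path_homotopic X x y h h'"
proof (rule path_homotopic_cong[OF _ h])
 show "path_homotopic X x y (\<lambda>t. g (f t)) (\<lambda>t. g (f' t))"
  using g by (intro homotopic_in_convex[of "{0..1}"] f f') (use assms in \<open>auto simp: pathin_def\<close>)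
qed

lemma joins_concat: "joins X x y g ==> joins X y z h ==> joins X x z (concat_path g h)"
 by (auto simp: joins_def intro!: pathin_concat) (auto simp: concat_path_def)

lemma joins_rev: "joins X x y g ==> joins X y x (rev_path g)"
 using continuous_map_compose[of "\<I>" "\<I>" "\<lambda>t::real. 1 - t" X g]
  continuous_on_op_minus[of "{0..1}" "1 :: real"]
 by (auto simp: joins_def pathin_def rev_path_def comp_def continuous_map_into intro!: continuous_intros)

lemma joins_const: "x \<in> topspace X ==> joins X x x (\<lambda>_. x)"
 by (simp add: joins_def pathin_def)

lemma path_homotopic_concat:
 assumes g: "path_homotopic X x y g g'" and h: "path_homotopic X y z h h'"
 shows "path_homotopic X x z (concat_path g h) (concat_path g' h')"
proof -
 let ?I = "\<I>"
 obtain H :: "real \<times> real => 'a" where H: "continuous_map (prod_topology ?I ?I) X H"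
  "\<forall>x\<in>topspace ?I. H (0, x) = g x" "\<forall>x\<in>topspace ?I. H (1, x) = g' x" "\<forall>r\<in>{0..1}. H (r, 0) = x \<and> H (r, 1) = y"
  using g unfolding path_homotopic_def by (subst (asm) homotopic_with) auto
 obtain K :: "real \<times> real => 'a" where K: "continuous_map (prod_topology ?I ?I) X K"
  "\<forall>x\<in>topspace ?I. K (0, x) = h x" "\<forall>x\<in>topspace ?I. K (1, x) = h' x" "\<forall>r\<in>{0..1}. K (r, 0) = y \<and> K (r, 1) = z"
  using h unfolding path_homotopic_def by (subst (asm) homotopic_with) auto
 let ?M = "\<lambda>p. if snd p \<le> 1/2 then H (fst p, 2 * snd p) else K (fst p, 2 * snd p - 1)"
 let ?Q = "unit_square"
 have HK: "continuous_map ?Q X H" "continuous_map ?Q X K" using H(1) K(1) by (simp_all add: prod_topology_subtopology_eu)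
 have M: "continuous_map ?Q X ?M"
 proof (rule continuous_map_cases_le)
  show "continuous_map (subtopology ?Q {p \<in> topspace ?Q. snd p \<le> 1/2}) X (\<lambda>p. H (fst p, 2 * snd p))"
   by (rule continuous_map_compose[unfolded comp_def, OF _ HK(1)])
    (auto simp: continuous_map_into subtopology_subtopology intro!: continuous_intros)
  show "continuous_map (subtopology ?Q {p \<in> topspace ?Q. 1/2 \<le> snd p}) X (\<lambda>p. K (fst p, 2 * snd p - 1))"
   by (rule continuous_map_compose[unfolded comp_def, OF _ HK(2)])
    (auto simp: continuous_map_into subtopology_subtopology intro!: continuous_intros)
  show "H (fst p, 2 * snd p) = K (fst p, 2 * snd p - 1)" if "p \<in> topspace ?Q" "snd p = 1/2" for p
  proof -
   have "fst p \<in> {0..1}" using that(1) by auto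
   hence "H (fst p, 1) = K (fst p, 0)" using H(4) K(4) by auto
   thus ?thesis unfolding that(2) by simp
  qed
 qed (auto intro!: continuous_intros simp: continuous_map_into)
 show ?thesis
  unfolding path_homotopic_def
 proof (subst homotopic_with, force, intro exI[of _ ?M] conjI ballI)
  show "continuous_map (prod_topology ?I ?I) X ?M" using M by (simp add: prod_topology_subtopology_eu)
 qed (use H K in \<open>auto simp: concat_path_def\<close>)
qed

lemma concat_assoc:
 assumes "joins X x y g" "joins X y z h" "joins X z w k"
 shows "path_homotopic X x w (concat_path (concat_path g h) k) (concat_path g (concat_path h k))"
proof -
 have gh: "joins X x w (concat_path (concat_path g h) k)"
  by (rule joins_concat[OF joins_concat[OF assms(1,2)] assms(3)])
 have e: "g 1 = h 0" "h 1 = k 0" using assms by (auto simp: joins_def)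
 show ?thesis
 proof (rule path_reparam[where f = "\<lambda>t. t" and f' = "\<lambda>t. if t \<le> 1/2 then t / 2 else if t \<le> 3/4 then t - 1/4 else 2 * t - 1"])
  have "continuous_on {0..1} (\<lambda>t::real. max (t / 2) (max (t - 1/4) (2 * t - 1)))"
   by (intro continuous_intros) auto
  moreover have "(if t \<le> 1/2 then t / 2 else if t \<le> 3/4 then t - 1/4 else 2 * t - 1) = max (t / 2) (max (t - 1/4) (2 * t - 1))" for t :: real
   by (auto simp: max_def)
  ultimately show "continuous_on {0..1} (\<lambda>t::real. if t \<le> 1/2 then t / 2 else if t \<le> 3/4 then t - 1/4 else 2 * t - 1)"
   by simp
  fix t :: real assume t: "t \<in> {0..1}"
  consider "t \<le> 1/2" | "1/2 < t" "t \<le> 3/4" | "3/4 < t" by linarith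
  thus "concat_path g (concat_path h k) t = concat_path (concat_path g h) k (if t \<le> 1/2 then t / 2 else if t \<le> 3/4 then t - 1/4 else 2 * t - 1)"
  proof cases
   case 1 thus ?thesis using t by (simp add: concat_path_def)
  next
   case 2
   have a: "2 * (2 * (t - 1/4)) - 1 = 2 * (2 * t - 1)" by simp
   show ?thesis using 2 t unfolding concat_path_def by (simp add: a)
  next
   case 3 thus ?thesis using t by (simp add: concat_path_def)
  qed
 qed (use gh in \<open>auto simp: joins_def\<close>)
qed

lemma concat_const_right:
 assumes "joins X x y g"
 shows "path_homotopic X x y (concat_path g (\<lambda>_. y)) g"
proof (rule path_reparam[where g = g and f = "\<lambda>t. min (2 * t) 1" and f' = "\<lambda>t. t"])
 show "continuous_on {0..1} (\<lambda>t::real. min (2 * t) 1)" by (intro continuous_intros)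
qed (use assms in \<open>auto simp: joins_def concat_path_def rev_path_def min_def\<close>)

lemma concat_const_left:
 assumes "joins X x y g"
 shows "path_homotopic X x y (concat_path (\<lambda>_. x) g) g"
proof (rule path_reparam[where g = g and f = "\<lambda>t. max (2 * t - 1) 0" and f' = "\<lambda>t. t"])
 show "continuous_on {0..1} (\<lambda>t::real. max (2 * t - 1) 0)" by (intro continuous_intros)
qed (use assms in \<open>auto simp: joins_def concat_path_def rev_path_def max_def\<close>)

lemma concat_rev:
 assumes "joins X x y g"
 shows "path_homotopic X x x (concat_path g (rev_path g)) (\<lambda>_. x)"
proof (rule path_reparam[where g = g and f = "\<lambda>t. min (2 * t) (2 - 2 * t)" and f' = "\<lambda>t. 0"])
 show "continuous_on {0..1} (\<lambda>t::real. min (2 * t) (2 - 2 * t))" by (intro continuous_intros)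
qed (use assms in \<open>auto simp: joins_def concat_path_def rev_path_def min_def\<close>)

lemma rev_rev_path [simp]: "rev_path (rev_path g) = g"
 by (simp add: rev_path_def)

lemma rev_concat: "g 1 = h 0 ==> rev_path (concat_path g h) = concat_path (rev_path h) (rev_path g)"
proof
 fix t :: real assume e: "g 1 = h 0"
 consider "t < 1/2" | "t = 1/2" | "t > 1/2" by linarith
 thus "rev_path (concat_path g h) t = concat_path (rev_path h) (rev_path g) t"
 proof cases
  case 1 thus ?thesis by (simp add: rev_path_def concat_path_def)
 next
  case 2 show ?thesis unfolding 2 using e by (simp add: rev_path_def concat_path_def)
 next
  case 3 thus ?thesis by (simp add: rev_path_def concat_path_def)
 qed
qed

lemma concat_rev_left:
 "joins X x y g ==> path_homotopic X y y (concat_path (rev_path g) g) (\<lambda>_. y)"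
 using concat_rev[OF joins_rev, of X x y g] by (simp only: rev_rev_path)

lemma path_homotopic_rev: "path_homotopic X x y g h ==> path_homotopic X y x (rev_path g) (rev_path h)"
 unfolding path_homotopic_def rev_path_def
 using homotopic_with_compose_continuous_map_right[of "\<lambda>k. k 0 = x \<and> k 1 = y" "\<I>" X g h
   "\<I>" "\<lambda>t. 1 - t" "\<lambda>k. k 0 = y \<and> k 1 = x"]
  continuous_on_op_minus[of "{0..1}" "1 :: real"]
 by (auto simp: comp_def continuous_map_into intro!: continuous_intros)

section \<open>The fundamental group is a group\<close>

lemma loops_iff: "g \<in> loops X p \<longleftrightarrow> joins X p p g"
 by (simp add: loops_def joins_def)

lemma loop_class_iff: "h \<in> loop_class X p g \<longleftrightarrow> path_homotopic X p p g h"
 using path_homotopic_imp[of X p p g h] by (auto simp: loop_class_def loops_iff path_homotopic_def)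

lemma loop_class_eqI: "path_homotopic X p p g h ==> loop_class X p g = loop_class X p h"
 by (rule Set.set_eqI, unfold loop_class_iff) (meson path_homotopic_trans path_homotopic_sym)

lemma loop_class_eqD: "joins X p p g ==> loop_class X p g = loop_class X p h ==> path_homotopic X p p g h"
 by (metis loop_class_iff path_homotopic_refl path_homotopic_sym)

lemma carrier_fundamental_group: "carrier (fundamental_group X p) = loop_class X p ` {g. joins X p p g}"
 by (auto simp: fundamental_group_def loops_iff)

lemma loop_class_in_carrier: "joins X p p g ==> loop_class X p g \<in> carrier (fundamental_group X p)"
 by (auto simp: carrier_fundamental_group)

lemma one_fundamental_group: "\<one>\<^bsub>fundamental_group X p\<^esub> = loop_class X p (\<lambda>_. p)"
 by (simp add: fundamental_group_def)

lemma mult_fundamental_group: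
 assumes "joins X p p g" "joins X p p h"
 shows "loop_class X p g \<otimes>\<^bsub>fundamental_group X p\<^esub> loop_class X p h = loop_class X p (concat_path g h)"
proof -
 have "loop_class X p (concat_path g' h') = loop_class X p (concat_path g h)"
  if "path_homotopic X p p g g'" "path_homotopic X p p h h'" for g' h'
  by (rule loop_class_eqI[OF path_homotopic_sym[OF path_homotopic_concat[OF that]]])
 hence "(\<Union>g'\<in>loop_class X p g. \<Union>h'\<in>loop_class X p h. loop_class X p (concat_path g' h'))
   = (\<Union>g'\<in>loop_class X p g. \<Union>h'\<in>loop_class X p h. loop_class X p (concat_path g h))"
  unfolding loop_class_iff[symmetric] by blast
 moreover have "g \<in> loop_class X p g" "h \<in> loop_class X p h"
  using path_homotopic_refl assms by (simp_all add: loop_class_iff)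
 ultimately show ?thesis by (auto simp: fundamental_group_def)
qed

lemma group_fundamental_group:
 assumes p: "p \<in> topspace X"
 shows "group (fundamental_group X p)"
proof (rule groupI)
 fix A assume "A \<in> carrier (fundamental_group X p)"
 then obtain g where g: "joins X p p g" "A = loop_class X p g" by (auto simp: carrier_fundamental_group)
 show "\<one>\<^bsub>fundamental_group X p\<^esub> \<otimes>\<^bsub>fundamental_group X p\<^esub> A = A"
  unfolding one_fundamental_group g mult_fundamental_group[OF joins_const[OF p] g(1)]
  by (rule loop_class_eqI[OF concat_const_left[OF g(1)]])
 note r = joins_rev[OF g(1)]
 have "loop_class X p (rev_path g) \<otimes>\<^bsub>fundamental_group X p\<^esub> A = \<one>\<^bsub>fundamental_group X p\<^esub>"
  unfolding one_fundamental_group g mult_fundamental_group[OF r g(1)]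
  by (rule loop_class_eqI[OF concat_rev_left[OF g(1)]])
 thus "\<exists>B\<in>carrier (fundamental_group X p). B \<otimes>\<^bsub>fundamental_group X p\<^esub> A = \<one>\<^bsub>fundamental_group X p\<^esub>"
  using loop_class_in_carrier[OF r] by blast
 fix B assume "B \<in> carrier (fundamental_group X p)"
 then obtain h where h: "joins X p p h" "B = loop_class X p h" by (auto simp: carrier_fundamental_group)
 show "A \<otimes>\<^bsub>fundamental_group X p\<^esub> B \<in> carrier (fundamental_group X p)"
  unfolding g h mult_fundamental_group[OF g(1) h(1)]
  by (rule loop_class_in_carrier[OF joins_concat[OF g(1) h(1)]])
 fix C assume "C \<in> carrier (fundamental_group X p)"
 then obtain k where k: "joins X p p k" "C = loop_class X p k" by (auto simp: carrier_fundamental_group)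
 show "A \<otimes>\<^bsub>fundamental_group X p\<^esub> B \<otimes>\<^bsub>fundamental_group X p\<^esub> C = A \<otimes>\<^bsub>fundamental_group X p\<^esub> (B \<otimes>\<^bsub>fundamental_group X p\<^esub> C)"
  unfolding g h k mult_fundamental_group[OF g(1) h(1)] mult_fundamental_group[OF h(1) k(1)]
   mult_fundamental_group[OF joins_concat[OF g(1) h(1)] k(1)]
   mult_fundamental_group[OF g(1) joins_concat[OF h(1) k(1)]]
  by (rule loop_class_eqI[OF concat_assoc[OF g(1) h(1) k(1)]])
next
 show "\<one>\<^bsub>fundamental_group X p\<^esub> \<in> carrier (fundamental_group X p)"
  unfolding one_fundamental_group by (rule loop_class_in_carrier[OF joins_const[OF p]])
qed

text \<open>The class of the loop that follows \<open>g\<close> and returns along \<open>h\<close>, for paths from \<open>p\<close> to a common end.\<close>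
definition path_quotient :: "'x topology => 'x => (real => 'x) => (real => 'x) => (real => 'x) set" where
 "path_quotient X p g h = loop_class X p (concat_path g (rev_path h))"

lemma path_quotient_closed:
 "joins X p x g ==> joins X p x h ==> path_quotient X p g h \<in> carrier (fundamental_group X p)"
 unfolding path_quotient_def by (intro loop_class_in_carrier joins_concat joins_rev)

lemma path_quotient_cong:
 assumes "path_homotopic X p x g g'" "path_homotopic X p x h h'"
 shows "path_quotient X p g h = path_quotient X p g' h'"
 unfolding path_quotient_def
 by (intro loop_class_eqI path_homotopic_concat[OF assms(1) path_homotopic_rev[OF assms(2)]])

lemma path_quotient_self: "joins X p x g ==> path_quotient X p g g = \<one>\<^bsub>fundamental_group X p\<^esub>"
 unfolding path_quotient_def one_fundamental_group by (intro loop_class_eqI concat_rev)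

lemma concat_cancel:
 assumes "joins X x y g" "joins X z y h" "joins X y w k"
 shows "path_homotopic X x w (concat_path (concat_path g (rev_path h)) (concat_path h k)) (concat_path g k)"
proof -
 note r = joins_rev[OF assms(2)]
 note refl = path_homotopic_refl
 have "path_homotopic X x w (concat_path (concat_path g (rev_path h)) (concat_path h k))
   (concat_path g (concat_path (rev_path h) (concat_path h k)))"
  by (rule concat_assoc[OF assms(1) r joins_concat[OF assms(2,3)]])
 also have "path_homotopic X x w \<dots> (concat_path g (concat_path (concat_path (rev_path h) h) k))"
  by (intro path_homotopic_concat[OF refl[OF assms(1)]] path_homotopic_sym[OF concat_assoc[OF r assms(2,3)]])
 also have "path_homotopic X x w \<dots> (concat_path g (concat_path (\<lambda>_. y) k))"
  by (rule path_homotopic_concat[OF refl[OF assms(1)] path_homotopic_concat[OF concat_rev_left[OF assms(2)] refl[OF assms(3)]]])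
 also have "path_homotopic X x w \<dots> (concat_path g k)"
  by (intro path_homotopic_concat[OF refl[OF assms(1)]] concat_const_left[OF assms(3)])
 finally show ?thesis .
qed

lemma path_quotient_mult:
 assumes "joins X p x g" "joins X p x h" "joins X p x k"
 shows "path_quotient X p g h \<otimes>\<^bsub>fundamental_group X p\<^esub> path_quotient X p h k = path_quotient X p g k"
proof -
 note r = joins_rev[OF assms(2)] joins_rev[OF assms(3)]
 show ?thesis
  unfolding path_quotient_def
   mult_fundamental_group[OF joins_concat[OF assms(1) r(1)] joins_concat[OF assms(2) r(2)]]
  by (rule loop_class_eqI[OF concat_cancel[OF assms(1,2) r(2)]])
qed

lemma path_quotient_extend:
 assumes "joins X p x g" "joins X p x h" "joins X x y m"
 shows "path_quotient X p (concat_path g m) (concat_path h m) = path_quotient X p g h"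
proof -
 note r = joins_rev[OF assms(2)] joins_rev[OF assms(3)]
 have e: "rev_path (concat_path h m) = concat_path (rev_path m) (rev_path h)"
  using assms by (intro rev_concat) (auto simp: joins_def)
 have "path_homotopic X p p (concat_path (concat_path g (rev_path (rev_path m))) (concat_path (rev_path m) (rev_path h)))
   (concat_path g (rev_path h))"
  by (rule concat_cancel[OF assms(1) r(2) r(1)])
 thus ?thesis unfolding path_quotient_def e by (intro loop_class_eqI) simp
qed

lemma path_quotient_const:
 assumes "joins X p p g"
 shows "path_quotient X p g (\<lambda>_. p) = loop_class X p g"
 unfolding path_quotient_def using loop_class_eqI[OF concat_const_right[OF assms]] by (simp add: rev_path_def)

section \<open>The standard simplex\<close>

definition std_simplex :: "(real^'c::finite) set" ("\<Delta>") where
 "\<Delta> = {y. (\<forall>i. 0 \<le> y $ i) \<and> (\<Sum>i\<in>UNIV. y $ i) = 1}"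

definition supp :: "real^'c::finite => 'c set" where
 "supp y = {i. y $ i \<noteq> 0}"

definition bary :: "'c set => real^'c::finite" where
 "bary A = (\<chi> i. if i \<in> A then 1 / card A else 0)"

lemma bary_simp: "A \<noteq> {} ==> bary A \<in> \<Delta>"
 by (auto simp: std_simplex_def bary_def sum.If_cases)

lemma supp_bary: "A \<noteq> {} ==> supp (bary A) = A"
 by (auto simp: supp_def bary_def)

lemma bary_sing: "bary {i} = axis i 1"
 by (auto simp: bary_def axis_def vec_eq_iff)

lemma axis_simp: "axis i 1 \<in> \<Delta>"
 using bary_simp[of "{i}"] by (simp add: bary_sing)

lemma simp_nonneg: "y \<in> \<Delta> ==> 0 \<le> y $ i"
 by (simp add: std_simplex_def)

lemma supp_pos: "y \<in> \<Delta> ==> i \<in> supp y \<longleftrightarrow> 0 < y $ i"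
 using simp_nonneg[of y i] by (auto simp: supp_def)

lemma supp_nonempty: "y \<in> \<Delta> ==> supp y \<noteq> {}"
proof
 assume y: "y \<in> \<Delta>" "supp y = {}"
 hence "y $ i = 0" for i by (auto simp: supp_def)
 thus False using y(1) by (simp add: std_simplex_def)
qed

lemma convex_simp: "convex (\<Delta> :: (real^'c::finite) set)"
proof (rule convexI)
 fix x y :: "real^'c" and u v :: real assume *: "x \<in> \<Delta>" "y \<in> \<Delta>" "0 \<le> u" "0 \<le> v" "u + v = 1"
 have "(\<Sum>i\<in>UNIV. (u *\<^sub>R x + v *\<^sub>R y) $ i) = u * (\<Sum>i\<in>UNIV. x $ i) + v * (\<Sum>i\<in>UNIV. y $ i)"
  by (simp add: sum.distrib sum_distrib_left)
 thus "u *\<^sub>R x + v *\<^sub>R y \<in> \<Delta>" using * by (simp add: std_simplex_def)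
qed

lemma simp_le_1: "y \<in> \<Delta> ==> y $ i \<le> 1"
 unfolding std_simplex_def using member_le_sum[of i UNIV "\<lambda>i. y $ i"] by auto

lemma closed_simp: "closed (\<Delta> :: (real^'c::finite) set)"
proof -
 have eq: "(\<Delta> :: (real^'c) set) = (\<Inter>i. {y. 0 \<le> y $ i}) \<inter> {y. (\<Sum>i\<in>UNIV. y $ i) = 1}"
  by (auto simp: std_simplex_def)
 show ?thesis
  unfolding eq by (intro closed_Int closed_INT ballI closed_Collect_le closed_Collect_eq continuous_intros)
qed

lemma compact_simp: "compact (\<Delta> :: (real^'c::finite) set)"
proof -
 have "bounded (\<Delta> :: (real^'c) set)"
  by (rule bounded_subset[OF bounded_cbox[of 0 1]]) (auto simp: mem_box_cart simp_nonneg simp_le_1)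
 thus ?thesis using closed_simp by (simp add: compact_eq_bounded_closed)
qed

lemma simp_eq_axis: "y \<in> \<Delta> ==> supp y \<subseteq> {i} ==> y = axis i 1"
proof -
 assume y: "y \<in> \<Delta>" "supp y \<subseteq> {i}"
 hence 0: "y $ j = 0" if "j \<noteq> i" for j using that by (auto simp: supp_def)
 have "(\<Sum>j\<in>UNIV. y $ j) = y $ i" by (subst sum.remove[of _ i]) (auto simp: 0)
 hence "y $ i = 1" using y by (simp add: std_simplex_def)
 thus ?thesis using 0 by (auto simp: vec_eq_iff axis_def)
qed

lemma supp_combination:
 assumes "x \<in> \<Delta>" "y \<in> \<Delta>" "0 < t" "t < 1"
 shows "supp ((1 - t) *\<^sub>R x + t *\<^sub>R y) = supp x \<union> supp y"
proof -
 have "(1 - t) * x $ i + t * y $ i = 0 \<longleftrightarrow> x $ i = 0 \<and> y $ i = 0" for i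
  using assms simp_nonneg[OF assms(1), of i] simp_nonneg[OF assms(2), of i]
  by (subst add_nonneg_eq_0_iff) auto
 thus ?thesis by (auto simp: supp_def)
qed

section \<open>Spaces glued from tetrahedra\<close>

text \<open>Every point has arbitrarily small neighbourhoods that are images of a ball with the point in the centre.\<close>
definition ball_charts :: "'x topology => bool" where
 "ball_charts X \<longleftrightarrow> (\<forall>N x. openin X N \<and> x \<in> N --> (\<exists>\<theta> \<theta>'. continuous_map (top_of_set (ball 0 1)) X \<theta> \<and>
    openin X (\<theta> ` ball (0::real^3) 1) \<and> \<theta> ` ball 0 1 \<subseteq> N \<and> \<theta> 0 = x \<and>
    continuous_map (subtopology X (\<theta> ` ball 0 1)) euclidean \<theta>' \<and> (\<forall>p\<in>ball 0 1. \<theta>' (\<theta> p) = p)))"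

definition plane :: "(real^'c::finite) set" where
 "plane = {y. (\<Sum>i\<in>UNIV. y $ i) = 1}"

lemma plane_eq: "plane = {y. 1 \<bullet> y = 1}"
 by (simp add: plane_def inner_vec_def)

lemma affine_plane: "affine plane"
 unfolding plane_eq by (rule affine_hyperplane)

lemma aff_dim_plane:
 assumes "CARD('c::finite) = 4"
 shows "aff_dim (plane :: (real^'c) set) = 3"
 unfolding plane_eq using assms by (subst aff_dim_hyperplane) (auto simp: vec_eq_iff)

lemma simp_plane: "\<Delta> \<subseteq> plane"
 by (auto simp: std_simplex_def plane_def)

text \<open>If \<open>\<beta>\<close> is injective near \<open>x\<close>, its values fill a neighbourhood of \<open>\<beta> x\<close> in the hyperplane of the simplex, by
 invariance of domain. With \<open>\<beta> x $ c = 0\<close> some of them would have a negative coordinate.\<close>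
lemma simplex_boundary_not_open:
 fixes X :: "'x topology" and \<beta> :: "'x => real^'c::finite"
 assumes card4: "CARD('c) = 4" and charts: "ball_charts X"
  and beta_cont: "continuous_map X euclidean \<beta>" and beta_in: "!!x. x \<in> topspace X ==> \<beta> x \<in> \<Delta>"
  and N: "openin X N" "x \<in> N" and inj: "inj_on \<beta> N"
 shows "\<beta> x $ c \<noteq> 0"
proof
 assume 0: "\<beta> x $ c = 0"
 obtain \<theta> \<theta>' where th: "continuous_map (top_of_set (ball 0 1)) X \<theta>"
  "openin X (\<theta> ` ball (0::real^3) 1)" "\<theta> ` ball 0 1 \<subseteq> N" "\<theta> 0 = x" "\<forall>p\<in>ball 0 1. \<theta>' (\<theta> p) = p"
  using charts N unfolding ball_charts_def by blast
 have NX: "N \<subseteq> topspace X" using N(1) by (rule openin_subset)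
 let ?f = "\<beta> \<circ> \<theta>"
 have "continuous_on (ball 0 1) ?f"
  using continuous_map_compose[OF th(1) beta_cont] by simp
 moreover have "inj_on ?f (ball 0 1)"
  using inj th(3,5) by (intro comp_inj_on) (metis inj_on_inverseI, metis inj_on_subset)
 moreover have im: "?f p \<in> \<Delta>" if "p \<in> ball 0 1" for p
  using th(3) beta_in[of "\<theta> p"] NX that unfolding image_subset_iff comp_apply by blast
 ultimately have op: "openin (top_of_set plane) (?f ` ball 0 1)"
  using aff_dim_plane[OF card4] simp_plane affine_plane
  by (intro invariance_of_domain_affine_sets[where U = "UNIV :: (real^3) set"]) auto
 have x: "\<beta> x \<in> ?f ` ball 0 1" using th(4) by (auto intro!: image_eqI[of _ _ 0])
 obtain T where T: "open T" "?f ` ball 0 1 = plane \<inter> T" using op by (auto simp: openin_open)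
 obtain e where e: "e > 0" "ball (\<beta> x) e \<subseteq> T" using T x open_contains_ball by blast
 have "card (- {c}) = 3" unfolding Compl_eq_Diff_UNIV card_Diff_singleton[OF UNIV_I] card4 by simp
 hence "- {c} \<noteq> {}" by auto
 then obtain d where d: "d \<noteq> c" by blast
 define y where "y = \<beta> x + (e / 4) *\<^sub>R (axis d 1 - axis c 1)"
 have "norm (axis d 1 - axis c 1 :: real^'c) \<le> 2"
  using norm_triangle_ineq4[of "axis d 1 :: real^'c" "axis c 1"] by simp
 hence "norm ((e / 4) *\<^sub>R (axis d 1 - axis c 1 :: real^'c)) < e" using e(1) by simp
 hence "y \<in> ball (\<beta> x) e" by (simp add: y_def dist_norm)
 moreover have "y \<in> plane"
  using subsetD[OF simp_plane, of "\<beta> x"] x im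
  by (auto simp: y_def plane_eq inner_add_right inner_diff_right inner_axis)
 ultimately have "y \<in> ?f ` ball 0 1" using T e by blast
 hence "y \<in> \<Delta>" using im by auto
 hence "0 \<le> y $ c" by (rule simp_nonneg)
 moreover have "y $ c = - (e / 4)" using 0 d by (simp add: y_def axis_def)
 ultimately show False using e(1) by simp
qed

text \<open>A 3-manifold glued from tetrahedra with labelled vertices. As gluings respect the labels, \<open>\<beta>\<close> gives
 barycentric coordinates on the whole space; tetrahedra that share a point share the face carrying it (\<open>glued\<close>). That there is
 only one vertex for each label (\<open>common_vertices\<close>) expresses that the complex is contracted.\<close>
locale tetrahedra =
 fixes X :: "'x topology" and V :: "'v set"
  and \<phi> :: "'v => real^'c::finite => 'x" and \<beta> :: "'x => real^'c"
 assumes card4: "CARD('c) = 4"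
  and finV: "finite V"
  and Hausdorff: "Hausdorff_space X"
  and phi_cont: "u \<in> V ==> continuous_map (top_of_set \<Delta>) X (\<phi> u)"
  and beta_cont: "continuous_map X euclidean \<beta>"
  and beta_phi: "u \<in> V ==> y \<in> \<Delta> ==> \<beta> (\<phi> u y) = y"
  and cover: "topspace X = (\<Union>u\<in>V. \<phi> u ` \<Delta>)"
  and glued: "u \<in> V ==> v \<in> V ==> y \<in> \<Delta> ==> z \<in> \<Delta> ==> \<phi> u y = \<phi> v y ==> supp z \<subseteq> supp y ==> \<phi> u z = \<phi> v z"
  and interior_distinct: "u \<in> V ==> v \<in> V ==> y \<in> \<Delta> ==> \<phi> u y = \<phi> v y ==> supp y = UNIV ==> u = v"
  and common_vertices: "u \<in> V ==> v \<in> V ==> \<phi> u (axis i 1) = \<phi> v (axis i 1)"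
  and ball_charts: "ball_charts X"
begin

abbreviation tetra :: "'v => 'x set" where
 "tetra u \<equiv> \<phi> u ` \<Delta>"

text \<open>\<open>u\<close> and \<open>v\<close> share the face with labels \<open>A\<close>; it suffices to test its barycenter.\<close>
definition meet :: "'v => 'v => 'c set => bool" where
 "meet u v A \<longleftrightarrow> \<phi> u (bary A) = \<phi> v (bary A)"

lemma meet_refl: "meet u u A" by (simp add: meet_def)
lemma meet_sym: "meet u v A ==> meet v u A" by (simp add: meet_def)
lemma meet_trans: "meet u v A ==> meet v w A ==> meet u w A" by (simp add: meet_def)

lemma meet_point:
 assumes "u \<in> V" "v \<in> V" "meet u v A" "A \<noteq> {}" "y \<in> \<Delta>" "supp y \<subseteq> A"
 shows "\<phi> u y = \<phi> v y"
 using glued[OF assms(1,2) bary_simp[OF assms(4)] assms(5)] assms by (simp add: meet_def supp_bary)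

lemma point_meet:
 assumes "u \<in> V" "v \<in> V" "y \<in> \<Delta>" "\<phi> u y = \<phi> v y" "A \<subseteq> supp y" "A \<noteq> {}"
 shows "meet u v A"
 unfolding meet_def using glued[OF assms(1-3) bary_simp[OF assms(6)] assms(4)] assms by (simp add: supp_bary)

lemma meet_mono: "u \<in> V ==> v \<in> V ==> meet u v A ==> B \<subseteq> A ==> B \<noteq> {} ==> meet u v B"
 using point_meet[of u v "bary A" B] bary_simp[of A] supp_bary[of A] by (auto simp: meet_def)

lemma phi_topspace: "u \<in> V ==> y \<in> \<Delta> ==> \<phi> u y \<in> topspace X"
 using cover by blast

lemma phi_closed: "u \<in> V ==> closedin X (tetra u)"
 using image_compactin[OF _ phi_cont, of \<Delta> u] compact_simp Hausdorff
 by (intro compactin_imp_closedin) (auto simp: compactin_subtopology)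

lemma tets_closed: "W \<subseteq> V ==> closedin X (\<Union>u\<in>W. tetra u)"
 by (intro closedin_Union) (use phi_closed finite_subset[OF _ finV] in auto)

lemma beta_in: "x \<in> topspace X ==> \<beta> x \<in> \<Delta>"
 using cover beta_phi by auto

lemma in_tet: "u \<in> V ==> x \<in> tetra u \<longleftrightarrow> x \<in> topspace X \<and> \<phi> u (\<beta> x) = x"
proof
 assume u: "u \<in> V" and "x \<in> tetra u"
 thus "x \<in> topspace X \<and> \<phi> u (\<beta> x) = x" using beta_phi[OF u] phi_topspace[OF u] by auto
next
 assume "u \<in> V" and "x \<in> topspace X \<and> \<phi> u (\<beta> x) = x"
 thus "x \<in> tetra u" using beta_in[of x] by (metis imageI)
qed

definition tet :: "'x => 'v" where
 "tet x = (SOME u. u \<in> V \<and> x \<in> tetra u)"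

lemma tet: "x \<in> topspace X ==> tet x \<in> V \<and> x \<in> tetra (tet x)"
 unfolding tet_def using cover someI_ex[of "\<lambda>u. u \<in> V \<and> x \<in> tetra u"] by blast

lemma common_meet:
 assumes "u \<in> V" "v \<in> V" "x \<in> tetra u" "x \<in> tetra v" "A \<subseteq> supp (\<beta> x)" "A \<noteq> {}"
 shows "meet u v A"
 using assms in_tet beta_in by (intro point_meet[of u v "\<beta> x"]) auto

lemma beta_coord_open: "openin X {x \<in> topspace X. P (\<beta> x)}" if "open {y. P y}"
 using openin_vimage[OF beta_cont, of P] that by simp

lemma beta_pos_open: "openin X {x \<in> topspace X. 0 < \<beta> x $ i}"
 by (rule beta_coord_open) (intro open_Collect_less continuous_intros)

lemma charts:
 assumes "openin X N" "x \<in> N"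
 shows "\<exists>\<theta> \<theta>'. continuous_map (top_of_set (ball 0 1)) X \<theta> \<and>
  openin X (\<theta> ` ball (0::real^3) 1) \<and> \<theta> ` ball 0 1 \<subseteq> N \<and> \<theta> 0 = x \<and>
  continuous_map (subtopology X (\<theta> ` ball 0 1)) euclidean \<theta>' \<and> (\<forall>p\<in>ball 0 1. \<theta>' (\<theta> p) = p)"
 using ball_charts assms unfolding ball_charts_def by blast

lemma not_boundary: "openin X N ==> x \<in> N ==> inj_on \<beta> N ==> \<beta> x $ c \<noteq> 0"
 by (rule simplex_boundary_not_open[OF card4 ball_charts beta_cont beta_in])

lemmas aff_dim_plane = aff_dim_plane[OF card4]

lemma three_others: "card (- {c}) = 3" for c :: 'c
 unfolding Compl_eq_Diff_UNIV card_Diff_singleton[OF UNIV_I] card4 by simp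

lemma facet_nonempty: "- {c} \<noteq> {}" for c :: 'c
 using three_others[of c] by auto

text \<open>Near the barycenter of a facet that belongs to no other tetrahedron, \<open>\<beta>\<close> would be injective.\<close>
lemma facet_partner_exists:
 assumes u: "u \<in> V"
 shows "\<exists>v\<in>V. v \<noteq> u \<and> meet u v (- {c})"
proof (rule ccontr)
 assume no: "\<not> ?thesis"
 let ?b = "bary (- {c})"
 have b: "?b \<in> \<Delta>" "supp ?b = - {c}"
  by (rule bary_simp[OF facet_nonempty], rule supp_bary[OF facet_nonempty])
 let ?N = "topspace X - (\<Union>v\<in>V - {u}. tetra v)"
 have "openin X ?N" by (intro openin_diff openin_topspace tets_closed Diff_subset)
 moreover have "\<phi> u ?b \<in> ?N"
 proof -
  have "\<phi> u ?b \<notin> tetra v" if v: "v \<in> V - {u}" for v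
  proof
   assume "\<phi> u ?b \<in> tetra v"
   hence "\<phi> v ?b = \<phi> u ?b" using in_tet[of v "\<phi> u ?b"] beta_phi[OF u b(1)] v by simp
   thus False using no v by (auto simp: meet_def)
  qed
  thus ?thesis using phi_topspace[OF u b(1)] by blast
 qed
 moreover have "inj_on \<beta> ?N"
 proof (rule inj_onI)
  fix x y assume x: "x \<in> ?N" and y: "y \<in> ?N" and eq: "\<beta> x = \<beta> y"
  have "z \<in> tetra u" if "z \<in> ?N" for z
   using tet[of z] that by (cases "tet z = u") auto
  hence "x \<in> tetra u" "y \<in> tetra u" using x y by blast+
  thus "x = y" using in_tet[OF u] eq by metis
 qed
 ultimately have "\<beta> (\<phi> u ?b) $ c \<noteq> 0" by (rule not_boundary)
 thus False using beta_phi[OF u b(1)] by (simp add: bary_def)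
qed

text \<open>By invariance of domain, \<open>u\<close> and \<open>v\<close> together cover a neighbourhood of the barycenter of their common
 facet: \<open>m\<close> embeds a neighbourhood \<open>Q\<close> of it in the hyperplane, via \<open>u\<close> on one side and, after a reflection \<open>r\<close>,
 via \<open>v\<close> on the other. Interior points of a third tetrahedron would lie in this neighbourhood.\<close>
lemma facet_partner_unique:
 assumes u: "u \<in> V" and v: "v \<in> V" and w: "w \<in> V" and uv: "u \<noteq> v" and uw: "u \<noteq> w" and vw: "v \<noteq> w"
  and muv: "meet u v (- {c})" and muw: "meet u w (- {c})"
 shows False
proof -
 let ?b = "bary (- {c})"
 have b: "?b \<in> \<Delta>" "supp ?b = - {c}"
  by (rule bary_simp[OF facet_nonempty], rule supp_bary[OF facet_nonempty])
 have bi: "?b $ a = 1/3" if "a \<noteq> c" for a using that three_others[of c] unfolding bary_def by (simp only: vec_lambda_beta Compl_iff singleton_iff if_True simp_thms of_nat_numeral)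
 have bc: "?b $ c = 0" by (simp add: bary_def)
 \<comment> \<open>The reflection in the facet that exchanges its two sides.\<close>
 define r :: "real^'c => real^'c" where "r y = (\<chi> a. if a = c then - (y $ c) else y $ a + (2/3) * y $ c)" for y
 define S :: "(real^'c) set" where "S = {y. \<forall>a. a \<noteq> c --> 0 < y $ a \<and> 0 < y $ a + (2/3) * y $ c}"
 define Q where "Q = plane \<inter> S"
 have sum_split: "(\<Sum>i\<in>UNIV. y $ i) = y $ c + (\<Sum>i\<in>- {c}. y $ i)" for y :: "real^'c"
  by (subst sum.remove[of _ c]) (auto simp: Compl_eq_Diff_UNIV)
 have r_plane: "r y \<in> plane" if "y \<in> plane" for y
 proof -
  have "(\<Sum>i\<in>- {c}. r y $ i) = (\<Sum>i\<in>- {c}. y $ i + (2/3) * y $ c)"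
   by (rule sum.cong) (auto simp: r_def)
  also have "\<dots> = (\<Sum>i\<in>- {c}. y $ i) + 2 * y $ c" using three_others[of c] by (simp add: sum.distrib)
  finally have "(\<Sum>i\<in>UNIV. r y $ i) = (\<Sum>i\<in>UNIV. y $ i)"
   using sum_split[of "r y"] sum_split[of y] by (simp add: r_def)
  thus ?thesis using that by (simp add: plane_def)
 qed
 have Qu: "y \<in> \<Delta>" if "y \<in> Q" "0 \<le> y $ c" for y
  using that by (auto simp: Q_def S_def std_simplex_def plane_def)
 have Qv: "r y \<in> \<Delta>" if "y \<in> Q" "y $ c \<le> 0" for y
  using that r_plane[of y] by (auto simp: Q_def S_def std_simplex_def plane_def r_def less_imp_le)
 define m where "m = (\<lambda>y. if 0 \<le> y $ c then \<phi> u y else \<phi> v (r y))"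
 have m_u: "m y = \<phi> u y" if "0 \<le> y $ c" for y using that by (simp add: m_def)
 have m_v: "m y = \<phi> v (r y)" if "y \<in> Q" "y $ c \<le> 0" for y
 proof (cases "y $ c = 0")
  case True
  hence "r y = y" by (auto simp: r_def vec_eq_iff)
  moreover have "\<phi> u y = \<phi> v y"
   using Qu[OF that(1)] True by (intro meet_point[OF u v muv facet_nonempty]) (auto simp: supp_def)
  ultimately show ?thesis using True by (simp add: m_def)
 qed (use that in \<open>auto simp: m_def\<close>)
 have cont_r: "continuous_on UNIV r"
  unfolding r_def
 proof (rule continuous_on_vec_lambda)
  show "continuous_on UNIV (\<lambda>y. if a = c then - (y $ c) else y $ a + (2/3) * y $ c :: real)" for a
   by (cases "a = c") (auto intro!: continuous_intros)
 qed
 have m_cont: "continuous_map (top_of_set Q) X m"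
  unfolding m_def
 proof (rule continuous_map_cases_le)
  show "continuous_map (subtopology (top_of_set Q) {y \<in> topspace (top_of_set Q). 0 \<le> y $ c}) X (\<phi> u)"
   using continuous_map_compose[of "subtopology (top_of_set Q) {y \<in> topspace (top_of_set Q). 0 \<le> y $ c}" _ id, OF _ phi_cont[OF u]]
   by (auto simp: subtopology_subtopology continuous_map_into Pi_iff Qu)
  show "continuous_map (subtopology (top_of_set Q) {y \<in> topspace (top_of_set Q). y $ c \<le> 0}) X (\<lambda>y. \<phi> v (r y))"
   using continuous_map_compose[of "subtopology (top_of_set Q) {y \<in> topspace (top_of_set Q). y $ c \<le> 0}" _ r, OF _ phi_cont[OF v]]
    continuous_on_subset[OF cont_r]
   by (auto simp: subtopology_subtopology continuous_map_into comp_def Pi_iff Qv)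
  show "\<phi> u y = \<phi> v (r y)" if "y \<in> topspace (top_of_set Q)" "0 = y $ c" for y
   using m_u[of y] m_v[of y] that by simp
 qed (auto intro!: continuous_intros)
 have m_inj: "inj_on m Q"
 proof (rule inj_on_inverseI)
  have rr: "r (r y) = y" for y by (auto simp: r_def vec_eq_iff)
  fix y assume y: "y \<in> Q"
  show "(if m y \<in> tetra u then \<beta> (m y) else r (\<beta> (m y))) = y"
  proof (cases "0 \<le> y $ c")
   case True
   thus ?thesis using m_u beta_phi[OF u Qu[OF y True]] Qu[OF y True] by simp
  next
   case False
   hence ry: "r y \<in> \<Delta>" "m y = \<phi> v (r y)" using Qv[OF y] m_v[OF y] by auto
   have "supp (r y) = UNIV" using y False by (auto simp: supp_def Q_def S_def r_def)
   hence "\<phi> v (r y) \<noteq> \<phi> u (r y)" using interior_distinct[OF v u ry(1)] uv by blast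
   hence "\<phi> v (r y) \<notin> tetra u"
    using in_tet[OF u, of "\<phi> v (r y)"] beta_phi[OF v ry(1)] by simp
   thus ?thesis using ry beta_phi[OF v ry(1)] rr by simp
  qed
 qed
 have "open S"
 proof -
  have "S = (\<Inter>a\<in>- {c}. {y. 0 < y $ a} \<inter> {y. 0 < y $ a + (2/3) * y $ c})" by (auto simp: S_def)
  also have "open \<dots>" by (intro open_INT ballI open_Int open_Collect_less continuous_intros) auto
  finally show ?thesis .
 qed
 have bQ: "?b \<in> Q" using b(1) simp_plane unfolding Q_def S_def by (auto simp: bi bc)
 obtain \<theta> \<theta>' where th: "continuous_map (top_of_set (ball 0 1)) X \<theta>"
  "openin X (\<theta> ` ball (0::real^3) 1)" "\<theta> 0 = \<phi> u ?b" "\<forall>p\<in>ball 0 1. \<theta>' (\<theta> p) = p"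
  "continuous_map (subtopology X (\<theta> ` ball 0 1)) euclidean \<theta>'"
  using charts[OF openin_topspace phi_topspace[OF u b(1)]] by blast
 let ?O = "\<theta> ` ball (0::real^3) 1"
 have th_back: "\<theta> (\<theta>' x) = x" if "x \<in> ?O" for x using th(4) that by auto
 define Q' where "Q' = {y \<in> Q. m y \<in> ?O}"
 have Q'_open: "openin (top_of_set plane) Q'"
 proof -
  have "openin (top_of_set Q) Q'"
   using openin_continuous_map_preimage[OF m_cont th(2)] by (simp add: Q'_def)
  moreover have "openin (top_of_set plane) Q" using \<open>open S\<close> by (auto simp: Q_def openin_open)
  ultimately show ?thesis by (rule openin_trans)
 qed
 have bQ': "?b \<in> Q'" using bQ th(3) m_u[of ?b] bc by (auto simp: Q'_def intro!: image_eqI[of _ _ 0])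
 have "openin (top_of_set (UNIV :: (real^3) set)) ((\<theta>' \<circ> m) ` Q')"
 proof (rule invariance_of_domain_affine_sets[OF Q'_open affine_plane affine_UNIV])
  have "continuous_map (top_of_set Q') (subtopology X ?O) m"
   using continuous_map_from_subtopology_mono[OF m_cont] by (auto simp: continuous_map_into Q'_def)
  thus "continuous_on Q' (\<theta>' \<circ> m)" using continuous_map_compose[OF _ th(5)] by fastforce
  show "inj_on (\<theta>' \<circ> m) Q'"
  proof (rule comp_inj_on)
   show "inj_on m Q'" using m_inj by (rule inj_on_subset) (auto simp: Q'_def)
   show "inj_on \<theta>' (m ` Q')" by (rule inj_on_inverseI[of _ \<theta>]) (use th_back in \<open>auto simp: Q'_def\<close>)
  qed
 qed (use aff_dim_plane in auto)
 hence opT: "open ((\<theta>' \<circ> m) ` Q')" by simp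
 \<comment> \<open>Points of the third simplex close to the barycenter of the facet.\<close>
 define p where "p t = (1 - t) *\<^sub>R ?b + t *\<^sub>R axis c 1" for t :: real
 have p_simp: "p t \<in> \<Delta>" if "t \<in> {0..1}" for t
  unfolding p_def using convexD_alt[OF convex_simp b(1) axis_simp] that by auto
 have pc: "continuous_map \<I> X (\<lambda>t. \<phi> w (p t))"
 proof -
  have "continuous_map \<I> (top_of_set \<Delta>) p"
   using p_simp by (auto simp: continuous_map_into p_def intro!: continuous_intros)
  thus ?thesis using continuous_map_compose[OF _ phi_cont[OF w]] unfolding comp_def by blast
 qed
 have wb: "\<phi> w ?b = \<phi> u ?b" using muw by (simp add: meet_def)
 define W where "W = {x \<in> ?O. \<theta>' x \<in> (\<theta>' \<circ> m) ` Q'}"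
 have "openin (subtopology X ?O) W"
  using openin_continuous_map_preimage[OF th(5)] opT openin_subset[OF th(2)] by (simp add: W_def Int_absorb1)
 hence "openin X W" using th(2) openin_trans_full by blast
 from openin_continuous_map_preimage[OF pc this]
 obtain T where T: "open T" "{t \<in> {0..1}. \<phi> w (p t) \<in> W} = {0..1} \<inter> T" by (auto simp: openin_open)
 have "\<phi> w (p 0) = m ?b" using wb m_u[of ?b] bc by (simp add: p_def)
 hence "0 \<in> {t \<in> {0..1}. \<phi> w (p t) \<in> W}" using bQ' by (auto simp: Q'_def W_def)
 hence "0 \<in> T" using T(2) by blast
 then obtain e where e: "e > 0" "ball 0 e \<subseteq> T" using T open_contains_ball by blast
 define t where "t = min (e / 2) (1 / 2)"
 have t: "0 < t" "t < 1" "t \<in> T" using e by (auto simp: t_def subset_iff dist_real_def)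
 hence "t \<in> {t \<in> {0..1}. \<phi> w (p t) \<in> W}" unfolding T(2) by simp
 hence "\<phi> w (p t) \<in> W" by blast
 then obtain q where q: "q \<in> Q'" "\<theta>' (\<phi> w (p t)) = \<theta>' (m q)" "\<phi> w (p t) \<in> ?O" by (auto simp: W_def)
 hence eq: "\<phi> w (p t) = m q" using th_back[of "m q"] th_back[OF q(3)] by (simp add: Q'_def)
 have pt: "p t \<in> \<Delta>" "supp (p t) = UNIV"
  using p_simp[of t] t supp_combination[OF b(1) axis_simp, of t c] b(2) by (auto simp: p_def supp_def axis_def)
 show False
 proof (cases "0 \<le> q $ c")
  case True
  hence "\<phi> w (p t) = \<phi> u q" "q \<in> \<Delta>" using eq m_u q Qu by (auto simp: Q'_def)
  hence "\<phi> w (p t) = \<phi> u (p t)" using beta_phi[OF u, of q] beta_phi[OF w pt(1)] by simp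
  thus False using interior_distinct[OF w u pt(1)] pt(2) uw by auto
 next
  case False
  hence "\<phi> w (p t) = \<phi> v (r q)" "r q \<in> \<Delta>" using eq m_v q Qv by (auto simp: Q'_def)
  hence "\<phi> w (p t) = \<phi> v (p t)" using beta_phi[OF v, of "r q"] beta_phi[OF w pt(1)] by simp
  thus False using interior_distinct[OF w v pt(1)] pt(2) vw by auto
 qed
qed

definition \<alpha> :: "'c => 'v => 'v" where
 "\<alpha> c u = (SOME v. v \<in> V \<and> v \<noteq> u \<and> meet u v (- {c}))"

lemma alpha_props: "u \<in> V ==> \<alpha> c u \<in> V \<and> \<alpha> c u \<noteq> u \<and> meet u (\<alpha> c u) (- {c})"
 unfolding \<alpha>_def by (rule someI_ex) (use facet_partner_exists in blast)

lemma facet_cases: "u \<in> V ==> v \<in> V ==> meet u v (- {c}) ==> v = u \<or> v = \<alpha> c u"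
 using facet_partner_unique[of u v "\<alpha> c u" c] alpha_props[of u c] by metis

sublocale I: colored_involutions V \<alpha>
proof
 show "\<alpha> c (\<alpha> c u) = u" if "u \<in> V" for c u
  using facet_cases[of "\<alpha> c u" u c] alpha_props[OF that, of c] that meet_sym by metis
qed (use finV alpha_props in auto)

end

section \<open>Sections near a point\<close>

context tetrahedra begin

lemma tet_const_open:
 assumes W: "openin X W" and same: "!!x u v. x \<in> W ==> u \<in> V ==> v \<in> V ==> x \<in> tetra u ==> x \<in> tetra v ==> T u = T v"
 shows "openin X {x \<in> W. T (tet x) = z}"
proof -
 have WX: "W \<subseteq> topspace X" using W by (rule openin_subset)
 let ?B = "\<Union>u\<in>{u \<in> V. T u \<noteq> z}. tetra u"
 have "closedin X ?B" by (intro tets_closed Collect_restrict)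
 moreover have "{x \<in> W. T (tet x) = z} = W - ?B"
 proof (intro subset_antisym subsetI)
  fix x assume "x \<in> {x \<in> W. T (tet x) = z}"
  hence x: "x \<in> W" "T (tet x) = z" by auto
  have t: "tet x \<in> V" "x \<in> tetra (tet x)" using tet[of x] x WX by auto
  have "T u = z" if "u \<in> V" "x \<in> tetra u" for u using same[OF x(1) that(1) t(1) that(2) t(2)] x(2) by simp
  thus "x \<in> W - ?B" using x(1) by blast
 next
  fix x assume x: "x \<in> W - ?B"
  have "tet x \<in> V" "x \<in> tetra (tet x)" using tet[of x] x WX by auto
  thus "x \<in> {x \<in> W. T (tet x) = z}" using x by blast
 qed
 ultimately show ?thesis using openin_diff[OF W, of ?B] by (simp only:)
qed

text \<open>\<open>P i u\<close> is a value for the patch \<open>U i\<close> on the tetrahedron \<open>u\<close>. The condition makes the transition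
 functions well defined where tetrahedra meet.\<close>
definition compatible ::
 "('g, 'm) monoid_scheme => 'x set => ('i => 'x set) => ('i => 'v => 'g) => bool" where
 "compatible G N U P \<longleftrightarrow>
   (\<forall>i. \<forall>u\<in>V. P i u \<in> carrier G) \<and>
   (\<forall>i j. \<forall>x\<in>N \<inter> U i \<inter> U j. \<forall>u\<in>V. \<forall>v\<in>V. x \<in> tetra u --> x \<in> tetra v -->
    P i u \<otimes>\<^bsub>G\<^esub> inv\<^bsub>G\<^esub> (P j u) = P i v \<otimes>\<^bsub>G\<^esub> inv\<^bsub>G\<^esub> (P j v))"

lemma potential_cocycle:
 fixes G (structure)
 assumes G: "group G" and N: "openin X N" and U: "!!i. openin X (U i)" and cov: "N \<subseteq> (\<Union>i. U i)"
  and P: "compatible G N U P"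
 shows "cocycle G (subtopology X N) U (\<lambda>i j x. P i (tet x) \<otimes> inv (P j (tet x)))"
proof -
 interpret group G by (rule G)
 have NX: "N \<subseteq> topspace X" using N by (rule openin_subset)
 have ts: "topspace (subtopology X N) = N" using NX by auto
 have tetN: "tet x \<in> V" "x \<in> tetra (tet x)" if "x \<in> N" for x using tet[of x] that NX by auto
 have Pc: "P i u \<in> carrier G" if "u \<in> V" for i u using P that by (simp add: compatible_def)
 have sub: "openin (subtopology X N) T" if "openin X T" "T \<subseteq> N" for T
  using that N by (simp add: openin_open_subtopology)
 show ?thesis
  unfolding cocycle_def ts
 proof (intro conjI allI ballI impI)
  show "openin (subtopology X N) {x \<in> N. x \<in> U a}" for a
   using openin_Int[OF N U[of a]] by (intro sub) (auto simp: Int_def)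
  show "\<exists>a. x \<in> U a" if "x \<in> N" for x using cov that by blast
  show "P a (tet x) \<otimes> inv P b (tet x) \<in> carrier G" if "x \<in> N" for a b x using tetN that Pc by simp
  show "P a (tet x) \<otimes> inv P b (tet x) \<otimes> (P b (tet x) \<otimes> inv P c (tet x)) = P a (tet x) \<otimes> inv P c (tet x)"
   if "x \<in> N" for a b c x using Pc[OF tetN(1)[OF that]] by (simp add: m_assoc inv_mult_cancel)
  fix a b z
  have "openin X {x \<in> N \<inter> U a \<inter> U b. P a (tet x) \<otimes> inv P b (tet x) = z}"
  proof (rule tet_const_open)
   show "openin X (N \<inter> U a \<inter> U b)" using N U by blast
   show "P a u \<otimes> inv P b u = P a v \<otimes> inv P b v"
    if "x \<in> N \<inter> U a \<inter> U b" "u \<in> V" "v \<in> V" "x \<in> tetra u" "x \<in> tetra v" for x u v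
    using P that unfolding compatible_def by blast
  qed
  thus "openin (subtopology X N) {x \<in> N. x \<in> U a \<and> x \<in> U b \<and> P a (tet x) \<otimes> inv P b (tet x) = z}"
   by (intro sub) (auto elim: back_subst[of "openin X"])
 qed
qed

lemma transition_at:
 fixes G (structure)
 assumes "openin X N" "compatible G N U P" "x \<in> N" "x \<in> U i" "x \<in> U j" "u \<in> V" "x \<in> tetra u"
 shows "P i (tet x) \<otimes> inv (P j (tet x)) = P i u \<otimes> inv (P j u)"
proof -
 have "x \<in> topspace X" using openin_subset[OF assms(1)] assms(3) by blast
 thus ?thesis using assms tet[of x] unfolding compatible_def by blast
qed

lemma locally_constant_connected:
 assumes "connected C" "C \<subseteq> D" "!!z. openin (top_of_set D) {x \<in> D. P x \<and> f x = z}" "!!x. x \<in> C ==> P x"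
  "x \<in> C" "y \<in> C"
 shows "f x = f y"
proof (rule ccontr)
 assume ne: "f x \<noteq> f y"
 let ?A = "{w \<in> D. P w \<and> f w = f x}" and ?B = "\<Union>z\<in>- {f x}. {w \<in> D. P w \<and> f w = z}"
 have "openin (top_of_set D) ?A" "openin (top_of_set D) ?B" using assms(3) by blast+
 then obtain S T where S: "open S" "?A = D \<inter> S" and T: "open T" "?B = D \<inter> T" by (auto simp: openin_open)
 have "C \<subseteq> S \<union> T"
 proof
  fix w assume "w \<in> C"
  hence "w \<in> ?A \<or> w \<in> ?B" using assms(2,4) by blast
  thus "w \<in> S \<union> T" unfolding S(2) T(2) by blast
 qed
 moreover have "S \<inter> T \<inter> C = {}"
 proof -
  have "?A \<inter> ?B = {}" by blast
  thus ?thesis using S T assms(2) by blast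
 qed
 moreover have "x \<in> D" "P x" "y \<in> D" "P y" using assms by blast+
 hence "x \<in> ?A" "y \<in> ?B" using ne by simp_all
 hence "S \<inter> C \<noteq> {}" "T \<inter> C \<noteq> {}" using S T assms(5,6) by blast+
 ultimately show False using assms(1) S(1) T(1) unfolding connected_def by blast
qed

text \<open>A punctured ball in \<open>\<real>\<^sup>3\<close> is simply connected, so every compatible system has a section \<open>S\<close> near a point, with the
 point itself removed. This is where the local topology of the manifold is used.\<close>
lemma local_section:
 fixes G (structure)
 assumes G: "group G" and N: "openin X N" "x0 \<in> N" and U: "!!i. openin X (U i)" and cov: "N - {x0} \<subseteq> (\<Union>i. U i)"
  and P: "compatible G (N - {x0}) U P"
 obtains B S where "openin X B" "x0 \<in> B" "B \<subseteq> N" "connectedin X (B - {x0})"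
  "!!i x. x \<in> B - {x0} ==> x \<in> U i ==> S i x \<in> carrier G"
  "!!i j u x. u \<in> V ==> x \<in> tetra u ==> x \<in> B - {x0} ==> x \<in> U i ==> x \<in> U j ==>
    S i x = P i u \<otimes> inv (P j u) \<otimes> S j x"
  "!!i C x y. connectedin X C ==> C \<subseteq> B - {x0} ==> C \<subseteq> U i ==> x \<in> C ==> y \<in> C ==> S i x = S i y"
proof -
 interpret group G by (rule G)
 obtain \<theta> \<theta>' where th: "continuous_map (top_of_set (ball 0 1)) X \<theta>"
  "openin X (\<theta> ` ball (0::real^3) 1)" "\<theta> ` ball 0 1 \<subseteq> N" "\<theta> 0 = x0"
  "continuous_map (subtopology X (\<theta> ` ball 0 1)) euclidean \<theta>'" "\<forall>p\<in>ball 0 1. \<theta>' (\<theta> p) = p"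
  using charts[OF N] by blast
 define B where "B = \<theta> ` ball (0::real^3) 1"
 define D where "D = ball (0::real^3) 1 - {0}"
 define N' where "N' = N - {x0}"
 have NX: "N \<subseteq> topspace X" using N(1) by (rule openin_subset)
 have N'o: "openin X N'"
  unfolding N'_def using N NX closedin_Hausdorff_singleton[OF Hausdorff, of x0] by (intro openin_diff) auto
 have DB: "\<theta> ` D = B - {x0}"
 proof (intro subset_antisym subsetI)
  fix x assume "x \<in> \<theta> ` D"
  then obtain p where p: "p \<in> D" "x = \<theta> p" by blast
  hence p: "p \<in> ball 0 1" "p \<noteq> 0" "x = \<theta> p" by (auto simp: D_def)
  have "\<theta> p \<noteq> x0"
  proof
   assume "\<theta> p = x0" hence "\<theta> p = \<theta> 0" using th(4) by simp
   hence "p = 0" using th(6) p(1) by (metis centre_in_ball zero_less_one)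
   thus False using p(2) by simp
  qed
  thus "x \<in> B - {x0}" using p by (auto simp: B_def)
 next
  fix x assume "x \<in> B - {x0}" thus "x \<in> \<theta> ` D" using th(4) by (auto simp: B_def D_def)
 qed
 have D: "open D" "simply_connected D" "connected D"
 proof -
  show "open D" by (auto simp: D_def)
  show "simply_connected D" unfolding D_def
   by (rule simply_connected_punctured_convex) (simp_all add: aff_dim_open)
  thus "connected D" by (rule simply_connected_imp_connected)
 qed
 have thD: "continuous_map (top_of_set D) (subtopology X N') \<theta>"
 proof -
  have "continuous_map (top_of_set D) X \<theta>"
   by (rule continuous_map_from_subtopology_mono[OF th(1)]) (auto simp: D_def)
  moreover have "\<theta> ` D \<subseteq> N'" using DB th(3) by (auto simp: B_def N'_def)
  ultimately show ?thesis by (auto simp: continuous_map_into)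
 qed
 let ?t = "\<lambda>i j x. P i (tet x) \<otimes> inv (P j (tet x))"
 have coc: "cocycle G (subtopology X N') U ?t"
  using P cov unfolding N'_def[symmetric] by (intro potential_cocycle G N'o U)
 obtain s where s: "global_section G (top_of_set D) (\<lambda>a. \<theta> -` U a) (\<lambda>a b y. ?t a b (\<theta> y)) s"
  using split_simply_connected[OF G cocycle_pullback[OF coc thD] D(1,2)] by blast
 define S where "S i x = s i (\<theta>' x)" for i x
 have th': "\<theta>' x \<in> D" "\<theta> (\<theta>' x) = x" if xB: "x \<in> B - {x0}" for x
 proof -
  obtain p where p: "p \<in> D" "x = \<theta> p" using xB unfolding DB[symmetric] by blast
  hence "\<theta>' x = p" using th(6) by (auto simp: D_def)
  thus "\<theta>' x \<in> D" "\<theta> (\<theta>' x) = x" using p by auto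
 qed
 have BN': "B - {x0} \<subseteq> N'" using th(3) by (auto simp: B_def N'_def)
 show ?thesis
 proof (rule that[of B S])
  show "openin X B" unfolding B_def by (rule th(2))
  show "x0 \<in> B" unfolding B_def using th(4) by (auto intro!: image_eqI[of _ _ 0])
  show "B \<subseteq> N" unfolding B_def by (rule th(3))
  have "connectedin (top_of_set D) D" using D(3) by (simp add: connectedin_subtopology)
  hence "connectedin (subtopology X N') (\<theta> ` D)" by (rule connectedin_continuous_map_image[OF thD])
  thus "connectedin X (B - {x0})" unfolding DB by (simp add: connectedin_subtopology)
  show "S i x \<in> carrier G" if "x \<in> B - {x0}" "x \<in> U i" for i x
   unfolding S_def by (rule section_closed[OF s]) (use th' that in auto)
  show "S i x = P i u \<otimes> inv (P j u) \<otimes> S j x"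
   if u: "u \<in> V" "x \<in> tetra u" and x: "x \<in> B - {x0}" and ij: "x \<in> U i" "x \<in> U j" for i j u x
  proof -
   have "S i x = ?t i j (\<theta> (\<theta>' x)) \<otimes> S j x"
    unfolding S_def by (rule section_transition[OF s]) (use th' x ij in auto)
   also have "?t i j (\<theta> (\<theta>' x)) = P i u \<otimes> inv (P j u)"
    unfolding th'(2)[OF x] by (rule transition_at[OF N'o P[folded N'_def] _ ij u]) (use BN' x in blast)
   finally show ?thesis .
  qed
  fix i C x y assume C: "connectedin X C" "C \<subseteq> B - {x0}" "C \<subseteq> U i" and x: "x \<in> C" and y: "y \<in> C"
  have "connectedin (subtopology X B) C" using C by (auto simp: connectedin_subtopology)
  hence conn: "connected (\<theta>' ` C)"
   using connectedin_continuous_map_image[OF th(5)[folded B_def]] by (metis connectedin_iff_connected)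
  show "S i x = S i y"
   unfolding S_def
  proof (rule locally_constant_connected[OF conn, where P = "\<lambda>p. p \<in> \<theta> -` U i"])
   show "\<theta>' ` C \<subseteq> D" using th'(1) C(2) by blast
   show "openin (top_of_set D) {x \<in> D. x \<in> \<theta> -` U i \<and> s i x = z}" for z
    using section_fibre_open[OF s, of i z] by simp
   show "p \<in> \<theta> -` U i" if "p \<in> \<theta>' ` C" for p
   proof -
    obtain w where w: "w \<in> C" "p = \<theta>' w" using \<open>p \<in> \<theta>' ` C\<close> by blast
    hence "\<theta> p = w" using th'(2)[of w] C(2) by blast
    thus ?thesis using C(3) w(1) by auto
   qed
  qed (use x y in auto)
 qed
qed

lemma phi_near:
 assumes B: "openin X B" and y0: "y0 \<in> \<Delta>" "!!u. u \<in> K ==> \<phi> u y0 \<in> B" and K: "K \<subseteq> V"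
 shows "\<exists>d>0. \<forall>u\<in>K. \<forall>y\<in>\<Delta>. dist y0 y < d --> \<phi> u y \<in> B"
proof -
 have finK: "finite K" using K finV finite_subset by blast
 have "\<exists>d>0. \<forall>y\<in>\<Delta>. dist y0 y < d --> \<phi> u y \<in> B" if "u \<in> K" for u
 proof -
  have "u \<in> V" using K that by blast
  hence "openin (top_of_set \<Delta>) {y \<in> \<Delta>. \<phi> u y \<in> B}"
   using openin_continuous_map_preimage[OF phi_cont B] by simp
  then obtain T where T: "open T" "{y \<in> \<Delta>. \<phi> u y \<in> B} = \<Delta> \<inter> T" by (auto simp: openin_open)
  have "y0 \<in> T" using T y0 that by blast
  then obtain d where "d > 0" "ball y0 d \<subseteq> T" using T open_contains_ball by blast
  thus ?thesis using T(2) by (intro exI[of _ d]) auto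
 qed
 then obtain d where d: "!!u. u \<in> K ==> d u > 0 \<and> (\<forall>y\<in>\<Delta>. dist y0 y < d u --> \<phi> u y \<in> B)" by metis
 show ?thesis using d finK by (intro exI[of _ "Min (insert 1 (d ` K))"]) auto
qed

lemma phi_image_connected:
 assumes "u \<in> V" "convex Z" "Z \<subseteq> \<Delta>"
 shows "connectedin X (\<phi> u ` Z)"
proof -
 have "connectedin (top_of_set \<Delta>) Z"
  using convex_connected[OF assms(2)] assms(3) by (simp add: connectedin_subtopology)
 thus ?thesis by (rule connectedin_continuous_map_image[OF phi_cont[OF assms(1)]])
qed

lemma exhaust4:
 fixes i j k l :: 'c
 assumes "distinct [i, j, k, l]"
 shows "UNIV = {i, j, k, l}"
proof -
 have "card {i, j, k, l} = CARD('c)" using assms card4 by simp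
 thus ?thesis by (intro card_subset_eq[symmetric]) auto
qed

lemma meet_triangle:
 assumes d: "distinct [i, j, k, l]" and u: "u \<in> V" and v: "v \<in> V" and m: "meet u v A" "{i, j, k} \<subseteq> A"
 shows "v = u \<or> v = \<alpha> l u"
proof -
 have e: "- {l} = {i, j, k}" using exhaust4[OF d] d by auto
 have "meet u v (- {l})" unfolding e by (rule meet_mono[OF u v m]) simp
 thus ?thesis by (rule facet_cases[OF u v])
qed

end

section \<open>Links of edges and vertices\<close>

context tetrahedra begin

text \<open>Suppose that the tetrahedra around the edge \<open>k l\<close> form several cycles, one of them \<open>?V1\<close>. Near the midpoint \<open>m\<close> of the edge,
 with \<open>m\<close> removed, take one patch for each half of the edge and patches off the edge; let the transition to
 the patch \<open>l\<close> be nontrivial exactly on the tetrahedra of \<open>?V1\<close>. A section compares the two halves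
 of the edge through each tetrahedron. The outcome depends on whether the tetrahedron belongs to \<open>?V1\<close>, but the
 points of the edge belong to all of them.\<close>
lemma edge_link_connected:
 assumes d: "distinct [i, j, k, l]" and uv: "u0 \<in> V" "v0 \<in> V" "meet u0 v0 {k, l}"
 shows "v0 \<in> I.orb {i, j} u0"
proof (rule ccontr)
 assume no: "v0 \<notin> I.orb {i, j} u0"
 have all: "UNIV = {i, j, k, l}" by (rule exhaust4[OF d])
 let ?V1 = "I.orb {i, j} u0"
 define m where "m = (bary {k, l} :: real^'c)"
 have m: "m \<in> \<Delta>" "supp m = {k, l}" unfolding m_def by (rule bary_simp supp_bary; simp)+
 have mc: "m $ k = 1/2" "m $ l = 1/2" "m $ i = 0" "m $ j = 0" using d by (simp_all add: m_def bary_def)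
 define x0 where "x0 = \<phi> u0 m"
 define K where "K = {u \<in> V. meet u0 u {k, l}}"
 have x0K: "\<phi> u m = x0" if "u \<in> K" for u using that by (auto simp: K_def x0_def m_def meet_def)
 define N where "N = topspace X - (\<Union>u\<in>V - K. tetra u)"
 have N: "openin X N"
  unfolding N_def by (intro openin_diff openin_topspace tets_closed Diff_subset)
 have bx0: "\<beta> x0 = m" unfolding x0_def by (rule beta_phi[OF uv(1) m(1)])
 have x0X: "x0 \<in> topspace X" unfolding x0_def by (rule phi_topspace[OF uv(1) m(1)])
 have x0N: "x0 \<in> N"
 proof -
  have "x0 \<notin> tetra u" if "u \<in> V - K" for u
  proof
   assume a: "x0 \<in> tetra u"
   have "x0 \<in> tetra u0" using m(1) by (auto simp: x0_def)
   hence "meet u0 u {k, l}" using a that uv(1) bx0 m(2) by (intro common_meet[of u0 u x0]) auto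
   thus False using that by (auto simp: K_def)
  qed
  thus ?thesis using x0X by (auto simp: N_def)
 qed
 \<comment> \<open>Two patches near the two halves of the edge, and one around each of the remaining corners.\<close>
 define g :: "'c => real^'c => bool" where "g a y \<longleftrightarrow>
  (if a = k then 0 < y $ l \<and> y $ l < y $ k else if a = l then 0 < y $ k \<and> y $ k < y $ l else 0 < y $ a \<and> 0 < y $ k \<and> 0 < y $ l)" for a y
 have g: "open {y. g a y}" "convex {y. g a y}" for a
 proof -
  have half: "convex {y::real^'c. 0 < y $ b}" for b
   using convex_halfspace_gt[of 0 "axis b 1 :: real^'c"] by (simp add: inner_axis' inner_axis)
  have diff: "convex {y::real^'c. y $ b < y $ c}" for b c
   using convex_halfspace_gt[of 0 "axis c 1 - axis b 1 :: real^'c"] by (simp add: inner_axis' inner_diff_left)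
  have e: "{y. g a y} = (if a = k then {y. 0 < y $ l} \<inter> {y. y $ l < y $ k}
   else if a = l then {y. 0 < y $ k} \<inter> {y. y $ k < y $ l} else {y. 0 < y $ a} \<inter> ({y. 0 < y $ k} \<inter> {y. 0 < y $ l}))"
   by (auto simp: g_def)
  show "open {y. g a y}" unfolding e by (auto intro!: open_Int open_Collect_less continuous_intros)
  show "convex {y. g a y}" unfolding e using half diff by (auto intro!: convex_Int)
 qed
 define U where "U a = {x \<in> topspace X. g a (\<beta> x)}" for a
 have U: "openin X (U a)" for a unfolding U_def by (rule beta_coord_open[OF g(1)])
 define N' where "N' = N \<inter> ({x \<in> topspace X. 0 < \<beta> x $ k} \<inter> {x \<in> topspace X. 0 < \<beta> x $ l})"
 have N': "openin X N'" unfolding N'_def by (intro openin_Int N beta_pos_open)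
 have x0N': "x0 \<in> N'" using x0N x0X bx0 mc by (auto simp: N'_def)
 define P :: "'c => 'v => bool" where "P a u \<longleftrightarrow> a = l \<and> u \<in> ?V1" for a u
 have cov: "N' - {x0} \<subseteq> (\<Union>a. U a)"
 proof
  fix x assume x: "x \<in> N' - {x0}"
  hence xX: "x \<in> topspace X" and pos: "0 < \<beta> x $ k" "0 < \<beta> x $ l" by (auto simp: N'_def)
  show "x \<in> (\<Union>a. U a)"
  proof (rule ccontr)
   assume no: "x \<notin> (\<Union>a. U a)"
   have "x \<notin> U i" "x \<notin> U j" "x \<notin> U k" "x \<notin> U l" using no by blast+
   hence "\<not> 0 < \<beta> x $ i" "\<not> 0 < \<beta> x $ j" "\<beta> x $ k = \<beta> x $ l"
    using xX pos d by (auto simp: U_def g_def)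
   hence z: "\<beta> x $ i = 0" "\<beta> x $ j = 0" "\<beta> x $ k = \<beta> x $ l"
    using simp_nonneg[OF beta_in[OF xX]] by (metis less_eq_real_def)+
   have "(\<Sum>a\<in>UNIV. \<beta> x $ a) = 1" using beta_in[OF xX] by (simp add: std_simplex_def)
   hence "\<beta> x $ i + (\<beta> x $ j + (\<beta> x $ k + \<beta> x $ l)) = 1" using d unfolding all by simp
   hence "\<beta> x $ k = 1/2" "\<beta> x $ l = 1/2" using z by auto
   hence "\<beta> x $ a = m $ a" if "a \<in> {i, j, k, l}" for a using z mc that by auto
   hence "\<beta> x $ a = m $ a" for a using all by blast
   hence bm: "\<beta> x = m" by (simp add: vec_eq_iff)
   have "tet x \<in> K"
   proof (rule ccontr)
    assume "tet x \<notin> K"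
    hence "x \<in> (\<Union>u\<in>V - K. tetra u)" using tet[OF xX] by blast
    thus False using x by (auto simp: N'_def N_def)
   qed
   hence "x = x0" using x0K[of "tet x"] in_tet[of "tet x" x] tet[OF xX] bm by simp
   thus False using x by blast
  qed
 qed
 have comp: "compatible Z2 (N' - {x0}) U P"
  unfolding compatible_def
 proof (intro conjI allI ballI impI)
  fix a b x u v assume x: "x \<in> (N' - {x0}) \<inter> U a \<inter> U b" and u: "u \<in> V" "x \<in> tetra u"
   and v: "v \<in> V" "x \<in> tetra v"
  have xX: "x \<in> topspace X" using x openin_subset[OF N'] by blast
  have pos: "0 < \<beta> x $ k" "0 < \<beta> x $ l" using x by (auto simp: N'_def)
  have key: "u \<in> ?V1 \<longleftrightarrow> v \<in> ?V1" if "c \<in> {i, j}" "x \<in> U c" for c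
  proof -
   have "0 < \<beta> x $ c" using that d by (auto simp: U_def g_def split: if_splits)
   hence sub: "{k, l, c} \<subseteq> supp (\<beta> x)" using pos by (auto simp: supp_def)
   have muv: "meet u v (supp (\<beta> x))" using sub by (intro common_meet[OF u(1) v(1) u(2) v(2)]) auto
   define e where "e = (if c = i then j else i)"
   have e: "e \<in> {i, j}" "distinct [k, l, c, e]" using that d by (auto simp: e_def)
   have "v = u \<or> v = \<alpha> e u" by (rule meet_triangle[OF e(2) u(1) v(1) muv sub])
   thus ?thesis using I.orb_step[of _ "{i, j}" u0 e] e(1) I.alpha_alpha[OF u(1), of e] by metis
  qed
  have "\<not> (a = k \<and> b = l)" "\<not> (a = l \<and> b = k)" using x d by (auto simp: U_def g_def)
  thus "P a u \<otimes>\<^bsub>Z2\<^esub> inv\<^bsub>Z2\<^esub> P b u = P a v \<otimes>\<^bsub>Z2\<^esub> inv\<^bsub>Z2\<^esub> P b v"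
   using key x all UNIV_I[of a] UNIV_I[of b] d unfolding P_def inv_Z2 Z2_simps(2) by (metis IntD1 IntD2 empty_iff insert_iff)
 qed simp
 obtain B S where BS: "openin X B" "x0 \<in> B" "B \<subseteq> N'"
   "!!a b u x. u \<in> V ==> x \<in> tetra u ==> x \<in> B - {x0} ==> x \<in> U a ==> x \<in> U b ==>
    S a x = (P a u \<otimes>\<^bsub>Z2\<^esub> inv\<^bsub>Z2\<^esub> P b u \<otimes>\<^bsub>Z2\<^esub> S b x)"
   "!!a C x y. connectedin X C ==> C \<subseteq> B - {x0} ==> C \<subseteq> U a ==> x \<in> C ==> y \<in> C ==> S a x = S a y"
  by (rule local_section[OF group_Z2 N' x0N' U cov comp]) blast
 obtain \<delta> where \<delta>: "\<delta> > 0" "!!u y. u \<in> K ==> y \<in> \<Delta> ==> dist m y < \<delta> ==> \<phi> u y \<in> B"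
  using phi_near[OF BS(1) m(1), of K] x0K BS(2) by (auto simp: K_def)
 have KV: "u \<in> V" if "u \<in> K" for u using that by (simp add: K_def)
 define e where "e = min (\<delta> / 8) (1/8)"
 have e: "0 < e" "e \<le> 1/8" "e \<le> \<delta> / 8" using \<delta>(1) by (auto simp: e_def)
 define Z where "Z = \<Delta> \<inter> ball m \<delta>"
 \<comment> \<open>For \<open>t = 0\<close> these points lie on the edge, for small \<open>t > 0\<close> in the triangle opposite to \<open>j\<close>.\<close>
 define q where "q s t = m + (s *\<^sub>R (axis k 1 - axis l 1) + t *\<^sub>R ((axis i 1 - axis k 1) + (axis i 1 - axis l 1)))" for s t
 have q: "q s t $ k = 1/2 + s - t" "q s t $ l = 1/2 - s - t" "q s t $ i = 2 * t" "q s t $ j = 0" for s t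
  using d mc by (auto simp: q_def axis_def)
 have qZ: "q s t \<in> Z" if "\<bar>s\<bar> \<le> e" "0 \<le> t" "t \<le> e" for s t
 proof -
  let ?v = "axis k 1 - axis l 1 :: real^'c" and ?w = "(axis i 1 - axis k 1) + (axis i 1 - axis l 1) :: real^'c"
  have n2: "norm (axis a 1 - axis b 1 :: real^'c) \<le> 2" for a b
   using norm_triangle_ineq4[of "axis a 1 :: real^'c" "axis b 1"] by simp
  have "norm ?w \<le> 2 + 2" by (intro order_trans[OF norm_triangle_ineq] add_mono n2)
  hence "\<bar>s\<bar> * norm ?v \<le> e * 2" "\<bar>t\<bar> * norm ?w \<le> e * 4" using that e n2 by (intro mult_mono; simp)+
  hence "norm (s *\<^sub>R ?v + t *\<^sub>R ?w) < \<delta>"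
   using norm_triangle_ineq[of "s *\<^sub>R ?v" "t *\<^sub>R ?w"] e unfolding norm_scaleR by linarith
  hence "dist m (q s t) < \<delta>" unfolding q_def by (metis add_diff_cancel_left' dist_norm norm_minus_commute)
  moreover have "0 \<le> q s t $ a" for a
  proof -
   have "a \<in> {i, j, k, l}" using all by blast
   thus ?thesis using that e by (auto simp: q)
  qed
  moreover have "(\<Sum>a\<in>UNIV. q s t $ a) = 1" using d unfolding all by (simp add: q)
  ultimately show ?thesis by (simp add: Z_def std_simplex_def)
 qed
 have const: "S a (\<phi> u y) = S a (\<phi> u z)" if u: "u \<in> K" and "y \<in> Z" "z \<in> Z" "g a y" "g a z" for a u y z
 proof (rule BS(5)[of "\<phi> u ` (Z \<inter> {y. g a y})"])
  have "a \<in> {i, j, k, l}" using all by blast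
  hence "\<not> g a m" by (auto simp: g_def mc)
  thus "\<phi> u ` (Z \<inter> {y. g a y}) \<subseteq> B - {x0}"
   using \<delta>(2)[OF u] beta_phi[OF KV[OF u]] bx0 by (fastforce simp: Z_def)
  show "\<phi> u ` (Z \<inter> {y. g a y}) \<subseteq> U a"
   using beta_phi[OF KV[OF u]] phi_topspace[OF KV[OF u]] by (auto simp: U_def Z_def)
  have "convex (Z \<inter> {y. g a y})" unfolding Z_def by (intro convex_Int convex_simp convex_ball g)
  thus "connectedin X (\<phi> u ` (Z \<inter> {y. g a y}))"
   by (rule phi_image_connected[OF KV[OF u]]) (auto simp: Z_def)
 qed (use that in auto)
 have main: "S k (\<phi> u0 (q e 0)) = (u \<in> ?V1) \<longleftrightarrow> \<not> S l (\<phi> u0 (q (-e) 0))" if u: "u \<in> K" for u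
 proof -
  have mu: "meet u u0 {k, l}" using u by (simp add: K_def meet_sym)
  have same: "\<phi> u (q s 0) = \<phi> u0 (q s 0)" if "\<bar>s\<bar> \<le> e" for s
  proof (rule meet_point[OF KV[OF u] uv(1) mu])
   show "q s 0 \<in> \<Delta>" using qZ[of s 0] that e by (simp add: Z_def)
   have "a \<in> {k, l}" if "q s 0 $ a \<noteq> 0" for a
    using that q(3,4)[of s 0] all by (metis UNIV_I insertE mult_zero_right insertI1 insert_commute empty_iff)
   thus "supp (q s 0) \<subseteq> {k, l}" by (auto simp: supp_def)
  qed simp
  have Z: "q e 0 \<in> Z" "q e (e/2) \<in> Z" "q (-e) 0 \<in> Z" "q (-e) (e/2) \<in> Z" by (intro qZ; use e in simp)+
  have gs: "g k (q e 0)" "g k (q e (e/2))" "g l (q (-e) 0)" "g l (q (-e) (e/2))" "g i (q e (e/2))" "g i (q (-e) (e/2))"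
   using e d by (auto simp: g_def q)
  have "S i (\<phi> u (q s (e/2))) = ((P i u \<noteq> P a u) \<noteq> S a (\<phi> u (q s (e/2))))"
   if "g a (q s (e/2))" "g i (q s (e/2))" "q s (e/2) \<in> Z" for a s
  proof -
   have y: "q s (e/2) \<in> \<Delta>" "dist m (q s (e/2)) < \<delta>" using that(3) by (simp_all add: Z_def)
   have "q s (e/2) \<noteq> m" using q(3)[of s "e/2"] mc(3) e(1) by auto
   hence "\<phi> u (q s (e/2)) \<in> B - {x0}" using \<delta>(2)[OF u y] beta_phi[OF KV[OF u] y(1)] bx0 by auto
   thus ?thesis using BS(4)[OF KV[OF u], of "\<phi> u (q s (e/2))" i a] that y beta_phi[OF KV[OF u] y(1)] phi_topspace[OF KV[OF u] y(1)]
    by (auto simp: U_def)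
  qed
  note this[OF gs(2,5) Z(2)] this[OF gs(4,6) Z(4)]
  moreover have "S k (\<phi> u (q e 0)) = S k (\<phi> u (q e (e/2)))" "S l (\<phi> u (q (-e) 0)) = S l (\<phi> u (q (-e) (e/2)))"
   "S i (\<phi> u (q e (e/2))) = S i (\<phi> u (q (-e) (e/2)))"
   by (rule const[OF u]; use Z gs in blast)+
  ultimately show ?thesis using same[of e] same[of "-e"] d e(1) by (auto simp: P_def)
 qed
 have "u0 \<in> K" "v0 \<in> K" using uv by (simp_all add: K_def meet_refl)
 thus False using main[of u0] main[of v0] no I.orb_refl by auto
qed

end

context colored_involutions begin

lemma orb_mono: "D \<subseteq> D' ==> orb D u \<subseteq> orb D' u"
 unfolding orb_def by blast

text \<open>Each vertex lies on only one face of the given colours, so the potentials of the faces combine.\<close>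
lemma trivial_on_orbits:
 fixes G (structure)
 assumes "!!u. u \<in> V ==> trivial_on G h (face D u)"
 obtains F where "!!u. u \<in> V ==> F u \<in> carrier G"
  "!!c u. c \<in> D ==> u \<in> V ==> h c u = inv (F u) \<otimes> F (\<alpha> c u)"
proof -
 have ex: "\<forall>a\<in>face D ` V. \<exists>F. F \<in> V \<rightarrow> carrier G \<and> (\<forall>(c, x)\<in>a. h c x = inv (F x) \<otimes> F (\<alpha> c x))"
  using assms unfolding trivial_on_def by blast
 from bchoice[OF ex] obtain F where
  F0: "\<forall>a\<in>face D ` V. F a \<in> V \<rightarrow> carrier G \<and> (\<forall>(c, x)\<in>a. h c x = inv (F a x) \<otimes> F a (\<alpha> c x))" ..
 have F: "F (face D u) \<in> V \<rightarrow> carrier G"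
  "(c, x) \<in> face D u ==> h c x = inv (F (face D u) x) \<otimes> F (face D u) (\<alpha> c x)" if "u \<in> V" for u c x
  using bspec[OF F0 imageI[OF that]] by auto
 show ?thesis
 proof (rule that[of "\<lambda>u. F (face D u) u"])
  show "F (face D u) u \<in> carrier G" if "u \<in> V" for u using F(1)[OF that] that by auto
  show "h c u = inv (F (face D u) u) \<otimes> F (face D (\<alpha> c u)) (\<alpha> c u)" if "c \<in> D" "u \<in> V" for c u
  proof -
   have "face D (\<alpha> c u) = face D u" using that by (intro face_eq_orb orb_step orb_refl)
   moreover have "(c, u) \<in> face D u" using that orb_refl by (simp add: face_def)
   ultimately show ?thesis using F(2)[OF that(2)] by simp
  qed
 qed
qed

end

context tetrahedra begin

lemma other_colors:
 fixes k a :: 'c assumes "k \<noteq> a"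
 obtains i j where "distinct [i, j, k, a]"
proof -
 have "card (UNIV - {k, a}) = 2" using assms card4 by (simp add: card_Diff_subset)
 then obtain i j where "UNIV - {k, a} = {i, j}" "i \<noteq> j" by (auto simp: card_2_iff)
 thus ?thesis using that[of i j] assms by auto
qed

definition vert :: "'c => 'x" where
 "vert k = \<phi> (SOME u. u \<in> V) (axis k 1)"

lemma vert: "u \<in> V ==> \<phi> u (axis k 1) = vert k"
 unfolding vert_def by (rule common_vertices) (auto intro: someI)

text \<open>The open star of the vertex with label \<open>k\<close>.\<close>
definition star :: "'c => 'x set" where
 "star k = {x \<in> topspace X. 0 < \<beta> x $ k}"

lemma star_open: "openin X (star k)"
 unfolding star_def by (rule beta_pos_open)

lemma vert_star: "u \<in> V ==> vert k \<in> star k"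
 using beta_phi[of u "axis k 1"] phi_topspace[of u "axis k 1"] axis_simp[of k] vert[of u k]
 by (auto simp: star_def)

lemma star_not_vert:
 assumes "x \<in> star k" "x \<noteq> vert k"
 obtains a where "a \<noteq> k" "x \<in> star a"
proof -
 have x: "x \<in> topspace X" using assms by (simp add: star_def)
 have "\<not> supp (\<beta> x) \<subseteq> {k}"
 proof
  assume "supp (\<beta> x) \<subseteq> {k}"
  hence "\<beta> x = axis k 1" by (rule simp_eq_axis[OF beta_in[OF x]])
  hence "x = vert k" using in_tet[of "tet x" x] tet[OF x] vert[of "tet x" k] by simp
  thus False using assms by simp
 qed
 then obtain a where "a \<noteq> k" "a \<in> supp (\<beta> x)" by blast
 thus ?thesis using that x supp_pos[OF beta_in[OF x]] by (auto simp: star_def)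
qed

lemma vertex_near:
 assumes "openin X B" "vert k \<in> B"
 obtains \<delta> where "\<delta> > 0" "!!u y. u \<in> V ==> y \<in> \<Delta> ==> dist (axis k 1) y < \<delta> ==> \<phi> u y \<in> B"
proof -
 have "\<exists>d>0. \<forall>u\<in>V. \<forall>y\<in>\<Delta>. dist (axis k 1) y < d --> \<phi> u y \<in> B"
  by (rule phi_near[OF assms(1)]) (auto simp: axis_simp vert assms(2))
 thus ?thesis using that by blast
qed

lemma near_vertex_point:
 fixes k :: 'c
 assumes "\<delta> > 0"
 obtains e where "0 < e" "e < 1" "!!y. y \<in> \<Delta> ==> dist (axis k 1) ((1 - e) *\<^sub>R axis k 1 + e *\<^sub>R y) < \<delta>"
proof -
 obtain b where b: "b > 0" "!!y. y \<in> (\<Delta> :: (real^'c) set) ==> norm y \<le> b"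
  using compact_imp_bounded[OF compact_simp] by (auto simp: bounded_pos)
 define e where "e = min (1/2) (\<delta> / (2 * (b + b)))"
 have e: "0 < e" "e < 1" using assms b by (auto simp: e_def)
 have "dist (axis k 1) ((1 - e) *\<^sub>R axis k 1 + e *\<^sub>R y) < \<delta>" if y: "y \<in> \<Delta>" for y :: "real^'c"
 proof -
  have "axis k 1 - ((1 - e) *\<^sub>R axis k 1 + e *\<^sub>R y) = e *\<^sub>R (axis k 1 - y)" by (simp add: algebra_simps)
  hence "dist (axis k 1) ((1 - e) *\<^sub>R axis k 1 + e *\<^sub>R y) = e * norm (axis k 1 - y)"
   using e by (simp add: dist_norm)
  also have "\<dots> \<le> e * (b + b)"
   using e b(2)[OF y] b(2)[OF axis_simp, of k] norm_triangle_ineq4[of "axis k 1" y] by (intro mult_left_mono) auto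
  also have "\<dots> \<le> \<delta> / (2 * (b + b)) * (b + b)" using b by (intro mult_right_mono) (auto simp: e_def)
  also have "\<dots> < \<delta>" using assms b by simp
  finally show ?thesis .
 qed
 thus ?thesis using that e by blast
qed

text \<open>A punctured ball is connected. Tetrahedra that share a point of it share an edge at the vertex \<open>k\<close> and hence lie in one
 orbit by \<open>edge_link_connected\<close>, so several orbits would disconnect the ball.\<close>
lemma vertex_link_connected:
 assumes u: "u \<in> V"
 shows "I.orb (- {k}) u = V"
proof (rule ccontr)
 let ?V1 = "I.orb (- {k}) u"
 assume "?V1 \<noteq> V"
 then obtain v where v: "v \<in> V" "v \<notin> ?V1" using I.orb_subset[OF u] by blast
 let ?x0 = "vert k"
 have "compatible Z2 (star k - {?x0}) (\<lambda>_::unit. star k) (\<lambda>_ _. False)"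
  by (auto simp: compatible_def)
 then obtain B S where B: "openin X B" "?x0 \<in> B" "B \<subseteq> star k" "connectedin X (B - {?x0})"
  by (rule local_section[OF group_Z2 star_open vert_star[OF u], of "\<lambda>_::unit. star k", rotated 2])
   (auto simp: star_open)
 define E where "E W = (\<Union>w\<in>W. tetra w)" for W
 have clE: "closedin X (E W)" if "W \<subseteq> V" for W
  unfolding E_def using that by (rule tets_closed)
 have BX: "B \<subseteq> topspace X" using B(1) by (rule openin_subset)
 obtain \<delta> where \<delta>: "\<delta> > 0" "!!u y. u \<in> V ==> y \<in> \<Delta> ==> dist (axis k 1) y < \<delta> ==> \<phi> u y \<in> B"
  using vertex_near[OF B(1,2)] by blast
 obtain e where e: "0 < e" "e < 1" "!!y. y \<in> \<Delta> ==> dist (axis k 1) ((1 - e) *\<^sub>R axis k 1 + e *\<^sub>R y) < \<delta>"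
  using near_vertex_point[OF \<delta>(1), of k] by blast
 define q where "q = (1 - e) *\<^sub>R axis k 1 + e *\<^sub>R (bary UNIV :: real^'c)"
 have bU: "bary UNIV \<in> \<Delta>" "supp (bary UNIV :: real^'c) = UNIV" by (rule bary_simp supp_bary; simp)+
 have q: "q \<in> \<Delta>" "supp q = UNIV"
  using convexD_alt[OF convex_simp axis_simp[of k] bU(1), of e] supp_combination[OF axis_simp[of k] bU(1), of e] e bU(2)
  by (auto simp: q_def)
 have qB: "\<phi> w q \<in> B - {?x0}" if "w \<in> V" for w
 proof -
  have "\<phi> w q \<in> B" using \<delta>(2)[OF that q(1)] e(3)[OF bU(1)] by (simp add: q_def)
  moreover have "\<phi> w q \<noteq> ?x0"
  proof
   assume "\<phi> w q = ?x0"
   hence "q = axis k 1" using beta_phi[OF that q(1)] beta_phi[OF that axis_simp[of k]] vert[OF that, of k] by simp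
   hence "supp q = {k}" using supp_bary[of "{k}"] by (simp add: bary_sing)
   thus False using q(2) facet_nonempty[of k] by auto
  qed
  ultimately show ?thesis by blast
 qed
 have V1: "?V1 \<subseteq> V" using I.orb_subset[OF u] .
 have "E ?V1 \<inter> E (V - ?V1) \<inter> (B - {?x0}) = {}"
 proof (rule ccontr)
  assume "E ?V1 \<inter> E (V - ?V1) \<inter> (B - {?x0}) \<noteq> {}"
  then obtain x w1 w2 where x: "x \<in> B" "x \<noteq> ?x0" and w: "w1 \<in> ?V1" "w2 \<in> V" "w2 \<notin> ?V1"
   "x \<in> tetra w1" "x \<in> tetra w2" by (auto simp: E_def)
  have "x \<in> star k" using x B(3) by blast
  then obtain a where a: "a \<noteq> k" "x \<in> star a" using star_not_vert x(2) by blast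
  obtain i j where ij: "distinct [i, j, k, a]" using other_colors[of k a] a by metis
  have w1: "w1 \<in> V" using w V1 by blast
  have "meet w1 w2 {k, a}"
   using \<open>x \<in> star k\<close> a(2) by (intro common_meet[OF w1 w(2,4,5)]) (auto simp: supp_def star_def)
  hence "w2 \<in> I.orb {i, j} w1" by (rule edge_link_connected[OF ij w1 w(2)])
  hence "w2 \<in> I.orb (- {k}) w1" using I.orb_mono[of "{i, j}" "- {k}" w1] ij by auto
  thus False using w I.orb_trans by blast
 qed
 moreover have "B - {?x0} \<subseteq> E ?V1 \<union> E (V - ?V1)"
 proof
  fix x assume "x \<in> B - {?x0}"
  hence "x \<in> topspace X" using BX by blast
  thus "x \<in> E ?V1 \<union> E (V - ?V1)" using tet[of x] by (auto simp: E_def)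
 qed
 moreover have "\<phi> u q \<in> E ?V1 \<inter> (B - {?x0})" "\<phi> v q \<in> E (V - ?V1) \<inter> (B - {?x0})"
  using qB[OF u] qB[OF v(1)] v q(1) I.orb_refl[of u] by (auto simp: E_def)
 ultimately show False
  using B(4) clE[OF V1] clE[of "V - ?V1"] unfolding connectedin_closedin by blast
qed

text \<open>The first cohomology of the link with coefficients in \<open>\<int>/2\<close> vanishes. The 2-cells of the link belong to the edges at
 the vertex, and the potentials \<open>P a\<close> of \<open>h\<close> on them define a cocycle over the stars of the other vertices. A section over the punctured
 ball corrects them to a common potential.\<close>
lemma vertex_link_pure:
 assumes ne: "V \<noteq> {}"
 shows "I.pure Z2 ((- {k}) \<times> V) (I.faces (- {k}))"
 unfolding I.pure_def
proof (intro allI impI)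
 fix h assume h: "I.connection Z2 h \<and> (\<forall>a\<in>I.faces (- {k}). I.trivial_on Z2 h a)"
 obtain u0 where u0: "u0 \<in> V" using ne by blast
 let ?x0 = "vert k"
 have ex: "\<exists>F :: 'v => bool. \<forall>c u. c \<in> - {k} - {a} --> u \<in> V --> h c u = (F u \<noteq> F (\<alpha> c u))" if a: "a \<noteq> k" for a
 proof -
  have triv: "I.trivial_on Z2 h (I.face (- {k} - {a}) u)" if "u \<in> V" for u
   using h a that unfolding I.faces_def by blast
  obtain F :: "'v => bool" where "!!c u. c \<in> - {k} - {a} ==> u \<in> V ==> h c u = (F u \<noteq> F (\<alpha> c u))"
   by (rule I.trivial_on_orbits[OF triv]) auto
  thus ?thesis by blast
 qed
 then obtain P :: "'c => 'v => bool"
  where P: "!!a c u. a \<noteq> k ==> c \<noteq> k ==> c \<noteq> a ==> u \<in> V ==> h c u = (P a u \<noteq> P a (\<alpha> c u))"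
  by (metis (no_types, lifting) ComplI DiffI singletonD)
 define U where "U a = (if a = k then {} else star k \<inter> star a)" for a
 have U: "openin X (U a)" for a unfolding U_def using star_open by (auto intro: openin_Int)
 have cov: "star k - {?x0} \<subseteq> (\<Union>a. U a)"
 proof
  fix x assume "x \<in> star k - {?x0}"
  thus "x \<in> (\<Union>a. U a)" using star_not_vert[of x k] by (auto simp: U_def)
 qed
 have comp: "compatible Z2 (star k - {?x0}) U P"
  unfolding compatible_def
 proof (intro conjI allI ballI impI)
  fix a b x u v assume x: "x \<in> (star k - {?x0}) \<inter> U a \<inter> U b" and u: "u \<in> V" "x \<in> tetra u"
   and v: "v \<in> V" "x \<in> tetra v"
  have ab: "a \<noteq> k" "b \<noteq> k" "x \<in> star k" "x \<in> star a" "x \<in> star b" using x by (auto simp: U_def split: if_splits)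
  have "(P a u \<noteq> P b u) = (P a v \<noteq> P b v)"
  proof (cases "a = b")
   case False
   obtain c where c: "distinct [c, a, k, b]"
   proof -
    have "card (UNIV - {a, k, b}) = 1" using False ab card4 by (simp add: card_Diff_subset)
    then obtain c where "UNIV - {a, k, b} = {c}" by (auto simp: card_1_singleton_iff)
    thus ?thesis using that[of c] False ab by auto
   qed
   have sub: "{k, a, b} \<subseteq> supp (\<beta> x)" using ab by (auto simp: supp_def star_def)
   have "meet u v (supp (\<beta> x))" using sub by (intro common_meet[OF u(1) v(1) u(2) v(2)]) auto
   hence "v = u \<or> v = \<alpha> c u" using sub c by (intro meet_triangle[of k a b c u v]) (auto simp: u v)
   thus ?thesis using P[of a c u] P[of b c u] c ab u by auto
  qed simp
  thus "P a u \<otimes>\<^bsub>Z2\<^esub> inv\<^bsub>Z2\<^esub> P b u = P a v \<otimes>\<^bsub>Z2\<^esub> inv\<^bsub>Z2\<^esub> P b v" by simp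
 qed simp
 obtain B S where BS: "openin X B" "?x0 \<in> B" "B \<subseteq> star k"
   "!!a b u x. u \<in> V ==> x \<in> tetra u ==> x \<in> B - {?x0} ==> x \<in> U a ==> x \<in> U b ==>
    S a x = (P a u \<otimes>\<^bsub>Z2\<^esub> inv\<^bsub>Z2\<^esub> P b u \<otimes>\<^bsub>Z2\<^esub> S b x)"
   "!!a C x y. connectedin X C ==> C \<subseteq> B - {?x0} ==> C \<subseteq> U a ==> x \<in> C ==> y \<in> C ==> S a x = S a y"
  by (rule local_section[OF group_Z2 star_open vert_star[OF u0] U cov comp]) blast
 obtain \<delta> where \<delta>: "\<delta> > 0" "!!u y. u \<in> V ==> y \<in> \<Delta> ==> dist (axis k 1) y < \<delta> ==> \<phi> u y \<in> B"
  using vertex_near[OF BS(1,2)] by blast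
 obtain e where e: "0 < e" "e < 1" "!!y. y \<in> \<Delta> ==> dist (axis k 1) ((1 - e) *\<^sub>R axis k 1 + e *\<^sub>R y) < \<delta>"
  using near_vertex_point[OF \<delta>(1), of k] by blast
 define qq where "qq A = (1 - e) *\<^sub>R axis k 1 + e *\<^sub>R (bary A :: real^'c)" for A
 have qq: "qq A \<in> \<Delta>" "supp (qq A) = insert k A" "dist (axis k 1) (qq A) < \<delta>" if "A \<noteq> {}" for A
  using convexD_alt[OF convex_simp axis_simp[of k] bary_simp[OF that], of e] e(1,2)
   supp_combination[OF axis_simp[of k] bary_simp[OF that] e(1,2)] supp_bary[OF that] supp_bary[of "{k}"]
   e(3)[OF bary_simp[OF that]] by (auto simp: qq_def bary_sing)
 define xx where "xx u = \<phi> u (qq UNIV)" for u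
 define Z where "Z a = {y \<in> \<Delta>. dist (axis k 1) y < \<delta> \<and> 0 < y $ a \<and> 0 < y $ k}" for a
 have Z: "convex (Z a)" "Z a \<subseteq> \<Delta>" for a
 proof -
  have half: "convex {y::real^'c. 0 < y $ a}" for a
   using convex_halfspace_gt[of 0 "axis a 1 :: real^'c"] by (simp add: inner_axis' inner_axis)
  have "Z a = \<Delta> \<inter> ball (axis k 1) \<delta> \<inter> ({y. 0 < y $ a} \<inter> {y. 0 < y $ k})" by (auto simp: Z_def)
  thus "convex (Z a)" using half by (simp add: convex_Int convex_simp)
 qed (auto simp: Z_def)
 have qZ: "qq A \<in> Z a" if "a \<in> A" for a A
 proof -
  have A: "A \<noteq> {}" using that by blast
  have "0 < qq A $ a" "0 < qq A $ k" using supp_pos[OF qq(1)[OF A]] qq(2)[OF A] that by auto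
  thus ?thesis using qq[OF A] by (simp add: Z_def)
 qed
 have phiZ: "\<phi> u ` Z a \<subseteq> B - {?x0}" "\<phi> u ` Z a \<subseteq> U a" if "u \<in> V" "a \<noteq> k" for u a
 proof -
  have key: "\<phi> u y \<in> B - {?x0} \<and> \<phi> u y \<in> U a" if y: "y \<in> Z a" for y
  proof -
   have ys: "y \<in> \<Delta>" "0 < y $ a" "0 < y $ k" "dist (axis k 1) y < \<delta>" using y by (auto simp: Z_def)
   have "\<phi> u y \<noteq> ?x0"
   proof
    assume "\<phi> u y = ?x0"
    hence "y = axis k 1" using beta_phi[OF \<open>u \<in> V\<close>] ys(1) axis_simp[of k] vert[OF \<open>u \<in> V\<close>, of k] by metis
    thus False using ys(2) \<open>a \<noteq> k\<close> by (simp add: axis_def)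
   qed
   moreover have "\<phi> u y \<in> B" by (rule \<delta>(2)[OF \<open>u \<in> V\<close> ys(1,4)])
   moreover have "\<phi> u y \<in> U a"
    using ys beta_phi[OF \<open>u \<in> V\<close> ys(1)] phi_topspace[OF \<open>u \<in> V\<close> ys(1)] \<open>a \<noteq> k\<close> by (simp add: U_def star_def)
   ultimately show ?thesis by blast
  qed
  show "\<phi> u ` Z a \<subseteq> B - {?x0}" by (rule image_subsetI) (rule conjunct1[OF key])
  show "\<phi> u ` Z a \<subseteq> U a" by (rule image_subsetI) (rule conjunct2[OF key])
 qed
 have Sconst: "S a (\<phi> u y) = S a (\<phi> u z)" if "u \<in> V" "a \<noteq> k" "y \<in> Z a" "z \<in> Z a" for u a y z
  using BS(5)[OF phi_image_connected[OF that(1) Z] phiZ[OF that(1,2)]] that by blast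
 obtain a0 where a0: "a0 \<noteq> k" using facet_nonempty[of k] by blast
 define F where "F u = (S a0 (xx u) \<noteq> P a0 u)" for u
 have F: "F u = (S a (xx u) \<noteq> P a u)" if "u \<in> V" "a \<noteq> k" for u a
 proof -
  have xxZ: "xx u \<in> \<phi> u ` Z b" for b unfolding xx_def by (rule imageI[OF qZ[OF UNIV_I]])
  note xxu = subsetD[OF phiZ(1)[OF that] xxZ] subsetD[OF phiZ(2)[OF that] xxZ] subsetD[OF phiZ(2)[OF that(1) a0] xxZ]
  have "xx u \<in> tetra u" unfolding xx_def using qq(1)[of UNIV] by simp
  hence "S a (xx u) = ((P a u \<noteq> P a0 u) \<noteq> S a0 (xx u))"
   using BS(4)[OF that(1) _ xxu] by simp
  thus ?thesis unfolding F_def by auto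
 qed
 have "h c u = (F u \<noteq> F (\<alpha> c u))" if "c \<noteq> k" "u \<in> V" for c u
 proof -
  have "k \<noteq> c" using that by blast
  then obtain a b where ab: "distinct [a, b, k, c]" using other_colors[of k c] \<open>c \<noteq> k\<close> by metis
  have v: "\<alpha> c u \<in> V" "meet u (\<alpha> c u) (- {c})" using alpha_props[OF that(2)] by auto
  have aZ: "qq (- {c}) \<in> Z a" "qq UNIV \<in> Z a" using qZ ab by auto
  have "\<phi> u (qq (- {c})) = \<phi> (\<alpha> c u) (qq (- {c}))"
   using qq(1,2)[OF facet_nonempty[of c]] that(1) by (intro meet_point[OF that(2) v facet_nonempty]) auto
  hence "S a (xx u) = S a (xx (\<alpha> c u))"
   using Sconst[OF that(2) _ aZ, of ] Sconst[OF v(1) _ aZ] ab unfolding xx_def by auto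
  thus ?thesis using F[OF that(2), of a] F[OF v(1), of a] P[of a c u] ab that by auto
 qed
 thus "I.trivial_on Z2 h ((- {k}) \<times> V)"
  unfolding I.trivial_on_def by (intro exI[of _ F]) auto
qed

lemma link_sphere:
 fixes G (structure)
 assumes ne: "V \<noteq> {}" and G: "group G" and f: "f \<in> I.faces (- {k})"
 shows "2 * card (I.faces (- {k})) = card V + 4" "I.pure G ((- {k}) \<times> V) (I.faces (- {k}) - {f})"
 using I.sphere_faces[OF three_others vertex_link_connected ne vertex_link_pure[OF ne] G f] by auto

text \<open>The Euler characteristic of the link of the vertex \<open>k\<close>.\<close>
lemma count_link:
 assumes ne: "V \<noteq> {}" and d: "distinct [i, j, l, k]"
 shows "2 * (card (I.orbs {i, j}) + card (I.orbs {i, l}) + card (I.orbs {j, l})) = card V + 4"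
proof -
 have T: "- {k} = {i, j, l}" using exhaust4[OF d] d by auto
 obtain u where u: "u \<in> V" using ne by blast
 have "I.face (- {k} - {i}) u \<in> I.faces (- {k})" using u d by (auto simp: I.faces_def)
 from link_sphere(1)[OF ne group_Z2 this]
 have "2 * (\<Sum>c\<in>{i, j, l}. card (I.orbs ({i, j, l} - {c}))) = card V + 4"
  using I.card_faces[OF three_others[of k]] unfolding T by simp
 moreover have "{i, j, l} - {i} = {j, l}" "{i, j, l} - {j} = {i, l}" "{i, j, l} - {l} = {i, j}" using d by auto
 ultimately show ?thesis using d by (simp add: insert_commute)
qed

text \<open>The equations of \<open>count_link\<close> for the four vertices are linear in the six numbers of cycles.\<close>
lemma opposite_orbs:
 assumes ne: "V \<noteq> {}" and d: "distinct [i, j, k, l]"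
 shows "card (I.orbs {i, j}) = card (I.orbs {k, l})"
 using count_link[OF ne, of i j k l] count_link[OF ne, of i j l k] count_link[OF ne, of i k l j] count_link[OF ne, of j k l i] d
 by (auto simp: insert_commute)

text \<open>The smallest of the three numbers in one link is at most their mean.\<close>
lemma small_pair:
 assumes ne: "V \<noteq> {}"
 obtains i j k l where "distinct [i, j, k, l]" "6 * card (I.orbs {i, j}) \<le> card V + 4"
proof -
 obtain k :: 'c where True by simp
 have "card (- {k}) = 3" by (rule three_others)
 then obtain i j l where T: "- {k} = {i, j, l}" "distinct [i, j, l]" by (auto simp: card_3_iff)
 hence d: "distinct [i, j, l, k]" by auto
 have "6 * card (I.orbs {i, j}) \<le> card V + 4 \<or> 6 * card (I.orbs {i, l}) \<le> card V + 4 \<or> 6 * card (I.orbs {j, l}) \<le> card V + 4"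
  by (rule ccontr) (use count_link[OF ne d] in simp)
 moreover have "distinct [i, j, l, k]" "distinct [i, l, j, k]" "distinct [j, l, i, k]" using d by auto
 ultimately show ?thesis by (elim disjE) (rule that; assumption)+
qed

end

section \<open>Spokes and rays\<close>

context tetrahedra begin

lemma star_supp: "x \<in> star a \<longleftrightarrow> x \<in> topspace X \<and> a \<in> supp (\<beta> x)"
 using supp_pos[OF beta_in] by (auto simp: star_def)

lemma star_cover: "topspace X \<subseteq> (\<Union>a. star a)"
 using supp_nonempty[OF beta_in] by (fastforce simp: star_supp)

lemma global_cocycle:
 fixes G (structure)
 assumes G: "group G" and f: "!!a u. u \<in> V ==> f a u \<in> carrier G"
  and inv: "!!a b u v. u \<in> V ==> v \<in> V ==> meet u v {a, b} ==> f a u \<otimes> inv (f b u) = f a v \<otimes> inv (f b v)"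
 shows "cocycle G X star (\<lambda>a b x. f a (tet x) \<otimes> inv (f b (tet x)))"
  and "!!x a b u. u \<in> V ==> x \<in> tetra u ==> x \<in> star a ==> x \<in> star b ==>
   f a (tet x) \<otimes> inv (f b (tet x)) = f a u \<otimes> inv (f b u)"
proof -
 have comp: "compatible G (topspace X) star f"
  unfolding compatible_def
 proof (intro conjI allI ballI impI)
  show "f a u \<in> carrier G" if "u \<in> V" for a u using f that .
  show "f a u \<otimes> inv f b u = f a v \<otimes> inv f b v"
   if "x \<in> topspace X \<inter> star a \<inter> star b" "u \<in> V" "v \<in> V" "x \<in> tetra u" "x \<in> tetra v"
   for a b x u v
   using that by (intro inv common_meet[of u v x]) (auto simp: star_supp)
 qed
 show "cocycle G X star (\<lambda>a b x. f a (tet x) \<otimes> inv (f b (tet x)))"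
  using potential_cocycle[OF G openin_topspace star_open star_cover comp] by simp
 show "f a (tet x) \<otimes> inv (f b (tet x)) = f a u \<otimes> inv (f b u)"
  if "u \<in> V" "x \<in> tetra u" "x \<in> star a" "x \<in> star b" for x a b u
  using that by (intro transition_at[OF openin_topspace comp]) (auto simp: star_def)
qed

definition cone_point :: "'c => 'x => real => real^'c" where
 "cone_point a x s = (1 - s) *\<^sub>R axis a 1 + s *\<^sub>R \<beta> x"

text \<open>The segment from the vertex \<open>a\<close> to \<open>x\<close>.\<close>
definition spoke :: "'c => 'x => real => 'x" where
 "spoke a x s = \<phi> (tet x) (cone_point a x s)"

lemma cone_point_simp: "x \<in> topspace X ==> s \<in> {0..1} ==> cone_point a x s \<in> \<Delta>"
 unfolding cone_point_def using convexD_alt[OF convex_simp axis_simp[of a] beta_in[of x], of s] by auto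

lemma spoke_at:
 assumes x: "x \<in> star a" and u: "u \<in> V" "x \<in> tetra u" and s: "s \<in> {0..1}"
 shows "spoke a x s = \<phi> u (cone_point a x s)"
proof -
 have xX: "x \<in> topspace X" and a: "a \<in> supp (\<beta> x)" using x by (auto simp: star_supp)
 have t: "tet x \<in> V" "x \<in> tetra (tet x)" using tet[OF xX] by auto
 have ne: "supp (\<beta> x) \<noteq> {}" using a by blast
 have m: "meet (tet x) u (supp (\<beta> x))" by (rule common_meet[OF t(1) u(1) t(2) u(2) subset_refl ne])
 have "supp (cone_point a x s) \<subseteq> supp (\<beta> x)"
  using a by (auto simp: cone_point_def supp_def axis_def)
 thus ?thesis unfolding spoke_def
  by (intro meet_point[OF t(1) u(1) m ne cone_point_simp[OF xX s]])
qed

lemma spoke_0: "x \<in> topspace X ==> spoke a x 0 = vert a"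
 using tet[of x] vert[of "tet x" a] by (simp add: spoke_def cone_point_def)

lemma spoke_1: "x \<in> topspace X ==> spoke a x 1 = x"
 using tet[of x] in_tet[of "tet x" x] by (simp add: spoke_def cone_point_def)

lemma spoke_square_continuous:
 assumes g: "pathin X g" and a: "!!t. t \<in> {0..1} ==> g t \<in> star a"
 shows "continuous_map unit_square X (\<lambda>(s, t). spoke a (g t) s)"
proof -
 let ?Q = "unit_square"
 have gs: "continuous_map ?Q X (\<lambda>p. g (snd p))"
  by (rule continuous_map_compose[unfolded comp_def, OF _ g[unfolded pathin_def]])
   (auto simp: continuous_map_into intro!: continuous_intros)
 have bgs: "continuous_map ?Q euclidean (\<lambda>p. \<beta> (g (snd p)))"
  using continuous_map_compose[OF gs beta_cont] by (simp add: comp_def)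
 define C where "C u = {p \<in> topspace ?Q. g (snd p) \<in> tetra u}" for u
 show ?thesis
 proof (rule pasting_lemma_closed[OF finV])
  show "closedin ?Q (C u)" if "u \<in> V" for u
   unfolding C_def by (rule closedin_continuous_map_preimage[OF gs phi_closed[OF that]])
  show "continuous_map (subtopology ?Q (C u)) X (\<lambda>p. \<phi> u (cone_point a (g (snd p)) (fst p)))" if u: "u \<in> V" for u
  proof (rule continuous_map_compose[unfolded comp_def, OF _ phi_cont[OF u]])
   have "continuous_on ({0..1::real} \<times> {0..1::real}) (\<lambda>p. \<beta> (g (snd p)))" using bgs by simp
   hence "continuous_on ({0..1::real} \<times> {0..1::real}) (\<lambda>p. cone_point a (g (snd p)) (fst p))"
    unfolding cone_point_def by (intro continuous_intros)
   hence "continuous_map (subtopology ?Q (C u)) euclidean (\<lambda>p. cone_point a (g (snd p)) (fst p))"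
    using continuous_map_from_subtopology[of ?Q euclidean] by simp
   moreover have "cone_point a (g (snd p)) (fst p) \<in> \<Delta>" if "p \<in> C u" for p
   proof (rule cone_point_simp)
    show "g (snd p) \<in> topspace X" using that phi_topspace[OF u] by (auto simp: C_def)
   qed (use that in \<open>auto simp: C_def\<close>)
   ultimately show "continuous_map (subtopology ?Q (C u)) (top_of_set \<Delta>) (\<lambda>p. cone_point a (g (snd p)) (fst p))"
    by (auto simp: continuous_map_into)
  qed
  show "\<phi> u (cone_point a (g (snd p)) (fst p)) = \<phi> v (cone_point a (g (snd p)) (fst p))"
   if "u \<in> V" "v \<in> V" "p \<in> topspace ?Q \<inter> C u \<inter> C v" for u v p
   using spoke_at[of "g (snd p)" a u "fst p"] spoke_at[of "g (snd p)" a v "fst p"] a[of "snd p"] that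
   by (auto simp: C_def)
  show "\<exists>u. u \<in> V \<and> p \<in> C u \<and> (case p of (s, t) => spoke a (g t) s) = \<phi> u (cone_point a (g (snd p)) (fst p))"
   if p: "p \<in> topspace ?Q" for p
  proof -
   have "g (snd p) \<in> topspace X" using a[of "snd p"] p by (auto simp: star_def)
   thus ?thesis using tet[of "g (snd p)"] p
    by (intro exI[of _ "tet (g (snd p))"]) (auto simp: C_def spoke_def case_prod_unfold)
  qed
 qed
qed

lemma spoke_path:
 assumes "x \<in> star a"
 shows "joins X (vert a) x (spoke a x)"
proof -
 have x: "x \<in> topspace X" using assms by (simp add: star_def)
 have "continuous_map unit_square X (\<lambda>(s, t::real). spoke a x s)"
  using spoke_square_continuous[of "\<lambda>_. x" a] assms x by (simp add: pathin_def)
 moreover have "continuous_map \<I> unit_square (\<lambda>s::real. (s, 0::real))"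
  by (auto simp: continuous_map_into intro!: continuous_intros)
 ultimately have "continuous_map \<I> X (spoke a x)"
  using continuous_map_compose[of "\<I>" "unit_square" "\<lambda>s::real. (s, 0::real)" X "\<lambda>(s, t::real). spoke a x s"]
  by (simp add: comp_def)
 thus ?thesis using spoke_0[OF x] spoke_1[OF x] by (simp add: joins_def pathin_def)
qed

lemma spoke_move:
 assumes g: "joins X x y g" and a: "!!t. t \<in> {0..1} ==> g t \<in> star a"
 shows "path_homotopic X (vert a) y (concat_path (spoke a x) g) (spoke a y)"
proof -
 let ?Q = "\<lambda>(s, t). spoke a (g t) s"
 let ?f = "\<lambda>r::real. (min (2 * r) 1, max (2 * r - 1) 0)" and ?h = "\<lambda>r::real. (max (2 * r - 1) 0, min (2 * r) 1)"
 have ends: "g 0 = x" "g 1 = y" and p: "pathin X g" using g by (auto simp: joins_def)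
 have gX: "g t \<in> topspace X" if "t \<in> {0..1}" for t using a[OF that] by (simp add: star_def)
 have xy: "x \<in> star a" "y \<in> star a" using a[of 0] a[of 1] ends by auto
 have "path_homotopic X (vert a) y (\<lambda>r. ?Q (?f r)) (\<lambda>r. ?Q (?h r))"
 proof (rule homotopic_in_convex[OF spoke_square_continuous[OF p a]])
  show "convex ({0..1} \<times> {0..1} :: (real \<times> real) set)" by (intro convex_Times) auto
  show "continuous_on {0..1} ?f" "continuous_on {0..1} ?h" by (intro continuous_intros)+
  show "?Q (?f 0) = vert a" "?Q (?f 1) = y" using spoke_0[OF gX[of 0]] spoke_1[OF gX[of 1]] ends by auto
 qed auto
 moreover have "concat_path (spoke a x) g r = ?Q (?f r)" if "r \<in> {0..1}" for r
  using that spoke_1[OF gX[of "2 * r - 1"]] ends by (cases "r \<le> 1/2") (auto simp: concat_path_def min_def max_def)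
 moreover have "concat_path (\<lambda>_. vert a) (spoke a y) r = ?Q (?h r)" if "r \<in> {0..1}" for r
  using that spoke_0[OF gX[of "2 * r"]] ends by (cases "r \<le> 1/2") (auto simp: concat_path_def min_def max_def)
 ultimately have "path_homotopic X (vert a) y (concat_path (spoke a x) g) (concat_path (\<lambda>_. vert a) (spoke a y))"
  by (rule path_homotopic_cong)
 also have "path_homotopic X (vert a) y \<dots> (spoke a y)"
  by (rule concat_const_left[OF spoke_path[OF xy(2)]])
 finally show ?thesis .
qed

end

text \<open>\<open>d a\<close> is a path from the base point to the vertex \<open>a\<close>.\<close>
locale based_tetrahedra = tetrahedra X V \<phi> \<beta>
 for X :: "'x topology" and V :: "'v set" and \<phi> :: "'v => real^'c::finite => 'x" and \<beta> +
 fixes p :: 'x and d :: "'c => real => 'x"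
 assumes p: "p \<in> topspace X" and d: "joins X p (vert a) (d a)"
begin

abbreviation "PG \<equiv> fundamental_group X p"
abbreviation mult_PG (infixl "\<cdot>" 70) where "x \<cdot> y \<equiv> x \<otimes>\<^bsub>PG\<^esub> y"
abbreviation one_PG ("\<one>\<^sub>G") where "\<one>\<^sub>G \<equiv> \<one>\<^bsub>PG\<^esub>"
abbreviation inv_PG ("inv\<^sub>G _" [81] 80) where "inv\<^sub>G x \<equiv> inv\<^bsub>PG\<^esub> x"

lemma group_Pi: "group PG"
 by (rule group_fundamental_group[OF p])

definition ray :: "'c => 'x => real => 'x" where
 "ray a x = concat_path (d a) (spoke a x)"

lemma ray_path: "x \<in> star a ==> joins X p x (ray a x)"
 unfolding ray_def by (rule joins_concat[OF d spoke_path])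

lemma ray_move:
 assumes g: "joins X x y g" and a: "!!t. t \<in> {0..1} ==> g t \<in> star a"
 shows "path_homotopic X p y (concat_path (ray a x) g) (ray a y)"
proof -
 have xy: "x \<in> star a" "y \<in> star a" using a[of 0] a[of 1] g by (auto simp: joins_def)
 have "path_homotopic X p y (concat_path (ray a x) g) (concat_path (d a) (concat_path (spoke a x) g))"
  unfolding ray_def by (rule concat_assoc[OF d spoke_path[OF xy(1)] g])
 also have "path_homotopic X p y \<dots> (ray a y)"
  unfolding ray_def by (rule path_homotopic_concat[OF path_homotopic_refl[OF d] spoke_move[OF g a]])
 finally show ?thesis .
qed

definition center :: "'v => 'x" where
 "center u = \<phi> u (bary UNIV)"

lemma beta_center: "u \<in> V ==> \<beta> (center u) = bary UNIV"
 unfolding center_def by (rule beta_phi) (auto intro: bary_simp)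

lemma center_star: "u \<in> V ==> center u \<in> star a"
 using beta_center[of u] phi_topspace[of u "bary UNIV"] bary_simp[of UNIV] supp_bary[of "UNIV :: 'c set"]
 by (simp add: star_supp center_def)

text \<open>The class of the loop that reaches the center of \<open>u\<close> through the vertex \<open>a\<close> and returns through the vertex \<open>b\<close>.\<close>
definition trans_Pi :: "'c => 'c => 'v => (real => 'x) set" where
 "trans_Pi a b u = path_quotient X p (ray a (center u)) (ray b (center u))"

lemma trans_Pi_closed: "u \<in> V ==> trans_Pi a b u \<in> carrier PG"
 unfolding trans_Pi_def by (rule path_quotient_closed[OF ray_path ray_path]) (auto intro: center_star)

lemma trans_Pi_mult: "u \<in> V ==> trans_Pi a b u \<cdot> trans_Pi b c u = trans_Pi a c u"
 unfolding trans_Pi_def by (rule path_quotient_mult[OF ray_path ray_path ray_path]) (auto intro: center_star)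

lemma trans_Pi_self: "u \<in> V ==> trans_Pi a a u = \<one>\<^sub>G"
 unfolding trans_Pi_def by (rule path_quotient_self[OF ray_path]) (auto intro: center_star)

lemma trans_Pi_inv: "u \<in> V ==> inv\<^sub>G (trans_Pi a b u) = trans_Pi b a u"
proof -
 assume u: "u \<in> V"
 interpret group PG by (rule group_Pi)
 show ?thesis
  by (rule inv_equality) (auto simp: trans_Pi_mult[OF u] trans_Pi_self[OF u] trans_Pi_closed[OF u])
qed

text \<open>The point \<open>x\<close> can be moved along a segment to the center of \<open>u\<close> within both stars.\<close>
lemma quotient_at:
 assumes u: "u \<in> V" "x \<in> tetra u" and x: "x \<in> star a" "x \<in> star b"
 shows "path_quotient X p (ray a x) (ray b x) = trans_Pi a b u"
proof -
 have xX: "x \<in> topspace X" using x by (simp add: star_def)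
 define y where "y t = (1 - t) *\<^sub>R bary UNIV + t *\<^sub>R \<beta> x" for t
 have bU: "bary UNIV \<in> \<Delta>" "supp (bary UNIV :: real^'c) = UNIV" by (rule bary_simp supp_bary; simp)+
 have y: "y t \<in> \<Delta>" if "t \<in> {0..1}" for t
  unfolding y_def using convexD_alt[OF convex_simp bU(1) beta_in[OF xX]] that by auto
 define m where "m t = \<phi> u (y t)" for t
 have bm: "\<beta> (m t) = y t" "m t \<in> topspace X" if "t \<in> {0..1}" for t
  unfolding m_def using beta_phi[OF u(1) y[OF that]] phi_topspace[OF u(1) y[OF that]] by auto
 have ystar: "m t \<in> star c" if "t \<in> {0..1}" "x \<in> star c" for t c
 proof -
  have "0 < bary UNIV $ c" "0 < \<beta> x $ c" using that(2) supp_pos[OF bU(1), of c] bU(2) by (auto simp: star_def)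
  hence "0 < y t $ c" using that(1) by (cases "t = 0") (auto simp: y_def intro!: add_nonneg_pos)
  thus ?thesis using bm[OF that(1)] by (simp add: star_def)
 qed
 have "continuous_map \<I> (top_of_set \<Delta>) y"
  using y by (auto simp: continuous_map_into y_def intro!: continuous_intros)
 hence "continuous_map \<I> X m"
  using continuous_map_compose[OF _ phi_cont[OF u(1)]] unfolding m_def comp_def by blast
 moreover have "m 1 = x" using in_tet[of u x] u by (simp add: m_def y_def)
 ultimately have m: "joins X (center u) x m"
  by (simp add: joins_def pathin_def m_def y_def center_def)
 have "path_quotient X p (ray a x) (ray b x)
   = path_quotient X p (concat_path (ray a (center u)) m) (concat_path (ray b (center u)) m)"
  by (rule path_quotient_cong[OF path_homotopic_sym[OF ray_move[OF m]] path_homotopic_sym[OF ray_move[OF m]]])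
   (use ystar x in auto)
 also have "\<dots> = trans_Pi a b u"
  unfolding trans_Pi_def by (rule path_quotient_extend[OF ray_path ray_path m]) (auto intro: center_star u)
 finally show ?thesis .
qed

lemma trans_Pi_meet:
 assumes "u \<in> V" "v \<in> V" "meet u v {a, b}"
 shows "trans_Pi a b u = trans_Pi a b v"
proof -
 define m where "m = (bary {a, b} :: real^'c)"
 have m: "m \<in> \<Delta>" "supp m = {a, b}" unfolding m_def by (rule bary_simp supp_bary; simp)+
 have "\<phi> u m = \<phi> v m" using assms(3) by (simp add: meet_def m_def)
 moreover have "\<phi> u m \<in> star a" "\<phi> u m \<in> star b"
  using beta_phi[OF assms(1) m(1)] phi_topspace[OF assms(1) m(1)] m(2) by (auto simp: star_supp)
 ultimately show ?thesis
  using quotient_at[OF assms(1), of "\<phi> u m" a b] quotient_at[OF assms(2), of "\<phi> u m" a b] m(1)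
  by (metis imageI)
qed

definition initial :: "(real => 'x) => real => real => 'x" where
 "initial \<gamma> r = (\<lambda>t. \<gamma> (t * r))"

lemma initial_path:
 assumes g: "joins X p q \<gamma>" and r: "r \<in> {0..1}"
 shows "joins X p (\<gamma> r) (initial \<gamma> r)"
proof -
 have "(\<lambda>t. t * r) \<in> {0..1} \<rightarrow> {0..1}" using r by (auto simp: mult_le_one)
 hence "continuous_map \<I> \<I> (\<lambda>t. t * r)"
  by (auto simp: continuous_map_into intro!: continuous_intros)
 thus ?thesis
  using g continuous_map_compose[of "\<I>" "\<I>" "\<lambda>t. t * r" X \<gamma>]
  by (auto simp: joins_def pathin_def initial_def comp_def)
qed

lemma initial_move:
 assumes g: "joins X p q \<gamma>" and r: "r \<in> {0..1}" "r' \<in> {0..1}"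
 shows "joins X (\<gamma> r) (\<gamma> r') (\<lambda>t. \<gamma> ((1 - t) * r + t * r'))"
  and "path_homotopic X p (\<gamma> r') (concat_path (initial \<gamma> r) (\<lambda>t. \<gamma> ((1 - t) * r + t * r'))) (initial \<gamma> r')"
proof -
 have conv: "(1 - t) * r + t * r' \<in> {0..1}" if "t \<in> {0..1}" for t
  using convexD_alt[of "{0..1::real}" r r' t] r that by auto
 hence "continuous_map \<I> \<I> (\<lambda>t. (1 - t) * r + t * r')"
  by (auto simp: continuous_map_into intro!: continuous_intros)
 thus m: "joins X (\<gamma> r) (\<gamma> r') (\<lambda>t. \<gamma> ((1 - t) * r + t * r'))"
  using g continuous_map_compose[of "\<I>" "\<I>" "\<lambda>t. (1 - t) * r + t * r'" X \<gamma>]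
  by (auto simp: joins_def pathin_def comp_def)
 let ?f = "\<lambda>t::real. (1 - max (2 * t - 1) 0) * (min (2 * t) 1 * r) + max (2 * t - 1) 0 * r'"
 show "path_homotopic X p (\<gamma> r') (concat_path (initial \<gamma> r) (\<lambda>t. \<gamma> ((1 - t) * r + t * r'))) (initial \<gamma> r')"
 proof (rule path_reparam[where g = \<gamma> and f = ?f and f' = "\<lambda>t. t * r'"])
  show "pathin X \<gamma>" using g by (simp add: joins_def)
  show "continuous_on {0..1} ?f" "continuous_on {0..1} (\<lambda>t. t * r')" by (intro continuous_intros)+
  show "(\<lambda>t. t * r') \<in> {0..1} \<rightarrow> {0..1}" using r by (auto simp: mult_le_one)
  show "?f \<in> {0..1} \<rightarrow> {0..1}"
  proof
   fix t :: real assume t: "t \<in> {0..1}"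
   show "?f t \<in> {0..1}"
   proof (cases "t \<le> 1/2")
    case True
    hence "?f t = 2 * t * r" by (simp add: min_def max_def)
    thus ?thesis using True t r by (auto simp: mult_le_one)
   next
    case False
    thus ?thesis using conv[of "2 * t - 1"] t by (simp add: min_def max_def)
   qed
  qed
  fix t :: real assume t: "t \<in> {0..1}"
  show "concat_path (initial \<gamma> r) (\<lambda>t. \<gamma> ((1 - t) * r + t * r')) t = \<gamma> (?f t)"
   by (cases "t \<le> 1/2") (auto simp: concat_path_def initial_def min_def max_def)
  show "initial \<gamma> r' t = \<gamma> (t * r')" by (simp add: initial_def)
 qed (use g in \<open>auto simp: concat_path_def initial_def joins_def\<close>)
qed

definition trans_cocycle :: "'c => 'c => 'x => (real => 'x) set" where
 "trans_cocycle a b x = path_quotient X p (ray a x) (ray b x)"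

lemma trans_cocycle_at:
 "u \<in> V ==> x \<in> tetra u ==> x \<in> star a ==> x \<in> star b ==> trans_cocycle a b x = trans_Pi a b u"
 unfolding trans_cocycle_def by (rule quotient_at)

text \<open>The loop through the vertex \<open>a\<close> to \<open>\<gamma> r\<close> and back along \<open>\<gamma>\<close> does not change its class while \<open>\<gamma>\<close> stays in the
 star of \<open>a\<close>. So these classes form a section along \<open>\<gamma>\<close>, and its holonomy recovers the class of \<open>\<gamma>\<close>.\<close>
lemma path_section_Pi:
 assumes g: "joins X p q \<gamma>"
 shows "path_section PG star trans_cocycle \<gamma> (\<lambda>a r. path_quotient X p (ray a (\<gamma> r)) (initial \<gamma> r))"
proof (rule global_sectionI, unfold topspace_euclidean_subtopology vimage_eq)
 fix a r assume r: "r \<in> {0..1::real}" and a: "\<gamma> r \<in> star a"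
 show "path_quotient X p (ray a (\<gamma> r)) (initial \<gamma> r) \<in> carrier PG"
  by (rule path_quotient_closed[OF ray_path[OF a] initial_path[OF g r]])
 fix b assume b: "\<gamma> r \<in> star b"
 show "path_quotient X p (ray a (\<gamma> r)) (initial \<gamma> r) =
    trans_cocycle a b (\<gamma> r) \<cdot> path_quotient X p (ray b (\<gamma> r)) (initial \<gamma> r)"
  unfolding trans_cocycle_def
  by (rule path_quotient_mult[OF ray_path[OF a] ray_path[OF b] initial_path[OF g r], symmetric])
next
 fix a z
 let ?s = "\<lambda>r. path_quotient X p (ray a (\<gamma> r)) (initial \<gamma> r)"
 have cont: "continuous_map \<I> X \<gamma>" using g by (simp add: joins_def pathin_def)
 show "openin \<I> {r \<in> {0..1}. \<gamma> r \<in> star a \<and> ?s r = z}"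
  unfolding openin_contains_ball
 proof (intro conjI ballI)
  fix r assume "r \<in> {r \<in> {0..1}. \<gamma> r \<in> star a \<and> ?s r = z}"
  hence r: "r \<in> {0..1}" "\<gamma> r \<in> star a" "?s r = z" by auto
  have "openin \<I> {r \<in> {0..1}. \<gamma> r \<in> star a}"
   using openin_continuous_map_preimage[OF cont star_open] by simp
  then obtain e where e: "e > 0" "ball r e \<inter> {0..1} \<subseteq> {r \<in> {0..1}. \<gamma> r \<in> star a}"
   using r unfolding openin_contains_ball by auto
  have "?s r' = z" if r': "r' \<in> ball r e \<inter> {0..1}" for r'
  proof -
   have r'01: "r' \<in> {0..1}" using r' by blast
   note m = initial_move[OF g r(1) r'01]
   have inst: "\<gamma> ((1 - t) * r + t * r') \<in> star a" if "t \<in> {0..1}" for t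
   proof -
    have "convex (ball r e \<inter> {0..1})" by (intro convex_Int) auto
    hence "(1 - t) *\<^sub>R r + t *\<^sub>R r' \<in> ball r e \<inter> {0..1}"
     using r' r(1) e(1) that by (intro convexD_alt) auto
    thus ?thesis using e(2) by auto
   qed
   have "?s r' = path_quotient X p (concat_path (ray a (\<gamma> r)) (\<lambda>t. \<gamma> ((1 - t) * r + t * r')))
      (concat_path (initial \<gamma> r) (\<lambda>t. \<gamma> ((1 - t) * r + t * r')))"
    by (rule path_quotient_cong[OF path_homotopic_sym[OF ray_move[OF m(1) inst]] path_homotopic_sym[OF m(2)]])
   also have "\<dots> = ?s r"
    by (rule path_quotient_extend[OF ray_path[OF r(2)] initial_path[OF g r(1)] m(1)])
   finally show ?thesis using r(3) by simp
  qed
  thus "\<exists>e>0. ball r e \<inter> {0..1} \<subseteq> {r \<in> {0..1}. \<gamma> r \<in> star a \<and> ?s r = z}"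
   using e by (intro exI[of _ e]) auto
 qed auto
qed

end

section \<open>The weight of a word\<close>

fun adj :: "bool list => nat" where
 "adj (a # b # bs) = of_bool (a = b) + adj (b # bs)"
| "adj _ = 0"

text \<open>The number of letters plus the number of cyclically adjacent equal signs. By \<open>sign_variation_cyc\<close> it is the expression
 \<open>2 * length w - sign_variation w div 2\<close> in the definition of the weight.\<close>
definition cyc :: "bool list => nat" where
 "cyc bs = (if bs = [] then 0 else length bs + adj bs + of_bool (last bs = hd bs))"

lemma adj_append:
 "xs \<noteq> [] ==> ys \<noteq> [] ==> adj (xs @ ys) = adj xs + of_bool (last xs = hd ys) + adj ys"
proof (induction xs rule: adj.induct)
 case ("2_2" v)
 thus ?case by (cases ys) auto
qed auto

text \<open>A deleted sign that differs from both neighbours takes one letter away and may create at most one pair of equal signs.\<close>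
lemma cyc_remove: "cyc (xs @ ys) \<le> cyc (xs @ b # ys)"
proof -
 have b: "adj (b # ys) = of_bool (b = hd ys) + adj ys" if "ys \<noteq> []"
  using that by (cases ys) auto
 consider "xs = []" "ys = []" | "xs = []" "ys \<noteq> []" | "xs \<noteq> []" "ys = []" | "xs \<noteq> []" "ys \<noteq> []" by blast
 thus ?thesis
 proof cases
  case 1 thus ?thesis by (simp add: cyc_def)
 next
  case 2 thus ?thesis using b by (auto simp: cyc_def)
 next
  case 3 thus ?thesis using adj_append[of xs "[b]"] by (auto simp: cyc_def)
 next
  case 4 thus ?thesis using b adj_append[of xs "b # ys"] adj_append[of xs ys] by (auto simp: cyc_def)
 qed
qed

lemma cyc_subseq: "subseq xs ys ==> cyc (zs @ xs) \<le> cyc (zs @ ys)"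
proof (induction arbitrary: zs rule: list_emb.induct)
 case (list_emb_Nil ys)
 show ?case
 proof (induction ys arbitrary: zs)
  case (Cons y ys)
  show ?case using order_trans[OF Cons[of zs] cyc_remove[of zs ys y]] .
 qed simp
next
 case (list_emb_Cons xs ys y)
 thus ?case using cyc_remove[of zs ys y] by (meson order_trans)
next
 case (list_emb_Cons2 x y xs ys)
 thus ?case using list_emb_Cons2.IH[of "zs @ [x]"] by simp
qed

lemma cyc_subseq_signs: "subseq u v ==> cyc (map snd u) \<le> cyc (map snd v)"
 using cyc_subseq[of "map snd u" "map snd v" "[]"] subseq_map[of u v snd] by simp

lemma sum_adj: "(\<Sum>i<length bs - 1. of_bool (bs ! i = bs ! Suc i)) = adj bs"
proof (induction bs rule: adj.induct)
 case (1 a b bs)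
 have IH: "(\<Sum>i<length bs. of_bool ((b # bs) ! i = (b # bs) ! Suc i)) = adj (b # bs)"
  using 1 by (simp only: length_Cons diff_Suc_1)
 have "(\<Sum>i<Suc (length bs). of_bool ((a # b # bs) ! i = (a # b # bs) ! Suc i) :: nat) =
   of_bool (a = b) + (\<Sum>i<length bs. of_bool ((b # bs) ! i = (b # bs) ! Suc i))"
  by (subst sum.lessThan_Suc_shift) simp
 thus ?case unfolding IH by (simp only: length_Cons diff_Suc_1 adj.simps)
qed auto

lemma sign_variation_cyc:
 assumes "w \<noteq> []"
 shows "nat (2 * int (length w) - sign_variation w div 2) = cyc (map snd w)"
proof (cases "length w \<le> 1")
 case True
 then obtain a where "w = [a]" using assms by (cases w) auto
 thus ?thesis by (simp add: sign_variation_def cyc_def)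
next
 case False
 define n where "n = length w - 1"
 have n: "length w = Suc n" "n \<ge> 1" using False by (auto simp: n_def)
 let ?b = "map snd w"
 have s: "\<bar>sign a - sign b\<bar> = 2 - 2 * of_bool (snd a = snd b)" for a b :: "'a \<times> bool"
  by (auto simp: sign_def)
 have "sign_variation w = (\<Sum>i<n. \<bar>sign (w ! i) - sign (w ! Suc i)\<bar>) + \<bar>sign (w ! n) - sign (w ! 0)\<bar>"
  using n by (simp add: sign_variation_def)
 also have "(\<Sum>i<n. \<bar>sign (w ! i) - sign (w ! Suc i)\<bar>) = (\<Sum>i<n. 2 - 2 * of_bool (?b ! i = ?b ! Suc i))"
  using n by (intro sum.cong) (auto simp: s)
 also have "\<dots> = 2 * int n - 2 * int (adj ?b)"
  using sum_adj[of ?b] n by (simp add: sum_subtractf flip: sum_distrib_left)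
 finally have "sign_variation w = 2 * (int n + 1 - int (adj ?b) - of_bool (last ?b = hd ?b))"
  using n assms by (simp add: s last_conv_nth hd_conv_nth last_map hd_map)
 thus ?thesis using n assms by (auto simp: cyc_def nat_eq_iff)
qed

lemma subseq_butlast_tl: "subseq (butlast (tl w)) w"
 by (metis list_emb_Cons prefix_imp_subseq prefixeq_butlast list.sel(2) subseq_order.order_trans subseq_Cons' list.exhaust_sel subseq_order.order_refl)

text \<open>Cyclic reduction deletes letters; the bound 2 is attained by the empty word.\<close>
lemma lambda_weight_le: "lambda_weight w \<le> max 2 (cyc (map snd w))"
proof (induction w rule: lambda_weight.induct)
 case (1 w)
 consider "w = []" | "w \<noteq> []" "last w \<noteq> inv_letter (hd w)" | "w \<noteq> []" "last w = inv_letter (hd w)" by blast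
 thus ?case
 proof cases
  case 1 thus ?thesis by (simp add: lambda_weight.simps)
 next
  case 2
  thus ?thesis using sign_variation_cyc[of w] by (simp add: lambda_weight.simps)
 next
  case 3
  hence "lambda_weight w = lambda_weight (butlast (tl w))" by (simp add: lambda_weight.simps)
  moreover have "cyc (map snd (butlast (tl w))) \<le> cyc (map snd w)"
   by (rule cyc_subseq_signs[OF subseq_butlast_tl])
  ultimately show ?thesis using 1 3 by simp
 qed
qed

lemma subseq_push: "subseq (push a w) (a # w)"
 by (cases w) (auto simp: push_def)

lemma subseq_reduce: "subseq (foldr push u []) u"
proof (induction u)
 case (Cons a u)
 have "subseq (push a (foldr push u [])) (a # foldr push u [])" by (rule subseq_push)
 also have "subseq \<dots> (a # u)" using Cons by simp
 finally show ?case by simp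
qed simp

lemma cyc_alternating:
 assumes "m > 0"
 shows "cyc (map even [0..<2 * m]) = 2 * m"
proof -
 have "adj (map even [0..<2 * m]) = 0"
  unfolding sum_adj[symmetric] by simp
 moreover have "last (map even [0..<2 * m]) = even (2 * m - 1)" using assms by (simp add: last_map last_upt)
 ultimately show ?thesis using assms by (simp add: cyc_def hd_map hd_upt)
qed

text \<open>An alternating word has no adjacent equal signs, and erasing letters or reducing freely only deletes letters.\<close>
lemma lambda_weight_alternating:
 assumes "m > 0"
 shows "lambda_weight (foldr push (filter P (map (\<lambda>t. (f t, even t)) [0..<2 * m])) []) \<le> 2 * m"
proof -
 let ?L = "map (\<lambda>t. (f t, even t)) [0..<2 * m]"
 have "subseq (foldr push (filter P ?L) []) ?L"
  using subseq_reduce subseq_filter_left subseq_order.order_trans by blast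
 hence "cyc (map snd (foldr push (filter P ?L) [])) \<le> cyc (map snd ?L)" by (rule cyc_subseq_signs)
 also have "map snd ?L = map even [0..<2 * m]" by simp
 also have "cyc \<dots> = 2 * m" by (rule cyc_alternating[OF assms])
 finally show ?thesis using lambda_weight_le[of "foldr push (filter P ?L) []"] assms by simp
qed

section \<open>Normal closures and conjugate relators\<close>

lemma free_group_simps [simp]:
 "carrier (free_group S) = {w. reduced w \<and> fst ` set w \<subseteq> S}"
 "x \<otimes>\<^bsub>free_group S\<^esub> y = foldr push x y" "\<one>\<^bsub>free_group S\<^esub> = []"
 by (simp_all add: free_group_def)

lemma normal_carrier: "group G ==> carrier G \<lhd> G"
proof -
 assume "group G"
 then interpret group G .
 show ?thesis by (rule normal_invI) (auto simp: subgroup_self)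
qed

abbreviation words :: "'x set => 'x word set" where "words S \<equiv> carrier (free_group S)"

context
 fixes S :: "'x set"
begin

interpretation F: group "free_group S" by (rule group_free_group)

abbreviation mult_free (infixl "\<cdot>" 70) where "x \<cdot> y \<equiv> x \<otimes>\<^bsub>free_group S\<^esub> y"
abbreviation inv_free ("inv\<^sub>F _" [81] 80) where "inv\<^sub>F x \<equiv> inv\<^bsub>free_group S\<^esub> x"

lemma normal_closure_normal:
 assumes "R \<subseteq> words S"
 shows "normal_closure S R \<lhd> free_group S"
proof -
 let ?A = "{N. N \<lhd> free_group S \<and> R \<subseteq> N}"
 have ne: "words S \<in> ?A" using normal_carrier[OF group_free_group] assms by blast
 show ?thesis
  unfolding normal_closure_def
 proof (rule F.normal_invI)
  show "subgroup (\<Inter>?A) (free_group S)"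
   using ne by (intro F.subgroups_Inter) (auto simp: normal_imp_subgroup)
  fix x h assume "x \<in> words S" "h \<in> \<Inter>?A"
  thus "x \<cdot> h \<cdot> inv\<^sub>F x \<in> \<Inter>?A"
   by (auto simp del: free_group_simps intro: normal.inv_op_closed2)
 qed
qed

lemma normal_closure_superset: "R \<subseteq> normal_closure S R"
 by (auto simp: normal_closure_def)

lemma normal_closure_least: "N \<lhd> free_group S ==> R \<subseteq> N ==> normal_closure S R \<subseteq> N"
 by (auto simp: normal_closure_def)

lemma normal_closure_subset:
 assumes "R' \<subseteq> words S" "R \<subseteq> normal_closure S R'"
 shows "normal_closure S R \<subseteq> normal_closure S R'"
 by (rule normal_closure_least[OF normal_closure_normal[OF assms(1)] assms(2)])

definition conjugate :: "'x word => 'x word => bool" where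
 "conjugate r r' \<longleftrightarrow> r \<in> words S \<and>
   (\<exists>g\<in>words S. r' = g \<cdot> r \<cdot> inv\<^sub>F g)"

lemma conjugate_carrier: "conjugate r r' ==> r \<in> words S \<and> r' \<in> words S"
proof -
 show "conjugate r r' ==> r \<in> words S \<and> r' \<in> words S"
  unfolding conjugate_def by (auto simp del: free_group_simps)
qed

lemma conjugate_in_normal:
 assumes "conjugate r r'" "N \<lhd> free_group S"
 shows "r' \<in> N \<longleftrightarrow> r \<in> N"
proof -
 interpret N: normal N "free_group S" by fact
 obtain g where g: "g \<in> words S" "r \<in> words S"
  and r': "r' = g \<cdot> r \<cdot> inv\<^sub>F g"
  using assms(1) by (auto simp: conjugate_def simp del: free_group_simps)
 have "r = inv\<^sub>F g \<cdot> r' \<cdot> g"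
  using g unfolding r' by (simp add: F.m_assoc F.inv_solve_left' del: free_group_simps flip: F.m_assoc)
   (simp add: F.m_assoc del: free_group_simps)
 thus ?thesis using N.inv_op_closed1[OF g(1), of r'] N.inv_op_closed2[OF g(1), of r] r' by metis
qed

lemma normal_closure_conjugate:
 assumes "!!i. i \<in> I ==> conjugate (r i) (r' i)"
 shows "normal_closure S (A \<union> r' ` I) = normal_closure S (A \<union> r ` I)"
proof -
 have "A \<union> r' ` I \<subseteq> N \<longleftrightarrow> A \<union> r ` I \<subseteq> N" if "N \<lhd> free_group S" for N
  using conjugate_in_normal[OF assms that] by auto
 thus ?thesis unfolding normal_closure_def by (intro arg_cong[of _ _ Inter] Collect_cong) blast
qed

lemma normal_closure_insert_Nil: "normal_closure S (insert [] A) = normal_closure S A"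
proof -
 have "[] \<in> N" if "N \<lhd> free_group S" for N
  using subgroup.one_closed[OF normal_imp_subgroup[OF that]] by simp
 thus ?thesis unfolding normal_closure_def by (intro arg_cong[of _ _ Inter] Collect_cong) blast
qed

lemma conjugate_refl: "r \<in> words S ==> conjugate r r"
proof -
 show "r \<in> words S ==> conjugate r r"
  unfolding conjugate_def by (intro conjI bexI[of _ "\<one>\<^bsub>free_group S\<^esub>"]) (simp_all del: free_group_simps)
qed

lemma conjugate_trans: assumes "conjugate r r'" "conjugate r' r''" shows "conjugate r r''"
proof -
 obtain g k where g: "g \<in> words S" "k \<in> words S" "r \<in> words S"
  "r' = g \<cdot> r \<cdot> inv\<^sub>F g"
  "r'' = k \<cdot> r' \<cdot> inv\<^sub>F k"
  using assms by (auto simp: conjugate_def simp del: free_group_simps)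
 thus ?thesis unfolding conjugate_def
  by (intro conjI bexI[of _ "k \<cdot> g"]) (simp_all add: F.m_assoc F.inv_mult_group del: free_group_simps)
qed

text \<open>The weight of a word depends on its cyclic core only. Among the three letters \<open>x\<close>, \<open>x\<close> inverse and \<open>y\<close>, one cancels with neither
 end of \<open>r\<close>; conjugation by it lengthens \<open>r\<close> by two.\<close>
lemma lengthen:
 assumes r: "r \<in> words S" "r \<noteq> []" and S: "x \<in> S" "y \<in> S" "x \<noteq> y"
 shows "\<exists>r'. conjugate r r' \<and> length r' = length r + 2 \<and> lambda_weight r' = lambda_weight r"
proof -
 obtain a where a: "fst a \<in> S" "a \<noteq> inv_letter (hd r)" "a \<noteq> last r"
 proof -
  have "card {(x, True), (x, False), (y, True)} = 3" using S by simp
  moreover have "card {inv_letter (hd r), last r} \<le> 2" by (simp add: card_insert_if)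
  ultimately have "\<not> {(x, True), (x, False), (y, True)} \<subseteq> {inv_letter (hd r), last r}"
   using card_mono[of "{inv_letter (hd r), last r}" "{(x, True), (x, False), (y, True)}"] by auto
  thus ?thesis using that S by fastforce
 qed
 have ac: "[a] \<in> words S" "[inv_letter a] \<in> words S"
  using a by (auto simp: reduced_def inv_letter_def)
 have inva: "inv\<^sub>F [a] = [inv_letter a]"
  by (rule F.inv_equality) (use ac in \<open>auto simp: push_def\<close>)
 have "hd r \<noteq> inv_letter a" "inv_letter a \<noteq> inv_letter (last r)" using a by (metis inv_letter_inv_letter)+
 hence "reduced (a # r @ [inv_letter a])"
  using r by (cases r) (auto simp: reduced_def successively_append_iff successively_Cons hd_append split: if_splits)
 hence "foldr push (a # r @ [inv_letter a]) [] = a # r @ [inv_letter a]" by (rule foldr_push_Nil)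
 hence e: "[a] \<cdot> r \<cdot> inv\<^sub>F [a] = a # r @ [inv_letter a]"
  unfolding inva using F.m_assoc[OF ac(1) r(1) ac(2)] ac by (simp add: push_def)
 have "conjugate r (a # r @ [inv_letter a])"
  unfolding conjugate_def using r ac e by (intro conjI bexI[of _ "[a]"]) simp_all
 moreover have "lambda_weight (a # r @ [inv_letter a]) = lambda_weight r"
  by (subst lambda_weight.simps) simp
 ultimately show ?thesis by (intro exI[of _ "a # r @ [inv_letter a]"]) simp
qed

lemma lengthen_many:
 assumes "r \<in> words S" "r \<noteq> []" "x \<in> S" "y \<in> S" "x \<noteq> y"
 shows "\<exists>r'. conjugate r r' \<and> length r' = length r + 2 * k \<and> lambda_weight r' = lambda_weight r"
proof (induction k)
 case 0 thus ?case using conjugate_refl assms by (intro exI[of _ r]) simp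
next
 case (Suc k)
 then obtain r' where r': "conjugate r r'" "length r' = length r + 2 * k" "lambda_weight r' = lambda_weight r" by blast
 hence "r' \<noteq> []" using assms by auto
 then obtain r'' where "conjugate r' r''" "length r'' = length r' + 2" "lambda_weight r'' = lambda_weight r'"
  using lengthen[OF conjunct2[OF conjugate_carrier[OF r'(1)]] _ assms(3-5)] by blast
 thus ?case using r' conjugate_trans[OF r'(1)] by (intro exI[of _ r'']) auto
qed

text \<open>The relators of a presentation form a set. To keep equal relators apart they are replaced by conjugates of different lengths, which
 changes neither the weights nor the normal closure.\<close>
lemma distinct_conjugates:
 assumes "finite I" "!!i. i \<in> I ==> r i \<in> words S \<and> r i \<noteq> []"
  "card I \<le> 1 \<or> (\<exists>x\<in>S. \<exists>y\<in>S. x \<noteq> y)"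
 shows "\<exists>r'. inj_on r' I \<and> (\<forall>i\<in>I. conjugate (r i) (r' i) \<and> lambda_weight (r' i) = lambda_weight (r i))"
proof (cases "card I \<le> 1")
 case True
 hence "inj_on r I" using assms(1) by (auto simp: inj_on_def card_le_Suc0_iff_eq)
 thus ?thesis using assms conjugate_refl by blast
next
 case False
 then obtain x y where xy: "x \<in> S" "y \<in> S" "x \<noteq> y" using assms by blast
 from assms(1,2) show ?thesis
 proof (induction I)
  case (insert i I)
  then obtain r' where r': "inj_on r' I" "\<forall>i\<in>I. conjugate (r i) (r' i) \<and> lambda_weight (r' i) = lambda_weight (r i)"
   by auto
  define k where "k = Suc (\<Sum>j\<in>I. length (r' j))"
  obtain s where s: "conjugate (r i) s" "length s = length (r i) + 2 * k" "lambda_weight s = lambda_weight (r i)"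
   using lengthen_many[OF _ _ xy, of "r i" k] insert.prems by blast
  have "length (r' j) < length s" if "j \<in> I" for j
   using member_le_sum[of j I "\<lambda>j. length (r' j)"] that insert.hyps s by (simp add: k_def)
  hence "s \<notin> r' ` I" by auto
  hence "inj_on (r'(i := s)) (insert i I)"
   using r'(1) insert.hyps by (auto simp: inj_on_def)
  moreover have "\<forall>j\<in>insert i I. conjugate (r j) ((r'(i := s)) j) \<and> lambda_weight ((r'(i := s)) j) = lambda_weight (r j)"
   using r'(2) s insert.hyps by simp
  ultimately show ?case by blast
 qed auto
qed

end

section \<open>The weight of a balanced family of relators\<close>

text \<open>One relator \<open>r i0\<close> is set aside, an empty one if there is any. Every other empty relator is dropped; its weight 2 pays for
 the term \<open>2 * (card S - card R)\<close>. The rest is made distinct by conjugation. As any one relator follows from the others, \<open>r i0\<close>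
 can replace each element of \<open>R\<close>.\<close>
lemma presentation_from_relators:
 fixes r :: "'i => nat word"
 assumes fin: "finite S" "finite I" and card: "card I = Suc (card S)"
  and r: "!!i. i \<in> I ==> r i \<in> words S"
  and redundant: "!!i. i \<in> I ==> normal_closure S (r ` (I - {i})) = normal_closure S (r ` I)"
  and iso: "presented_group S (r ` I) \<cong> G"
 shows "\<exists>R. (S, R) \<in> presentations G (card S) \<and> presentation_weight S R \<le> (\<Sum>i\<in>I. lambda_weight (r i))"
proof -
 have "I \<noteq> {}" using card by auto
 then obtain i0 where i0: "i0 \<in> I" "(\<exists>i\<in>I. r i = []) --> r i0 = []" by blast
 define I1 where "I1 = I - {i0}"
 define I2 where "I2 = {i \<in> I1. r i \<noteq> []}"
 have fin12: "finite I1" "finite I2" "I2 \<subseteq> I1" "I1 \<subseteq> I" using fin by (auto simp: I1_def I2_def)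
 have card1: "card I1 = card S" using card i0 fin by (simp add: I1_def)
 have card2: "card I2 \<le> card S" using card_mono[OF fin12(1,3)] card1 by simp
 have "r i \<in> words S \<and> r i \<noteq> []" if "i \<in> I2" for i
  using that r[of i] fin12 by (auto simp: I2_def simp del: free_group_simps)
 moreover have "card I2 \<le> 1 \<or> (\<exists>x\<in>S. \<exists>y\<in>S. x \<noteq> y)"
 proof (cases "card S \<le> 1")
  case False
  hence "\<not> card S \<le> Suc 0" by simp
  thus ?thesis using fin(1) by (auto simp: card_le_Suc0_iff_eq)
 qed (use card2 in auto)
 ultimately have "\<exists>r'. inj_on r' I2 \<and> (\<forall>i\<in>I2. conjugate S (r i) (r' i) \<and> lambda_weight (r' i) = lambda_weight (r i))"
  using fin12(2) by (intro distinct_conjugates) blast+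
 then obtain r' where r': "inj_on r' I2"
   "!!i. i \<in> I2 ==> conjugate S (r i) (r' i)" "!!i. i \<in> I2 ==> lambda_weight (r' i) = lambda_weight (r i)"
  by blast
 define R where "R = r' ` I2"
 have cR: "R \<subseteq> words S" using r'(2) conjugate_carrier unfolding R_def by blast
 have cardR: "card R = card I2" unfolding R_def by (rule card_image[OF r'(1)])
 have rI: "r ` J \<subseteq> words S" if "J \<subseteq> I" for J using r that by blast
 \<comment> \<open>Empty relators and passing to conjugates do not change the normal closure.\<close>
 have drop: "normal_closure S (r ` J) = normal_closure S (A \<union> r ` K)"
  if "J \<subseteq> I" "A \<union> r ` K \<subseteq> r ` J" "r ` J \<subseteq> insert [] (A \<union> r ` K)" for J K A
 proof (rule subset_antisym)
  have c: "A \<union> r ` K \<subseteq> words S" using rI[OF that(1)] that(2) by blast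
  have "r ` J \<subseteq> normal_closure S (insert [] (A \<union> r ` K))"
   using normal_closure_superset that(3) by blast
  hence "r ` J \<subseteq> normal_closure S (A \<union> r ` K)" unfolding normal_closure_insert_Nil .
  thus "normal_closure S (r ` J) \<subseteq> normal_closure S (A \<union> r ` K)" by (rule normal_closure_subset[OF c])
  show "normal_closure S (A \<union> r ` K) \<subseteq> normal_closure S (r ` J)"
   using that(2) normal_closure_superset by (intro normal_closure_subset rI that) blast
 qed
 have NR: "normal_closure S R = normal_closure S (r ` I)"
 proof -
  have "normal_closure S (r ` I) = normal_closure S (r ` I1)" using redundant[OF i0(1)] by (simp add: I1_def)
  also have "\<dots> = normal_closure S ({} \<union> r ` I2)"
   by (rule drop) (auto simp: I2_def fin12)
  also have "\<dots> = normal_closure S ({} \<union> r' ` I2)"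
   by (rule normal_closure_conjugate[symmetric]) (auto simp: r'(2))
  finally show ?thesis by (simp add: R_def)
 qed
 have "r i0 \<in> replacing_relators S R"
  unfolding replacing_relators_def
 proof (intro CollectI conjI ballI)
  show "r i0 \<in> normal_closure S R" unfolding NR by (rule subsetD[OF normal_closure_superset imageI[OF i0(1)]])
  fix x assume "x \<in> R"
  then obtain i where i: "i \<in> I2" "x = r' i" by (auto simp: R_def)
  have "R - {x} = r' ` (I2 - {i})" using i r'(1) by (auto simp: R_def inj_on_def)
  hence "normal_closure S (insert (r i0) (R - {x})) = normal_closure S ({r i0} \<union> r' ` (I2 - {i}))" by simp
  also have "\<dots> = normal_closure S ({r i0} \<union> r ` (I2 - {i}))"
   using r i0 by (intro normal_closure_conjugate) (auto intro: r'(2))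
  also have "\<dots> = normal_closure S (r ` (I - {i}))"
  proof (rule drop[symmetric])
   show "I - {i} \<subseteq> I" by blast
   show "{r i0} \<union> r ` (I2 - {i}) \<subseteq> r ` (I - {i})" using i i0 by (auto simp: I2_def I1_def)
   have "r j \<in> insert [] ({r i0} \<union> r ` (I2 - {i}))" if "j \<in> I - {i}" for j
    using that i by (cases "j = i0 \<or> r j = []") (auto simp: I2_def I1_def)
   thus "r ` (I - {i}) \<subseteq> insert [] ({r i0} \<union> r ` (I2 - {i}))" by blast
  qed
  also have "\<dots> = normal_closure S R" using redundant[of i] i(1) fin12(3,4) NR by (metis subsetD)
  finally show "normal_closure S (insert (r i0) (R - {x})) = normal_closure S R" .
 qed
 hence L: "(LEAST n. n \<in> lambda_weight ` replacing_relators S R) \<le> lambda_weight (r i0)"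
  by (intro Least_le) blast
 have "(\<Sum>x\<in>R. lambda_weight x) = (\<Sum>i\<in>I2. lambda_weight (r i))"
  unfolding R_def sum.reindex[OF r'(1)] by (simp add: r'(3))
 moreover have "(\<Sum>i\<in>I1 - I2. lambda_weight (r i)) = 2 * (card S - card R)"
 proof -
  have "(\<Sum>i\<in>I1 - I2. lambda_weight (r i)) = (\<Sum>i\<in>I1 - I2. 2)"
   by (rule sum.cong) (auto simp: I2_def lambda_weight.simps)
  thus ?thesis using fin12 card1 cardR by (simp add: card_Diff_subset)
 qed
 moreover have "(\<Sum>i\<in>I. lambda_weight (r i)) = lambda_weight (r i0) + (\<Sum>i\<in>I1. lambda_weight (r i))"
  unfolding I1_def by (rule sum.remove[OF fin(2) i0(1)])
 moreover have "(\<Sum>i\<in>I1. lambda_weight (r i)) = (\<Sum>i\<in>I1 - I2. lambda_weight (r i)) + (\<Sum>i\<in>I2. lambda_weight (r i))"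
  by (rule sum.subset_diff[OF fin12(3,1)])
 ultimately have "presentation_weight S R \<le> (\<Sum>i\<in>I. lambda_weight (r i))"
  unfolding presentation_weight_def using L by linarith
 moreover have "(S, R) \<in> presentations G (card S)"
  unfolding presentations_def using fin fin12 cR card2 cardR iso NR
  by (auto simp: R_def presented_group_def)
 ultimately show ?thesis by blast
qed

section \<open>Estimating the weight of a group\<close>

text \<open>Put \<open>q = (n - 2) div 6\<close>; then \<open>n \<le> 6 * (q + 1)\<close> since \<open>n\<close> is even. Either the index of \<open>G\<close> is \<open>q\<close>, and the given
 presentation bounds the weight, or it is smaller, and the defining inequality of the index does.\<close>
lemma group_weight_le:
 assumes P: "(S, R) \<in> presentations G (card S)" and w: "presentation_weight S R \<le> n"
  and n: "even n" "6 * card S + 2 \<le> n"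
 shows "group_weight G \<le> n"
proof -
 define q where "q = (n - 2) div 6"
 have q: "6 * q + 2 \<le> n" "n \<le> 6 * (q + 1)" "card S \<le> q" using n unfolding q_def by presburger+
 have Pq: "(S, R) \<in> presentations G q" using P q by (auto simp: presentations_def)
 have min: "min_generators G \<le> card S" unfolding min_generators_def using P by (intro Least_le) blast
 have "weight_upto G q \<le> presentation_weight S R"
  unfolding weight_upto_def using Pq by (intro Least_le) auto
 hence wq: "weight_upto G q \<le> n" using w by simp
 have ex: "min_generators G \<le> q \<and> weight_upto G q \<le> 6 * (q + 1)" using min q wq by simp
 have "weight_upto G (weight_index G) \<le> 6 * (weight_index G + 1)"
  unfolding weight_index_def using LeastI[of "\<lambda>q. min_generators G \<le> q \<and> weight_upto G q \<le> 6 * (q + 1)", OF ex] by blast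
 moreover have "weight_index G \<le> q" unfolding weight_index_def using ex by (intro Least_le) blast
 ultimately have "weight_upto G (weight_index G) \<le> n"
  using wq q(1) by (cases "weight_index G = q") auto
 moreover have "6 * min_generators G + 2 \<le> n" using min n by simp
 ultimately show ?thesis by (simp add: group_weight_def)
qed

section \<open>Evaluating words\<close>

definition eval_word :: "('g, 'm) monoid_scheme => ('x => 'g) => 'x word => 'g" where
 "eval_word Q Y w = foldr (\<lambda>a z. (if snd a then Y (fst a) else inv\<^bsub>Q\<^esub> (Y (fst a))) \<otimes>\<^bsub>Q\<^esub> z) w \<one>\<^bsub>Q\<^esub>"

context
 fixes Q (structure) and Y :: "'x => 'g"
 assumes Q: "group Q" and Y: "!!x. Y x \<in> carrier Q"
begin

interpretation group Q by (rule Q)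

lemma eval_word_closed: "eval_word Q Y w \<in> carrier Q"
 by (induction w) (auto simp: eval_word_def Y)

lemma eval_word_Nil: "eval_word Q Y [] = \<one>" by (simp add: eval_word_def)

lemma eval_word_Cons: "eval_word Q Y (a # w) = (if snd a then Y (fst a) else inv (Y (fst a))) \<otimes> eval_word Q Y w"
 by (simp add: eval_word_def)

lemma eval_word_append: "eval_word Q Y (v @ w) = eval_word Q Y v \<otimes> eval_word Q Y w"
 by (induction v) (auto simp: eval_word_Nil eval_word_Cons eval_word_closed Y m_assoc)

lemma eval_word_push: "eval_word Q Y (push a w) = eval_word Q Y (a # w)"
proof (cases "w \<noteq> [] \<and> hd w = inv_letter a")
 case True
 then obtain v where "w = inv_letter a # v" by (cases w) auto
 thus ?thesis
  using eval_word_closed[of v] Y[of "fst a"]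
  by (auto simp: push_def eval_word_Cons inv_letter_def inv_mult_cancel mult_inv_cancel)
qed (auto simp: push_def)

lemma eval_word_foldr_push: "eval_word Q Y (foldr push u v) = eval_word Q Y u \<otimes> eval_word Q Y v"
 by (induction u) (auto simp: eval_word_Nil eval_word_push eval_word_Cons eval_word_closed Y m_assoc)

lemma eval_word_hom: "eval_word Q Y \<in> hom (free_group S) Q"
 by (rule homI) (auto simp: eval_word_closed eval_word_foldr_push)

lemma eval_word_reduce: "eval_word Q Y (foldr push u []) = eval_word Q Y u"
 by (simp add: eval_word_foldr_push eval_word_Nil eval_word_closed)

lemma eval_word_filter:
 "(!!a. a \<in> set L ==> \<not> P a ==> Y (fst a) = \<one>) ==> eval_word Q Y (filter P L) = eval_word Q Y L"
 by (induction L) (auto simp: eval_word_Cons eval_word_Nil eval_word_closed)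

end

lemma hom_eval_word:
 fixes Q (structure)
 assumes Q: "group Q" and e: "e \<in> hom (free_group S) Q" and w: "w \<in> words S"
 shows "e w = eval_word Q (\<lambda>x. if x \<in> S then e [(x, True)] else \<one>) w"
proof -
 interpret group Q by (rule Q)
 interpret F: group "free_group S" by (rule group_free_group)
 interpret h: group_hom "free_group S" Q e by unfold_locales (rule e)
 let ?Y = "\<lambda>x. if x \<in> S then e [(x, True)] else \<one>"
 have letter: "[(x, b)] \<in> words S" if "x \<in> S" for x b using that by (simp add: reduced_def)
 have Yc: "?Y x \<in> carrier Q" for x using h.hom_closed[OF letter] by simp
 show ?thesis using w
 proof (induction w)
  case Nil
  have "e [] = \<one>" using h.hom_one by simp
  thus ?case by (simp add: eval_word_def)
 next
  case (Cons a w)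
  obtain x b where a: "a = (x, b)" by (cases a)
  have x: "x \<in> S" using Cons.prems a by simp
  have w: "w \<in> words S" using Cons.prems by (cases w) (auto simp: reduced_def)
  have "[a] \<otimes>\<^bsub>free_group S\<^esub> w = a # w"
   using Cons.prems by (cases w) (auto simp: push_def reduced_def)
  hence 1: "e (a # w) = e [a] \<otimes> e w"
   using h.hom_mult[OF letter[OF x, of b] w] a by simp
  have "e [(x, False)] = inv (e [(x, True)])"
  proof (rule inv_equality[symmetric])
   have "[(x, False)] \<otimes>\<^bsub>free_group S\<^esub> [(x, True)] = \<one>\<^bsub>free_group S\<^esub>"
    by (simp add: push_def inv_letter_def)
   thus "e [(x, False)] \<otimes> e [(x, True)] = \<one>"
    using h.hom_mult[OF letter[OF x, of False] letter[OF x, of True]] h.hom_one by metis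
  qed (use h.hom_closed letter x in auto)
  hence "e [a] = (if snd a then ?Y (fst a) else inv (?Y (fst a)))" using a x by simp
  thus ?case using 1 Cons.IH[OF w] eval_word_Cons[OF Q, of ?Y a w] Yc by simp
 qed
qed

section \<open>Relators\<close>

context colored_involutions begin

definition relator_list :: "('v => 'n) => 'c => 'c => 'v => 'n word" where
 "relator_list K i j u = map (\<lambda>t. (K (zig i j u t), even t)) [0..<2 * half_period i j u]"

text \<open>The word that is read along the cycle of colours \<open>i, j\<close> through \<open>u\<close>, with exponents that alternate and with the letters
 outside \<open>S\<close> erased.\<close>
definition relator :: "'n set => ('v => 'n) => 'c => 'c => 'v => 'n word" where
 "relator S K i j u = foldr push (filter (\<lambda>a. fst a \<in> S) (relator_list K i j u)) []"

text \<open>The connection that is concentrated on the edges of colour \<open>i\<close>. Its holonomy along a cycle of colours \<open>i, j\<close> is the value of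
 the relator (\<open>holonomy_relator\<close>).\<close>
definition pair_connection :: "('g, 'm) monoid_scheme => ('v => 'g) => 'c => 'c => 'v => 'g" where
 "pair_connection Q y i c u = (if c = i then y u \<otimes>\<^bsub>Q\<^esub> inv\<^bsub>Q\<^esub> (y (\<alpha> i u)) else \<one>\<^bsub>Q\<^esub>)"

lemma relator_carrier: "relator S K i j u \<in> words S"
proof -
 have "reduced (relator S K i j u)" unfolding relator_def by (rule reduced_foldr_push) (simp add: reduced_def)
 moreover have "set (relator S K i j u) \<subseteq> {a. fst a \<in> S}"
  unfolding relator_def using set_foldr_push[of "filter (\<lambda>a. fst a \<in> S) (relator_list K i j u)" "[]"] by auto
 ultimately show ?thesis by auto
qed

lemma lambda_relator: "u \<in> V ==> lambda_weight (relator S K i j u) \<le> card (orb {i, j} u)"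
 using lambda_weight_alternating[OF half_period(1)[of u i j], of "\<lambda>a. fst a \<in> S" "\<lambda>t. K (zig i j u t)"]
 by (simp add: card_orb2 relator_def relator_list_def)

lemma pair_connection_connection:
 fixes Q (structure)
 assumes "group Q" "!!u. u \<in> V ==> y u \<in> carrier Q"
 shows "connection Q (pair_connection Q y i)"
proof -
 interpret group Q by fact
 show ?thesis
  using assms(2) alpha_closed by (auto simp: connection_def pair_connection_def alpha_alpha inv_mult_group)
qed

lemma holonomy_relator:
 fixes Q (structure)
 assumes Q: "group Q" and Y: "!!x. Y x \<in> carrier Q" and 1: "!!x. x \<notin> S ==> Y x = \<one>" and u: "u \<in> V" and ij: "i \<noteq> j"
 shows "holonomy Q (pair_connection Q (\<lambda>v. Y (K v)) i) i j u (2 * half_period i j u) = eval_word Q Y (relator S K i j u)"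
proof -
 interpret group Q by (rule Q)
 let ?h = "pair_connection Q (\<lambda>v. Y (K v)) i" and ?p = "zig i j u"
 have "holonomy Q ?h i j u (2 * k) = eval_word Q Y (map (\<lambda>t. (K (?p t), even t)) [0..<2 * k])" for k
 proof (induction k)
  case 0 show ?case by (simp add: eval_word_Nil[OF Q Y])
 next
  case (Suc k)
  let ?w = "map (\<lambda>t. (K (?p t), even t)) [0..<2 * k]"
  have "[0..<2 * Suc k] = [0..<2 * k] @ [2 * k, 2 * k + 1]" by simp
  hence word: "eval_word Q Y (map (\<lambda>t. (K (?p t), even t)) [0..<2 * Suc k]) =
    eval_word Q Y ?w \<otimes> (Y (K (?p (2 * k))) \<otimes> inv (Y (K (?p (2 * k + 1)))))"
   by (simp only: map_append eval_word_append[OF Q Y])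
    (simp add: eval_word_Cons[OF Q Y] eval_word_Nil[OF Q Y] Y del: zig.simps)
  have hol: "holonomy Q ?h i j u (2 * Suc k) =
    holonomy Q ?h i j u (2 * k) \<otimes> (Y (K (?p (2 * k))) \<otimes> inv (Y (K (?p (2 * k + 1))))) \<otimes> \<one>"
   using ij by (simp add: pair_connection_def)
  show ?case unfolding hol word Suc.IH
   by (rule r_one) (intro m_closed inv_closed eval_word_closed[OF Q Y] Y)
 qed
 moreover have "eval_word Q Y (relator S K i j u) = eval_word Q Y (relator_list K i j u)"
  unfolding relator_def eval_word_reduce[OF Q Y]
  using 1 by (intro eval_word_filter[OF Q Y]) auto
 ultimately show ?thesis by (simp add: relator_list_def)
qed

lemma relator_trivial_iff:
 fixes Q (structure)
 assumes Q: "group Q" and Y: "!!x. Y x \<in> carrier Q" and 1: "!!x. x \<notin> S ==> Y x = \<one>" and u: "u \<in> V" and ij: "i \<noteq> j"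
 shows "eval_word Q Y (relator S K i j u) = \<one> \<longleftrightarrow> trivial_on Q (pair_connection Q (\<lambda>v. Y (K v)) i) (face {i, j} u)"
proof -
 have eq: "eval_word Q Y (relator S K i j u) = holonomy Q (pair_connection Q (\<lambda>v. Y (K v)) i) i j u (2 * half_period i j u)"
  using holonomy_relator[where K = K and S = S and Y = Y and Q = Q] assms by simp
 show ?thesis unfolding eq
proof
 let ?h = "pair_connection Q (\<lambda>v. Y (K v)) i"
 have con: "connection Q ?h" by (rule pair_connection_connection[OF Q]) (rule Y)
 show "trivial_on Q ?h (face {i, j} u)" if "holonomy Q ?h i j u (2 * half_period i j u) = \<one>"
  by (rule trivial_on_face[OF Q con u that])
 show "holonomy Q ?h i j u (2 * half_period i j u) = \<one>" if "trivial_on Q ?h (face {i, j} u)"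
  by (rule holonomy_face[OF Q u that])
qed
qed

end

context tetrahedra begin

lemma meet_orb:
 assumes u: "u \<in> V" and v: "v \<in> I.orb {k, l} u" and "k \<notin> A" "l \<notin> A" "A \<noteq> {}"
 shows "meet u v A"
 using v
proof (rule I.orb_induct)
 show "meet u u A" by (rule meet_refl)
 fix x c assume x: "x \<in> I.orb {k, l} u" "meet u x A" "c \<in> {k, l}"
 have xV: "x \<in> V" using x(1) I.orb_subset[OF u] by blast
 have "meet x (\<alpha> c x) A"
  using alpha_props[OF xV, of c] x(3) assms by (intro meet_mono[of x "\<alpha> c x" "- {c}" A]) (auto simp: xV)
 thus "meet u (\<alpha> c x) A" using x(2) meet_trans by blast
qed

context
 fixes i j k l :: 'c and K :: "'v => 'n" and S :: "'n set"
 assumes distinct: "distinct [i, j, k, l]" and ne: "V \<noteq> {}"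
  and kappa: "!!u v. u \<in> V ==> v \<in> I.orb {k, l} u ==> K v = K u"
begin

text \<open>In the link of \<open>k\<close> or \<open>l\<close> the cycles of colours \<open>i, j\<close> are some of the 2-cells, and around all other 2-cells the connection is
 trivial. In a sphere one 2-cell can be left out.\<close>
lemma link_trivial:
 fixes Q (structure)
 assumes Q: "group Q" and Y: "!!x. Y x \<in> carrier Q" and 1: "!!x. x \<notin> S ==> Y x = \<one>"
  and u0: "u0 \<in> V" and rel: "!!u. u \<in> V ==> u \<notin> I.orb {i, j} u0 ==> eval_word Q Y (I.relator S K i j u) = \<one>"
  and m: "m = k \<or> m = l"
 shows "I.trivial_on Q (I.pair_connection Q (\<lambda>v. Y (K v)) i) ((- {m}) \<times> V)"
proof -
 interpret group Q by (rule Q)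
 let ?h = "I.pair_connection Q (\<lambda>v. Y (K v)) i"
 define n where "n = (if m = k then l else k)"
 have dm: "distinct [i, j, n, m]" "n \<in> {k, l}" using distinct m by (auto simp: n_def)
 have T: "- {m} = {i, j, n}" using exhaust4[OF dm(1)] dm(1) by auto
 have Tn: "- {m} - {n} = {i, j}" "- {m} - {i} = {j, n}" "- {m} - {j} = {i, n}" unfolding T using dm by auto
 have con: "I.connection Q ?h" by (rule I.pair_connection_connection[OF Q]) (rule Y)
 have f0: "I.face {i, j} u0 \<in> I.faces (- {m})"
  unfolding I.faces_def using Tn(1) T u0 by (intro CollectI exI[of _ n] exI[of _ u0]) auto
 show ?thesis
 proof (rule I.pureD[OF link_sphere(2)[OF ne Q f0] con])
  fix a assume a: "a \<in> I.faces (- {m}) - {I.face {i, j} u0}"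
  then obtain c u where cu: "c \<in> {i, j, n}" "u \<in> V" "a = I.face (- {m} - {c}) u"
   unfolding I.faces_def T by blast
  consider "c = n" | "c = i" | "c = j" using cu by blast
  thus "I.trivial_on Q ?h a"
  proof cases
   case 1
   hence a1: "a = I.face {i, j} u" using cu Tn by simp
   have "u \<notin> I.orb {i, j} u0" using a a1 I.face_eq_orb[OF u0, of u] by blast
   thus ?thesis unfolding a1 using rel[OF cu(2)] dm(1)
    by (subst I.relator_trivial_iff[OF Q Y assms(3) cu(2), symmetric]) auto
  next
   case 2
   thus ?thesis unfolding I.trivial_on_def using cu Tn dm(1)
    by (intro exI[of _ "\<lambda>_. \<one>"]) (auto simp: I.face_def I.pair_connection_def)
  next
   case 3
   hence a3: "a = I.face {i, n} u" using cu Tn by simp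
   have "?h e x = inv (inv (Y (K x))) \<otimes> inv (Y (K (\<alpha> e x)))" if ex: "(e, x) \<in> a" for e x
   proof -
    have "x \<in> V" "e = i \<or> e = n" using ex I.orb_subset[OF cu(2)] by (auto simp: a3 I.face_def)
    moreover have "K (\<alpha> n x) = K x"
     by (rule kappa[OF \<open>x \<in> V\<close>]) (rule I.orb_step[OF I.orb_refl dm(2)])
    ultimately show ?thesis using Y dm(1) by (auto simp: I.pair_connection_def)
   qed
   thus ?thesis unfolding I.trivial_on_def using Y by (intro exI[of _ "\<lambda>x. inv (Y (K x))"]) auto
  qed
 qed
qed

text \<open>By \<open>link_trivial\<close>, applied to the connection whose holonomies are the values of the relators.\<close>
lemma relator_redundant:
 fixes Q (structure)
 assumes Q: "group Q" and Y: "!!x. Y x \<in> carrier Q" and 1: "!!x. x \<notin> S ==> Y x = \<one>"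
  and u0: "u0 \<in> V" and rel: "!!u. u \<in> V ==> u \<notin> I.orb {i, j} u0 ==> eval_word Q Y (I.relator S K i j u) = \<one>"
 shows "eval_word Q Y (I.relator S K i j u0) = \<one>"
proof -
 have "I.face {i, j} u0 \<subseteq> (- {k}) \<times> V" using distinct I.orb_subset[OF u0] by (auto simp: I.face_def)
 hence "I.trivial_on Q (I.pair_connection Q (\<lambda>v. Y (K v)) i) (I.face {i, j} u0)"
  using link_trivial[OF assms, of k] I.trivial_on_mono by blast
 moreover have "i \<noteq> j" using distinct by simp
 ultimately show ?thesis
  using I.relator_trivial_iff[where Q = Q and Y = Y and S = S and K = K and u = u0 and i = i and j = j] Q Y 1 u0 by blast
qed

text \<open>For the vertices \<open>i\<close> and \<open>j\<close> the potentials are explicit. For \<open>k\<close> and \<open>l\<close> they exist because the links are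
 simply connected and the relators hold.\<close>
lemma potentials_exist:
 fixes Q (structure)
 assumes Q: "group Q" and Y: "!!x. Y x \<in> carrier Q" and 1: "!!x. x \<notin> S ==> Y x = \<one>"
  and rel: "!!u. u \<in> V ==> eval_word Q Y (I.relator S K i j u) = \<one>"
 obtains f where "!!a u. u \<in> V ==> f a u \<in> carrier Q" "!!u. u \<in> V ==> f i u = \<one>" "!!u. u \<in> V ==> f j u = inv (Y (K u))"
  "!!a c u. u \<in> V ==> c \<noteq> a ==> I.pair_connection Q (\<lambda>v. Y (K v)) i c u = inv (f a u) \<otimes> f a (\<alpha> c u)"
proof -
 interpret group Q by (rule Q)
 let ?h = "I.pair_connection Q (\<lambda>v. Y (K v)) i"
 obtain u0 where u0: "u0 \<in> V" using ne by blast
 have triv: "I.trivial_on Q ?h ((- {m}) \<times> V)" if "m = k \<or> m = l" for m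
  using link_trivial[OF Q Y 1 u0 rel that] .
 obtain fk where fk: "fk \<in> V \<rightarrow> carrier Q" "!!c u. (c, u) \<in> (- {k}) \<times> V ==> ?h c u = inv (fk u) \<otimes> fk (\<alpha> c u)"
  using I.trivial_onE[OF triv[of k]] by blast
 obtain fl where fl: "fl \<in> V \<rightarrow> carrier Q" "!!c u. (c, u) \<in> (- {l}) \<times> V ==> ?h c u = inv (fl u) \<otimes> fl (\<alpha> c u)"
  using I.trivial_onE[OF triv[of l]] by blast
 define f where "f a u = (if a = i then \<one> else if a = j then inv (Y (K u)) else if a = k then fk u else fl u)" for a u
 have all: "a = i \<or> a = j \<or> a = k \<or> a = l" for a using exhaust4[OF distinct] by blast
 show ?thesis
 proof (rule that[of f])
  show "f a u \<in> carrier Q" if "u \<in> V" for a u using that fk(1) fl(1) Y by (auto simp: f_def)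
  show "f i u = \<one>" "f j u = inv (Y (K u))" for u using distinct by (auto simp: f_def)
  fix a c :: 'c and u assume u: "u \<in> V" and ca: "c \<noteq> a"
  consider "a = i" | "a = j" | "a = k" | "a = l" using all by blast
  thus "?h c u = inv (f a u) \<otimes> f a (\<alpha> c u)"
  proof cases
   case 1 thus ?thesis using ca by (simp add: f_def I.pair_connection_def)
  next
   case 2
   have "K (\<alpha> c u) = K u" if "c \<noteq> i"
   proof (rule kappa[OF u])
    have "c \<in> {k, l}" using that ca 2 all[of c] by blast
    thus "\<alpha> c u \<in> I.orb {k, l} u" by (rule I.orb_step[OF I.orb_refl])
   qed
   thus ?thesis using 2 ca distinct Y by (auto simp: f_def I.pair_connection_def)
  next
   case 3 thus ?thesis using fk(2)[of c u] u ca distinct by (auto simp: f_def)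
  next
   case 4 thus ?thesis using fl(2)[of c u] u ca distinct by (auto simp: f_def)
  qed
 qed
qed

end

text \<open>Around the edge \<open>a b\<close> both potentials change by the same connection, and the tetrahedra at this edge form one cycle.\<close>
lemma potentials_invariant:
 fixes Q (structure)
 assumes Q: "group Q" and f: "!!a u. u \<in> V ==> f a u \<in> carrier Q"
  and h: "!!a c u. u \<in> V ==> c \<noteq> a ==> h c u = inv (f a u) \<otimes> f a (\<alpha> c u)"
  and uv: "u \<in> V" "v \<in> V" "meet u v {a, b}"
 shows "f a u \<otimes> inv (f b u) = f a v \<otimes> inv (f b v)"
proof (cases "a = b")
 case True
 interpret group Q by (rule Q)
 show ?thesis using True f uv by simp
next
 case False
 interpret group Q by (rule Q)
 obtain i j where ij: "distinct [i, j, a, b]" using other_colors[OF False] by metis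
 have "v \<in> I.orb {i, j} u" by (rule edge_link_connected[OF ij uv])
 thus ?thesis
 proof (rule I.orb_induct)
  fix x c assume x: "x \<in> I.orb {i, j} u" "f a u \<otimes> inv f b u = f a x \<otimes> inv f b x" "c \<in> {i, j}"
  have xV: "x \<in> V" "\<alpha> c x \<in> V" using x(1) I.orb_subset[OF uv(1)] alpha_props by blast+
  have c: "c \<noteq> a" "c \<noteq> b" using x(3) ij by auto
  have eq: "inv (f a x) \<otimes> f a (\<alpha> c x) = inv (f b x) \<otimes> f b (\<alpha> c x)"
   using h[OF xV(1) c(1)] h[OF xV(1) c(2)] by simp
  have "f a (\<alpha> c x) = f a x \<otimes> (inv (f a x) \<otimes> f a (\<alpha> c x))"
   using f xV by (simp add: mult_inv_cancel)
  also have "\<dots> = f a x \<otimes> (inv (f b x) \<otimes> f b (\<alpha> c x))" unfolding eq ..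
  finally show "f a u \<otimes> inv f b u = f a (\<alpha> c x) \<otimes> inv f b (\<alpha> c x)"
   using f xV x(2) by (simp add: m_assoc)
 qed simp
qed

end

section \<open>Generators of a presented group\<close>

text \<open>The image of a word in the presented group. A letter outside \<open>S\<close> is sent to the identity.\<close>
definition word_class :: "'n set => 'n word set => 'n word => 'n word set" where
 "word_class S R w = normal_closure S R #>\<^bsub>free_group S\<^esub> w"

definition letter_class :: "'n set => 'n word set => 'n => 'n word set" where
 "letter_class S R x = (if x \<in> S then word_class S R [(x, True)] else \<one>\<^bsub>presented_group S R\<^esub>)"

lemma letter_carrier: "x \<in> S ==> [(x, b)] \<in> words S"
 by (simp add: reduced_def)

context
 fixes S :: "'n set" and R :: "'n word set"
 assumes R: "R \<subseteq> words S"
begin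

lemma group_presented_group: "group (presented_group S R)"
 unfolding presented_group_def by (rule normal.factorgroup_is_group[OF normal_closure_normal[OF R]])

lemma word_class_hom: "word_class S R \<in> hom (free_group S) (presented_group S R)"
 unfolding word_class_def presented_group_def by (rule normal.r_coset_hom_Mod[OF normal_closure_normal[OF R]])

lemma word_class_surj: "carrier (presented_group S R) = word_class S R ` words S"
 unfolding presented_group_def carrier_FactGroup word_class_def ..

lemma word_class_one_iff:
 assumes "w \<in> words S"
 shows "word_class S R w = \<one>\<^bsub>presented_group S R\<^esub> \<longleftrightarrow> w \<in> normal_closure S R"
proof -
 interpret F: group "free_group S" by (rule group_free_group)
 note N = normal_imp_subgroup[OF normal_closure_normal[OF R]]
 show ?thesis
  unfolding word_class_def presented_group_def one_FactGroup
  using F.coset_join1[OF _ assms N] F.coset_join2[OF assms N] by blast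
qed

lemma letter_class_closed: "letter_class S R x \<in> carrier (presented_group S R)"
proof -
 interpret P: group "presented_group S R" by (rule group_presented_group)
 show ?thesis
 proof (cases "x \<in> S")
  case True
  thus ?thesis unfolding letter_class_def using hom_in_carrier[OF word_class_hom letter_carrier[OF True]] by simp
 qed (simp add: letter_class_def)
qed

lemma eval_letter_class:
 assumes w: "w \<in> words S"
 shows "eval_word (presented_group S R) (letter_class S R) w = word_class S R w"
proof -
 have "letter_class S R = (\<lambda>x. if x \<in> S then word_class S R [(x, True)] else \<one>\<^bsub>presented_group S R\<^esub>)"
  by (simp add: fun_eq_iff letter_class_def)
 thus ?thesis using hom_eval_word[OF group_presented_group word_class_hom w] by simp
qed

text \<open>A word that dies whenever the relators die is a consequence of the relators.\<close>
lemma in_normal_closureI: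
 assumes w: "w \<in> words S"
  and die: "!!(Q :: 'n word set monoid) Y. group Q ==> (!!x. Y x \<in> carrier Q) ==>
   (!!x. x \<notin> S ==> Y x = \<one>\<^bsub>Q\<^esub>) ==> (!!r. r \<in> R ==> eval_word Q Y r = \<one>\<^bsub>Q\<^esub>) ==> eval_word Q Y w = \<one>\<^bsub>Q\<^esub>"
 shows "w \<in> normal_closure S R"
proof -
 have "eval_word (presented_group S R) (letter_class S R) w = \<one>\<^bsub>presented_group S R\<^esub>"
 proof (rule die[OF group_presented_group letter_class_closed])
  show "letter_class S R x = \<one>\<^bsub>presented_group S R\<^esub>" if "x \<notin> S" for x using that by (simp add: letter_class_def)
  fix r assume r: "r \<in> R"
  have "word_class S R r = \<one>\<^bsub>presented_group S R\<^esub>"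
   using word_class_one_iff[OF subsetD[OF R r]] normal_closure_superset[of R S] r by blast
  thus "eval_word (presented_group S R) (letter_class S R) r = \<one>\<^bsub>presented_group S R\<^esub>"
   using eval_letter_class[OF subsetD[OF R r]] by simp
 qed
 thus ?thesis using eval_letter_class[OF w] word_class_one_iff[OF w] by simp
qed

end

section \<open>The presentation of the fundamental group\<close>

context tetrahedra begin

text \<open>Potentials of the same connection on a connected link differ by a constant left factor.\<close>
lemma potentials_unique:
 fixes Q (structure)
 assumes Q: "group Q" and F: "!!u. u \<in> V ==> F u \<in> carrier Q" "!!u. u \<in> V ==> F' u \<in> carrier Q"
  and eq: "!!c u. c \<noteq> a ==> u \<in> V ==> inv (F u) \<otimes> F (\<alpha> c u) = inv (F' u) \<otimes> F' (\<alpha> c u)"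
 shows "\<exists>g\<in>carrier Q. \<forall>u\<in>V. F u = g \<otimes> F' u"
proof (cases "V = {}")
 case True
 thus ?thesis using group.is_monoid[OF Q] monoid.one_closed by auto
next
 case False
 interpret group Q by (rule Q)
 obtain u0 where u0: "u0 \<in> V" using False by blast
 define g where "g = F u0 \<otimes> inv (F' u0)"
 have g: "g \<in> carrier Q" using F u0 by (simp add: g_def)
 have "F u = g \<otimes> F' u" if "u \<in> V" for u
 proof -
  have "u \<in> I.orb (- {a}) u0" using vertex_link_connected[OF u0] that by blast
  thus ?thesis
  proof (rule I.orb_induct)
   show "F u0 = g \<otimes> F' u0" using F u0 by (simp add: g_def m_assoc)
   fix x c assume x: "x \<in> I.orb (- {a}) u0" "F x = g \<otimes> F' x" "c \<in> - {a}"
   have xV: "x \<in> V" "\<alpha> c x \<in> V" using x(1) I.orb_subset[OF u0] alpha_props by blast+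
   have "F (\<alpha> c x) = F x \<otimes> (inv (F x) \<otimes> F (\<alpha> c x))" using F xV by (simp add: mult_inv_cancel)
   also have "\<dots> = F x \<otimes> (inv (F' x) \<otimes> F' (\<alpha> c x))" using eq[of c x] x(3) xV by simp
   finally show "F (\<alpha> c x) = g \<otimes> F' (\<alpha> c x)" using F xV g x(2) by (simp add: m_assoc mult_inv_cancel)
  qed
 qed
 thus ?thesis using g by blast
qed

lemma spoke_in_star: "x \<in> star a ==> s \<in> {0..1} ==> spoke a x s \<in> star a"
proof -
 assume x: "x \<in> star a" and s: "s \<in> {0..1}"
 have xX: "x \<in> topspace X" "0 < \<beta> x $ a" using x by (auto simp: star_def)
 have t: "tet x \<in> V" using tet[OF xX(1)] by blast
 note c = cone_point_simp[OF xX(1) s, of a]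
 have "0 < cone_point a x s $ a" using xX(2) s by (cases "s = 0") (auto simp: cone_point_def axis_def intro!: add_nonneg_pos)
 thus ?thesis using beta_phi[OF t c] phi_topspace[OF t c] by (simp add: star_def spoke_def)
qed

end

lemma path_section_cong:
 assumes s: "path_section G U t \<gamma> s"
  and t: "!!a b x. x \<in> {0..1} ==> \<gamma> x \<in> U a ==> \<gamma> x \<in> U b ==> t' a b (\<gamma> x) = t a b (\<gamma> x)"
 shows "path_section G U t' \<gamma> s"
 by (rule section_cong[OF s]) (use t in auto)

text \<open>\<open>K u\<close> names the cycle of colours \<open>k, l\<close> through \<open>u\<close>, that is, the edge \<open>i j\<close> of the complex on \<open>u\<close>. The generators \<open>S\<close>
 are all of these names but one, and \<open>base\<close> normalizes the paths to the vertices along the omitted edge.\<close>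
locale presented_tetrahedra = based_tetrahedra X V \<phi> \<beta> p d
 for X :: "'x topology" and V :: "'v set" and \<phi> :: "'v => real^'c::finite => 'x" and \<beta> p d +
 fixes i j k l :: 'c and K :: "'v => 'n" and S :: "'n set" and R :: "'n word set" and u\<^sub>0 :: 'v
 assumes distinct: "distinct [i, j, k, l]"
  and kappa: "!!u v. u \<in> V ==> v \<in> V ==> K u = K v \<longleftrightarrow> v \<in> I.orb {k, l} u"
  and kappa_surj: "S \<subseteq> K ` V"
  and u0: "u\<^sub>0 \<in> V" "K u\<^sub>0 \<notin> S"
  and base: "!!u. u \<in> V ==> K u \<notin> S ==> trans_Pi i j u = \<one>\<^sub>G"
  and R_relators: "R \<subseteq> I.relator S K i j ` V"
  and relators_R: "!!u. u \<in> V ==> I.relator S K i j u \<in> normal_closure S R"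
begin

lemma kappa_orb: "u \<in> V ==> v \<in> I.orb {k, l} u ==> K v = K u"
 using kappa[of u v] subsetD[OF I.orb_subset[of u "{k, l}"], of v] by simp

lemma V_ne: "V \<noteq> {}" using u0 by blast

abbreviation "PR \<equiv> presented_group S R"
abbreviation mult_PR (infixl "\<star>" 70) where "x \<star> y \<equiv> x \<otimes>\<^bsub>PR\<^esub> y"
abbreviation one_PR ("\<one>\<^sub>R") where "\<one>\<^sub>R \<equiv> \<one>\<^bsub>PR\<^esub>"
abbreviation inv_PR ("inv\<^sub>R _" [81] 80) where "inv\<^sub>R x \<equiv> inv\<^bsub>PR\<^esub> x"

lemma R_carrier: "R \<subseteq> words S"
 using R_relators I.relator_carrier by blast

lemma group_PR: "group PR"
 by (rule group_presented_group[OF R_carrier])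

abbreviation "Y_P \<equiv> letter_class S R"

lemma relators_P: "u \<in> V ==> eval_word PR Y_P (I.relator S K i j u) = \<one>\<^sub>R"
 using eval_letter_class[OF R_carrier I.relator_carrier] word_class_one_iff[OF R_carrier I.relator_carrier] relators_R by simp

text \<open>The element of the fundamental group for a generator: in through the vertex \<open>i\<close> and out through \<open>j\<close>.\<close>
definition Y_Pi :: "'n => (real => 'x) set" where
 "Y_Pi x = (if x \<in> S then trans_Pi i j (SOME u. u \<in> V \<and> K u = x) else \<one>\<^sub>G)"

lemma Y_Pi_kappa: "u \<in> V ==> Y_Pi (K u) = trans_Pi i j u"
proof (cases "K u \<in> S")
 case True
 assume u: "u \<in> V"
 define v where "v = (SOME v. v \<in> V \<and> K v = K u)"
 have v: "v \<in> V" "K v = K u" unfolding v_def using someI[of "\<lambda>v. v \<in> V \<and> K v = K u" u] u by auto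
 hence "u \<in> I.orb {k, l} v" using kappa u by simp
 hence "meet v u {i, j}" using distinct by (intro meet_orb[OF v(1)]) auto
 thus ?thesis using True trans_Pi_meet[OF v(1) u] by (simp add: Y_Pi_def v_def)
qed (simp add: Y_Pi_def base)

lemma Y_Pi_closed: "Y_Pi x \<in> carrier PG"
proof -
 interpret PG: group PG by (rule group_Pi)
 show ?thesis
 proof (cases "x \<in> S")
  case True
  then obtain u where "u \<in> V" "x = K u" using kappa_surj by blast
  thus ?thesis using Y_Pi_kappa trans_Pi_closed by simp
 qed (simp add: Y_Pi_def)
qed

abbreviation "h_Pi \<equiv> I.pair_connection PG (\<lambda>v. Y_Pi (K v)) i"
abbreviation "h_P \<equiv> I.pair_connection PR (\<lambda>v. Y_P (K v)) i"

lemma trans_Pi_alpha: "u \<in> V ==> c \<noteq> a ==> c \<noteq> b ==> trans_Pi a b (\<alpha> c u) = trans_Pi a b u"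
 using alpha_props[of u c] meet_mono[of u "\<alpha> c u" "- {c}" "{a, b}"]
 by (intro trans_Pi_meet) (auto simp: meet_sym)

lemma potentials_Pi:
 assumes u: "u \<in> V" and c: "c \<noteq> a"
 shows "h_Pi c u = inv\<^sub>G (trans_Pi a i u) \<cdot> trans_Pi a i (\<alpha> c u)"
proof -
 interpret PG: group PG by (rule group_Pi)
 have u': "\<alpha> c u \<in> V" using alpha_props[OF u] by blast
 note cl = trans_Pi_closed[OF u] trans_Pi_closed[OF u']
 show ?thesis
 proof (cases "c = i")
  case False
  thus ?thesis using trans_Pi_alpha[OF u c False] cl by (simp add: I.pair_connection_def)
 next
  case True
  have "c \<noteq> j" using True distinct by auto
  hence aj: "trans_Pi a j (\<alpha> c u) = trans_Pi a j u" by (rule trans_Pi_alpha[OF u c])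
  have "h_Pi c u = trans_Pi i j u \<cdot> trans_Pi j i (\<alpha> c u)"
   using True Y_Pi_kappa[OF u] Y_Pi_kappa[OF u'] trans_Pi_inv[OF u'] by (simp add: I.pair_connection_def)
  also have "\<dots> = (trans_Pi i a u \<cdot> trans_Pi a j u) \<cdot> (trans_Pi j a (\<alpha> c u) \<cdot> trans_Pi a i (\<alpha> c u))"
   by (simp only: trans_Pi_mult[OF u] trans_Pi_mult[OF u'])
  also have "trans_Pi j a (\<alpha> c u) = inv\<^sub>G (trans_Pi a j u)"
   using trans_Pi_inv[OF u', of a j] aj by simp
  finally show ?thesis using cl trans_Pi_inv[OF u, of a i] by (simp add: PG.m_assoc PG.mult_inv_cancel)
 qed
qed

text \<open>The transitions \<open>trans_Pi k i\<close> to the vertex \<open>k\<close> are a potential along the cycle, which lies in the link of \<open>k\<close>.\<close>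
lemma relators_Pi:
 assumes u: "u \<in> V"
 shows "eval_word PG Y_Pi (I.relator S K i j u) = \<one>\<^sub>G"
proof -
 have "i \<noteq> j" using distinct by simp
 moreover have "I.trivial_on PG h_Pi (I.face {i, j} u)"
  unfolding I.trivial_on_def
 proof (intro exI[of _ "trans_Pi k i"] conjI)
  show "trans_Pi k i \<in> V \<rightarrow> carrier PG" using trans_Pi_closed by blast
  show "\<forall>(c, x)\<in>I.face {i, j} u. h_Pi c x = inv\<^sub>G (trans_Pi k i x) \<cdot> trans_Pi k i (\<alpha> c x)"
  proof clarify
   fix c x assume "(c, x) \<in> I.face {i, j} u"
   hence "x \<in> V" "c \<noteq> k" using I.orb_subset[OF u] distinct by (auto simp: I.face_def)
   thus "h_Pi c x = inv\<^sub>G (trans_Pi k i x) \<cdot> trans_Pi k i (\<alpha> c x)" by (rule potentials_Pi)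
  qed
 qed
 moreover have "Y_Pi x = \<one>\<^sub>G" if "x \<notin> S" for x using that by (simp add: Y_Pi_def)
 ultimately show ?thesis
  using I.relator_trivial_iff[where Q = PG and Y = Y_Pi and S = S and K = K and u = u and i = i and j = j]
   group_Pi Y_Pi_closed u by blast
qed

lemma Psi_exists:
 obtains \<Psi> where "\<Psi> \<in> hom PR PG" "!!x. \<Psi> (Y_P x) = Y_Pi x"
proof -
 interpret PG: group PG by (rule group_Pi)
 interpret F: group "free_group S" by (rule group_free_group)
 let ?e = "eval_word PG Y_Pi"
 have hom: "?e \<in> hom (free_group S) PG" by (rule eval_word_hom[OF group_Pi Y_Pi_closed])
 interpret h: group_hom "free_group S" PG ?e by unfold_locales (rule hom)
 have "R \<subseteq> kernel (free_group S) PG ?e"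
  using R_relators R_carrier relators_Pi by (auto simp: kernel_def simp del: free_group_simps)
 hence "normal_closure S R \<subseteq> kernel (free_group S) PG ?e"
  by (rule normal_closure_least[OF h.normal_kernel])
 then obtain \<Psi> where Psi: "\<Psi> \<in> hom (free_group S Mod normal_closure S R) PG"
  "!!x. x \<in> words S ==> \<Psi> (normal_closure S R #>\<^bsub>free_group S\<^esub> x) = ?e x"
  using h.FactGroup_universal_kernel[OF normal_closure_normal[OF R_carrier]] by metis
 have hom': "\<Psi> \<in> hom PR PG" using Psi(1) by (simp add: presented_group_def)
 have "\<Psi> (Y_P x) = Y_Pi x" for x
 proof (cases "x \<in> S")
  case True
  thus ?thesis using Psi(2)[OF letter_carrier[OF True, of True]] Y_Pi_closed[of x]
   by (simp add: letter_class_def word_class_def eval_word_def)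
 next
  case False
  thus ?thesis using hom_one[OF hom' group_PR group_Pi] by (simp add: letter_class_def Y_Pi_def)
 qed
 thus ?thesis using that hom' by blast
qed

text \<open>Homomorphisms from the presented group are determined on letters.\<close>
lemma presented_group_hom_eqI:
 fixes Q (structure)
 assumes Q: "group Q" and h: "h \<in> hom PR Q" "h' \<in> hom PR Q" and eq: "!!x. h (Y_P x) = h' (Y_P x)" and q: "q \<in> carrier PR"
 shows "h q = h' q"
proof -
 have key: "e (word_class S R w) = eval_word Q (\<lambda>x. if x \<in> S then e (Y_P x) else \<one>) w"
  if "e \<in> hom PR Q" "w \<in> words S" for e w
  using hom_eval_word[OF Q hom_compose[OF word_class_hom[OF R_carrier] that(1)] that(2)]
  by (simp add: letter_class_def cong: if_cong del: free_group_simps)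
 obtain w where w: "w \<in> words S" "q = word_class S R w"
  using q unfolding word_class_surj[OF R_carrier] by (rule imageE)
 show ?thesis unfolding w(2) key[OF h(1) w(1)] key[OF h(2) w(1)] eq ..
qed

context
 fixes \<Psi> and f :: "'c => 'v => 'n word set"
 assumes Psi: "\<Psi> \<in> hom PR PG" "!!x. \<Psi> (Y_P x) = Y_Pi x"
  and f: "!!a u. u \<in> V ==> f a u \<in> carrier PR" "!!u. u \<in> V ==> f i u = \<one>\<^sub>R"
   "!!u. u \<in> V ==> f j u = inv\<^sub>R (Y_P (K u))"
  and fh: "!!a c u. u \<in> V ==> c \<noteq> a ==> h_P c u = inv\<^sub>R (f a u) \<star> f a (\<alpha> c u)"
 fixes a0 assumes a0: "p \<in> star a0"
begin

interpretation PG: group PG by (rule group_Pi)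
interpretation PR: group PR by (rule group_PR)
interpretation Psi: group_hom PR PG \<Psi> by unfold_locales (rule Psi(1))

definition t :: "'c => 'c => 'x => 'n word set" where
 "t a b x = f a (tet x) \<star> inv\<^sub>R (f b (tet x))"

lemma t_cocycle: "cocycle PR X star t"
 and t_at: "u \<in> V ==> x \<in> tetra u ==> x \<in> star a ==> x \<in> star b ==> t a b x = f a u \<star> inv\<^sub>R (f b u)"
proof -
 have inv: "f a u \<star> inv\<^sub>R (f b u) = f a v \<star> inv\<^sub>R (f b v)"
  if "u \<in> V" "v \<in> V" "meet u v {a, b}" for a b u v
  by (rule potentials_invariant[OF group_PR f(1) fh that])
 show "cocycle PR X star t" unfolding t_def[abs_def] by (rule global_cocycle(1)[OF group_PR f(1) inv])
 show "u \<in> V ==> x \<in> tetra u ==> x \<in> star a ==> x \<in> star b ==> t a b x = f a u \<star> inv\<^sub>R (f b u)"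
  unfolding t_def by (rule global_cocycle(2)[OF group_PR f(1) inv])
qed

definition t' :: "'c => 'c => 'x => (real => 'x) set" where
 "t' a b x = trans_Pi a i (tet x) \<cdot> inv\<^sub>G (trans_Pi b i (tet x))"

lemma t'_cocycle: "cocycle PG X star t'"
 unfolding t'_def[abs_def]
proof (rule global_cocycle(1)[OF group_Pi trans_Pi_closed])
 show "trans_Pi a i u \<cdot> inv\<^sub>G trans_Pi b i u = trans_Pi a i v \<cdot> inv\<^sub>G trans_Pi b i v"
  if "u \<in> V" "v \<in> V" "meet u v {a, b}" for a b u v
  by (rule potentials_invariant[OF group_Pi trans_Pi_closed potentials_Pi that])
qed

lemma t'_at:
 assumes "x \<in> star a" "x \<in> star b" shows "t' a b x = trans_cocycle a b x"
proof -
 have "x \<in> topspace X" using assms by (simp add: star_def)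
 hence tx: "tet x \<in> V" "x \<in> tetra (tet x)" using tet by auto
 thus ?thesis
  using trans_cocycle_at[OF tx assms] trans_Pi_inv[OF tx(1)] trans_Pi_mult[OF tx(1)] by (simp add: t'_def)
qed

text \<open>Both sides are potentials of the same connection on the link of \<open>a\<close>, so \<open>potentials_unique\<close> applies.\<close>
lemma trans_Psi: "\<exists>g\<in>carrier PG. \<forall>u\<in>V. trans_Pi a i u = g \<cdot> \<Psi> (f a u)"
proof (rule potentials_unique[OF group_Pi])
 show "trans_Pi a i u \<in> carrier PG" "\<Psi> (f a u) \<in> carrier PG" if "u \<in> V" for u using trans_Pi_closed f(1) that by auto
 fix c u assume cu: "c \<noteq> a" "u \<in> V"
 have u': "\<alpha> c u \<in> V" using alpha_props cu by blast
 have "inv\<^sub>G (trans_Pi a i u) \<cdot> trans_Pi a i (\<alpha> c u) = h_Pi c u" using potentials_Pi cu by simp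
 also have "\<dots> = \<Psi> (h_P c u)" using Psi(2) letter_class_closed[OF R_carrier] by (simp add: I.pair_connection_def)
 also have "h_P c u = inv\<^sub>R (f a u) \<star> f a (\<alpha> c u)" by (rule fh[OF cu(2,1)])
 also have "\<Psi> (inv\<^sub>R (f a u) \<star> f a (\<alpha> c u)) = inv\<^sub>G (\<Psi> (f a u)) \<cdot> \<Psi> (f a (\<alpha> c u))" using f(1) cu u' by simp
 finally show "inv\<^sub>G (trans_Pi a i u) \<cdot> trans_Pi a i (\<alpha> c u) = inv\<^sub>G (\<Psi> (f a u)) \<cdot> \<Psi> (f a (\<alpha> c u))" .
qed

abbreviation "hol_P \<equiv> hol PR star t"

lemma loopD:
 assumes "joins X p p \<gamma>"
 shows "pathin X \<gamma>" "\<gamma> 0 \<in> star a0" "\<gamma> 1 \<in> star a0"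
 using assms a0 by (auto simp: joins_def)

text \<open>\<open>\<Psi>\<close> maps the bundle \<open>t\<close> to the bundle \<open>t'\<close> up to a constant change of frame \<open>g a\<close> in each star. So the holonomy in \<open>t\<close>
 determines the holonomy in \<open>t'\<close>, which is the class of the loop.\<close>
lemma holonomy_determines_class:
 assumes \<gamma>: "joins X p p \<gamma>" and \<delta>: "joins X p p \<delta>" and eq: "hol_P \<gamma> a0 a0 = hol_P \<delta> a0 a0"
 shows "loop_class X p \<gamma> = loop_class X p \<delta>"
proof -
 obtain g where g: "!!a. g a \<in> carrier PG" "!!a u. u \<in> V ==> trans_Pi a i u = g a \<cdot> \<Psi> (f a u)"
  using trans_Psi by metis
 note r = ray_path[OF a0] and c = joins_const[OF p]
 define A where "A = path_quotient X p (ray a0 p) (\<lambda>_. p)"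
 have Ac: "A \<in> carrier PG" unfolding A_def by (rule path_quotient_closed[OF r c])
 have quotient: "A \<cdot> inv\<^sub>G (path_quotient X p (ray a0 p) \<gamma>) = g a0 \<cdot> \<Psi> (hol_P \<gamma> a0 a0) \<cdot> inv\<^sub>G (g a0)"
  if \<gamma>: "joins X p p \<gamma>" for \<gamma>
 proof -
  note lp = loopD[OF \<gamma>]
  obtain s where s: "path_section PR star t \<gamma> s" using path_section_exists[OF group_PR t_cocycle lp(1)] by blast
  have s': "path_section PG star t' \<gamma> (\<lambda>a r. g a \<cdot> \<Psi> (s a r))"
  proof (rule global_sectionI, unfold topspace_euclidean_subtopology vimage_eq)
   fix a r assume r: "r \<in> {0..1::real}" "\<gamma> r \<in> star a"
   have sc: "s b r \<in> carrier PR" if "\<gamma> r \<in> star b" for b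
    using section_closed[OF s, of r b] r(1) that by simp
   show "g a \<cdot> \<Psi> (s a r) \<in> carrier PG" using sc[OF r(2)] g(1) by simp
   fix b assume b: "\<gamma> r \<in> star b"
   have u: "tet (\<gamma> r) \<in> V" using tet[of "\<gamma> r"] b by (simp add: star_def)
   have "s a r = t a b (\<gamma> r) \<star> s b r" using section_transition[OF s, of r a b] r b by simp
   hence "\<Psi> (s a r) = \<Psi> (f a (tet (\<gamma> r))) \<cdot> inv\<^sub>G (\<Psi> (f b (tet (\<gamma> r)))) \<cdot> \<Psi> (s b r)"
    using f(1)[OF u] sc[OF b] by (simp add: t_def)
   thus "g a \<cdot> \<Psi> (s a r) = t' a b (\<gamma> r) \<cdot> (g b \<cdot> \<Psi> (s b r))"
    using g(1) f(1)[OF u] sc[OF b]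
    by (simp add: t'_def g(2)[OF u] PG.m_assoc PG.inv_mult_group PG.inv_mult_cancel)
  next
   fix a z
   have "{r \<in> {0..1}. \<gamma> r \<in> star a \<and> g a \<cdot> \<Psi> (s a r) = z} =
     (\<Union>y\<in>{y. g a \<cdot> \<Psi> y = z}. {r \<in> {0..1}. \<gamma> r \<in> star a \<and> s a r = y})" by blast
   moreover have "openin \<I> {r \<in> {0..1}. \<gamma> r \<in> star a \<and> s a r = y}" for y
    using section_fibre_open[OF s, of a y] by simp
   ultimately show "openin \<I> {r \<in> {0..1}. \<gamma> r \<in> star a \<and> g a \<cdot> \<Psi> (s a r) = z}"
    by auto
  qed
  have s'': "path_section PG star t' \<gamma> (\<lambda>a r. path_quotient X p (ray a (\<gamma> r)) (initial \<gamma> r))"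
   by (rule path_section_cong[OF path_section_Pi[OF \<gamma>]]) (rule t'_at)
  have cl: "s a0 0 \<in> carrier PR" "s a0 1 \<in> carrier PR"
   using section_closed[OF s, of 0 a0] section_closed[OF s, of 1 a0] lp by auto
  have "A \<cdot> inv\<^sub>G (path_quotient X p (ray a0 p) \<gamma>) = hol PG star t' \<gamma> a0 a0"
   unfolding hol_eq[OF group_Pi t'_cocycle lp(1) s'' lp(2,3)] using \<gamma> by (simp add: A_def initial_def joins_def)
  also have "\<dots> = (g a0 \<cdot> \<Psi> (s a0 0)) \<cdot> inv\<^sub>G (g a0 \<cdot> \<Psi> (s a0 1))"
   by (rule hol_eq[OF group_Pi t'_cocycle lp(1) s' lp(2,3)])
  also have "\<dots> = g a0 \<cdot> \<Psi> (hol_P \<gamma> a0 a0) \<cdot> inv\<^sub>G (g a0)"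
   unfolding hol_eq[OF group_PR t_cocycle lp(1) s lp(2,3)] using g(1) cl by (simp add: PG.m_assoc PG.inv_mult_group)
  finally show ?thesis .
 qed
 have cls: "loop_class X p \<gamma> = inv\<^sub>G (path_quotient X p (ray a0 p) \<gamma>) \<cdot> A" if \<gamma>: "joins X p p \<gamma>" for \<gamma>
  using path_quotient_mult[OF r \<gamma> c] path_quotient_const[OF \<gamma>] path_quotient_closed[OF r \<gamma>] loop_class_in_carrier[OF \<gamma>]
  by (metis A_def PG.inv_mult_cancel)
 have "inv\<^sub>G (path_quotient X p (ray a0 p) \<gamma>) = inv\<^sub>G (path_quotient X p (ray a0 p) \<delta>)"
  using quotient[OF \<gamma>] quotient[OF \<delta>] eq Ac path_quotient_closed[OF r \<gamma>] path_quotient_closed[OF r \<delta>]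
  by (metis PG.inv_mult_cancel PG.inv_closed)
 thus ?thesis using cls[OF \<gamma>] cls[OF \<delta>] by simp
qed

lemma vert_in: "vert a \<in> star a" "vert a \<in> topspace X"
 using vert_star[OF u0(1), of a] by (auto simp: star_def)

lemma hol_P_const: "x \<in> star a ==> hol_P (\<lambda>_. x) a a = \<one>\<^sub>R"
 using hol_in_chart[OF group_PR t_cocycle, of "\<lambda>_. x" a a a] cocycle_self[OF group_PR t_cocycle, of x a]
 by (simp add: pathin_def star_def)

lemma hol_P_rev:
 assumes \<gamma>: "joins X x z \<gamma>" and ab: "x \<in> star a" "z \<in> star b"
 shows "hol_P (rev_path \<gamma>) b a = inv\<^sub>R (hol_P \<gamma> a b)"
proof -
 note \<gamma>' = joins_rev[OF \<gamma>]
 have "hol_P \<gamma> a b \<star> hol_P (rev_path \<gamma>) b a = hol_P (concat_path \<gamma> (rev_path \<gamma>)) a a"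
  using \<gamma> \<gamma>' ab by (intro hol_concat[OF group_PR t_cocycle, symmetric]) (auto simp: joins_def)
 also have "\<dots> = \<one>\<^sub>R"
  using hol_homotopic[OF group_PR t_cocycle concat_rev[OF \<gamma>, unfolded path_homotopic_def] ab(1,1)] hol_P_const[OF ab(1)] by simp
 finally have "hol_P \<gamma> a b \<star> hol_P (rev_path \<gamma>) b a = \<one>\<^sub>R" .
 moreover have "hol_P \<gamma> a b \<in> carrier PR" "hol_P (rev_path \<gamma>) b a \<in> carrier PR"
  using \<gamma> \<gamma>' ab by (auto simp: joins_def intro!: hol_closed[OF group_PR t_cocycle])
 ultimately show ?thesis by (metis PR.inv_mult_cancel PR.r_one PR.inv_closed)
qed

lemma hol_P_base: "hol_P (d a) a0 a \<in> carrier PR"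
 using d[of a] a0 vert_in by (auto simp: joins_def intro!: hol_closed[OF group_PR t_cocycle])

lemma hol_P_ray:
 assumes x: "x \<in> star a" "x \<in> star b"
 shows "hol_P (ray a x) a0 b = hol_P (d a) a0 a \<star> t a b x"
proof -
 have s: "pathin X (spoke a x)" "spoke a x 0 = vert a" "spoke a x 1 = x"
  using spoke_path[OF x(1)] by (auto simp: joins_def)
 have "hol_P (spoke a x) a b = t a a (vert a) \<star> t a b x"
  using hol_in_chart[OF group_PR t_cocycle s(1), of a b a] s vert_in x spoke_in_star[OF x(1)] by (auto simp: Pi_iff)
 hence "hol_P (spoke a x) a b = t a b x"
  using cocycle_self[OF group_PR t_cocycle vert_in(2,1)] cocycle_closed[OF t_cocycle _ x] x by (simp add: star_def)
 moreover have "hol_P (ray a x) a0 b = hol_P (d a) a0 a \<star> hol_P (spoke a x) a b"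
  unfolding ray_def using d[of a] s a0 vert_in x
  by (intro hol_concat[OF group_PR t_cocycle]) (auto simp: joins_def)
 ultimately show ?thesis by simp
qed

text \<open>The two rays contribute the constants of their base paths; the change from the star of \<open>i\<close> to the star of \<open>j\<close> at the
 center of \<open>u\<close> contributes the letter.\<close>
lemma hol_P_generator:
 assumes u: "u \<in> V"
 shows "hol_P (concat_path (ray i (center u)) (rev_path (ray j (center u)))) a0 a0 =
  hol_P (d i) a0 i \<star> Y_P (K u) \<star> inv\<^sub>R (hol_P (d j) a0 j)"
proof -
 let ?m = "center u"
 have m: "?m \<in> star a" "?m \<in> tetra u" for a
  using center_star[OF u] bary_simp[of UNIV] by (auto simp: center_def)
 note rays = ray_path[OF m(1)[of i]] ray_path[OF m(1)[of j]]
 have "t i i ?m = \<one>\<^sub>R" "t j i ?m = inv\<^sub>R (Y_P (K u))"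
  using t_at[OF u m(2) m(1) m(1)] f(2,3)[OF u] letter_class_closed[OF R_carrier] by simp_all
 hence "hol_P (ray i ?m) a0 i = hol_P (d i) a0 i"
  "hol_P (rev_path (ray j ?m)) i a0 = Y_P (K u) \<star> inv\<^sub>R (hol_P (d j) a0 j)"
  using hol_P_ray[OF m(1) m(1), of i i] hol_P_ray[OF m(1) m(1), of j i] hol_P_rev[OF rays(2) a0 m(1), of i]
   hol_P_base letter_class_closed[OF R_carrier] by (simp_all add: PR.inv_mult_group)
 moreover have "hol_P (concat_path (ray i ?m) (rev_path (ray j ?m))) a0 a0 =
   hol_P (ray i ?m) a0 i \<star> hol_P (rev_path (ray j ?m)) i a0"
  using rays(1) joins_rev[OF rays(2)] a0 m(1)
  by (intro hol_concat[OF group_PR t_cocycle]) (auto simp: joins_def)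
 ultimately show ?thesis using hol_P_base letter_class_closed[OF R_carrier] by (simp add: PR.m_assoc)
qed

text \<open>The holonomy \<open>\<eta>\<close> is injective by \<open>holonomy_determines_class\<close>. On generators \<open>\<eta> \<circ> \<Psi>\<close> is conjugation by \<open>?y\<close>, because \<open>base\<close>
 makes the two constants in \<open>hol_P_generator\<close> equal; hence \<open>\<eta>\<close> is onto.\<close>
lemma presentation_iso: "PR \<cong> PG"
proof -
 define \<eta> where "\<eta> C = hol_P (SOME \<gamma>. joins X p p \<gamma> \<and> C = loop_class X p \<gamma>) a0 a0" for C
 have eta: "\<eta> (loop_class X p \<gamma>) = hol_P \<gamma> a0 a0" if "joins X p p \<gamma>" for \<gamma>
 proof -
  define \<delta> where "\<delta> = (SOME \<delta>. joins X p p \<delta> \<and> loop_class X p \<gamma> = loop_class X p \<delta>)"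
  have "joins X p p \<delta> \<and> loop_class X p \<gamma> = loop_class X p \<delta>"
   unfolding \<delta>_def by (rule someI[of _ \<gamma>]) (use that in simp)
  hence "path_homotopic X p p \<gamma> \<delta>" using loop_class_eqD[OF that] by blast
  thus ?thesis unfolding \<eta>_def \<delta>_def[symmetric]
   using hol_homotopic[OF group_PR t_cocycle _ a0 a0] by (simp add: path_homotopic_def)
 qed
 have hom: "\<eta> \<in> hom PG PR"
 proof (rule homI; unfold carrier_fundamental_group)
  fix C assume "C \<in> loop_class X p ` {\<gamma>. joins X p p \<gamma>}"
  then obtain \<gamma> where \<gamma>: "joins X p p \<gamma>" "C = loop_class X p \<gamma>" by blast
  show "\<eta> C \<in> carrier PR" unfolding \<gamma>(2) eta[OF \<gamma>(1)] by (rule hol_closed[OF group_PR t_cocycle loopD[OF \<gamma>(1)]])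
  fix D assume "D \<in> loop_class X p ` {\<gamma>. joins X p p \<gamma>}"
  then obtain \<delta> where \<delta>: "joins X p p \<delta>" "D = loop_class X p \<delta>" by blast
  have "hol_P (concat_path \<gamma> \<delta>) a0 a0 = hol_P \<gamma> a0 a0 \<star> hol_P \<delta> a0 a0"
   using \<gamma>(1) \<delta>(1) a0 by (intro hol_concat[OF group_PR t_cocycle]) (auto simp: joins_def)
  thus "\<eta> (C \<cdot> D) = \<eta> C \<star> \<eta> D"
   unfolding \<gamma>(2) \<delta>(2) mult_fundamental_group[OF \<gamma>(1) \<delta>(1)] eta[OF \<gamma>(1)] eta[OF \<delta>(1)]
    eta[OF joins_concat[OF \<gamma>(1) \<delta>(1)]] .
 qed
 interpret eta: group_hom PG PR \<eta> by unfold_locales (rule hom)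
 have inj: "inj_on \<eta> (carrier PG)"
 proof (rule inj_onI; unfold carrier_fundamental_group; elim imageE CollectE)
  fix C D \<gamma> \<delta> assume *: "\<eta> C = \<eta> D" "C = loop_class X p \<gamma>" "joins X p p \<gamma>" "D = loop_class X p \<delta>" "joins X p p \<delta>"
  thus "C = D" using holonomy_determines_class[OF *(3,5)] eta by simp
 qed
 let ?y = "hol_P (d i) a0 i"
 have gen: "\<eta> (trans_Pi i j u) = ?y \<star> Y_P (K u) \<star> inv\<^sub>R (hol_P (d j) a0 j)" if u: "u \<in> V" for u
  using eta[OF joins_concat[OF ray_path joins_rev[OF ray_path]]] hol_P_generator[OF u] center_star[OF u]
  by (simp add: trans_Pi_def path_quotient_def)
 have "?y \<star> inv\<^sub>R (hol_P (d j) a0 j) = \<one>\<^sub>R"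
  using gen[OF u0(1)] base[OF u0] u0(2) hol_P_base by (simp add: letter_class_def)
 hence yj: "hol_P (d j) a0 j = ?y" using hol_P_base by (metis PR.inv_closed PR.inv_equality PR.inv_inv)
 define k where "k q = ?y \<star> q \<star> inv\<^sub>R ?y" for q
 have k: "k \<in> hom PR PR" by (rule homI) (simp_all add: k_def hol_P_base PR.m_assoc PR.inv_mult_cancel)
 have letters: "\<eta> (Y_Pi x) = k (Y_P x)" for x
 proof (cases "x \<in> S")
  case True
  then obtain u where "u \<in> V" "x = K u" using kappa_surj by blast
  thus ?thesis using gen Y_Pi_kappa yj by (simp add: k_def)
 qed (simp add: Y_Pi_def letter_class_def k_def hol_P_base)
 have "q \<in> \<eta> ` carrier PG" if q: "q \<in> carrier PR" for q
 proof -
  let ?q = "inv\<^sub>R ?y \<star> q \<star> ?y"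
  have qc: "?q \<in> carrier PR" using q hol_P_base by simp
  have "(\<eta> \<circ> \<Psi>) ?q = k ?q"
   using Psi(2) letters by (intro presented_group_hom_eqI[OF group_PR hom_compose[OF Psi(1) hom] k _ qc]) simp
  also have "\<dots> = q" using q hol_P_base by (simp add: k_def PR.m_assoc PR.mult_inv_cancel)
  finally show ?thesis using qc by (intro image_eqI[of _ _ "\<Psi> ?q"]) simp_all
 qed
 hence "\<eta> \<in> iso PG PR" using hom inj by (auto simp: iso_def bij_betw_def)
 thus ?thesis using PG.iso_sym by (auto simp: is_iso_def)
qed

end

theorem fundamental_group_presentation: "PR \<cong> PG"
proof -
 obtain \<Psi> where Psi: "\<Psi> \<in> hom PR PG" "!!x. \<Psi> (Y_P x) = Y_Pi x" using Psi_exists by blast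
 obtain a0 where a0: "p \<in> star a0" using star_cover p by blast
 have Y_P1: "Y_P x = \<one>\<^sub>R" if "x \<notin> S" for x using that by (simp add: letter_class_def)
 show ?thesis
  by (rule potentials_exist[OF distinct V_ne kappa_orb group_PR letter_class_closed[OF R_carrier] Y_P1 relators_P])
   (assumption+, rule presentation_iso[OF Psi _ _ _ _ a0])
qed

end

section \<open>The weight of the fundamental group\<close>

context tetrahedra begin

text \<open>Choose the paths to all vertices through the center of \<open>m\<close>.\<close>
lemma transitions_from_center:
 assumes p: "p \<in> topspace X" and m: "m \<in> V"
 obtains d where "based_tetrahedra X V \<phi> \<beta> p d"
  "!!a b. based_tetrahedra.trans_Pi X V \<phi> \<beta> p d a b m = \<one>\<^bsub>fundamental_group X p\<^esub>"
proof -
 define c where "c = \<phi> m (bary UNIV)"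
 have bm: "bary UNIV \<in> \<Delta>" "supp (bary UNIV) = (UNIV :: 'c set)" by (rule bary_simp supp_bary; simp)+
 have cs: "c \<in> star a" for a
  using phi_topspace[OF m bm(1)] beta_phi[OF m bm(1)] bm(2) by (simp add: star_supp c_def)
 obtain a0 where a0: "p \<in> star a0" using star_cover p by blast
 define P0 where "P0 = concat_path (rev_path (spoke a0 p)) (spoke a0 c)"
 have P0: "joins X p c P0"
  unfolding P0_def by (rule joins_concat[OF joins_rev[OF spoke_path[OF a0]] spoke_path[OF cs]])
 define d where "d a = concat_path P0 (rev_path (spoke a c))" for a
 have d: "joins X p (vert a) (d a)" for a
  unfolding d_def by (rule joins_concat[OF P0 joins_rev[OF spoke_path[OF cs]]])
 interpret B: based_tetrahedra X V \<phi> \<beta> p d by unfold_locales (rule p, rule d)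
 have ray: "path_homotopic X p c (B.ray a c) P0" for a
 proof -
  note s = spoke_path[OF cs[of a]]
  have "path_homotopic X p c (B.ray a c) (concat_path P0 (concat_path (rev_path (spoke a c)) (spoke a c)))"
   unfolding B.ray_def d_def by (rule concat_assoc[OF P0 joins_rev[OF s] s])
  also have "path_homotopic X p c \<dots> (concat_path P0 (\<lambda>_. c))"
   by (rule path_homotopic_concat[OF path_homotopic_refl[OF P0] concat_rev_left[OF s]])
  also have "path_homotopic X p c \<dots> P0" by (rule concat_const_right[OF P0])
  finally show ?thesis .
 qed
 have "B.trans_Pi a b m = \<one>\<^bsub>fundamental_group X p\<^esub>" for a b
  unfolding B.trans_Pi_def B.center_def c_def[symmetric]
  using path_quotient_cong[OF ray ray] path_quotient_self[OF P0] by simp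
 thus ?thesis using that B.based_tetrahedra_axioms by blast
qed

text \<open>The cycle of colours \<open>k, l\<close> numbered \<open>s\<close> is the omitted generator. A relator is read from an arbitrary vertex \<open>rep C\<close> of its cycle.\<close>
theorem fundamental_group_weight:
 assumes ne: "V \<noteq> {}" and p: "p \<in> topspace X"
 shows "group_weight (fundamental_group X p) \<le> card V"
proof -
 obtain i j k l where d: "distinct [i, j, k, l]" and small: "6 * card (I.orbs {i, j}) \<le> card V + 4"
  by (rule small_pair[OF ne])
 have opp: "card (I.orbs {i, j}) = card (I.orbs {k, l})" by (rule opposite_orbs[OF ne d])
 have pos: "card (I.orbs {k, l}) > 0"
  using ne I.finite_orbs by (simp add: card_gt_0_iff I.orbs_def)
 define s where "s = card (I.orbs {k, l}) - 1"
 have s: "card (I.orbs {k, l}) = Suc s" using pos by (simp add: s_def)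
 obtain e where e: "bij_betw e (I.orbs {k, l}) {..s}"
  using finite_same_card_bij[OF I.finite_orbs, of "{..s}" "{k, l}"] s by auto
 define K where "K u = e (I.orb {k, l} u)" for u
 define S where "S = {..<s}"
 have orbs: "I.orb {k, l} u \<in> I.orbs {k, l}" if "u \<in> V" for u using that by (simp add: I.orbs_def)
 have kappa: "K u = K v \<longleftrightarrow> v \<in> I.orb {k, l} u" if uv: "u \<in> V" "v \<in> V" for u v
 proof -
  have "K u = K v \<longleftrightarrow> I.orb {k, l} u = I.orb {k, l} v"
   unfolding K_def by (rule inj_on_eq_iff[OF bij_betw_imp_inj_on[OF e] orbs[OF uv(1)] orbs[OF uv(2)]])
  also have "\<dots> \<longleftrightarrow> v \<in> I.orb {k, l} u" using I.orb_eq[OF uv(1)] I.orb_refl[of v "{k, l}"] by metis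
  finally show ?thesis .
 qed
 have kappa_im: "K ` V = {..s}"
  using bij_betw_imp_surj_on[OF e] by (simp add: K_def I.orbs_def image_image)
 then obtain u\<^sub>0 where u0: "u\<^sub>0 \<in> V" "K u\<^sub>0 = s" by (metis atMost_iff imageE order_refl)
 have same: "K v = K u" if "u \<in> V" "v \<in> I.orb {k, l} u" for u v
  using kappa[OF that(1) subsetD[OF I.orb_subset[OF that(1)] that(2)]] that(2) by simp
 obtain d' where B: "based_tetrahedra X V \<phi> \<beta> p d'"
  and base: "!!a b. based_tetrahedra.trans_Pi X V \<phi> \<beta> p d' a b u\<^sub>0 = \<one>\<^bsub>fundamental_group X p\<^esub>"
  by (rule transitions_from_center[OF p u0(1)]) blast
 interpret B: based_tetrahedra X V \<phi> \<beta> p d' by (rule B)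
 define J where "J = I.orbs {i, j}"
 define rep where "rep C = (SOME u. u \<in> V \<and> C = I.orb {i, j} u)" for C
 have rep: "rep C \<in> V" "C = I.orb {i, j} (rep C)" if "C \<in> J" for C
 proof -
  have "\<exists>u. u \<in> V \<and> C = I.orb {i, j} u" using that unfolding J_def I.orbs_def by blast
  from someI_ex[OF this] show "rep C \<in> V" "C = I.orb {i, j} (rep C)" unfolding rep_def by blast+
 qed
 define r where "r C = I.relator S K i j (rep C)" for C
 have rc: "r C \<in> words S" for C unfolding r_def by (rule I.relator_carrier)
 have dies: "eval_word Q Y (I.relator S K i j u) = \<one>\<^bsub>Q\<^esub>"
  if "group Q" "!!x. Y x \<in> carrier Q" "!!x. x \<notin> S ==> Y x = \<one>\<^bsub>Q\<^esub>" "u \<in> V" "eval_word Q Y (r (I.orb {i, j} u)) = \<one>\<^bsub>Q\<^esub>"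
  for Q :: "nat word set monoid" and Y u
 proof -
  have C: "I.orb {i, j} u \<in> J" using that(4) by (simp add: J_def I.orbs_def)
  have ij: "i \<noteq> j" using d by simp
  have "I.face {i, j} (rep (I.orb {i, j} u)) = I.face {i, j} u"
   unfolding I.face_def using rep(2)[OF C] by simp
  thus ?thesis
   using that(5) I.relator_trivial_iff[OF that(1-3) rep(1)[OF C] ij, where K = K] I.relator_trivial_iff[OF that(1-4) ij, where K = K]
   unfolding r_def by simp
 qed
 have relators: "I.relator S K i j u \<in> normal_closure S (r ` J)" if u: "u \<in> V" for u
 proof (rule in_normal_closureI)
  show "r ` J \<subseteq> words S" using rc by blast
  show "I.relator S K i j u \<in> words S" by (rule I.relator_carrier)
  fix Q :: "nat word set monoid" and Y
  assume Q: "group Q" "!!x. Y x \<in> carrier Q" "!!x. x \<notin> S ==> Y x = \<one>\<^bsub>Q\<^esub>" "!!w. w \<in> r ` J ==> eval_word Q Y w = \<one>\<^bsub>Q\<^esub>"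
  have "I.orb {i, j} u \<in> J" using u by (simp add: J_def I.orbs_def)
  thus "eval_word Q Y (I.relator S K i j u) = \<one>\<^bsub>Q\<^esub>" by (intro dies[OF Q(1-3) u] Q(4) imageI)
 qed
 have redundant: "normal_closure S (r ` (J - {C})) = normal_closure S (r ` J)" if C: "C \<in> J" for C
 proof (rule subset_antisym)
  have c: "r ` (J - {C}) \<subseteq> words S" "r ` J \<subseteq> words S" using rc by blast+
  show "normal_closure S (r ` (J - {C})) \<subseteq> normal_closure S (r ` J)"
   using normal_closure_superset[of "r ` J" S] by (intro normal_closure_subset c) blast
  have "r C \<in> normal_closure S (r ` (J - {C}))"
  proof (rule in_normal_closureI[OF c(1) rc])
   fix Q :: "nat word set monoid" and Y
   assume Q: "group Q" "!!x. Y x \<in> carrier Q" "!!x. x \<notin> S ==> Y x = \<one>\<^bsub>Q\<^esub>"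
    and z: "!!w. w \<in> r ` (J - {C}) ==> eval_word Q Y w = \<one>\<^bsub>Q\<^esub>"
   show "eval_word Q Y (r C) = \<one>\<^bsub>Q\<^esub>"
    unfolding r_def
   proof (rule relator_redundant[OF d ne same Q rep(1)[OF C]])
    fix u assume u: "u \<in> V" "u \<notin> I.orb {i, j} (rep C)"
    have "I.orb {i, j} u \<noteq> C" using u(2) rep(2)[OF C] I.orb_refl[of u "{i, j}"] by metis
    hence "I.orb {i, j} u \<in> J - {C}" using u(1) by (simp add: J_def I.orbs_def)
    thus "eval_word Q Y (I.relator S K i j u) = \<one>\<^bsub>Q\<^esub>" by (intro dies[OF Q u(1)] z imageI)
   qed
  qed
  hence "r ` J \<subseteq> normal_closure S (r ` (J - {C}))"
   using normal_closure_superset[of "r ` (J - {C})" S] by blast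
  thus "normal_closure S (r ` J) \<subseteq> normal_closure S (r ` (J - {C}))" by (rule normal_closure_subset[OF c(1)])
 qed
 interpret P: presented_tetrahedra X V \<phi> \<beta> p d' i j k l K S "r ` J" u\<^sub>0
 proof
  show "distinct [i, j, k, l]" by (rule d)
  show "K u = K v \<longleftrightarrow> v \<in> I.orb {k, l} u" if "u \<in> V" "v \<in> V" for u v by (rule kappa[OF that])
  show "S \<subseteq> K ` V" unfolding kappa_im S_def by auto
  show "u\<^sub>0 \<in> V" "K u\<^sub>0 \<notin> S" using u0 by (auto simp: S_def)
  show "r ` J \<subseteq> I.relator S K i j ` V" unfolding r_def using rep(1) by blast
  show "I.relator S K i j u \<in> normal_closure S (r ` J)" if "u \<in> V" for u by (rule relators[OF that])
  fix u assume u: "u \<in> V" "K u \<notin> S"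
  have "K u \<in> {..s}" using kappa_im u(1) by blast
  hence "K u\<^sub>0 = K u" using u(2) u0(2) by (simp add: S_def)
  hence "u \<in> I.orb {k, l} u\<^sub>0" using kappa[OF u0(1) u(1)] by simp
  hence "meet u\<^sub>0 u {i, j}" using d by (intro meet_orb[OF u0(1)]) auto
  thus "B.trans_Pi i j u = \<one>\<^bsub>fundamental_group X p\<^esub>"
   using B.trans_Pi_meet[OF u0(1) u(1), of i j] base by simp
 qed
 have "\<exists>R. (S, R) \<in> presentations (fundamental_group X p) (card S) \<and>
   presentation_weight S R \<le> (\<Sum>C\<in>J. lambda_weight (r C))"
 proof (rule presentation_from_relators)
  show "finite S" "finite J" by (auto simp: S_def J_def I.finite_orbs)
  show "card J = Suc (card S)" using opp s by (simp add: S_def J_def)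
  show "presented_group S (r ` J) \<cong> fundamental_group X p" by (rule P.fundamental_group_presentation)
 qed (rule rc, rule redundant)
 then obtain R where R: "(S, R) \<in> presentations (fundamental_group X p) (card S)"
  "presentation_weight S R \<le> (\<Sum>C\<in>J. lambda_weight (r C))" by blast
 have "(\<Sum>C\<in>J. lambda_weight (r C)) \<le> (\<Sum>C\<in>J. card C)"
 proof (rule sum_mono)
  fix C assume C: "C \<in> J"
  show "lambda_weight (r C) \<le> card C"
   using I.lambda_relator[OF rep(1)[OF C], of S K i j] rep(2)[OF C] unfolding r_def by simp
 qed
 also have "\<dots> = card V" unfolding J_def by (rule I.sum_card_orbs)
 finally have "presentation_weight S R \<le> card V" using R(2) by simp
 moreover have "6 * card S + 2 \<le> card V" using small opp s by (simp add: S_def)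
 ultimately show ?thesis by (rule group_weight_le[OF R(1) _ I.even_card_V])
qed

end

section \<open>Cones over the boundary of a simplex\<close>

definition face_simplex :: "'c set => (real^'c::finite) set" where
 "face_simplex A = {y \<in> \<Delta>. supp y \<subseteq> A}"

definition coordinate_space :: "'c set => (real^'c::finite) set" where
 "coordinate_space B = {y. supp y \<subseteq> B}"

lemma supp_subset_iff: "supp y \<subseteq> A \<longleftrightarrow> (\<forall>i. i \<notin> A --> y $ i = 0)"
 by (auto simp: supp_def)

lemma coordinate_space_iff: "y \<in> coordinate_space B \<longleftrightarrow> (\<forall>i. i \<notin> B --> y $ i = 0)"
 by (simp add: coordinate_space_def supp_subset_iff)

lemma subspace_coordinate_space: "subspace (coordinate_space B)"
 by (rule subspaceI) (auto simp: coordinate_space_iff)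

lemma supp_subset_closed: "closed {y :: real^'c::finite. supp y \<subseteq> A}"
proof -
 have "{y :: real^'c. supp y \<subseteq> A} = (\<Inter>i\<in>- A. {y. y $ i = 0})" by (auto simp: supp_def)
 thus ?thesis by (auto intro!: closed_INT closed_Collect_eq continuous_intros)
qed

lemma convex_supp_subset: "convex {y :: real^'c::finite. supp y \<subseteq> A}"
 by (rule convexI) (auto simp: supp_subset_iff)

lemma convex_face_simplex: "convex (face_simplex A)"
proof -
 have "face_simplex A = \<Delta> \<inter> {y. supp y \<subseteq> A}" by (auto simp: face_simplex_def)
 thus ?thesis by (simp add: convex_Int convex_simp convex_supp_subset)
qed

lemma bary_face: "A \<noteq> {} ==> bary A \<in> face_simplex A"
 by (simp add: face_simplex_def bary_simp supp_bary)

lemma sum_face: "y \<in> face_simplex A ==> (\<Sum>i\<in>A. y $ i) = 1"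
proof -
 assume y: "y \<in> face_simplex A"
 have "(\<Sum>i\<in>A. y $ i) = (\<Sum>i\<in>UNIV. y $ i)"
  by (rule sum.mono_neutral_left) (use y in \<open>auto simp: face_simplex_def supp_def\<close>)
 thus ?thesis using y by (simp add: face_simplex_def std_simplex_def)
qed

lemma cone_radius_le:
 assumes A: "A \<noteq> {}" and b: "b \<in> face_simplex A" "b' \<in> face_simplex A" "supp b' \<noteq> A" and r: "0 \<le> r"
  and eq: "bary A + r *\<^sub>R (b - bary A) = bary A + r' *\<^sub>R (b' - bary A)"
 shows "r' \<le> r"
proof -
 obtain a where a: "a \<in> A" "b' $ a = 0" using b(2,3) by (auto simp: face_simplex_def supp_def)
 have n: "0 < real (card A)" using A by (simp add: card_gt_0_iff)
 have "(bary A + r *\<^sub>R (b - bary A)) $ a = (bary A + r' *\<^sub>R (b' - bary A)) $ a" using eq by simp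
 hence "r * (b $ a) + r' / card A = r / card A" using a by (simp add: bary_def algebra_simps)
 moreover have "0 \<le> r * (b $ a)" using r b(1) simp_nonneg[of b a] by (simp add: face_simplex_def)
 ultimately have "r' / card A \<le> r / card A" by simp
 thus ?thesis using n by (simp add: divide_le_cancel)
qed

text \<open>A point of the face with labels \<open>A\<close> other than the barycenter has unique polar coordinates \<open>r\<close> and \<open>b\<close>, where \<open>b\<close> lies on the
 boundary.\<close>
lemma cone_unique:
 assumes "A \<noteq> {}" "b \<in> face_simplex A" "supp b \<noteq> A" "b' \<in> face_simplex A" "supp b' \<noteq> A" "0 \<le> r" "0 \<le> r'"
  and eq: "bary A + r *\<^sub>R (b - bary A) = bary A + r' *\<^sub>R (b' - bary A)"
 shows "r = r'" "r \<noteq> 0 ==> b = b'"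
proof -
 show "r = r'"
  using cone_radius_le[OF assms(1,2,4,5,6) eq] cone_radius_le[OF assms(1,4,2,3,7) eq[symmetric]] by simp
 thus "r \<noteq> 0 ==> b = b'" using eq by simp
qed

lemma cone_surj:
 fixes y :: "real^'c::finite"
 assumes A: "A \<noteq> {}" and y: "y \<in> face_simplex A" "y \<noteq> bary A"
 obtains r b where "0 < r" "r \<le> 1" "b \<in> face_simplex A" "supp b \<noteq> A" "y = bary A + r *\<^sub>R (b - bary A)"
proof -
 define n where "n = real (card A)"
 have n: "0 < n" using A by (simp add: n_def card_gt_0_iff)
 define m where "m = Min ((\<lambda>i. y $ i) ` A)"
 have ys: "y \<in> \<Delta>" "supp y \<subseteq> A" using y by (auto simp: face_simplex_def)
 have m: "m \<le> y $ i" if "i \<in> A" for i unfolding m_def using that by simp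
 have "m \<in> (\<lambda>i. y $ i) ` A" unfolding m_def using A by (intro Min_in) auto
 then obtain a where a: "a \<in> A" "y $ a = m" by auto
 have m0: "0 \<le> m" using simp_nonneg[OF ys(1), of a] a by simp
 have nm: "n * m = (\<Sum>i\<in>A. m)" by (simp add: n_def)
 have le: "n * m \<le> 1" unfolding nm using m sum_face[OF y(1)] sum_mono[of A "\<lambda>_. m" "\<lambda>i. y $ i"] by simp
 have lt: "n * m < 1"
 proof (rule ccontr)
  assume "\<not> n * m < 1"
  hence e: "(\<Sum>i\<in>A. y $ i - m) = 0" using le sum_face[OF y(1)] nm by (simp add: sum_subtractf)
  have "y $ i = m" if "i \<in> A" for i
   using sum_nonneg_0[of A "\<lambda>i. y $ i - m" i] e m that by simp
  moreover have "m = 1 / n" using \<open>\<not> n * m < 1\<close> le n by (simp add: field_simps)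
  moreover have "y $ i = 0" if "i \<notin> A" for i using ys(2) that by (auto simp: supp_def)
  ultimately have "y = bary A" by (auto simp: vec_eq_iff bary_def n_def)
  thus False using y(2) by simp
 qed
 define r where "r = 1 - n * m"
 define b where "b = bary A + (1 / r) *\<^sub>R (y - bary A)"
 have r: "0 < r" "r \<le> 1" using lt n m0 by (auto simp: r_def)
 have bi: "b $ i = (if i \<in> A then (y $ i - m) / r else 0)" for i
 proof (cases "i \<in> A")
  case True
  have "1 / n + (y $ i - 1 / n) / r = (y $ i - m) / r"
   using r n by (simp add: field_simps) (simp add: r_def algebra_simps)
  thus ?thesis using True by (simp add: b_def bary_def n_def)
 next
  case False
  hence "y $ i = 0" using ys(2) by (auto simp: supp_def)
  thus ?thesis using False by (simp add: b_def bary_def)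
 qed
 have "(\<Sum>i\<in>UNIV. b $ i) = (\<Sum>i\<in>A. (y $ i - m) / r)"
  by (rule sum.mono_neutral_cong_right) (auto simp: bi)
 also have "\<dots> = (1 - n * m) / r"
  unfolding sum_divide_distrib[symmetric] sum_subtractf nm sum_face[OF y(1)] ..
 finally have "(\<Sum>i\<in>UNIV. b $ i) = 1" using r by (simp add: r_def)
 hence "b \<in> \<Delta>" using m r by (auto simp: std_simplex_def bi)
 moreover have "supp b \<subseteq> A" "a \<notin> supp b" using a by (auto simp: supp_def bi)
 moreover have "y = bary A + r *\<^sub>R (b - bary A)" using r by (simp add: b_def)
 ultimately show ?thesis using that[OF r, of b] a by (auto simp: face_simplex_def)
qed

lemma cone_supp:
 assumes A: "A \<noteq> {}" and b: "b \<in> face_simplex A" and r: "0 \<le> r" "r < 1"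
 shows "supp (bary A + r *\<^sub>R (b - bary A)) = A"
proof (cases "r = 0")
 case False
 have "bary A + r *\<^sub>R (b - bary A) = (1 - r) *\<^sub>R bary A + r *\<^sub>R b" by (simp add: algebra_simps)
 thus ?thesis
  using supp_combination[OF bary_simp[OF A], of b r] False r b supp_bary[OF A] by (auto simp: face_simplex_def)
qed (use supp_bary[OF A] in simp)

lemma cone_in: "A \<noteq> {} ==> b \<in> face_simplex A ==> 0 \<le> r ==> r \<le> 1 ==> bary A + r *\<^sub>R (b - bary A) \<in> face_simplex A"
 using convexD_alt[OF convex_face_simplex bary_face, of A b r] by (simp add: algebra_simps)

text \<open>The radial extension of a map from the unit sphere to the boundary of a simplex.\<close>
definition cone_map :: "'c set => (real^'c => real^'c) => real^'c => real^'c::finite" where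
 "cone_map A b z = bary A + norm z *\<^sub>R (b (z /\<^sub>R norm z) - bary A)"

lemma cone_map_continuous:
 fixes b :: "real^'c => real^'c::finite"
 assumes F: "compact F" "F \<subseteq> sphere 0 1" and b: "continuous_on F b"
  and C: "!!z. z \<in> C ==> z \<noteq> 0 ==> z /\<^sub>R norm z \<in> F"
 shows "continuous_on C (cone_map A b)"
proof -
 define k where "k x = b x - bary A" for x
 have k: "continuous_on F k" unfolding k_def by (intro continuous_intros b)
 hence "bounded (k ` F)" using F compact_continuous_image compact_imp_bounded by blast
 then obtain K where K: "!!x. x \<in> F ==> norm (k x) \<le> K" by (auto simp: bounded_iff)
 have "continuous_on C (\<lambda>z. norm z *\<^sub>R k (z /\<^sub>R norm z))"
  unfolding continuous_on_def
 proof
  fix z assume z: "z \<in> C"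
  show "((\<lambda>z. norm z *\<^sub>R k (z /\<^sub>R norm z)) \<longlongrightarrow> norm z *\<^sub>R k (z /\<^sub>R norm z)) (at z within C)"
  proof (cases "z = 0")
   case True
   have "\<forall>\<^sub>F x in at 0 within C. norm (norm x *\<^sub>R k (x /\<^sub>R norm x)) \<le> norm x * K"
    unfolding eventually_at by (intro exI[of _ 1]) (use K C in \<open>auto intro!: mult_left_mono\<close>)
   moreover have "((\<lambda>x. norm x * K) \<longlongrightarrow> 0) (at 0 within C)"
    using tendsto_mult_right[OF tendsto_norm[OF tendsto_ident_at[of "0::real^'c" C]], of K] by simp
   ultimately show ?thesis unfolding True by (simp add: Lim_null_comparison)
  next
   case False
   have "continuous_on (C - {0}) (\<lambda>z. norm z *\<^sub>R k (z /\<^sub>R norm z))"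
    by (intro continuous_intros continuous_on_compose2[OF k]) (use C in auto)
   hence "((\<lambda>z. norm z *\<^sub>R k (z /\<^sub>R norm z)) \<longlongrightarrow> norm z *\<^sub>R k (z /\<^sub>R norm z)) (at z within C - {0})"
    using z False by (auto simp: continuous_on_def)
   moreover have "at z within C - {0} = at z within C"
    by (rule at_within_nhd[of z "- {0}"]) (use False in auto)
   ultimately show ?thesis by simp
  qed
 qed
 thus ?thesis unfolding cone_map_def k_def by (intro continuous_on_add continuous_on_const)
qed

text \<open>The cone \<open>C\<close> over \<open>F\<close> is mapped homeomorphically onto the simplex. Its open part is the image, under \<open>f \<circ> lift\<close>, of an open
 simplex in the coordinate space and therefore open by invariance of domain; it is also closed in the open
 ball, hence all of it. So \<open>F\<close> is the whole sphere.\<close>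
lemma cone_extension:
 fixes b :: "real^'c => real^'c::finite"
 assumes a0: "a0 \<in> A" and F: "closed F" "F \<subseteq> sphere 0 1 \<inter> coordinate_space (A - {a0})"
  and b: "continuous_on F b" "inj_on b F" "b ` F = {y \<in> face_simplex A. supp y \<noteq> A}"
 shows "F = sphere 0 1 \<inter> coordinate_space (A - {a0})"
  and "continuous_on (cball 0 1 \<inter> coordinate_space (A - {a0})) (cone_map A b)"
  and "inj_on (cone_map A b) (cball 0 1 \<inter> coordinate_space (A - {a0}))"
  and "cone_map A b ` (cball 0 1 \<inter> coordinate_space (A - {a0})) = face_simplex A"
proof -
 let ?L = "coordinate_space (A - {a0})"
 have A: "A \<noteq> {}" using a0 by blast
 have cF: "compact F" using F compact_sphere by (metis compact_Int_closed inf.absorb_iff2 le_inf_iff)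
 have L0: "0 \<in> ?L" "!!r x. x \<in> ?L ==> r *\<^sub>R x \<in> ?L"
  using subspace_coordinate_space subspace_0 subspace_scale by blast+
 define C where "C = insert 0 ((\<lambda>(r, x). r *\<^sub>R x) ` ({0..1} \<times> F))"
 have C_iff: "z \<in> C \<longleftrightarrow> z = 0 \<or> (norm z \<le> 1 \<and> z /\<^sub>R norm z \<in> F)" for z
 proof
  assume "z \<in> C"
  thus "z = 0 \<or> (norm z \<le> 1 \<and> z /\<^sub>R norm z \<in> F)" using F(2) by (auto simp: C_def)
 next
  assume "z = 0 \<or> (norm z \<le> 1 \<and> z /\<^sub>R norm z \<in> F)"
  thus "z \<in> C"
  proof (elim disjE conjE)
   assume z: "norm z \<le> 1" "z /\<^sub>R norm z \<in> F"
   have "z = norm z *\<^sub>R (z /\<^sub>R norm z)" by (cases "z = 0") auto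
   thus "z \<in> C" unfolding C_def using z by (intro insertI2 image_eqI[of _ _ "(norm z, z /\<^sub>R norm z)"]) auto
  qed (simp add: C_def)
 qed
 have cC: "compact C"
  unfolding C_def
  by (intro compact_insert compact_continuous_image compact_Times cF) (auto simp: case_prod_unfold intro!: continuous_intros)
 have CD: "C \<subseteq> cball 0 1 \<inter> ?L"
 proof
  fix z assume z: "z \<in> C"
  then consider "z = 0" | "norm z \<le> 1" "z /\<^sub>R norm z \<in> F" using C_iff by blast
  thus "z \<in> cball 0 1 \<inter> ?L"
  proof cases
   case 2
   hence "z /\<^sub>R norm z \<in> ?L" using F(2) by blast
   from L0(2)[OF this, of "norm z"] have "z \<in> ?L" by (cases "z = 0") auto
   thus ?thesis using 2(1) by simp
  qed (simp add: L0(1))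
 qed
 let ?g = "cone_map A b"
 have contC: "continuous_on C ?g"
  using F(2) by (intro cone_map_continuous[OF cF _ b(1)]) (auto simp: C_iff)
 have bF: "b x \<in> face_simplex A" "supp (b x) \<noteq> A" if "x \<in> F" for x using b(3) that by auto
 have unit: "z /\<^sub>R norm z \<in> F" "norm z \<le> 1" if "z \<in> C" "z \<noteq> 0" for z using that C_iff by blast+
 have injC: "inj_on ?g C"
 proof (rule inj_onI)
  fix x y assume xy: "x \<in> C" "y \<in> C" "?g x = ?g y"
  show "x = y"
  proof (cases "x = 0 \<and> y = 0")
   case False
   define w where "w = (if x = 0 then y /\<^sub>R norm y else x /\<^sub>R norm x)"
   define w' where "w' = (if y = 0 then x /\<^sub>R norm x else y /\<^sub>R norm y)"
   have w: "w \<in> F" "w' \<in> F" using False unit xy by (auto simp: w_def w'_def)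
   have g: "?g x = bary A + norm x *\<^sub>R (b w - bary A)" "?g y = bary A + norm y *\<^sub>R (b w' - bary A)"
    by (auto simp: cone_map_def w_def w'_def)
   note u = cone_unique[OF A bF[OF w(1)] bF[OF w(2)] norm_ge_zero norm_ge_zero xy(3)[unfolded g]]
   have "x \<noteq> 0" "y \<noteq> 0" using u(1) False by auto
   moreover have "w = w'" using u(2) calculation b(2) w by (auto dest: inj_onD)
   ultimately show ?thesis using u(1) unfolding w_def w'_def by simp
  qed simp
 qed
 have imC: "?g ` C = face_simplex A"
 proof
  show "?g ` C \<subseteq> face_simplex A"
  proof (rule image_subsetI)
   fix z assume z: "z \<in> C"
   show "?g z \<in> face_simplex A"
   proof (cases "z = 0")
    case False
    thus ?thesis unfolding cone_map_def using unit[OF z False] bF by (intro cone_in[OF A]) auto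
   qed (simp add: cone_map_def bary_face[OF A])
  qed
  show "face_simplex A \<subseteq> ?g ` C"
  proof
   fix y assume y: "y \<in> face_simplex A"
   show "y \<in> ?g ` C"
   proof (cases "y = bary A")
    case True
    thus ?thesis by (intro image_eqI[of _ _ 0]) (auto simp: cone_map_def C_def)
   next
    case False
    obtain r b' where rb: "0 < r" "r \<le> 1" "b' \<in> face_simplex A" "supp b' \<noteq> A" "y = bary A + r *\<^sub>R (b' - bary A)"
     by (rule cone_surj[OF A y False])
    hence "b' \<in> b ` F" unfolding b(3) by blast
    then obtain x where x: "x \<in> F" "b' = b x" by blast
    have "norm x = 1" using x F(2) by auto
    thus ?thesis using rb x
     by (intro image_eqI[of _ _ "r *\<^sub>R x"]) (auto simp: cone_map_def C_iff)
   qed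
  qed
 qed
 have g_supp: "supp (?g z) = A \<longleftrightarrow> norm z < 1" if z: "z \<in> C" for z
 proof (cases "z = 0")
  case False
  note u = unit[OF z False]
  show ?thesis
  proof (cases "norm z < 1")
   case True
   thus ?thesis unfolding cone_map_def using cone_supp[OF A bF(1)[OF u(1)]] by simp
  next
   case False
   thus ?thesis unfolding cone_map_def using u bF(2)[OF u(1)] by simp
  qed
 qed (simp add: cone_map_def supp_bary[OF A])
 define f where "f = inv_into C ?g"
 have f: "f y \<in> C" "?g (f y) = y" if "y \<in> face_simplex A" for y
  using that unfolding f_def imC[symmetric] by (auto intro: inv_into_into f_inv_into_f)
 have contf: "continuous_on (face_simplex A) f"
  unfolding f_def imC[symmetric] by (rule continuous_on_inv[OF contC cC]) (simp add: injC)
 have injf: "inj_on f (face_simplex A)"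
  unfolding f_def imC[symmetric] by (rule inj_on_inv_into) simp
 define lift where "lift x = x + (1 - (\<Sum>i\<in>UNIV. x $ i)) *\<^sub>R axis a0 1" for x :: "real^'c"
 define S where "S = ?L \<inter> ({x. \<forall>i\<in>A - {a0}. 0 < x $ i} \<inter> {x. (\<Sum>i\<in>UNIV. x $ i) < 1})"
 have lift_nth: "lift x $ i = (if i = a0 then 1 - (\<Sum>i\<in>UNIV. x $ i) + x $ a0 else x $ i)" for x i
  by (simp add: lift_def axis_def)
 have sum_lift: "(\<Sum>i\<in>UNIV. lift x $ i) = 1" for x
  by (simp add: lift_def sum.distrib axis_def flip: sum_distrib_left)
 have lift: "lift x \<in> face_simplex A" "supp (lift x) = A" if x: "x \<in> S" for x
 proof -
  have z: "x $ i = 0" if "i \<notin> A - {a0}" for i using x that by (auto simp: S_def coordinate_space_def supp_def)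
  have "lift x $ i = 0" if "i \<notin> A" for i using that z[of i] a0 by (auto simp: lift_nth)
  moreover have "0 < lift x $ i" if "i \<in> A" for i using that z[of a0] x by (auto simp: lift_nth S_def)
  ultimately have *: "!!i. lift x $ i = 0 \<longleftrightarrow> i \<notin> A" "!!i. 0 \<le> lift x $ i" by (metis less_irrefl, metis less_imp_le order_refl)
  thus "supp (lift x) = A" by (auto simp: supp_def)
  thus "lift x \<in> face_simplex A" using * sum_lift by (simp add: face_simplex_def std_simplex_def)
 qed
 have "openin (top_of_set ?L) ((f \<circ> lift) ` S)"
 proof (rule invariance_of_domain_affine_sets[where U = ?L])
  have "{x :: real^'c. \<forall>i\<in>A - {a0}. 0 < x $ i} = (\<Inter>i\<in>A - {a0}. {x. 0 < x $ i})" by auto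
  hence "open {x :: real^'c. \<forall>i\<in>A - {a0}. 0 < x $ i}"
   by (auto intro!: open_INT open_Collect_less continuous_intros)
  moreover have "open {x :: real^'c. (\<Sum>i\<in>UNIV. x $ i) < 1}" by (intro open_Collect_less continuous_intros)
  ultimately show "openin (top_of_set ?L) S" unfolding S_def by (intro openin_open_Int open_Int)
  show "affine ?L" by (rule subspace_imp_affine[OF subspace_coordinate_space])
  thus "affine ?L" .
  show "continuous_on S (f \<circ> lift)"
  proof (rule continuous_on_compose)
   show "continuous_on S lift" unfolding lift_def by (intro continuous_intros)
   show "continuous_on (lift ` S) f" using lift(1) by (intro continuous_on_subset[OF contf]) auto
  qed
  show "(f \<circ> lift) ` S \<subseteq> ?L"
  proof (rule image_subsetI)
   fix x assume x: "x \<in> S"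
   show "(f \<circ> lift) x \<in> ?L" using f(1)[OF lift(1)[OF x]] CD by auto
  qed
  show "inj_on (f \<circ> lift) S"
  proof (rule inj_onI)
   fix x y assume xy: "x \<in> S" "y \<in> S" "(f \<circ> lift) x = (f \<circ> lift) y"
   hence l: "lift x = lift y" using inj_onD[OF injf _ lift(1)[OF xy(1)] lift(1)[OF xy(2)]] by simp
   have z: "x $ a0 = 0" "y $ a0 = 0" using xy(1,2) by (auto simp: S_def coordinate_space_iff)
   have "x $ i = y $ i" for i
   proof (cases "i = a0")
    case True
    thus ?thesis using z by simp
   next
    case False
    thus ?thesis using lift_nth[of x i] lift_nth[of y i] l by simp
   qed
   thus "x = y" by (simp add: vec_eq_iff)
  qed
 qed simp
 moreover have "(f \<circ> lift) ` S = C \<inter> ball 0 1"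
 proof
  show "(f \<circ> lift) ` S \<subseteq> C \<inter> ball 0 1"
  proof (rule image_subsetI)
   fix x assume x: "x \<in> S"
   note fx = f[OF lift(1)[OF x]]
   show "(f \<circ> lift) x \<in> C \<inter> ball 0 1" using fx(1) g_supp[OF fx(1)] lift(2)[OF x] unfolding fx(2) by simp
  qed
  show "C \<inter> ball 0 1 \<subseteq> (f \<circ> lift) ` S"
  proof
   fix z assume z: "z \<in> C \<inter> ball 0 1"
   define y where "y = ?g z"
   have y: "y \<in> face_simplex A" "supp y = A" using z imC g_supp[of z] by (auto simp: y_def)
   have ysum: "(\<Sum>i\<in>UNIV. y $ i) = 1" using y(1) by (simp add: face_simplex_def std_simplex_def)
   define x where "x = y - (y $ a0) *\<^sub>R axis a0 1"
   have x: "x $ i = (if i = a0 then 0 else y $ i)" for i by (simp add: x_def axis_def)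
   have xsum: "(\<Sum>i\<in>UNIV. x $ i) = 1 - y $ a0"
    using sum.remove[of UNIV a0 "\<lambda>i. y $ i"] sum.remove[of UNIV a0 "\<lambda>i. x $ i"] ysum by (simp add: x)
   have ypos: "0 < y $ i" if "i \<in> A" for i
    using supp_pos[of y i] y that by (simp add: face_simplex_def)
   have "lift x = y" using xsum by (auto simp: vec_eq_iff lift_nth x)
   moreover have "x \<in> S"
    using ypos a0 xsum y(2) by (auto simp: S_def x coordinate_space_def supp_def)
   moreover have "f y = z" unfolding f_def y_def using injC z by simp
   ultimately show "z \<in> (f \<circ> lift) ` S" by (intro image_eqI[of _ _ x]) auto
  qed
 qed
 ultimately have op: "openin (top_of_set ?L) (C \<inter> ball 0 1)" by argo
 have conn: "connected (ball 0 1 \<inter> ?L)"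
  by (intro convex_connected convex_Int convex_ball subspace_imp_convex subspace_coordinate_space)
 have ball: "C \<inter> ball 0 1 = ball 0 1 \<inter> ?L"
 proof -
  have "openin (top_of_set (ball 0 1 \<inter> ?L)) (C \<inter> ball 0 1)"
   using CD by (intro openin_subset_trans[OF op]) auto
  moreover have "closedin (top_of_set (ball 0 1 \<inter> ?L)) (C \<inter> ball 0 1)"
  proof -
   have "C \<inter> ball 0 1 = ball 0 1 \<inter> ?L \<inter> C" using CD by blast
   thus ?thesis using compact_imp_closed[OF cC] by (metis closedin_closed_Int)
  qed
  moreover have "0 \<in> C \<inter> ball 0 1" by (simp add: C_def)
  ultimately show ?thesis using conn unfolding connected_clopen by blast
 qed
 show Feq: "F = sphere 0 1 \<inter> ?L"
 proof
  show "sphere 0 1 \<inter> ?L \<subseteq> F"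
  proof
   fix p :: "real^'c" assume p: "p \<in> sphere 0 1 \<inter> ?L"
   hence n: "norm p = 1" by simp
   have "(1/2) *\<^sub>R p \<in> ball 0 1 \<inter> ?L" using p n by (auto intro: L0(2))
   hence "(1/2) *\<^sub>R p \<in> C" using ball by blast
   moreover have "p \<noteq> 0" using n by auto
   ultimately show "p \<in> F" unfolding C_iff using n by simp
  qed
 qed (rule F(2))
 have "cball 0 1 \<inter> ?L \<subseteq> C"
 proof
  fix z assume z: "z \<in> cball 0 1 \<inter> ?L"
  thus "z \<in> C" unfolding C_iff Feq using L0(2)[of z "inverse (norm z)"] by (cases "z = 0") auto
 qed
 hence "C = cball 0 1 \<inter> ?L" using CD by blast
 thus "continuous_on (cball 0 1 \<inter> ?L) (cone_map A b)" "inj_on (cone_map A b) (cball 0 1 \<inter> ?L)"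
  "cone_map A b ` (cball 0 1 \<inter> ?L) = face_simplex A"
  using contC injC imC by auto
qed

section \<open>Barycentric coordinates on cells\<close>

lemma cell_chart:
 fixes W :: "'b topology" and B :: "'c::finite set"
 assumes c: "c \<subseteq> topspace W" and \<xi>: "homeomorphic_map (cball_space m) (subtopology W c) \<xi>" and B: "card B = m"
 obtains Z :: "real^'c => 'b" where
  "continuous_map (top_of_set (cball 0 1 \<inter> coordinate_space B)) W Z"
  "inj_on Z (cball 0 1 \<inter> coordinate_space B)" "Z ` (cball 0 1 \<inter> coordinate_space B) = c"
  "Z ` (sphere 0 1 \<inter> coordinate_space B) = \<xi> ` unit_sphere m"
proof -
 let ?L = "coordinate_space B :: (real^'c) set"
 have L: "?L = {y. \<forall>i. i \<notin> B --> y $ i = 0}" by (auto simp: coordinate_space_iff)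
 obtain b where b: "b \<subseteq> ?L" "pairwise orthogonal b" "!!x. x \<in> b ==> norm x = 1" "independent b"
  "card b = dim ?L" "span b = ?L"
  by (rule orthonormal_basis_subspace[OF subspace_coordinate_space[of B]]) (rule that)
 have "card b = m" using dim_substandard_cart[of B] B b(5) unfolding L dim_vec_eq[symmetric] by simp
 then obtain D E where DE: "homeomorphic_maps (Euclidean_space m) (top_of_set ?L) D E"
  "!!x. x \<in> topspace (Euclidean_space m) ==> (norm (D x))\<^sup>2 = (\<Sum>i<m. (x i)\<^sup>2)"
  using homeomorphic_maps_Euclidean_space_euclidean_gen[OF b(4,2) _ b(3)] unfolding b(6) by blast
 have D: "D x \<in> ?L" "E (D x) = x" if "x \<in> topspace (Euclidean_space m)" for x
  using DE(1) that by (auto simp: homeomorphic_maps_def continuous_map_into)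
 have E: "E y \<in> topspace (Euclidean_space m)" "D (E y) = y" "(\<Sum>i<m. (E y i)\<^sup>2) = (norm y)\<^sup>2" if y: "y \<in> ?L" for y
 proof -
  show 1: "E y \<in> topspace (Euclidean_space m)"
   using DE(1) y unfolding homeomorphic_maps_def by (auto dest!: continuous_map_funspace)
  show "D (E y) = y" using DE(1) y by (simp add: homeomorphic_maps_def)
  thus "(\<Sum>i<m. (E y i)\<^sup>2) = (norm y)\<^sup>2" using DE(2)[OF 1] by simp
 qed
 have inj: "inj_on E ?L" by (rule inj_on_inverseI[of _ D]) (rule E)
 have im: "E ` ({y. P ((norm y)\<^sup>2)} \<inter> ?L) = {x \<in> topspace (Euclidean_space m). P (\<Sum>i<m. (x i)\<^sup>2)}" for P
 proof
  show "{x \<in> topspace (Euclidean_space m). P (\<Sum>i<m. (x i)\<^sup>2)} \<subseteq> E ` ({y. P ((norm y)\<^sup>2)} \<inter> ?L)"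
   using D DE(2) by (intro subsetI, rule_tac x="D x" in image_eqI) auto
 qed (use E in auto)
 have "cball 0 1 = {y :: real^'c. (norm y)\<^sup>2 \<le> 1}" "sphere 0 1 = {y :: real^'c. (norm y)\<^sup>2 = 1}"
  by (simp_all add: set_eq_iff abs_square_eq_1 abs_square_le_1)
 hence cball: "E ` (cball 0 1 \<inter> ?L) = unit_cball m" and sphere: "E ` (sphere 0 1 \<inter> ?L) = unit_sphere m"
  unfolding unit_cball_def unit_sphere_def using im[of "\<lambda>r. r \<le> 1"] im[of "\<lambda>r. r = 1"] by simp_all
 have top: "topspace (cball_space m) = unit_cball m"
  by (auto simp: unit_cball_def)
 have hom: "inj_on \<xi> (unit_cball m)" "\<xi> ` unit_cball m = c" "continuous_map (cball_space m) W \<xi>"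
  using homeomorphic_imp_injective_map[OF \<xi>] homeomorphic_imp_surjective_map[OF \<xi>]
   homeomorphic_imp_continuous_map[OF \<xi>] c
  unfolding top by (auto simp: continuous_map_into)
 have "continuous_map (top_of_set ?L) (Euclidean_space m) E" using DE(1) by (simp add: homeomorphic_maps_def)
 hence Econt: "continuous_map (top_of_set (cball 0 1 \<inter> ?L)) (cball_space m) E"
  using cball by (auto simp: continuous_map_into intro: continuous_map_from_subtopology_mono)
 show ?thesis
 proof (rule that[of "\<xi> \<circ> E"])
  show "continuous_map (top_of_set (cball 0 1 \<inter> ?L)) W (\<xi> \<circ> E)"
   by (rule continuous_map_compose[OF Econt hom(3)])
  show "inj_on (\<xi> \<circ> E) (cball 0 1 \<inter> ?L)"
   using inj_on_subset[OF inj] hom(1) cball by (intro comp_inj_on) auto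
  show "(\<xi> \<circ> E) ` (cball 0 1 \<inter> ?L) = c" unfolding image_comp[symmetric] cball by (rule hom(2))
  show "(\<xi> \<circ> E) ` (sphere 0 1 \<inter> ?L) = \<xi> ` unit_sphere m" unfolding image_comp[symmetric] sphere ..
 qed
qed

text \<open>Coordinates on a closed subset of the boundary sphere that fill the boundary of a simplex extend to the cell, and the subset
 must then be the whole sphere.\<close>
lemma cell_extension:
 fixes W :: "'b topology" and \<beta> :: "'b => real^'c::finite"
 assumes W: "Hausdorff_space W" and c: "c \<subseteq> topspace W" and \<xi>: "homeomorphic_map (cball_space m) (subtopology W c) \<xi>"
  and A: "card A = Suc m" and F: "closedin W F" "F \<subseteq> \<xi> ` unit_sphere m"
  and \<beta>: "continuous_map (subtopology W F) euclidean \<beta>" "inj_on \<beta> F" "\<beta> ` F = {y \<in> face_simplex A. supp y \<noteq> A}"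
 shows "F = \<xi> ` unit_sphere m \<and> (\<exists>\<beta>'. continuous_map (subtopology W c) euclidean \<beta>' \<and> inj_on \<beta>' c \<and>
  \<beta>' ` c = face_simplex A \<and> (\<forall>x\<in>F. \<beta>' x = \<beta> x))"
proof -
 have "A \<noteq> {}" using A by auto
 then obtain a0 where a0: "a0 \<in> A" by blast
 let ?L = "coordinate_space (A - {a0}) :: (real^'c) set"
 let ?D = "cball 0 1 \<inter> ?L"
 have card: "card (A - {a0}) = m" using A a0 by simp
 obtain Z :: "real^'c => 'b" where Z: "continuous_map (top_of_set ?D) W Z" "inj_on Z ?D" "Z ` ?D = c"
  "Z ` (sphere 0 1 \<inter> ?L) = \<xi> ` unit_sphere m"
  by (rule cell_chart[OF c \<xi> card])
 have cL: "closed ?L" by (rule closed_subspace[OF subspace_coordinate_space])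
 have cD: "compact ?D" by (rule compact_Int_closed[OF compact_cball cL])
 define F' where "F' = {z \<in> sphere 0 1 \<inter> ?L. Z z \<in> F}"
 have "closedin (top_of_set ?D) {z \<in> topspace (top_of_set ?D). Z z \<in> F}"
  by (rule closedin_continuous_map_preimage[OF Z(1) F(1)])
 hence "closed {z \<in> ?D. Z z \<in> F}" using closedin_closed_eq[OF compact_imp_closed[OF cD]] by simp
 moreover have "F' = {z \<in> ?D. Z z \<in> F} \<inter> sphere 0 1" by (auto simp: F'_def)
 ultimately have clF': "closed F'" by (simp add: closed_Int)
 have F'im: "Z ` F' = F"
 proof
  show "F \<subseteq> Z ` F'" using F(2) unfolding Z(4)[symmetric] F'_def by blast
 qed (auto simp: F'_def)
 have F'D: "F' \<subseteq> ?D" by (auto simp: F'_def)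
 have "continuous_map (top_of_set F') (subtopology W F) Z"
  using continuous_map_from_subtopology_mono[OF Z(1) F'D] F'im F'D
  by (auto simp: continuous_map_into)
 from continuous_map_compose[OF this \<beta>(1)] have bc: "continuous_on F' (\<beta> \<circ> Z)" by simp
 have bi: "inj_on (\<beta> \<circ> Z) F'"
  using inj_on_subset[OF Z(2) F'D] \<beta>(2) F'im by (intro comp_inj_on) auto
 have bim: "(\<beta> \<circ> Z) ` F' = {y \<in> face_simplex A. supp y \<noteq> A}"
  unfolding image_comp[symmetric] F'im by (rule \<beta>(3))
 have F'sub: "F' \<subseteq> sphere 0 1 \<inter> ?L" by (auto simp: F'_def)
 note ext = cone_extension[OF a0 clF' F'sub bc bi bim]
 let ?g = "cone_map A (\<beta> \<circ> Z)"
 have Feq: "F = \<xi> ` unit_sphere m" unfolding F'im[symmetric] ext(1) by (rule Z(4))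
 have hom: "homeomorphic_map (top_of_set ?D) (subtopology W c) Z"
 proof (rule continuous_imp_homeomorphic_map)
  show "compact_space (top_of_set ?D)" using cD by (simp add: compact_space_subtopology)
  show "Hausdorff_space (subtopology W c)" by (rule Hausdorff_space_subtopology[OF W])
  show "continuous_map (top_of_set ?D) (subtopology W c) Z" using Z(1,3) by (auto simp: continuous_map_into)
  show "Z ` topspace (top_of_set ?D) = topspace (subtopology W c)" using Z(3) c by (simp add: Int_absorb1)
  show "inj_on Z (topspace (top_of_set ?D))" using Z(2) by simp
 qed
 then obtain Z' where Z': "homeomorphic_maps (top_of_set ?D) (subtopology W c) Z Z'"
  using homeomorphic_map_maps by blast
 have inv: "Z' x \<in> ?D \<and> Z (Z' x) = x" if x: "x \<in> c" for x
 proof -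
  have xc: "x \<in> topspace (subtopology W c)" using x c by auto
  have "continuous_map (subtopology W c) (top_of_set ?D) Z'" using Z' unfolding homeomorphic_maps_def by blast
  from continuous_map_image_subset_topspace[OF this] have "Z' x \<in> ?D" using xc by auto
  moreover have "Z (Z' x) = x" using Z' xc unfolding homeomorphic_maps_def by blast
  ultimately show ?thesis by blast
 qed
 have inv2: "Z' (Z z) = z" if "z \<in> ?D" for z using Z' that unfolding homeomorphic_maps_def by simp
 have im': "Z' ` c = ?D"
 proof
  show "?D \<subseteq> Z' ` c" using inv2 Z(3) by (metis image_eqI subsetI)
 qed (use inv in blast)
 have "continuous_map (subtopology W c) (top_of_set ?D) Z'" using Z' unfolding homeomorphic_maps_def by blast
 moreover have "continuous_map (top_of_set ?D) euclidean ?g" using ext(2) by simp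
 ultimately have "continuous_map (subtopology W c) euclidean (?g \<circ> Z')" by (rule continuous_map_compose)
 moreover have "inj_on (?g \<circ> Z') c"
 proof (rule comp_inj_on)
  show "inj_on Z' c" by (rule inj_on_inverseI[of _ Z]) (use inv in blast)
  show "inj_on ?g (Z' ` c)" unfolding im' by (rule ext(3))
 qed
 moreover have "(?g \<circ> Z') ` c = face_simplex A" unfolding image_comp[symmetric] im' by (rule ext(4))
 moreover have "\<forall>x\<in>F. (?g \<circ> Z') x = \<beta> x"
 proof
  fix x assume "x \<in> F"
  then obtain z where z: "z \<in> F'" "x = Z z" using F'im by blast
  have "norm z = 1" "Z' x = z" using z F'D inv2 by (auto simp: F'_def)
  thus "(?g \<circ> Z') x = \<beta> x" using z by (simp add: cone_map_def)
 qed
 ultimately show ?thesis using Feq by blast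
qed

text \<open>Each cell is labelled by its vertices: its faces are the nonempty subsets of its label, and a vertex is determined by its label.\<close>
locale labelled_cells =
 fixes \<C> :: "'b set set" and n :: "'b set => nat" and lab :: "'b set => 'c::finite set"
 assumes card_lab: "c \<in> \<C> ==> card (lab c) = Suc (n c)"
  and lab_mono: "c \<in> \<C> ==> e \<in> \<C> ==> e' \<in> \<C> ==> e \<subseteq> c ==> e' \<subseteq> c ==> e \<subseteq> e' \<longleftrightarrow> lab e \<subseteq> lab e'"
  and lab_surj: "c \<in> \<C> ==> B \<subseteq> lab c ==> B \<noteq> {} ==> \<exists>e\<in>\<C>. e \<subseteq> c \<and> lab e = B"
  and lab_vertex: "e \<in> \<C> ==> e' \<in> \<C> ==> lab e = {i} ==> lab e' = {i} ==> e = e'"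

locale simplicial_cells = labelled_cells \<C> n lab
 for W :: "'b topology" and \<C> and n and \<xi> :: "'b set => (nat => real) => 'b" and lab :: "'b set => 'c::finite set" +
 assumes Hausdorff: "Hausdorff_space W" and finite_cells: "finite \<C>"
  and cell_subset: "c \<in> \<C> ==> c \<subseteq> topspace W"
  and cell_map: "c \<in> \<C> ==> homeomorphic_map (cball_space (n c)) (subtopology W c) (\<xi> c)"
  and interiors_disjoint: "disjoint_family_on (\<lambda>c. \<xi> c ` unit_ball (n c)) \<C>"
  and interiors_cover: "(\<Union>c\<in>\<C>. \<xi> c ` unit_ball (n c)) = topspace W"
begin

abbreviation cell_interior :: "'b set => 'b set" where
 "cell_interior c \<equiv> \<xi> c ` unit_ball (n c)"

lemma cell_compact: "c \<in> \<C> ==> compactin W c"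
proof -
 assume c: "c \<in> \<C>"
 obtain Z :: "real^'c => 'b" and B where Z: "continuous_map (top_of_set (cball 0 1 \<inter> coordinate_space B)) W Z"
  "Z ` (cball 0 1 \<inter> coordinate_space B) = c"
 proof -
  obtain B where B: "B \<subseteq> lab c" "card B = n c"
   using obtain_subset_with_card_n[of "n c" "lab c"] card_lab[OF c] by auto
  show ?thesis by (rule cell_chart[OF cell_subset[OF c] cell_map[OF c] B(2)]) (rule that)
 qed
 have "compact (cball 0 1 \<inter> coordinate_space B :: (real^'c) set)"
  by (intro compact_Int_closed compact_cball closed_subspace subspace_coordinate_space)
 thus ?thesis
  using image_compactin[OF _ Z(1), of "cball 0 1 \<inter> coordinate_space B"] Z(2) by (simp add: compactin_subtopology)
qed

lemma cell_closed: "c \<in> \<C> ==> closedin W c"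
 by (rule compactin_imp_closedin[OF Hausdorff cell_compact])

lemma cell_decompose: "c \<in> \<C> ==> c = cell_interior c \<union> \<xi> c ` unit_sphere (n c)"
proof -
 assume c: "c \<in> \<C>"
 have "\<xi> c ` unit_cball (n c) = c"
  using homeomorphic_imp_surjective_map[OF cell_map[OF c]] cell_subset[OF c] by (auto simp: unit_cball_def)
 moreover have "unit_cball (n c) = unit_ball (n c) \<union> unit_sphere (n c)"
  by (auto simp: unit_cball_def unit_ball_def unit_sphere_def)
 ultimately show ?thesis by (metis image_Un)
qed

lemma interior_unique:
 "c \<in> \<C> ==> e \<in> \<C> ==> x \<in> cell_interior c ==> x \<in> cell_interior e ==> c = e"
 using interiors_disjoint by (auto simp: disjoint_family_on_def)

lemma lab_subset: "c \<in> \<C> ==> e \<in> \<C> ==> e \<subseteq> c ==> lab e \<subseteq> lab c"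
 using lab_mono[of c e c] by simp

lemma lab_psubset: "c \<in> \<C> ==> e \<in> \<C> ==> e \<subset> c ==> lab e \<subset> lab c"
 using lab_mono[of c e c] lab_mono[of c c e] by auto

lemma dim_less: "c \<in> \<C> ==> e \<in> \<C> ==> e \<subset> c ==> n e < n c"
 using psubset_card_mono[OF _ lab_psubset, of c e] card_lab by simp

lemma lab_inj: "c \<in> \<C> ==> e \<in> \<C> ==> e' \<in> \<C> ==> e \<subseteq> c ==> e' \<subseteq> c ==> lab e = lab e' ==> e = e'"
 using lab_mono[of c e e'] lab_mono[of c e' e] by auto

definition coordinates_on :: "('b => real^'c) => 'b set => bool" where
 "coordinates_on \<beta> c \<longleftrightarrow> continuous_map (subtopology W c) euclidean \<beta> \<and> inj_on \<beta> c \<and> \<beta> ` c = face_simplex (lab c)"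

lemma coordinates_on_cong:
 assumes "coordinates_on \<beta> c" "!!x. x \<in> c ==> \<beta>' x = \<beta> x"
 shows "coordinates_on \<beta>' c"
proof -
 have "continuous_map (subtopology W c) euclidean \<beta>'"
 proof (rule continuous_map_eq)
  show "continuous_map (subtopology W c) euclidean \<beta>" using assms(1) by (simp add: coordinates_on_def)
  show "\<beta> x = \<beta>' x" if "x \<in> topspace (subtopology W c)" for x using assms(2)[of x] that by simp
 qed
 moreover have "inj_on \<beta>' c"
  using assms(1) inj_on_cong[of c \<beta>' \<beta>, OF assms(2)] by (simp add: coordinates_on_def)
 moreover have "\<beta>' ` c = \<beta> ` c" using assms(2) by (rule image_cong[OF refl])
 ultimately show ?thesis using assms(1) by (simp add: coordinates_on_def)
qed

text \<open>The face that carries a point is read off from its support.\<close>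
lemma face_of_support:
 assumes c: "c \<in> \<C>" "x \<in> c" "coordinates_on \<beta> c" and good: "!!e. e \<in> \<C> ==> e \<subseteq> c ==> coordinates_on \<beta> e"
 obtains e where "e \<in> \<C>" "e \<subseteq> c" "lab e = supp (\<beta> x)" "x \<in> e"
proof -
 have bx: "\<beta> x \<in> face_simplex (lab c)" using c(2,3) unfolding coordinates_on_def by blast
 hence "supp (\<beta> x) \<subseteq> lab c" "supp (\<beta> x) \<noteq> {}" by (auto simp: face_simplex_def dest: supp_nonempty)
 then obtain e where e: "e \<in> \<C>" "e \<subseteq> c" "lab e = supp (\<beta> x)" using lab_surj[OF c(1)] by blast
 have "\<beta> x \<in> face_simplex (lab e)" using bx e(3) by (simp add: face_simplex_def)
 hence "\<beta> x \<in> \<beta> ` e" using good[OF e(1,2)] by (simp add: coordinates_on_def)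
 then obtain x' where "x' \<in> e" "\<beta> x' = \<beta> x" by auto
 moreover have "inj_on \<beta> c" using c(3) by (simp add: coordinates_on_def)
 ultimately have "x \<in> e" using e(2) c(2) by (metis inj_onD subsetD)
 thus ?thesis using that e by blast
qed

text \<open>The coordinates embed the union of the proper faces onto the boundary of a simplex, so by \<open>cell_extension\<close> the proper faces
 fill the whole boundary sphere of \<open>c\<close>.\<close>
lemma extend_coordinates:
 assumes c: "c \<in> \<C>" and good: "!!e. e \<in> \<C> ==> e \<subset> c ==> coordinates_on \<beta> e"
  and faces: "!!e x. e \<in> \<C> ==> e \<subset> c ==> x \<in> e ==> \<exists>e'\<in>\<C>. e' \<subseteq> e \<and> x \<in> cell_interior e'"
 shows "\<xi> c ` unit_sphere (n c) = \<Union>{e \<in> \<C>. e \<subset> c} \<and>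
  (\<exists>\<beta>'. coordinates_on \<beta>' c \<and> (\<forall>x\<in>\<Union>{e \<in> \<C>. e \<subset> c}. \<beta>' x = \<beta> x))"
proof -
 let ?F = "\<Union>{e \<in> \<C>. e \<subset> c}"
 have fin: "finite {e \<in> \<C>. e \<subset> c}" using finite_cells by simp
 have support: "\<exists>e'\<in>\<C>. e' \<subset> c \<and> lab e' = supp (\<beta> x) \<and> x \<in> e'" if x: "x \<in> ?F" for x
 proof -
  obtain e where e: "e \<in> \<C>" "e \<subset> c" "x \<in> e" using x by blast
  obtain e' where e': "e' \<in> \<C>" "e' \<subseteq> e" "lab e' = supp (\<beta> x)" "x \<in> e'"
   by (rule face_of_support[OF e(1,3) good[OF e(1,2)]]) (use good e(2) in blast)+
  thus ?thesis using e(2) by blast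
 qed
 have "closedin W ?F" using fin cell_closed by (intro closedin_Union) auto
 moreover have "?F \<subseteq> \<xi> c ` unit_sphere (n c)"
 proof
  fix x assume x: "x \<in> ?F"
  then obtain e where e: "e \<in> \<C>" "e \<subset> c" "x \<in> e" by blast
  obtain e' where e': "e' \<in> \<C>" "e' \<subseteq> e" "x \<in> cell_interior e'" using faces[OF e] by blast
  have "x \<notin> cell_interior c" using interior_unique[OF c e'(1) _ e'(3)] e'(2) e(2) by blast
  thus "x \<in> \<xi> c ` unit_sphere (n c)" using cell_decompose[OF c] e by blast
 qed
 moreover have "continuous_map (subtopology W ?F) euclidean \<beta>"
 proof (rule pasting_lemma_closed[OF fin, where T = "\<lambda>e. e" and f = "\<lambda>_. \<beta>"])
  fix e assume e: "e \<in> {e \<in> \<C>. e \<subset> c}"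
  hence eF: "e \<subseteq> ?F" by blast
  show "closedin (subtopology W ?F) e"
   by (rule closedin_subset_topspace[OF cell_closed eF]) (use e in blast)
  have "continuous_map (subtopology W e) euclidean \<beta>" using good e by (simp add: coordinates_on_def)
  thus "continuous_map (subtopology (subtopology W ?F) e) euclidean \<beta>"
   using eF by (simp add: subtopology_subtopology Int_absorb1)
 qed auto
 moreover have "inj_on \<beta> ?F"
 proof (rule inj_onI)
  fix x y assume x: "x \<in> ?F" and y: "y \<in> ?F" and eq: "\<beta> x = \<beta> y"
  obtain e where e: "e \<in> \<C>" "e \<subset> c" "lab e = supp (\<beta> x)" "x \<in> e" using support[OF x] by blast
  obtain e' where e': "e' \<in> \<C>" "e' \<subset> c" "lab e' = supp (\<beta> y)" "y \<in> e'" using support[OF y] by blast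
  have "e = e'" using lab_inj[OF c e(1) e'(1)] e e' eq by auto
  moreover have "inj_on \<beta> e" using good[OF e(1,2)] by (simp add: coordinates_on_def)
  ultimately show "x = y" using e(4) e'(4) eq by (auto dest: inj_onD)
 qed
 moreover have "\<beta> ` ?F = {y \<in> face_simplex (lab c). supp y \<noteq> lab c}"
 proof
  show "\<beta> ` ?F \<subseteq> {y \<in> face_simplex (lab c). supp y \<noteq> lab c}"
  proof (rule image_subsetI)
   fix x assume "x \<in> ?F"
   then obtain e where e: "e \<in> \<C>" "e \<subset> c" "x \<in> e" by blast
   hence "\<beta> x \<in> face_simplex (lab e)" using good[OF e(1,2)] unfolding coordinates_on_def by blast
   thus "\<beta> x \<in> {y \<in> face_simplex (lab c). supp y \<noteq> lab c}"
    using lab_psubset[OF c e(1,2)] by (auto simp: face_simplex_def)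
  qed
  show "{y \<in> face_simplex (lab c). supp y \<noteq> lab c} \<subseteq> \<beta> ` ?F"
  proof
   fix y assume y: "y \<in> {y \<in> face_simplex (lab c). supp y \<noteq> lab c}"
   hence "supp y \<subseteq> lab c" "supp y \<noteq> {}" by (auto simp: face_simplex_def dest: supp_nonempty)
   then obtain e where e: "e \<in> \<C>" "e \<subseteq> c" "lab e = supp y" using lab_surj[OF c] by blast
   hence e2: "e \<subset> c" using y by auto
   have "y \<in> face_simplex (lab e)" using y e(3) by (simp add: face_simplex_def)
   hence "y \<in> \<beta> ` e" using good[OF e(1) e2] by (simp add: coordinates_on_def)
   thus "y \<in> \<beta> ` ?F" using e(1) e2 by blast
  qed
 qed
 ultimately have "?F = \<xi> c ` unit_sphere (n c) \<and> (\<exists>\<beta>'. continuous_map (subtopology W c) euclidean \<beta>' \<and>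
   inj_on \<beta>' c \<and> \<beta>' ` c = face_simplex (lab c) \<and> (\<forall>x\<in>?F. \<beta>' x = \<beta> x))"
  by (rule cell_extension[OF Hausdorff cell_subset[OF c] cell_map[OF c] card_lab[OF c]])
 thus ?thesis unfolding coordinates_on_def by (intro conjI) (elim conjE, erule sym, elim conjE exE, blast)
qed

text \<open>That every point of a cell lies in the interior of one of its faces is proved in the same induction: it needs that the proper faces
 cover the boundary, and it makes the coordinates of different cells consistent.\<close>
lemma coordinates_exist_below:
 "(\<exists>\<beta>. \<forall>c\<in>\<C>. n c < k --> coordinates_on \<beta> c) \<and>
  (\<forall>c\<in>\<C>. n c < k --> (\<forall>x\<in>c. \<exists>e\<in>\<C>. e \<subseteq> c \<and> x \<in> cell_interior e))"
proof (induction k)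
 case (Suc k)
 obtain \<beta> where \<beta>: "!!c. c \<in> \<C> ==> n c < k ==> coordinates_on \<beta> c" using conjunct1[OF Suc] by blast
 have faces: "\<exists>e\<in>\<C>. e \<subseteq> c \<and> x \<in> cell_interior e" if "c \<in> \<C>" "n c < k" "x \<in> c" for c x
  by (rule bspec[OF mp[OF bspec[OF conjunct2[OF Suc] that(1)] that(2)] that(3)])
 let ?F = "\<lambda>c. \<Union>{e \<in> \<C>. e \<subset> c}"
 have ext: "\<xi> c ` unit_sphere (n c) = ?F c \<and> (\<exists>\<beta>'. coordinates_on \<beta>' c \<and> (\<forall>x\<in>?F c. \<beta>' x = \<beta> x))"
  if c: "c \<in> \<C>" "n c = k" for c
 proof (rule extend_coordinates[OF c(1)])
  fix e assume e: "e \<in> \<C>" "e \<subset> c"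
  have ek: "n e < k" using dim_less[OF c(1) e] c(2) by simp
  show "coordinates_on \<beta> e" by (rule \<beta>[OF e(1) ek])
  show "\<exists>e'\<in>\<C>. e' \<subseteq> e \<and> x \<in> cell_interior e'" if "x \<in> e" for x by (rule faces[OF e(1) ek that])
 qed
 hence "\<forall>c. \<exists>\<beta>'. c \<in> \<C> \<and> n c = k --> coordinates_on \<beta>' c \<and> (\<forall>x\<in>?F c. \<beta>' x = \<beta> x)" by blast
 from choice[OF this] obtain \<beta>' where
  \<beta>': "!!c. c \<in> \<C> ==> n c = k ==> coordinates_on (\<beta>' c) c" "!!c x. c \<in> \<C> ==> n c = k ==> x \<in> ?F c ==> \<beta>' c x = \<beta> x"
  by blast
 define top where "top x c \<longleftrightarrow> c \<in> \<C> \<and> n c = k \<and> x \<in> cell_interior c" for x c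
 define \<gamma> where "\<gamma> x = (if \<exists>c. top x c then \<beta>' (SOME c. top x c) x else \<beta> x)" for x
 have low: "\<gamma> x = \<beta> x" if e: "e \<in> \<C>" "n e < k" "x \<in> e" for e x
 proof -
  obtain e' where e': "e' \<in> \<C>" "e' \<subseteq> e" "x \<in> cell_interior e'" using faces[OF e] by blast
  have "n e' < k" using dim_less[OF e(1) e'(1)] e'(2) e(2) by (cases "e' = e") (simp_all add: psubset_eq)
  hence "\<not> top x c" for c using interior_unique[OF _ e'(1) _ e'(3), of c] by (auto simp: top_def)
  thus ?thesis by (simp add: \<gamma>_def)
 qed
 have high: "\<gamma> x = \<beta>' c x" if c: "c \<in> \<C>" "n c = k" "x \<in> c" for c x
 proof (cases "x \<in> cell_interior c")
  case True
  hence t: "top x c" using c by (simp add: top_def)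
  hence "top x (SOME c. top x c)" by (rule someI)
  hence "(SOME c. top x c) \<in> \<C>" "x \<in> cell_interior (SOME c. top x c)" unfolding top_def by blast+
  hence "(SOME c. top x c) = c" using interior_unique[OF _ c(1) _ True] by blast
  thus ?thesis using t by (auto simp: \<gamma>_def)
 next
  case False
  hence "x \<in> \<xi> c ` unit_sphere (n c)" using cell_decompose[OF c(1)] c(3) by blast
  hence xF: "x \<in> ?F c" using ext[OF c(1,2)] by blast
  then obtain e where e: "e \<in> \<C>" "e \<subset> c" "x \<in> e" by blast
  have "\<gamma> x = \<beta> x" using low[OF e(1) _ e(3)] dim_less[OF c(1) e(1,2)] c(2) by simp
  thus ?thesis using \<beta>'(2)[OF c(1,2) xF] by simp
 qed
 have "coordinates_on \<gamma> c" if c: "c \<in> \<C>" "n c < Suc k" for c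
 proof (cases "n c = k")
  case True
  show ?thesis by (rule coordinates_on_cong[OF \<beta>'(1)[OF c(1) True] high[OF c(1) True]])
 next
  case False
  hence "n c < k" using c(2) by simp
  show ?thesis by (rule coordinates_on_cong[OF \<beta>[OF c(1) \<open>n c < k\<close>] low[OF c(1) \<open>n c < k\<close>]])
 qed
 moreover have "\<exists>e\<in>\<C>. e \<subseteq> c \<and> x \<in> cell_interior e" if c: "c \<in> \<C>" "n c < Suc k" "x \<in> c" for c x
 proof (cases "n c = k \<and> x \<notin> cell_interior c")
  case True
  hence "x \<in> \<xi> c ` unit_sphere (n c)" using cell_decompose[OF c(1)] c(3) by blast
  hence "x \<in> ?F c" using ext[OF c(1)] True by blast
  then obtain e where e: "e \<in> \<C>" "e \<subset> c" "x \<in> e" by blast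
  have "n e < k" using dim_less[OF c(1) e(1,2)] True by simp
  thus ?thesis using faces[OF e(1) _ e(3)] e(2) by blast
 next
  case False
  thus ?thesis using c faces[OF c(1) _ c(3)] by (cases "n c = k") auto
 qed
 ultimately show ?case by blast
qed simp

lemma all_below: "\<exists>k. \<forall>c\<in>\<C>. n c < k"
 using finite_nat_set_iff_bounded[of "n ` \<C>"] finite_cells by blast

lemma carrier_cell:
 assumes "c \<in> \<C>" "x \<in> c"
 obtains e where "e \<in> \<C>" "e \<subseteq> c" "x \<in> cell_interior e"
 using coordinates_exist_below all_below assms by metis

lemma coordinates_exist:
 obtains \<beta> where "!!c. c \<in> \<C> ==> coordinates_on \<beta> c"
 using coordinates_exist_below all_below by metis

end

section \<open>Tetrahedra in a contracted complex\<close>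

text \<open>Small balls in the charts of the manifold.\<close>
lemma ball_charts_manifold:
 assumes M: "closed_manifold 3 M"
 shows "ball_charts M"
 unfolding ball_charts_def
proof (intro allI impI, elim conjE)
 fix N x assume N: "openin M N" "x \<in> N"
 hence xM: "x \<in> topspace M" using openin_subset by blast
 obtain U where U: "openin M U" "x \<in> U" "subtopology M U homeomorphic_space Euclidean_space 3"
  using M xM unfolding closed_manifold_def by blast
 have UM: "U \<subseteq> topspace M" by (rule openin_subset[OF U(1)])
 obtain f0 :: "(nat => real) => real^3" and g0 where "homeomorphic_maps (Euclidean_space (DIM(real^3))) euclidean f0 g0"
  by (rule homeomorphic_maps_Euclidean_space_euclidean)
 hence "Euclidean_space 3 homeomorphic_space (euclidean :: (real^3) topology)"
  unfolding homeomorphic_space_def by auto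
 hence "subtopology M U homeomorphic_space (euclidean :: (real^3) topology)"
  by (rule homeomorphic_space_trans[OF U(3)])
 then obtain f :: "_ => real^3" and g where fg: "homeomorphic_maps (subtopology M U) euclidean f g"
  unfolding homeomorphic_space_def by blast
 have f: "continuous_map (subtopology M U) euclidean f" and g: "continuous_map euclidean (subtopology M U) g"
  and gf: "!!y. y \<in> U ==> g (f y) = y" and fgy: "!!y. f (g y) = y"
  using fg UM unfolding homeomorphic_maps_def by auto
 have gU: "g y \<in> U" for y using continuous_map_image_subset_topspace[OF g] UM by auto
 have gM: "continuous_map euclidean M g" using g by (simp add: continuous_map_into)
 have "open (g -` N)"
  using openin_continuous_map_preimage[OF gM N(1)] by (simp add: vimage_def)
 moreover have "f x \<in> g -` N" using gf U(2) N(2) by simp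
 ultimately obtain r where r: "r > 0" "ball (f x) r \<subseteq> g -` N" unfolding open_contains_ball by blast
 define \<theta> where "\<theta> = (\<lambda>p. g (f x + r *\<^sub>R p))"
 define \<theta>' where "\<theta>' = (\<lambda>q. (1 / r) *\<^sub>R (f q - f x))"
 have im: "\<theta> ` ball 0 1 = {q \<in> U. f q \<in> ball (f x) r}"
 proof
  show "\<theta> ` ball 0 1 \<subseteq> {q \<in> U. f q \<in> ball (f x) r}"
   using r(1) gU by (auto simp: \<theta>_def fgy dist_norm)
  show "{q \<in> U. f q \<in> ball (f x) r} \<subseteq> \<theta> ` ball 0 1"
  proof clarify
   fix q assume q: "q \<in> U" "f q \<in> ball (f x) r"
   have "\<theta>' q \<in> ball 0 1" using q r(1) by (simp add: \<theta>'_def dist_norm norm_minus_commute)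
   moreover have "\<theta> (\<theta>' q) = q" using r(1) gf[OF q(1)] by (simp add: \<theta>_def \<theta>'_def)
   ultimately show "q \<in> \<theta> ` ball 0 1" by (metis imageI)
  qed
 qed
 have "openin (subtopology M U) {q \<in> topspace (subtopology M U). f q \<in> ball (f x) r}"
  by (rule openin_continuous_map_preimage[OF f]) simp
 moreover have "{q \<in> topspace (subtopology M U). f q \<in> ball (f x) r} = \<theta> ` ball 0 1" unfolding im using UM by auto
 ultimately have op: "openin M (\<theta> ` ball 0 1)"
  using openin_open_subtopology[OF U(1)] by simp
 have \<theta>: "continuous_map (top_of_set (ball 0 1)) M \<theta>"
 proof -
  have "continuous_map (top_of_set (ball 0 1)) euclidean (\<lambda>p. f x + r *\<^sub>R p)" by (auto intro!: continuous_intros)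
  from continuous_map_compose[OF this gM] show ?thesis by (simp add: \<theta>_def comp_def)
 qed
 have "continuous_map (subtopology M (\<theta> ` ball 0 1)) euclidean \<theta>'"
 proof -
  have "\<theta> ` ball 0 1 \<subseteq> U" unfolding im by blast
  hence f': "continuous_map (subtopology M (\<theta> ` ball 0 1)) euclidean f"
   by (rule continuous_map_from_subtopology_mono[OF f])
  have "continuous_map euclidean euclidean (\<lambda>y. (1 / r) *\<^sub>R (y - f x))" by (auto intro!: continuous_intros)
  from continuous_map_compose[OF f' this] show ?thesis unfolding \<theta>'_def comp_def .
 qed
 moreover have "\<theta> ` ball 0 1 \<subseteq> N"
 proof
  fix q assume "q \<in> \<theta> ` ball 0 1"
  hence q: "q \<in> U" "f q \<in> ball (f x) r" unfolding im by auto
  hence "f q \<in> g -` N" using r(2) by blast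
  thus "q \<in> N" using gf[OF q(1)] by simp
 qed
 moreover have "\<theta> 0 = x" using gf[OF U(2)] by (simp add: \<theta>_def)
 moreover have "\<forall>p\<in>ball 0 1. \<theta>' (\<theta> p) = p" using r(1) by (simp add: \<theta>_def \<theta>'_def fgy)
 ultimately show "\<exists>\<theta> \<theta>'. continuous_map (top_of_set (ball 0 1)) M \<theta> \<and> openin M (\<theta> ` ball (0::real^3) 1) \<and>
   \<theta> ` ball 0 1 \<subseteq> N \<and> \<theta> 0 = x \<and> continuous_map (subtopology M (\<theta> ` ball 0 1)) euclidean \<theta>' \<and> (\<forall>p\<in>ball 0 1. \<theta>' (\<theta> p) = p)"
  using \<theta> op by blast
qed

lemma face_simplex_UNIV: "face_simplex UNIV = \<Delta>"
 by (simp add: face_simplex_def)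

context simplicial_cells begin

lemma cell_in_lab_closed:
 assumes "!!c. c \<in> \<C> ==> coordinates_on \<beta> c" "c \<in> \<C>" "x \<in> c"
 obtains e where "e \<in> \<C>" "e \<subseteq> c" "x \<in> cell_interior e" "lab e = supp (\<beta> x)" "x \<in> e"
proof -
 obtain e where e: "e \<in> \<C>" "e \<subseteq> c" "lab e = supp (\<beta> x)" "x \<in> e"
 proof (rule face_of_support[OF assms(2,3) assms(1)[OF assms(2)]])
  show "coordinates_on \<beta> e" if "e \<in> \<C>" for e by (rule assms(1)[OF that])
 qed (rule that)
 obtain e' where e': "e' \<in> \<C>" "e' \<subseteq> e" "x \<in> cell_interior e'" by (rule carrier_cell[OF e(1,4)])
 have "x \<in> e'" using e'(1,3) cell_decompose by blast
 hence "\<beta> x \<in> face_simplex (lab e')" using assms(1)[OF e'(1)] unfolding coordinates_on_def by blast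
 hence "lab e' = lab e" unfolding e(3) using lab_subset[OF e(1) e'(1,2)] e(3) by (simp add: face_simplex_def subset_antisym)
 hence "e' = e" by (rule lab_inj[OF e(1) e'(1) e(1) e'(2) order_refl])
 thus ?thesis using that e e'(3) by blast
qed

lemma topspace_cells: "x \<in> topspace W ==> \<exists>c\<in>\<C>. x \<in> cell_interior c"
 using interiors_cover by blast

lemma coordinates_continuous:
 assumes good: "!!c. c \<in> \<C> ==> coordinates_on \<beta> c"
 shows "continuous_map W euclidean \<beta>"
proof (rule pasting_lemma_closed[OF finite_cells, where T = "\<lambda>e. e" and f = "\<lambda>_. \<beta>"])
 show "closedin W c" if "c \<in> \<C>" for c by (rule cell_closed[OF that])
 show "continuous_map (subtopology W c) euclidean \<beta>" if "c \<in> \<C>" for c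
  using good[OF that] by (simp add: coordinates_on_def)
 show "\<exists>c. c \<in> \<C> \<and> x \<in> c \<and> \<beta> x = \<beta> x" if "x \<in> topspace W" for x
  using topspace_cells[OF that] cell_decompose by blast
qed auto

lemma coordinates_in:
 assumes good: "!!c. c \<in> \<C> ==> coordinates_on \<beta> c" and x: "x \<in> topspace W"
 shows "\<beta> x \<in> \<Delta>"
proof -
 obtain c where c: "c \<in> \<C>" "x \<in> c" using topspace_cells[OF x] cell_decompose by blast
 have "\<beta> x \<in> face_simplex (lab c)" using c good[OF c(1)] unfolding coordinates_on_def by blast
 thus ?thesis by (simp add: face_simplex_def)
qed

text \<open>Among the cells that reach into the complement of the 3-cells let \<open>c\<close> have maximal dimension. Near an interior point the space is contained in
 \<open>c\<close>, so the coordinates are injective there, yet one coordinate vanishes.\<close>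
lemma three_cells_cover:
 fixes M :: "'a topology"
 assumes good: "!!c. c \<in> \<C> ==> coordinates_on \<beta> c" and card4: "CARD('c) = 4"
  and M: "ball_charts M" and h: "homeomorphic_maps M W h h'" and x: "x \<in> topspace W"
 shows "\<exists>c\<in>\<C>. n c = 3 \<and> x \<in> c"
proof (rule ccontr)
 assume no: "\<not> ?thesis"
 define U where "U = topspace W - \<Union>{c \<in> \<C>. n c = 3}"
 have closed: "closedin W (\<Union>{c \<in> \<C>. P c})" for P
  using finite_cells cell_closed by (intro closedin_Union) auto
 have U: "openin W U" unfolding U_def by (intro openin_diff openin_topspace closed)
 have xU: "x \<in> U" using x no by (auto simp: U_def)
 define S where "S = {e \<in> \<C>. cell_interior e \<inter> U \<noteq> {}}"
 have "finite S" "S \<noteq> {}" using finite_cells topspace_cells[OF x] xU by (auto simp: S_def)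
 hence "Max (n ` S) \<in> n ` S" by (intro Max_in) auto
 then obtain c where c: "c \<in> S" "n c = Max (n ` S)" by auto
 have max: "n e \<le> n c" if "e \<in> S" for e using \<open>finite S\<close> that c(2) by simp
 have cC: "c \<in> \<C>" using c(1) by (simp add: S_def)
 obtain y where y: "y \<in> cell_interior c" "y \<in> U" using c(1) by (auto simp: S_def)
 have yc: "y \<in> c" using y(1) cell_decompose[OF cC] by blast
 have "n c \<noteq> 3" using yc y(2) cC by (auto simp: U_def)
 hence "lab c \<noteq> UNIV" using card_lab[OF cC] card4 by auto
 then obtain i where i: "i \<notin> lab c" by blast
 define N where "N = U - \<Union>{e \<in> \<C>. n e \<le> n c \<and> e \<noteq> c}"
 have N: "openin W N" unfolding N_def by (intro openin_diff U closed)
 have yN: "y \<in> N"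
 proof -
  have False if e: "e \<in> \<C>" "n e \<le> n c" "e \<noteq> c" "y \<in> e" for e
  proof -
   obtain e' where e': "e' \<in> \<C>" "e' \<subseteq> e" "y \<in> cell_interior e'" by (rule carrier_cell[OF e(1,4)])
   have "e' = c" by (rule interior_unique[OF e'(1) cC e'(3) y(1)])
   hence "c \<subset> e" using e'(2) e(3) by blast
   thus False using dim_less[OF e(1) cC] e(2) by simp
  qed
  thus ?thesis using y(2) by (auto simp: N_def)
 qed
 have Nc: "N \<subseteq> c"
 proof
  fix z assume z: "z \<in> N"
  hence zU: "z \<in> U" "z \<in> topspace W" by (auto simp: N_def U_def)
  obtain e where e: "e \<in> \<C>" "z \<in> cell_interior e" using topspace_cells[OF zU(2)] by blast
  have "e \<in> S" using e zU(1) by (auto simp: S_def)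
  moreover have "z \<in> e" using e cell_decompose by blast
  ultimately show "z \<in> c" using max z e(1) by (auto simp: N_def)
 qed
 have hM: "continuous_map M W h" and h': "continuous_map W M h'" and hh': "!!z. z \<in> topspace W ==> h (h' z) = z"
  and h'h: "!!z. z \<in> topspace M ==> h' (h z) = z"
  using h unfolding homeomorphic_maps_def by auto
 have yW: "y \<in> topspace W" using y(2) by (auto simp: U_def)
 have "(\<beta> \<circ> h) (h' y) $ i \<noteq> 0"
 proof (rule simplex_boundary_not_open[OF card4 M])
  show "continuous_map M euclidean (\<beta> \<circ> h)" by (rule continuous_map_compose[OF hM coordinates_continuous[OF good]])
  show "(\<beta> \<circ> h) z \<in> \<Delta>" if "z \<in> topspace M" for z
   using coordinates_in[OF good] continuous_map_image_subset_topspace[OF hM] that by auto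
  show "openin M {z \<in> topspace M. h z \<in> N}" by (rule openin_continuous_map_preimage[OF hM N])
  show "h' y \<in> {z \<in> topspace M. h z \<in> N}"
   using yN hh'[OF yW] continuous_map_image_subset_topspace[OF h'] yW by auto
  show "inj_on (\<beta> \<circ> h) {z \<in> topspace M. h z \<in> N}"
  proof (rule comp_inj_on)
   show "inj_on h {z \<in> topspace M. h z \<in> N}" by (rule inj_on_inverseI[of _ h']) (use h'h in blast)
   have "inj_on \<beta> c" using good[OF cC] by (simp add: coordinates_on_def)
   thus "inj_on \<beta> (h ` {z \<in> topspace M. h z \<in> N})" by (rule inj_on_subset) (use Nc in blast)
  qed
 qed
 moreover have "\<beta> y $ i = 0"
 proof -
  have "\<beta> y \<in> face_simplex (lab c)" using yc good[OF cC] unfolding coordinates_on_def by blast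
  thus ?thesis using i by (simp add: face_simplex_def supp_subset_iff)
 qed
 ultimately show False using hh'[OF yW] by simp
qed

text \<open>The map \<open>\<phi> c\<close> inverts the barycentric coordinates on the 3-cell \<open>c\<close>.\<close>
theorem tetrahedra_of_cells:
 fixes M :: "'a topology"
 assumes card4: "CARD('c) = 4" and M: "Hausdorff_space M" "ball_charts M" and WM: "M homeomorphic_space W"
 shows "\<exists>\<phi> (\<beta> :: 'a => real^'c). tetrahedra M {c \<in> \<C>. n c = 3} \<phi> \<beta>"
proof -
 obtain h h' where h: "homeomorphic_maps M W h h'" using WM unfolding homeomorphic_space_def by blast
 have hM: "continuous_map M W h" and h': "continuous_map W M h'" and hh': "!!z. z \<in> topspace W ==> h (h' z) = z"
  and h'h: "!!z. z \<in> topspace M ==> h' (h z) = z"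
  using h unfolding homeomorphic_maps_def by auto
 obtain b :: "'b => real^'c" where good: "!!c. c \<in> \<C> ==> coordinates_on b c" using coordinates_exist by blast
 have inj: "inj_on b c" if "c \<in> \<C>" for c using good[OF that] by (simp add: coordinates_on_def)
 let ?V = "{c \<in> \<C>. n c = 3}"
 have lab: "lab c = UNIV" if "c \<in> ?V" for c
  using card_lab[of c] that card4 card_subset_eq[of UNIV "lab c"] by simp
 have im: "b ` c = \<Delta>" if "c \<in> ?V" for c
  using good[of c] lab[OF that] that by (simp add: coordinates_on_def face_simplex_UNIV)
 define g where "g c y = inv_into c b y" for c y
 have g: "g c y \<in> c" "b (g c y) = y" if "c \<in> ?V" "y \<in> \<Delta>" for c y
  using that im[OF that(1)] unfolding g_def by (auto intro: inv_into_into f_inv_into_f)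
 have gW: "g c y \<in> topspace W" if "c \<in> ?V" "y \<in> \<Delta>" for c y
  using g(1)[OF that] cell_subset that(1) by blast
 have gb: "g c (b x) = x" if "c \<in> ?V" "x \<in> c" for c x
  unfolding g_def using inj that by simp
 have gcont: "continuous_map (top_of_set \<Delta>) W (g c)" if c: "c \<in> ?V" for c
 proof -
  have cC: "c \<in> \<C>" using c by blast
  have top: "topspace (subtopology W c) = c" using cell_subset[OF cC] by auto
  have "homeomorphic_map (subtopology W c) (top_of_set \<Delta>) b"
  proof (rule continuous_imp_homeomorphic_map)
   show "compact_space (subtopology W c)" using cell_compact[OF cC] by (simp add: compact_space_subtopology)
   show "continuous_map (subtopology W c) (top_of_set \<Delta>) b"
    using good[OF cC] im[OF c] by (auto simp: continuous_map_into coordinates_on_def)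
   show "Hausdorff_space (top_of_set (\<Delta> :: (real^'c) set))" by (simp add: Hausdorff_space_subtopology)
   show "b ` topspace (subtopology W c) = topspace (top_of_set \<Delta>)" "inj_on b (topspace (subtopology W c))"
    unfolding top using im[OF c] inj[OF cC] by auto
  qed
  then obtain g' where g': "homeomorphic_maps (subtopology W c) (top_of_set \<Delta>) b g'"
   using homeomorphic_map_maps by blast
  have "continuous_map (top_of_set \<Delta>) (subtopology W c) (g c)"
  proof (rule continuous_map_eq)
   show "continuous_map (top_of_set \<Delta>) (subtopology W c) g'" using g' unfolding homeomorphic_maps_def by blast
   show "g' y = g c y" if "y \<in> topspace (top_of_set \<Delta>)" for y
   proof -
    have ys: "y \<in> \<Delta>" using that by simp
    have "g' (b (g c y)) = g c y" using g' g(1)[OF c ys] top unfolding homeomorphic_maps_def by blast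
    thus ?thesis using g(2)[OF c ys] by simp
   qed
  qed
  thus ?thesis by (simp add: continuous_map_into)
 qed
 define \<phi> :: "'b set => real^'c => 'a" where "\<phi> c y = h' (g c y)" for c y
 have eqD: "g c y = g e y'" if "c \<in> ?V" "e \<in> ?V" "y \<in> \<Delta>" "y' \<in> \<Delta>" "\<phi> c y = \<phi> e y'" for c e y y'
  using that(5) hh'[OF gW[OF that(1,3)]] hh'[OF gW[OF that(2,4)]] unfolding \<phi>_def by metis
 have common: "\<exists>a\<in>\<C>. a \<subseteq> c \<and> a \<subseteq> e \<and> lab a = supp y" if ce: "c \<in> ?V" "e \<in> ?V" "y \<in> \<Delta>" "g c y = g e y" for c e y
 proof -
  have C: "c \<in> \<C>" "e \<in> \<C>" using ce by auto
  obtain a where a: "a \<in> \<C>" "a \<subseteq> c" "g c y \<in> cell_interior a" "lab a = supp (b (g c y))" "g c y \<in> a"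
   by (rule cell_in_lab_closed[OF good C(1) g(1)[OF ce(1,3)]])
  obtain a' where a': "a' \<in> \<C>" "a' \<subseteq> e" "g e y \<in> cell_interior a'" "lab a' = supp (b (g e y))" "g e y \<in> a'"
   by (rule cell_in_lab_closed[OF good C(2) g(1)[OF ce(2,3)]])
  have "a = a'" using interior_unique[OF a(1) a'(1) a(3)] a'(3) ce(4) by simp
  thus ?thesis using a a'(2) g(2)[OF ce(1,3)] by auto
 qed
 have on_face: "g c z = g e z" if ce: "c \<in> ?V" "e \<in> ?V" "a \<in> \<C>" "a \<subseteq> c" "a \<subseteq> e" "z \<in> \<Delta>" "supp z \<subseteq> lab a" for a c e z
 proof -
  have "z \<in> b ` a" using good[OF ce(3)] ce(6,7) by (simp add: coordinates_on_def face_simplex_def)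
  then obtain w where w: "w \<in> a" "z = b w" by blast
  show ?thesis unfolding w(2) gb[OF ce(1) subsetD[OF ce(4) w(1)]] gb[OF ce(2) subsetD[OF ce(5) w(1)]] ..
 qed
 have "tetrahedra M ?V \<phi> (b \<circ> h)"
 proof
  show "CARD('c) = 4" "Hausdorff_space M" "ball_charts M" by (rule card4 M)+
  show "finite ?V" using finite_cells by simp
  show "continuous_map (top_of_set \<Delta>) M (\<phi> c)" if "c \<in> ?V" for c
   using continuous_map_compose[OF gcont[OF that] h'] unfolding \<phi>_def[abs_def] comp_def .
  show "continuous_map M euclidean (b \<circ> h)" by (rule continuous_map_compose[OF hM coordinates_continuous[OF good]])
  show "(b \<circ> h) (\<phi> c y) = y" if "c \<in> ?V" "y \<in> \<Delta>" for c y
   using hh'[OF gW[OF that]] g(2)[OF that] by (simp add: \<phi>_def)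
  show "topspace M = (\<Union>c\<in>?V. \<phi> c ` \<Delta>)"
  proof
   show "topspace M \<subseteq> (\<Union>c\<in>?V. \<phi> c ` \<Delta>)"
   proof
    fix x assume x: "x \<in> topspace M"
    hence hx: "h x \<in> topspace W" using continuous_map_image_subset_topspace[OF hM] by (simp add: image_subset_iff)
    obtain c where c: "c \<in> \<C>" "n c = 3" "h x \<in> c" using three_cells_cover[OF good card4 M(2) h hx] by blast
    hence cV: "c \<in> ?V" by blast
    have "\<phi> c (b (h x)) = x" using gb[OF cV c(3)] h'h[OF x] by (simp add: \<phi>_def)
    moreover have "b (h x) \<in> \<Delta>" using im[OF cV] c(3) by blast
    ultimately have "x \<in> \<phi> c ` \<Delta>" by (intro image_eqI[of _ _ "b (h x)"]) simp_all
    thus "x \<in> (\<Union>c\<in>?V. \<phi> c ` \<Delta>)" by (rule UN_I[OF cV])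
   qed
   show "(\<Union>c\<in>?V. \<phi> c ` \<Delta>) \<subseteq> topspace M"
   proof (rule UN_least, rule image_subsetI)
    fix c y assume "c \<in> ?V" "y \<in> (\<Delta> :: (real^'c) set)"
    thus "\<phi> c y \<in> topspace M"
     unfolding \<phi>_def using gW[of c y] continuous_map_image_subset_topspace[OF h'] by (simp add: image_subset_iff)
   qed
  qed
  show "\<phi> c z = \<phi> e z"
   if ce: "c \<in> ?V" "e \<in> ?V" "y \<in> \<Delta>" "z \<in> \<Delta>" "\<phi> c y = \<phi> e y" "supp z \<subseteq> supp y" for c e y z
  proof -
   obtain a where "a \<in> \<C>" "a \<subseteq> c" "a \<subseteq> e" "lab a = supp y" using common[OF ce(1-3) eqD[OF ce(1,2,3,3,5)]] by blast
   thus ?thesis using on_face[OF ce(1,2) _ _ _ ce(4)] ce(6) by (simp add: \<phi>_def)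
  qed
  show "c = e" if ce: "c \<in> ?V" "e \<in> ?V" "y \<in> \<Delta>" "\<phi> c y = \<phi> e y" "supp y = UNIV" for c e y
  proof -
   obtain a where a: "a \<in> \<C>" "a \<subseteq> c" "a \<subseteq> e" "lab a = supp y" using common[OF ce(1-3) eqD[OF ce(1,2,3,3,4)]] by blast
   have "a = c" using lab_inj[of c a c] a ce(1,5) lab[OF ce(1)] by auto
   moreover have "a = e" using lab_inj[of e a e] a ce(2,5) lab[OF ce(2)] by auto
   ultimately show ?thesis by simp
  qed
  show "\<phi> c (axis i 1) = \<phi> e (axis i 1)" if ce: "c \<in> ?V" "e \<in> ?V" for c e i
  proof -
   obtain a where a: "a \<in> \<C>" "a \<subseteq> c" "lab a = {i}" using lab_surj[of c "{i}"] ce(1) lab[OF ce(1)] by blast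
   obtain a' where a': "a' \<in> \<C>" "a' \<subseteq> e" "lab a' = {i}" using lab_surj[of e "{i}"] ce(2) lab[OF ce(2)] by blast
   have aa: "a \<subseteq> e" using lab_vertex[OF a(1) a'(1) a(3) a'(3)] a'(2) by simp
   have "supp (axis i 1 :: real^'c) \<subseteq> lab a" using a(3) by (auto simp: supp_def axis_def)
   thus ?thesis using on_face[OF ce a(1,2) aa axis_simp[of i]] by (simp add: \<phi>_def)
  qed
 qed
 thus ?thesis by blast
qed

end

section \<open>Finiteness and vertex labels\<close>

text \<open>The centers of the cells form a closed discrete set in a compact space.\<close>
lemma finite_regular_cells:
 assumes W: "Hausdorff_space W" "compact_space W"
  and cells: "!!c. c \<in> \<C> ==> c \<subseteq> topspace W" "!!c. c \<in> \<C> ==> homeomorphic_map (cball_space (n c)) (subtopology W c) (\<xi> c)"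
  and disj: "disjoint_family_on (\<lambda>c. \<xi> c ` unit_ball (n c)) \<C>"
  and closure: "!!c. c \<in> \<C> ==> \<exists>\<D>. finite \<D> \<and> \<D> \<subseteq> \<C> \<and> \<xi> c ` unit_sphere (n c) \<subseteq> (\<Union>e\<in>\<D>. \<xi> e ` unit_ball (n e))"
  and weak: "!!A. A \<subseteq> topspace W ==> (!!c. c \<in> \<C> ==> closedin (subtopology W c) (A \<inter> c)) ==> closedin W A"
 shows "finite \<C>"
proof -
 define z where "z c = \<xi> c (\<lambda>_. 0)" for c
 have z_in: "z c \<in> \<xi> c ` unit_ball (n c)" for c
  unfolding z_def by (rule imageI) (auto simp: unit_ball_def topspace_Euclidean_space)
 have uniq: "c = e" if "c \<in> \<C>" "e \<in> \<C>" "x \<in> \<xi> c ` unit_ball (n c)" "x \<in> \<xi> e ` unit_ball (n e)" for c e x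
  using disj that by (auto simp: disjoint_family_on_def)
 have inj: "inj_on z \<C>" using z_in uniq by (metis inj_onI)
 have im: "\<xi> c ` unit_cball (n c) = c" if "c \<in> \<C>" for c
  using homeomorphic_imp_surjective_map[OF cells(2)[OF that]] cells(1)[OF that] by (auto simp: unit_cball_def)
 have z_top: "z ` \<C> \<subseteq> topspace W"
 proof (rule image_subsetI)
  fix c assume c: "c \<in> \<C>"
  have "z c \<in> \<xi> c ` unit_cball (n c)" using z_in[of c] by (auto simp: unit_ball_def unit_cball_def)
  thus "z c \<in> topspace W" using im[OF c] cells(1)[OF c] by blast
 qed
 have closed: "closedin W B" if B: "B \<subseteq> z ` \<C>" for B
 proof (rule weak)
  show "B \<subseteq> topspace W" using B z_top by blast
  fix c assume c: "c \<in> \<C>"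
  obtain \<D> where D: "finite \<D>" "\<D> \<subseteq> \<C>" "\<xi> c ` unit_sphere (n c) \<subseteq> (\<Union>e\<in>\<D>. \<xi> e ` unit_ball (n e))"
   using closure[OF c] by blast
  have "B \<inter> c \<subseteq> z ` insert c \<D>"
  proof
   fix x assume x: "x \<in> B \<inter> c"
   then obtain e where e: "e \<in> \<C>" "x = z e" using B by blast
   have "x \<in> \<xi> c ` unit_ball (n c) \<union> \<xi> c ` unit_sphere (n c)"
    using x im[OF c] by (force simp: unit_cball_def unit_ball_def unit_sphere_def)
   then obtain e' where e': "e' \<in> insert c \<D>" "x \<in> \<xi> e' ` unit_ball (n e')" using D(3) by blast
   have "e' \<in> \<C>" using e'(1) c D(2) by blast
   have "e = e'" by (rule uniq[OF e(1) \<open>e' \<in> \<C>\<close> z_in e'(2)[unfolded e(2)]])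
   thus "x \<in> z ` insert c \<D>" using e(2) e'(1) by blast
  qed
  hence "finite (B \<inter> c)" using D(1) by (meson finite_imageI finite_insert finite_subset)
  thus "closedin (subtopology W c) (B \<inter> c)"
   using B z_top by (intro closedin_Hausdorff_finite Hausdorff_space_subtopology[OF W(1)]) auto
 qed
 have "discrete_topology (z ` \<C>) = subtopology W (z ` \<C>)"
  unfolding discrete_topology_unique
 proof (intro conjI ballI)
  show top: "topspace (subtopology W (z ` \<C>)) = z ` \<C>" using z_top by auto
  fix x assume x: "x \<in> z ` \<C>"
  have "closedin (subtopology W (z ` \<C>)) (z ` \<C> - {x})"
   by (rule closedin_subset_topspace[OF closed[OF Diff_subset] Diff_subset])
  hence "openin (subtopology W (z ` \<C>)) (z ` \<C> - (z ` \<C> - {x}))"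
   using openin_diff[OF openin_topspace[of "subtopology W (z ` \<C>)"]] unfolding top by simp
  moreover have "z ` \<C> - (z ` \<C> - {x}) = {x}" using x by blast
  ultimately show "openin (subtopology W (z ` \<C>)) {x}" by simp
 qed
 moreover have "compact_space (subtopology W (z ` \<C>))"
  using closedin_compact_space[OF W(2) closed[OF order_refl]] by (simp add: compact_space_subtopology)
 ultimately have "finite (z ` \<C>)" by (metis compact_space_discrete_topology)
 thus ?thesis by (rule finite_imageD[OF _ inj])
qed

lemma not_is_cell_empty: "\<not> is_cell W m {}"
proof
 assume "is_cell W m {}"
 then obtain g where "continuous_map (cball_space m) (subtopology W {}) g"
  unfolding is_cell_def homeomorphic_space_def homeomorphic_maps_def by blast
 moreover have "(\<lambda>_. 0) \<in> topspace (cball_space m)" by (simp add: unit_cball_def topspace_Euclidean_space)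
 ultimately show False using continuous_map_image_subset_topspace by fastforce
qed

lemma face_poset:
 assumes K: "simplicial_cell_complex d W K" and c: "c \<in> K" "is_cell W m c"
 obtains f where "bij_betw f {\<tau> \<in> K. \<tau> \<subseteq> c} (Pow {..m})"
  "!!x y. x \<in> K ==> x \<subseteq> c ==> y \<in> K ==> y \<subseteq> c ==> x \<subseteq> y \<longleftrightarrow> f x \<subseteq> f y"
proof -
 have "inclusion_isomorphic {\<tau> \<in> K. \<tau> \<subset> c} {T. T \<subset> {..m}}"
  using K c unfolding simplicial_cell_complex_def by blast
 then obtain g where g0: "bij_betw g {\<tau> \<in> K. \<tau> \<subset> c} {T. T \<subset> {..m}} \<and>
   (\<forall>x\<in>{\<tau> \<in> K. \<tau> \<subset> c}. \<forall>y\<in>{\<tau> \<in> K. \<tau> \<subset> c}. x \<subseteq> y \<longleftrightarrow> g x \<subseteq> g y)"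
  unfolding inclusion_isomorphic_def ..
 note g = conjunct1[OF g0] bspec[OF bspec[OF conjunct2[OF g0]]]
 define f where "f = g(c := {..m})"
 have proper: "f x \<subset> {..m}" "f x = g x" if "x \<in> K" "x \<subset> c" for x
  using bij_betwE[OF g(1)] that by (auto simp: f_def)
 have "bij_betw f {\<tau> \<in> K. \<tau> \<subset> c} {T. T \<subset> {..m}}"
  by (rule bij_betw_cong[THEN iffD2, OF _ g(1)]) (use proper(2) in blast)
 hence "bij_betw f ({\<tau> \<in> K. \<tau> \<subset> c} \<union> {c}) ({T. T \<subset> {..m}} \<union> {f c})"
  by (rule notIn_Un_bij_betw3[THEN iffD1, rotated 2]) (auto simp: f_def)
 moreover have "{\<tau> \<in> K. \<tau> \<subset> c} \<union> {c} = {\<tau> \<in> K. \<tau> \<subseteq> c}" using c(1) by auto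
 moreover have "{T. T \<subset> {..m}} \<union> {f c} = Pow {..m}" by (auto simp: f_def)
 ultimately have "bij_betw f {\<tau> \<in> K. \<tau> \<subseteq> c} (Pow {..m})" by simp
 moreover have "x \<subseteq> y \<longleftrightarrow> f x \<subseteq> f y" if "x \<in> K" "x \<subseteq> c" "y \<in> K" "y \<subseteq> c" for x y
 proof (cases "x = c \<or> y = c")
  case True
  thus ?thesis using that proper[of x] proper[of y] by (auto simp: f_def)
 next
  case False
  thus ?thesis using that g(2)[of x y] by (auto simp: f_def)
 qed
 ultimately show ?thesis using that by blast
qed

text \<open>The number of faces determines the dimension of a cell.\<close>
lemma card_lower_faces:
 assumes "simplicial_cell_complex d W K" "c \<in> K" "is_cell W m c"
 shows "card {\<tau> \<in> K. \<tau> \<subseteq> c} = 2 ^ Suc m"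
proof -
 obtain f where "bij_betw f {\<tau> \<in> K. \<tau> \<subseteq> c} (Pow {..m})" by (rule face_poset[OF assms])
 thus ?thesis using bij_betw_same_card[of f] by (simp add: card_Pow)
qed

lemma cell_dimension_unique:
 assumes K: "simplicial_cell_complex d W K" "c \<in> K" and "is_cell W m c" "is_cell W m' c"
 shows "m = m'"
 using card_lower_faces[OF K assms(3)] card_lower_faces[OF K assms(4)] by simp

text \<open>A bijection \<open>l\<close> from the vertices to the labels gives each cell the set of labels of its vertices. The isomorphism \<open>f c\<close> of the
 face poset of \<open>c\<close> with a power set shows that this determines the faces.\<close>
lemma labels_exist:
 assumes K: "simplicial_cell_complex d W K" and dim: "!!c. c \<in> K ==> c \<noteq> {} ==> is_cell W (n c) c"
  and vertices: "face_number W K 0 = CARD('c::finite)"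
 obtains lab :: "'b set => 'c::finite set" where "labelled_cells (K - {{}}) n lab"
proof -
 define vert where "vert c = {v \<in> K. is_cell W 0 v \<and> v \<subseteq> c}" for c
 have nonempty: "v \<noteq> {}" if "is_cell W m v" for m v using that not_is_cell_empty by blast
 have "\<forall>c\<in>K - {{}}. \<exists>f. bij_betw f {\<tau> \<in> K. \<tau> \<subseteq> c} (Pow {..n c}) \<and>
   (\<forall>x y. x \<in> K \<and> x \<subseteq> c \<and> y \<in> K \<and> y \<subseteq> c --> (x \<subseteq> y \<longleftrightarrow> f x \<subseteq> f y))"
 proof
  fix c assume "c \<in> K - {{}}"
  hence c: "c \<in> K" "is_cell W (n c) c" using dim by auto
  show "\<exists>f. bij_betw f {\<tau> \<in> K. \<tau> \<subseteq> c} (Pow {..n c}) \<and>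
   (\<forall>x y. x \<in> K \<and> x \<subseteq> c \<and> y \<in> K \<and> y \<subseteq> c --> (x \<subseteq> y \<longleftrightarrow> f x \<subseteq> f y))"
   by (rule face_poset[OF K c]) blast
 qed
 from bchoice[OF this] obtain f where f: "\<forall>c\<in>K - {{}}. bij_betw (f c) {\<tau> \<in> K. \<tau> \<subseteq> c} (Pow {..n c}) \<and>
   (\<forall>x y. x \<in> K \<and> x \<subseteq> c \<and> y \<in> K \<and> y \<subseteq> c --> (x \<subseteq> y \<longleftrightarrow> f c x \<subseteq> f c y))" ..
 have bij: "bij_betw (f c) {\<tau> \<in> K. \<tau> \<subseteq> c} (Pow {..n c})" if "c \<in> K" "c \<noteq> {}" for c
  using f that by simp
 have mono: "x \<subseteq> y \<longleftrightarrow> f c x \<subseteq> f c y"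
  if "c \<in> K" "c \<noteq> {}" "x \<in> K" "x \<subseteq> c" "y \<in> K" "y \<subseteq> c" for c x y
  using f that by simp
 have inj: "inj_on (f c) {\<tau> \<in> K. \<tau> \<subseteq> c}" if "c \<in> K" "c \<noteq> {}" for c
  by (rule bij_betw_imp_inj_on[OF bij[OF that]])
 have surj: "\<exists>e\<in>K. e \<subseteq> c \<and> f c e = T" if c: "c \<in> K" "c \<noteq> {}" "T \<subseteq> {..n c}" for c T
 proof -
  have "T \<in> f c ` {\<tau> \<in> K. \<tau> \<subseteq> c}" unfolding bij_betw_imp_surj_on[OF bij[OF c(1,2)]] using c(3) by blast
  thus ?thesis by blast
 qed
 have sub: "f c e \<subseteq> {..n c}" if "c \<in> K" "c \<noteq> {}" "e \<in> K" "e \<subseteq> c" for c e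
  using bij_betwE[OF bij[OF that(1,2)]] that(3,4) by simp
 have card_f: "card (f c e) = Suc (n e)" if c: "c \<in> K" "c \<noteq> {}" and e: "e \<in> K" "e \<subseteq> c" "e \<noteq> {}" for c e
 proof -
  have im: "f c ` {\<tau> \<in> K. \<tau> \<subseteq> e} = Pow (f c e)"
  proof
   show "f c ` {\<tau> \<in> K. \<tau> \<subseteq> e} \<subseteq> Pow (f c e)"
   proof (rule image_subsetI)
    fix \<tau> assume "\<tau> \<in> {\<tau> \<in> K. \<tau> \<subseteq> e}"
    thus "f c \<tau> \<in> Pow (f c e)" using mono[OF c _ _ e(1,2), of \<tau>] e(2) by auto
   qed
   show "Pow (f c e) \<subseteq> f c ` {\<tau> \<in> K. \<tau> \<subseteq> e}"
   proof
    fix T assume T: "T \<in> Pow (f c e)"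
    then obtain x where x: "x \<in> K" "x \<subseteq> c" "f c x = T" using surj[OF c, of T] sub[OF c e(1,2)] by blast
    have "x \<subseteq> e" unfolding mono[OF c x(1,2) e(1,2)] x(3) using T by simp
    thus "T \<in> f c ` {\<tau> \<in> K. \<tau> \<subseteq> e}" using x by blast
   qed
  qed
  have "inj_on (f c) {\<tau> \<in> K. \<tau> \<subseteq> e}" by (rule inj_on_subset[OF inj[OF c]]) (use e(2) in blast)
  from card_image[OF this] have "card (Pow (f c e)) = 2 ^ Suc (n e)"
   unfolding im using card_lower_faces[OF K e(1) dim[OF e(1,3)]] by simp
  moreover have "finite (f c e)" using sub[OF c e(1,2)] finite_subset by blast
  ultimately have "(2::nat) ^ card (f c e) = 2 ^ Suc (n e)" by (simp only: card_Pow)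
  thus ?thesis by (rule power_inject_exp[THEN iffD1, rotated]) simp
 qed
 have vert_f: "f c ` vert e = (\<lambda>i. {i}) ` f c e" if c: "c \<in> K" "c \<noteq> {}" and e: "e \<in> K" "e \<subseteq> c" for c e
 proof
  show "f c ` vert e \<subseteq> (\<lambda>i. {i}) ` f c e"
  proof (rule image_subsetI)
   fix v assume "v \<in> vert e"
   hence v: "v \<in> K" "is_cell W 0 v" "v \<subseteq> e" by (auto simp: vert_def)
   have vc: "v \<subseteq> c" using v(3) e(2) by blast
   have "n v = 0" by (rule cell_dimension_unique[OF K v(1) dim[OF v(1) nonempty[OF v(2)]] v(2)])
   hence "card (f c v) = 1" using card_f[OF c v(1) vc nonempty[OF v(2)]] by simp
   then obtain i where "f c v = {i}" by (auto simp: card_1_singleton_iff)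
   moreover have "f c v \<subseteq> f c e" using mono[OF c v(1) vc e] v(3) by simp
   ultimately show "f c v \<in> (\<lambda>i. {i}) ` f c e" by blast
  qed
  show "(\<lambda>i. {i}) ` f c e \<subseteq> f c ` vert e"
  proof (rule image_subsetI)
   fix i assume i: "i \<in> f c e"
   then obtain v where v: "v \<in> K" "v \<subseteq> c" "f c v = {i}" using surj[OF c, of "{i}"] sub[OF c e] by blast
   have ve: "v \<subseteq> e" unfolding mono[OF c v(1,2) e] v(3) using i by simp
   have "v \<noteq> {}"
   proof
    assume "v = {}"
    obtain w where w: "w \<in> K" "w \<subseteq> c" "f c w = {}" using surj[OF c, of "{}"] by blast
    thus False using mono[OF c v(1,2) w(1,2)] v(3) \<open>v = {}\<close> by simp
   qed
   hence "n v = 0" "is_cell W (n v) v" using card_f[OF c v(1,2)] v(3) dim[OF v(1)] by auto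
   hence "v \<in> vert e" using v(1) ve by (simp add: vert_def)
   thus "{i} \<in> f c ` vert e" using v(3) by (intro image_eqI[of _ _ v]) simp_all
  qed
 qed
 have "card {v \<in> K. is_cell W 0 v} = CARD('c)" using vertices by (simp add: face_number_def)
 moreover have "finite {v \<in> K. is_cell W 0 v}"
 proof (rule ccontr)
  assume "\<not> ?thesis"
  hence "card {v \<in> K. is_cell W 0 v} = 0" by simp
  thus False using calculation by simp
 qed
 ultimately obtain l where l: "bij_betw l {v \<in> K. is_cell W 0 v} (UNIV :: 'c set)"
  using finite_same_card_bij[of "{v \<in> K. is_cell W 0 v}" "UNIV :: 'c set"] by auto
 have inj_l: "inj_on l {v \<in> K. is_cell W 0 v}" by (rule bij_betw_imp_inj_on[OF l])
 have vert_sub: "vert c \<subseteq> {v \<in> K. is_cell W 0 v}" for c by (auto simp: vert_def)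
 have vert_D: "vert e \<subseteq> {\<tau> \<in> K. \<tau> \<subseteq> c}" if "e \<subseteq> c" for e c using that by (auto simp: vert_def)
 define lab where "lab c = l ` vert c" for c
 have card_lab: "card (lab c) = Suc (n c)" if c: "c \<in> K" "c \<noteq> {}" for c
 proof -
  have "card (lab c) = card (vert c)" unfolding lab_def by (rule card_image[OF inj_on_subset[OF inj_l vert_sub]])
  moreover have "card (f c ` vert c) = card (vert c)"
   by (rule card_image[OF inj_on_subset[OF inj[OF c] vert_D[OF order_refl]]])
  moreover have "card (f c ` vert c) = card (f c c)"
   unfolding vert_f[OF c c(1) order_refl] by (rule card_image) (simp add: inj_on_def)
  ultimately show ?thesis using card_f[OF c c(1) order_refl c(2)] by simp
 qed
 have lab_mono: "e \<subseteq> e' \<longleftrightarrow> lab e \<subseteq> lab e'"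
  if c: "c \<in> K" "c \<noteq> {}" and e: "e \<in> K" "e' \<in> K" "e \<subseteq> c" "e' \<subseteq> c" for c e e'
 proof -
  have "lab e \<subseteq> lab e' \<longleftrightarrow> vert e \<subseteq> vert e'"
   unfolding lab_def by (rule inj_on_image_subset_iff[OF inj_l vert_sub vert_sub])
  also have "\<dots> \<longleftrightarrow> f c ` vert e \<subseteq> f c ` vert e'"
   by (rule inj_on_image_subset_iff[OF inj[OF c] vert_D[OF e(3)] vert_D[OF e(4)], symmetric])
  also have "\<dots> \<longleftrightarrow> f c e \<subseteq> f c e'"
   unfolding vert_f[OF c e(1,3)] vert_f[OF c e(2,4)] by (rule inj_image_subset_iff) (simp add: inj_def)
  also have "\<dots> \<longleftrightarrow> e \<subseteq> e'" by (rule mono[OF c e(1,3,2,4), symmetric])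
  finally show ?thesis by (rule sym)
 qed
 have lab_surj: "\<exists>e\<in>K - {{}}. e \<subseteq> c \<and> lab e = B" if c: "c \<in> K" "c \<noteq> {}" and B: "B \<subseteq> lab c" "B \<noteq> {}" for c B
 proof -
  obtain Z where Z: "Z \<subseteq> vert c" "l ` Z = B" using B(1) unfolding lab_def subset_image_iff by blast
  have "f c ` Z \<subseteq> (\<lambda>i. {i}) ` f c c" using image_mono[OF Z(1)] vert_f[OF c c(1) order_refl] by metis
  then obtain T where T: "T \<subseteq> f c c" "f c ` Z = (\<lambda>i. {i}) ` T" unfolding subset_image_iff by blast
  obtain e where e: "e \<in> K" "e \<subseteq> c" "f c e = T"
   using surj[OF c, of T] T(1) sub[OF c c(1) order_refl] by blast
  have "f c ` vert e = f c ` Z" unfolding vert_f[OF c e(1,2)] e(3) T(2) ..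
  hence "vert e = Z"
   using inj_on_image_eq_iff[OF inj[OF c] vert_D[OF e(2)] order_trans[OF Z(1) vert_D[OF order_refl]]] by simp
  hence le: "lab e = B" using Z(2) by (simp add: lab_def)
  moreover have "e \<noteq> {}"
  proof
   assume "e = {}"
   hence "vert e = {}" using not_is_cell_empty by (auto simp: vert_def)
   thus False using B(2) le by (simp add: lab_def)
  qed
  ultimately show ?thesis using e(1,2) by blast
 qed
 have lab_vertex: "\<exists>v\<in>K. is_cell W 0 v \<and> e = v \<and> l v = i" if e: "e \<in> K" "e \<noteq> {}" "lab e = {i}" for e i
 proof -
  have "n e = 0" using card_lab[OF e(1,2)] e(3) by simp
  hence c0: "is_cell W 0 e" using dim[OF e(1,2)] by simp
  hence "e \<in> vert e" using e(1) by (simp add: vert_def)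
  hence "l e \<in> lab e" by (simp add: lab_def)
  thus ?thesis using c0 e(1,3) by auto
 qed
 show ?thesis
 proof (rule that[of lab], unfold_locales)
  show "e = e'" if "e \<in> K - {{}}" "e' \<in> K - {{}}" "lab e = {i}" "lab e' = {i}" for e e' i
   using lab_vertex[OF _ _ that(3)] lab_vertex[OF _ _ that(4)] that(1,2) inj_onD[OF inj_l, of e e'] by auto
 qed (rule card_lab lab_mono lab_surj; blast)+
qed

theorem simplicial_cells_of_complex:
 fixes W :: "'b topology"
 assumes K: "simplicial_cell_complex d W K" and W: "compact_space W"
  and vertices: "face_number W K 0 = CARD('c::finite)"
 obtains n \<xi> and lab :: "'b set => 'c::finite set" where "simplicial_cells W (K - {{}}) n \<xi> lab"
  "\<forall>c\<in>K - {{}}. \<forall>m. is_cell W m c \<longleftrightarrow> n c = m"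
proof -
 have "regular_cw_complex W (K - {{}})" using K by (simp add: simplicial_cell_complex_def)
 note R = this[unfolded regular_cw_complex_def]
 have H: "Hausdorff_space W" by (rule conjunct1[OF R])
 obtain n \<xi> where
  1: "\<forall>c\<in>K - {{}}. c \<subseteq> topspace W \<and> homeomorphic_map (cball_space (n c)) (subtopology W c) (\<xi> c)"
  and disj: "disjoint_family_on (\<lambda>c. \<xi> c ` unit_ball (n c)) (K - {{}})"
  and cover: "(\<Union>c\<in>K - {{}}. \<xi> c ` unit_ball (n c)) = topspace W"
  and 2: "\<forall>c\<in>K - {{}}. \<exists>\<D>. finite \<D> \<and> \<D> \<subseteq> K - {{}} \<and> (\<forall>e\<in>\<D>. n e < n c) \<and>
      \<xi> c ` unit_sphere (n c) \<subseteq> (\<Union>e\<in>\<D>. \<xi> e ` unit_ball (n e))"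
  and 3: "\<forall>A. A \<subseteq> topspace W \<and> (\<forall>c\<in>K - {{}}. closedin (subtopology W c) (A \<inter> c)) --> closedin W A"
  using conjunct2[OF R] by (elim exE conjE) (rule that)
 have cells: "c \<subseteq> topspace W" "homeomorphic_map (cball_space (n c)) (subtopology W c) (\<xi> c)" if "c \<in> K - {{}}" for c
  using bspec[OF 1 that] by (rule conjunct1, rule conjunct2)
 have closure: "\<exists>\<D>. finite \<D> \<and> \<D> \<subseteq> K - {{}} \<and> \<xi> c ` unit_sphere (n c) \<subseteq> (\<Union>e\<in>\<D>. \<xi> e ` unit_ball (n e))"
  if "c \<in> K - {{}}" for c
  using bspec[OF 2 that] by (elim exE conjE) (intro exI conjI)
 have weak: "closedin W A" if "A \<subseteq> topspace W" "!!c. c \<in> K - {{}} ==> closedin (subtopology W c) (A \<inter> c)" for A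
  using 3 that by simp
 have dim: "is_cell W (n c) c" if "c \<in> K" "c \<noteq> {}" for c
  using cells(2)[of c] that homeomorphic_map_imp_homeomorphic_space homeomorphic_space_sym
  unfolding is_cell_def by blast
 obtain lab :: "'b set => 'c set" where "labelled_cells (K - {{}}) n lab"
  by (rule labels_exist[OF K dim vertices])
 then interpret labelled_cells "K - {{}}" n lab .
 have "simplicial_cells W (K - {{}}) n \<xi> lab"
  by unfold_locales (rule H disj cover cells finite_regular_cells[OF H W cells disj closure weak]; assumption?)+
 moreover have "is_cell W m c \<longleftrightarrow> n c = m" if "c \<in> K - {{}}" for c m
  using dim[of c] cell_dimension_unique[OF K, of c m "n c"] that by auto
 ultimately show ?thesis using that by blast
qed

theorem contracted_pseudotriangulation_weight:
 fixes M :: "'a topology" and W :: "'b topology"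
 assumes M: "closed_manifold 3 M" and p: "p \<in> topspace M"
  and K: "pseudotriangulation 3 W K M" and vertices: "face_number W K 0 = 4"
 shows "group_weight (fundamental_group M p) \<le> face_number W K 3"
proof -
 have MW: "M homeomorphic_space W" and SK: "simplicial_cell_complex 3 W K" using K by (auto simp: pseudotriangulation_def)
 have "compact_space M" "Hausdorff_space M" using M by (auto simp: closed_manifold_def)
 hence W: "compact_space W" using homeomorphic_compact_space[OF MW] by simp
 have "face_number W K 0 = CARD(4)" using vertices by simp
 then obtain n \<xi> and lab :: "'b set => 4 set" where C: "simplicial_cells W (K - {{}}) n \<xi> lab"
  and cell: "\<forall>c\<in>K - {{}}. \<forall>m. is_cell W m c \<longleftrightarrow> n c = m"
  by (rule simplicial_cells_of_complex[OF SK W])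
 interpret C: simplicial_cells W "K - {{}}" n \<xi> lab by (rule C)
 let ?V = "{c \<in> K - {{}}. n c = 3}"
 have V: "{c \<in> K. is_cell W 3 c} = ?V" using cell not_is_cell_empty[of W 3] by blast
 obtain \<phi> and \<beta> :: "'a => real^4" where "tetrahedra M ?V \<phi> \<beta>"
  using C.tetrahedra_of_cells[OF _ \<open>Hausdorff_space M\<close> ball_charts_manifold[OF M] MW] by auto
 then interpret tetrahedra M ?V \<phi> \<beta> .
 have "?V \<noteq> {}" using SK unfolding simplicial_cell_complex_def V[symmetric] by blast
 from fundamental_group_weight[OF this p] show ?thesis unfolding face_number_def V .
qed

section \<open>The complex of a coloured graph\<close>

lemma singleton_is_cell: "q \<in> topspace W ==> is_cell W 0 {q}"
proof -
 assume q: "q \<in> topspace W"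
 have top: "topspace (cball_space 0) = {\<lambda>_. 0}"
  by (auto simp: topspace_Euclidean_space unit_cball_def)
 have "homeomorphic_maps (subtopology W {q}) (cball_space 0) (\<lambda>_ _. 0) (\<lambda>_. q)"
  unfolding homeomorphic_maps_def continuous_map_const top using q by auto
 thus ?thesis unfolding is_cell_def homeomorphic_space_def by blast
qed

lemma zero_cell_unique_point:
 assumes "is_cell W 0 c" "c \<subseteq> topspace W" "x \<in> c" "y \<in> c"
 shows "x = y"
proof -
 obtain f g where fg: "homeomorphic_maps (subtopology W c) (cball_space 0) f g"
  using assms(1) unfolding is_cell_def homeomorphic_space_def by blast
 have top: "topspace (cball_space 0) = {\<lambda>_. 0}"
  by (auto simp: topspace_Euclidean_space unit_cball_def)
 have "continuous_map (subtopology W c) (cball_space 0) f" using fg by (simp add: homeomorphic_maps_def)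
 from continuous_map_image_subset_topspace[OF this] have "f ` (topspace W \<inter> c) \<subseteq> {\<lambda>_. 0}" unfolding top by simp
 moreover have "x \<in> topspace W \<inter> c" "y \<in> topspace W \<inter> c" using assms(2-4) by auto
 ultimately have "f x = f y" by (simp add: image_subset_iff)
 moreover have "g (f x) = x" "g (f y) = y" using fg assms(2-4) by (auto simp: homeomorphic_maps_def)
 ultimately show ?thesis by metis
qed

definition unit_vector :: "nat => nat => real" where
 "unit_vector i j = (if j = i then 1 else 0)"

lemma unit_vector_simplex: "i \<le> d ==> unit_vector i \<in> standard_simplex d"
 by (auto simp: standard_simplex_def unit_vector_def)

lemma unit_vector_inj: "unit_vector i = unit_vector j \<longleftrightarrow> i = j"
 by (metis unit_vector_def zero_neq_one)

definition coordinate_face :: "nat => nat set => (nat => real) set" where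
 "coordinate_face d A = {x \<in> standard_simplex d. \<forall>i. i \<notin> A --> x i = 0}"

lemma unit_vector_face: "i \<le> d ==> unit_vector i \<in> coordinate_face d A \<longleftrightarrow> i \<in> A"
 using unit_vector_simplex[of i d] by (auto simp: coordinate_face_def unit_vector_def)

lemma coordinate_face_empty: "coordinate_face d {} = {}"
 by (auto simp: coordinate_face_def standard_simplex_def)

lemma coordinate_face_singleton: "i \<le> d ==> coordinate_face d {i} = {unit_vector i}"
proof -
 assume i: "i \<le> d"
 have "x = unit_vector i" if "x \<in> coordinate_face d {i}" for x
 proof -
  have z: "x j = 0" if "j \<noteq> i" for j using \<open>x \<in> coordinate_face d {i}\<close> that by (simp add: coordinate_face_def)
  have "(\<Sum>j\<le>d. x j) = x i" using i by (subst sum.remove[of _ i]) (auto simp: z)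
  hence "x i = 1" using that by (simp add: coordinate_face_def standard_simplex_def)
  thus ?thesis using z by (auto simp: unit_vector_def)
 qed
 thus ?thesis using unit_vector_face[OF i, of "{i}"] by blast
qed

context
 fixes d :: nat and \<Gamma> :: "('v, 'e) multigraph"
begin

lemma glue_snd: "(a, b) \<in> (gluing_step d \<Gamma>)\<^sup>* ==> snd b = snd a"
 by (induction rule: rtrancl_induct) (auto simp: gluing_step_def)

lemma glue_self: "a \<in> glue d \<Gamma> a"
 by (simp add: glue_def)

lemma glue_eq_snd: "glue d \<Gamma> (u, x) = glue d \<Gamma> (v, y) ==> x = y"
 using glue_self[of "(u, x)"] glue_snd[of "(v, y)" "(u, x)"] by (auto simp: glue_def)

lemma sym_gluing: "sym ((gluing_step d \<Gamma>)\<^sup>*)"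
 by (rule sym_rtrancl) (auto simp: sym_def gluing_step_def insert_commute)

lemma glue_eq: "(a, b) \<in> (gluing_step d \<Gamma>)\<^sup>* ==> glue d \<Gamma> a = glue d \<Gamma> b"
 unfolding glue_def using sym_gluing by (auto dest: symD intro: rtrancl_trans)

definition graph_cell :: "'v => nat set => ('v \<times> (nat => real)) set set" where
 "graph_cell v A = glue d \<Gamma> ` ({v} \<times> coordinate_face d A)"

lemma graph_complex_cells: "graph_complex d \<Gamma> = {graph_cell v A | v A. v \<in> verts \<Gamma> \<and> A \<subseteq> {..d}}"
 by (simp add: graph_complex_def graph_cell_def coordinate_face_def)

lemma graph_cell_topspace: "v \<in> verts \<Gamma> ==> graph_cell v A \<subseteq> topspace (graph_space d \<Gamma>)"
 by (auto simp: graph_cell_def graph_space_def topspace_quotient_topology coordinate_face_def)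

lemma graph_cell_singleton: "i \<le> d ==> graph_cell v {i} = {glue d \<Gamma> (v, unit_vector i)}"
 by (simp add: graph_cell_def coordinate_face_singleton)

lemma glue_in_cell: "glue d \<Gamma> (w, x) \<in> graph_cell v A \<longleftrightarrow> x \<in> coordinate_face d A \<and> glue d \<Gamma> (w, x) = glue d \<Gamma> (v, x)"
 using glue_eq_snd[of w x v] by (auto simp: graph_cell_def)

text \<open>A cell of the complex with two labels contains two different vertices, since gluing preserves coordinates.\<close>
lemma zero_cells_graph:
 assumes v: "v \<in> verts \<Gamma>" and A: "A \<subseteq> {..d}" and c: "is_cell (graph_space d \<Gamma>) 0 (graph_cell v A)"
 shows "\<exists>i\<le>d. A = {i}"
proof -
 have "graph_cell v A \<noteq> {}" using c not_is_cell_empty by metis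
 hence "A \<noteq> {}" by (auto simp: graph_cell_def coordinate_face_empty)
 then obtain i where i: "i \<in> A" by blast
 have "j = i" if j: "j \<in> A" for j
 proof -
  have m: "glue d \<Gamma> (v, unit_vector k) \<in> graph_cell v A" if "k \<in> A" for k
   using that A unit_vector_face[of k d A] by (auto simp: glue_in_cell)
  have "glue d \<Gamma> (v, unit_vector j) = glue d \<Gamma> (v, unit_vector i)"
   by (rule zero_cell_unique_point[OF c graph_cell_topspace[OF v] m[OF j] m[OF i]])
  thus ?thesis using glue_eq_snd unit_vector_inj by blast
 qed
 thus ?thesis using i A by blast
qed

text \<open>The gluings along edges of colours other than \<open>i\<close> identify the vertices labelled \<open>i\<close>.\<close>
lemma glue_vertex:
 assumes i: "i \<le> d" and con: "connected_in ({..d} - {i}) \<Gamma>" and uv: "u \<in> verts \<Gamma>" "v \<in> verts \<Gamma>"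
 shows "glue d \<Gamma> (u, unit_vector i) = glue d \<Gamma> (v, unit_vector i)"
proof (rule glue_eq)
 have "(u, v) \<in> {(a, b). \<exists>e\<in>edges \<Gamma>. color \<Gamma> e \<in> {..d} - {i} \<and> ends \<Gamma> e = {a, b}}\<^sup>*"
  using con uv by (simp add: connected_in_def)
 thus "((u, unit_vector i), (v, unit_vector i)) \<in> (gluing_step d \<Gamma>)\<^sup>*"
 proof (induction rule: rtrancl_induct)
  case (step a b)
  then obtain e where "e \<in> edges \<Gamma>" "color \<Gamma> e \<noteq> i" "ends \<Gamma> e = {a, b}" by auto
  hence "((a, unit_vector i), (b, unit_vector i)) \<in> gluing_step d \<Gamma>"
   using unit_vector_simplex[OF i] by (auto simp: gluing_step_def unit_vector_def)
  thus ?case using step.IH by (rule rtrancl.rtrancl_into_rtrancl[rotated])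
 qed simp
qed

lemma graph_vertex_number:
 assumes con: "contracted_graph {..d} \<Gamma>"
 shows "face_number (graph_space d \<Gamma>) (graph_complex d \<Gamma>) 0 = d + 1"
proof -
 have ci: "connected_in ({..d} - {i}) \<Gamma>" if "i \<le> d" for i using con that by (simp add: contracted_graph_def)
 have "verts \<Gamma> \<noteq> {}" using con by (auto simp: contracted_graph_def connected_in_def)
 then obtain v where v: "v \<in> verts \<Gamma>" by blast
 have "{c \<in> graph_complex d \<Gamma>. is_cell (graph_space d \<Gamma>) 0 c} = (\<lambda>i. graph_cell v {i}) ` {..d}"
 proof
  show "{c \<in> graph_complex d \<Gamma>. is_cell (graph_space d \<Gamma>) 0 c} \<subseteq> (\<lambda>i. graph_cell v {i}) ` {..d}"
  proof
   fix c assume "c \<in> {c \<in> graph_complex d \<Gamma>. is_cell (graph_space d \<Gamma>) 0 c}"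
   then obtain w A where w: "w \<in> verts \<Gamma>" "A \<subseteq> {..d}" "c = graph_cell w A" "is_cell (graph_space d \<Gamma>) 0 (graph_cell w A)"
    by (auto simp: graph_complex_cells)
   obtain i where i: "i \<le> d" "A = {i}" using zero_cells_graph[OF w(1,2,4)] by blast
   have "c = graph_cell v {i}"
    unfolding w(3) i(2) graph_cell_singleton[OF i(1)] glue_vertex[OF i(1) ci[OF i(1)] w(1) v] ..
   thus "c \<in> (\<lambda>i. graph_cell v {i}) ` {..d}" using i(1) by blast
  qed
  show "(\<lambda>i. graph_cell v {i}) ` {..d} \<subseteq> {c \<in> graph_complex d \<Gamma>. is_cell (graph_space d \<Gamma>) 0 c}"
  proof (rule image_subsetI)
   fix i assume "i \<in> {..d}"
   hence i: "i \<le> d" by simp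
   have "glue d \<Gamma> (v, unit_vector i) \<in> topspace (graph_space d \<Gamma>)"
    using graph_cell_topspace[OF v, of "{i}"] graph_cell_singleton[OF i] by simp
   hence "is_cell (graph_space d \<Gamma>) 0 (graph_cell v {i})"
    unfolding graph_cell_singleton[OF i] by (rule singleton_is_cell)
   thus "graph_cell v {i} \<in> {c \<in> graph_complex d \<Gamma>. is_cell (graph_space d \<Gamma>) 0 c}"
    using v i by (auto simp: graph_complex_cells)
  qed
 qed
 moreover have "inj_on (\<lambda>i. graph_cell v {i}) {..d}"
 proof (rule inj_onI)
  fix i j assume ij: "i \<in> {..d}" "j \<in> {..d}" "graph_cell v {i} = graph_cell v {j}"
  hence "glue d \<Gamma> (v, unit_vector i) = glue d \<Gamma> (v, unit_vector j)" by (simp add: graph_cell_singleton)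
  thus "i = j" using glue_eq_snd unit_vector_inj by blast
 qed
 ultimately show ?thesis by (simp add: face_number_def card_image)
qed

text \<open>A cell of dimension \<open>d\<close> has \<open>2 ^ Suc d\<close> faces and hence involves all labels.\<close>
lemma graph_facet_number:
 assumes K: "simplicial_cell_complex d (graph_space d \<Gamma>) (graph_complex d \<Gamma>)" and fin: "finite (verts \<Gamma>)"
 shows "face_number (graph_space d \<Gamma>) (graph_complex d \<Gamma>) d \<le> card (verts \<Gamma>)"
proof -
 have "{c \<in> graph_complex d \<Gamma>. is_cell (graph_space d \<Gamma>) d c} \<subseteq> (\<lambda>v. graph_cell v {..d}) ` verts \<Gamma>"
 proof
  fix c assume c: "c \<in> {c \<in> graph_complex d \<Gamma>. is_cell (graph_space d \<Gamma>) d c}"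
  then obtain v A where v: "v \<in> verts \<Gamma>" "A \<subseteq> {..d}" "c = graph_cell v A" by (auto simp: graph_complex_cells)
  have fA: "finite A" using v(2) finite_subset by blast
  have "{\<tau> \<in> graph_complex d \<Gamma>. \<tau> \<subseteq> c} \<subseteq> graph_cell v ` Pow A"
  proof
   fix \<tau> assume t: "\<tau> \<in> {\<tau> \<in> graph_complex d \<Gamma>. \<tau> \<subseteq> c}"
   then obtain w B where w: "w \<in> verts \<Gamma>" "B \<subseteq> {..d}" "\<tau> = graph_cell w B" by (auto simp: graph_complex_cells)
   have sub: "x \<in> coordinate_face d A \<and> glue d \<Gamma> (w, x) = glue d \<Gamma> (v, x)" if "x \<in> coordinate_face d B" for x
   proof -
    have "glue d \<Gamma> (w, x) \<in> graph_cell w B" using that by (simp add: glue_in_cell)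
    hence "glue d \<Gamma> (w, x) \<in> graph_cell v A" using t v(3) w(3) by blast
    thus ?thesis by (simp only: glue_in_cell)
   qed
   have "B \<subseteq> A"
   proof
    fix i assume i: "i \<in> B"
    hence "i \<le> d" using w(2) by auto
    thus "i \<in> A" using sub[of "unit_vector i"] unit_vector_face[of i d] i by blast
   qed
   moreover have "\<tau> = graph_cell v B"
    unfolding w(3) graph_cell_def using sub by (auto simp: image_iff)
   ultimately show "\<tau> \<in> graph_cell v ` Pow A" by blast
  qed
  hence "card {\<tau> \<in> graph_complex d \<Gamma>. \<tau> \<subseteq> c} \<le> card (graph_cell v ` Pow A)"
   using fA by (intro card_mono) auto
  also have "card (graph_cell v ` Pow A) \<le> card (Pow A)" using fA by (intro card_image_le) simp
  also have "card (Pow A) = 2 ^ card A" using fA by (rule card_Pow)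
  finally have "(2::nat) ^ Suc d \<le> 2 ^ card A" using card_lower_faces[OF K, of c d] c by simp
  hence "Suc d \<le> card A" by (rule power_le_imp_le_exp[rotated]) simp
  hence "A = {..d}" using card_seteq[of "{..d}" A] v(2) by simp
  thus "c \<in> (\<lambda>v. graph_cell v {..d}) ` verts \<Gamma>" using v by blast
 qed
 thus ?thesis unfolding face_number_def using fin by (rule surj_card_le[rotated])
qed

end

theorem theorem1p4:
 fixes M :: "'a topology" and p :: 'a
 assumes "connected_space M" and "closed_manifold 3 M" and "p \<in> topspace M"
 shows "(\<forall>\<Gamma> :: ('v, 'e) multigraph. crystallization 3 \<Gamma> M \<longrightarrow>
      group_weight (fundamental_group M p) \<le> card (verts \<Gamma>)) \<and>
     (\<forall>(W :: 'b topology) K. pseudotriangulation 3 W K M \<and> contracted_complex 3 W K \<longrightarrow>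
      group_weight (fundamental_group M p) \<le> face_number W K 3)"
proof (intro conjI allI impI; (elim conjE)?)
 fix \<Gamma> :: "('v, 'e) multigraph"
 assume "crystallization 3 \<Gamma> M"
 then have con: "contracted_graph {..3} \<Gamma>" and ps: "pseudotriangulation 3 (graph_space 3 \<Gamma>) (graph_complex 3 \<Gamma>) M"
  by (auto simp: crystallization_def)
 have "group_weight (fundamental_group M p) \<le> face_number (graph_space 3 \<Gamma>) (graph_complex 3 \<Gamma>) 3"
  using graph_vertex_number[OF con] by (intro contracted_pseudotriangulation_weight[OF assms(2,3) ps]) simp
 also have "\<dots> \<le> card (verts \<Gamma>)"
  using ps con by (intro graph_facet_number) (auto simp: pseudotriangulation_def contracted_graph_def colored_graph_def)
 finally show "group_weight (fundamental_group M p) \<le> card (verts \<Gamma>)" .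
next
 fix W :: "'b topology" and K
 assume "pseudotriangulation 3 W K M" "contracted_complex 3 W K"
 then show "group_weight (fundamental_group M p) \<le> face_number W K 3"
  by (intro contracted_pseudotriangulation_weight[OF assms(2,3)]) (auto simp: contracted_complex_def)
qed

end
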